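(* Fix $p>15$. There exists a constant $N_0=N_0(\|a\|_\infty,\|b\|_*,c,\alpha,\gamma,E^0,p)$ such that for any integer $N\ge N_0$ there exists a set $\tilde\Omega_N$ with $$\operatorname{mes}(\tilde\Omega_N)\lesssim\exp\left(-(\log\log\log N)^2/20\right),\qquad \operatorname{compl}(\tilde\Omega_N)\lesssim N^2(\log N)^p,$$ such that for any $\omega\in\Omega^0\cap\mathbb T_{c,\alpha}\setminus\tilde\Omega_N$ there exists a set $\tilde{\mathcal E}_{N,\omega}$ with $$\operatorname{mes}(\tilde{\mathcal E}_{N,\omega})\lesssim(\log\log N)^{-1/10},\qquad \operatorname{compl}(\tilde{\mathcal E}_{N,\omega})\lesssim N(\log N)^6,$$ such that for any $x\in\mathbb T$, if $E_j^{(N)}(x,\omega)\in\mathcal E^0\setminus\tilde{\mathcal E}_{N,\omega}$ for some $j$, then $$\left|E_j^{(N)}(x,\omega)-E_k^{(N)}(x,\omega)\right|\ge\frac1{N(\log N)^p}$$ for any $k\ne j$.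
   Context: $\mathbb T=\mathbb R/\mathbb Z$ and $\mathbb H_\rho=\{z\in\mathbb C:|\mathrm{Im}\,z|<\rho\}$. The functions $a:\mathbb T\to\mathbb R$ and $b:\mathbb T\to\mathbb C$ are real analytic, $b$ is not identically zero, and both extend ($1$-periodically) complex analytically to a set containing the closure of $\mathbb H_{\rho_0}$, $\rho_0>0$; $\tilde b$ denotes the complex analytic extension of $\bar b$ from $\mathbb T$ to $\mathbb H_{\rho_0}$. For fixed $0<c\ll1$, $\alpha>1$, $\mathbb T_{c,\alpha}=\{\omega\in(0,1):\|n\omega\|\ge \frac{c}{n(\log n)^\alpha}\text{ for all integers }n\ge2\}$, where $\|\cdot\|$ is the distance to the nearest integer. $H^{(N)}(z,\omega)$ is the $N\times N$ tridiagonal matrix, rows and columns indexed by $0,\dots,N-1$, with diagonal entries $a(z+k\omega)$ ($0\le k\le N-1$), entries $-b(z+(k+1)\omega)$ in position $(k,k+1)$ and $-\tilde b(z+(k+1)\omega)$ in position $(k+1,k)$ ($0\le k\le N-2$). It is Hermitian for real $z=x$ and $\omega$. $E_j^{(N)}(x,\omega)$, $j=1,\dots,N$, are its eigenvalues. The transfer matrices are $M_N(x,\omega,E)=\prod_{j=N-1}^{0}\frac1{b(x+(j+1)\omega)}\begin{pmatrix}a(x+j\omega)-E&-\tilde b(x+j\omega)\\ b(x+(j+1)\omega)&0\end{pmatrix}$ (factors in order of decreasing $j$ from left to right), and the Lyapunov exponent is $L(\omega,E)=\lim_{N\to\infty}\frac1N\int_{\mathbb T}\log\|M_N(x,\omega,E)\|\,dx$.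 Standing assumption: $\Omega^0=(\omega',\omega'')$ and $\mathcal E^0=(E',E'')$ are bounded intervals and $\gamma>0$ is such that $L(\omega,E)>\gamma$ for all $(\omega,E)\in\Omega^0\times\mathcal E^0$. $\|\cdot\|_\infty$ is the $L^\infty$ norm on $\mathbb H_{\rho_0}$, $\|b\|_*=\|b\|_\infty+\max_{|y|\le\rho_0}\left|\int_{\mathbb T}\log|b(x+iy)|\,dx\right|$, $E^0=\sup\{|E|:E\in\mathcal E^0\}$. Constants may also depend on $\rho_0$. For a real set $S$ (in $\mathbb R$ or $\mathbb T$), "$\operatorname{mes}(S)\le u$, $\operatorname{compl}(S)\le C$" means that $S$ is contained in a set $S'$ which is a union of at most $C$ intervals with Lebesgue measure $\operatorname{mes}(S')\le u$. The symbol $\lesssim$ means $\le$ up to an absolute multiplicative constant. *)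

theory Defs
  imports
    "HOL-Complex_Analysis.Complex_Analysis"
    "HOL-Probability.Essential_Supremum"
    "Jordan_Normal_Form.Char_Poly"
begin

text \<open>Functions on the circle are 1-periodic functions of a real variable. The coefficients are
  given by their analytic extensions, i.e. as functions of a complex variable; only their values
  on the closed strip matter.\<close>

definition strip :: "real \<Rightarrow> complex set" where
  "strip \<rho> = {z. \<bar>Im z\<bar> < \<rho>}"

text \<open>\<open>f analytic_on S\<close> means that \<open>f\<close> is holomorphic on an open set containing \<open>S\<close>.
  The function \<open>bt\<close> is the extension of \<open>cnj b\<close> from the real line; it is determined on the
  strip by the last two conditions.\<close>

definition jacobi_coeffs ::
  "real \<Rightarrow> (complex \<Rightarrow> complex) \<Rightarrow> (complex \<Rightarrow> complex) \<Rightarrow> (complex \<Rightarrow> complex) \<Rightarrow> bool" where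
  "jacobi_coeffs \<rho> a b bt \<longleftrightarrow>
     a analytic_on closure (strip \<rho>) \<and> b analytic_on closure (strip \<rho>) \<and>
     (\<forall>z\<in>closure (strip \<rho>). a (z + 1) = a z \<and> b (z + 1) = b z) \<and>
     (\<forall>x::real. a (of_real x) \<in> \<real>) \<and>
     (\<exists>x::real. b (of_real x) \<noteq> 0) \<and>
     bt holomorphic_on strip \<rho> \<and>
     (\<forall>x::real. bt (of_real x) = cnj (b (of_real x)))"

definition Linf_norm :: "real \<Rightarrow> (complex \<Rightarrow> complex) \<Rightarrow> real" where
  "Linf_norm \<rho> f =
     real_of_ereal (esssup (restrict_space lborel (strip \<rho>)) (\<lambda>z. ereal (cmod (f z))))"

definition star_norm :: "real \<Rightarrow> (complex \<Rightarrow> complex) \<Rightarrow> real" where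
  "star_norm \<rho> b = Linf_norm \<rho> b +
     (SUP y\<in>{-\<rho>..\<rho>}. \<bar>LINT x:{0..1}|lborel. ln (cmod (b (Complex x y)))\<bar>)"

text \<open>\<open>infdist x \<int>\<close> is the distance from \<open>x\<close> to the nearest integer.\<close>

definition diophantine :: "real \<Rightarrow> real \<Rightarrow> real set" where
  "diophantine c \<alpha> =
     {\<omega>\<in>{0<..<1}. \<forall>n::nat. n \<ge> 2 \<longrightarrow> infdist (real n * \<omega>) \<int> \<ge> c / (real n * ln (real n) powr \<alpha>)}"

definition jacobi_matrix ::
  "(complex \<Rightarrow> complex) \<Rightarrow> (complex \<Rightarrow> complex) \<Rightarrow> (complex \<Rightarrow> complex) \<Rightarrow>
     nat \<Rightarrow> complex \<Rightarrow> real \<Rightarrow> complex mat" where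
  "jacobi_matrix a b bt N z \<omega> = Matrix.mat N N (\<lambda>(k, l).
     if k = l then a (z + of_nat k * of_real \<omega>)
     else if l = Suc k then - b (z + of_nat (Suc k) * of_real \<omega>)
     else if k = Suc l then - bt (z + of_nat (Suc l) * of_real \<omega>)
     else 0)"

text \<open>The eigenvalues counted with multiplicity, in increasing order and numbered from 1 to \<open>N\<close>.
  For real phase the matrix is Hermitian, so taking real parts loses nothing; see the lemma
  \<open>char_poly_jacobi_matrix\<close> below.\<close>

definition jacobi_eigenvalue ::
  "(complex \<Rightarrow> complex) \<Rightarrow> (complex \<Rightarrow> complex) \<Rightarrow> (complex \<Rightarrow> complex) \<Rightarrow>
     nat \<Rightarrow> real \<Rightarrow> real \<Rightarrow> nat \<Rightarrow> real" where
  "jacobi_eigenvalue a b bt N x \<omega> j =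
     sorted_list_of_multiset
       (image_mset Re (proots (char_poly (jacobi_matrix a b bt N (of_real x) \<omega>)))) ! (j - 1)"

text \<open>Where \<open>b\<close> vanishes the transfer matrix is given a junk value; this concerns only finitely
  many \<open>x\<close> modulo 1 for each \<open>N\<close>, and does not affect the integral below.\<close>

definition transfer_factor ::
  "(complex \<Rightarrow> complex) \<Rightarrow> (complex \<Rightarrow> complex) \<Rightarrow> (complex \<Rightarrow> complex) \<Rightarrow>
     real \<Rightarrow> real \<Rightarrow> real \<Rightarrow> nat \<Rightarrow> complex^2^2" where
  "transfer_factor a b bt x \<omega> E j =
     (let b1 = b (of_real (x + real (Suc j) * \<omega>)) in
      vector [vector [(a (of_real (x + real j * \<omega>)) - of_real E) / b1,
                      - bt (of_real (x + real j * \<omega>)) / b1],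
              vector [b1 / b1, 0]])"

primrec transfer_matrix ::
  "(complex \<Rightarrow> complex) \<Rightarrow> (complex \<Rightarrow> complex) \<Rightarrow> (complex \<Rightarrow> complex) \<Rightarrow>
     real \<Rightarrow> real \<Rightarrow> real \<Rightarrow> nat \<Rightarrow> complex^2^2" where
  "transfer_matrix a b bt x \<omega> E 0 = Finite_Cartesian_Product.mat 1"
| "transfer_matrix a b bt x \<omega> E (Suc N) =
     transfer_factor a b bt x \<omega> E N ** transfer_matrix a b bt x \<omega> E N"

definition lyapunov ::
  "(complex \<Rightarrow> complex) \<Rightarrow> (complex \<Rightarrow> complex) \<Rightarrow> (complex \<Rightarrow> complex) \<Rightarrow>
     real \<Rightarrow> real \<Rightarrow> real" where
  "lyapunov a b bt \<omega> E =
     lim (\<lambda>N. (LINT x:{0..1}|lborel. ln (onorm ((*v) (transfer_matrix a b bt x \<omega> E N)))) / real N)"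

text \<open>The joint statement ``mes S at most u, compl S at most C''.\<close>

definition mes_compl_le :: "real set \<Rightarrow> real \<Rightarrow> real \<Rightarrow> bool" where
  "mes_compl_le S u C \<longleftrightarrow>
     (\<exists>I :: real set set. finite I \<and> real (card I) \<le> C \<and> (\<forall>J\<in>I. is_interval J) \<and>
        S \<subseteq> \<Union>I \<and> emeasure lborel (\<Union>I) \<le> ennreal u)"

lemma jacobi_matrix_hermitian:
  assumes "jacobi_coeffs \<rho> a b bt" "k < N" "l < N"
  shows "cnj (jacobi_matrix a b bt N (of_real x) \<omega> $$ (k, l)) =
           jacobi_matrix a b bt N (of_real x) \<omega> $$ (l, k)"
proof -
  have a: "cnj (a (of_real x)) = a (of_real x)" for x :: real
    using assms(1) by (simp add: jacobi_coeffs_def Reals_cnj_iff)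
  have bt: "bt (of_real x) = cnj (b (of_real x))" for x :: real
    using assms(1) by (simp add: jacobi_coeffs_def)
  have eq: "complex_of_real x + of_nat n * of_real \<omega> = of_real (x + real n * \<omega>)" for n
    by simp
  show ?thesis
    unfolding jacobi_matrix_def eq using assms(2,3) by (simp add: a bt del: of_real_add of_real_mult)
qed

lemma jacobi_matrix_eigenvalue_real:
  assumes "jacobi_coeffs \<rho> a b bt"
    and "eigenvalue (jacobi_matrix a b bt N (of_real x) \<omega>) e"
  shows "e \<in> \<real>"
proof -
  define A where "A = jacobi_matrix a b bt N (of_real x) \<omega>"
  have A: "A \<in> carrier_mat N N" by (simp add: A_def jacobi_matrix_def)
  from assms(2) obtain v where v: "v \<in> carrier_vec N" "v \<noteq> 0\<^sub>v N" "A *\<^sub>v v = e \<cdot>\<^sub>v v"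
    using A unfolding eigenvalue_def eigenvector_def A_def[symmetric] by auto
  define S where "S = (\<Sum>k<N. \<Sum>l<N. cnj (vec_index v k) * A $$ (k, l) * vec_index v l)"
  define T where "T = (\<Sum>k<N. (cmod (vec_index v k))\<^sup>2)"
  have Av: "vec_index (A *\<^sub>v v) k = (\<Sum>l<N. A $$ (k, l) * vec_index v l)" if "k < N" for k
    using A v(1) that by (simp add: scalar_prod_def atLeast0LessThan)
  have "S = (\<Sum>k<N. cnj (vec_index v k) * vec_index (A *\<^sub>v v) k)"
    unfolding S_def by (intro sum.cong refl) (simp add: Av sum_distrib_left mult.assoc del: index_mult_mat_vec)
  also have "\<dots> = (\<Sum>k<N. e * of_real ((cmod (vec_index v k))\<^sup>2))"
    using v by (intro sum.cong refl) (auto simp: complex_norm_square simp del: of_real_power)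
  finally have S: "S = e * of_real T" by (simp add: T_def sum_distrib_left)
  have "cnj S = (\<Sum>k<N. \<Sum>l<N. vec_index v k * A $$ (l, k) * cnj (vec_index v l))"
    unfolding S_def A_def using jacobi_matrix_hermitian[OF assms(1)] by (simp add: cnj_sum)
  also have "\<dots> = S"
    unfolding S_def by (subst sum.swap) (simp add: mult_ac)
  finally have cS: "cnj S = S" .
  obtain k where k: "k < N" "vec_index v k \<noteq> 0"
    using v by (metis carrier_vecD eq_vecI index_zero_vec)
  have "T > 0" unfolding T_def
    using k by (intro sum_pos2[of _ k]) auto
  with S cS have "cnj e = e" by simp
  then show ?thesis by (simp add: Reals_cnj_iff)
qed

lemma char_poly_jacobi_matrix:
  assumes "jacobi_coeffs \<rho> a b bt"
  shows "char_poly (jacobi_matrix a b bt N (of_real x) \<omega>) =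
           (\<Prod>j=1..N. [:- of_real (jacobi_eigenvalue a b bt N x \<omega> j), 1:])"
proof -
  define A where "A = jacobi_matrix a b bt N (of_real x) \<omega>"
  have A: "A \<in> carrier_mat N N" by (simp add: A_def jacobi_matrix_def)
  define P where "P = proots (char_poly A)"
  define es where "es = sorted_list_of_multiset (image_mset Re P)"
  have deg: "degree (char_poly A) = N" "lead_coeff (char_poly A) = 1"
    using degree_monic_char_poly[OF A] by auto
  then have nz: "char_poly A \<noteq> 0" by auto
  have real: "of_real (Re e) = e" if "e \<in># P" for e
    using that nz jacobi_matrix_eigenvalue_real[OF assms, of N x \<omega> e]
    by (simp add: P_def A_def[symmetric] eigenvalue_root_char_poly[OF A] of_real_Re)
  have mset: "mset es = image_mset Re P" by (simp add: es_def)
  have len: "length es = N"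
    by (metis P_def deg(1) mset size_image_mset size_mset size_proots_complex)
  have "char_poly A = (\<Prod>e\<in>#P. [:- e, 1:])"
    using complex_poly_decompose_multiset[of "char_poly A"] deg by (simp add: P_def)
  also have "\<dots> = (\<Prod>e\<in>#P. [:- of_real (Re e), 1:])"
    by (intro arg_cong[of _ _ prod_mset] image_mset_cong) (simp add: real)
  also have "\<dots> = (\<Prod>e\<in>#mset es. [:- of_real e, 1:])"
    by (simp add: mset multiset.map_comp o_def)
  also have "\<dots> = (\<Prod>e\<leftarrow>es. [:- of_real e, 1:])"
    by (simp flip: mset_map prod_mset_prod_list)
  also have "\<dots> = (\<Prod>i<N. [:- of_real (es ! i), 1:])"
    by (simp add: prod.list_conv_set_nth len atLeast0LessThan)
  also have "\<dots> = (\<Prod>j=1..N. [:- of_real (es ! (j - 1)), 1:])"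
    by (rule prod.reindex_bij_witness[of _ "\<lambda>j. j - 1" Suc]) auto
  finally show ?thesis
    by (simp add: jacobi_eigenvalue_def A_def es_def P_def)
qed

end

theory Submission
 imports Defs "HOL-Real_Asymp.Real_Asymp" "HOL-Analysis.Kronecker_Approximation_Theorem"
begin

text \<open>Let \<open>F n\<close> be the determinant of \<open>H n - E - i \<eta>\<close>. The Herglotz property keeps the ratios of
consecutive determinants away from the real axis, so \<open>ln (cmod (F n))\<close> is additive along the orbit up to
\<open>O(ln (1 / \<eta>))\<close>. Iterating the Denjoy-Koksma inequality over a fixed number of scales makes it nearly
constant in the phase, and a positive Lyapunov exponent then forces eigenvectors to decay across every
window of length about \<open>(ln N) powr 1.1\<close> that is not resonant with the energy. Counting zeros of the
determinants bounds the number of arcs of resonant phases; a double resonance at distance \<open>k\<close> pins down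
\<open>k * \<omega>\<close> modulo one, and iterating this excludes double resonances outside a small set of frequencies and
energies. Doing this at the scales \<open>N\<close> and \<open>exp ((ln N) powr 0.005)\<close> concentrates two eigenvectors with close
eigenvalues on one very small cluster of sites, where the smallness of their Wronskian contradicts
orthogonality.\<close>

section \<open>Continuants\<close>

text \<open>The exponents are forced by competing demands. The energy is shifted by \<eta> of order
  \<open>h / l\<close> with \<open>h\<close> near \<open>1 / N\<close>, so each cut of a determinant
  costs about \<open>ln N\<close>. A window reveals the Lyapunov exponent only if it is longer than
  this cost times the surviving oscillation; length \<open>(ln N) powr 1.1\<close> with an
  oscillation factor \<open>l powr 0.05\<close> satisfies this. Elimination at scale
  \<open>N\<close> treats only distances beyond \<open>l ^ 100\<close>, roughly
  \<open>(ln N) powr 110\<close>, and running the recurrence across a cluster that long loses more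
  than any power of \<open>N\<close>. Hence the second scale: with
  \<open>ln R = (ln N) powr 0.005\<close> the cluster shrinks to about
  \<open>(ln N) powr 0.55\<close> sites and the loss stays below every power of \<open>N\<close>,
  while \<open>R\<close> still exceeds the \<open>l ^ 100\<close> of scale \<open>N\<close>, so the
  two ranges of distances overlap. The price is that exceptional sets are only as small as a power
  of \<open>ln R\<close>. A zero of \<open>b\<close> inside the cluster would stall the recurrence,
  so energies resonant near such zeros are discarded too. Finally, \<open>N0\<close> may depend on
  the coefficients only through norms, so all estimates on \<open>b\<close> are explicit in a common
  bound \<open>A\<close>.\<close>

fun dt :: "(complex => complex) => (complex => complex) => complex => nat => complex => complex" where
 "dt A B w 0 z = 1"
| "dt A B w (Suc 0) z = A z"
| "dt A B w (Suc (Suc n)) z =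
   A (z + of_nat (Suc n) * w) * dt A B w (Suc n) z - B (z + of_nat (Suc n) * w) * dt A B w n z"

text \<open>The defining recursion strips the last site, this one strips the first. Both are needed
  because a cut in the middle of a chain meets the right end of one half and the left end of the
  other.\<close>

lemma dt_left: "dt A B w (Suc (Suc n)) z =
  A z * dt A B w (Suc n) (z + w) - B (z + w) * dt A B w n (z + w + w)"
proof (induction n rule: induct_nat_012)
 case 0
 then show ?case by (simp add: algebra_simps)
next
 case 1
 then show ?case by (simp add: algebra_simps)
next
 case (ge2 n)
 have "dt A B w (Suc (Suc (Suc (Suc n)))) z =
   A (z + of_nat (Suc (Suc (Suc n))) * w) * dt A B w (Suc (Suc (Suc n))) z
   - B (z + of_nat (Suc (Suc (Suc n))) * w) * dt A B w (Suc (Suc n)) z"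
  by (rule dt.simps)
 also have "... = A (z + of_nat (Suc (Suc (Suc n))) * w) *
   (A z * dt A B w (Suc (Suc n)) (z + w) - B (z + w) * dt A B w (Suc n) (z + w + w))
   - B (z + of_nat (Suc (Suc (Suc n))) * w) *
   (A z * dt A B w (Suc n) (z + w) - B (z + w) * dt A B w n (z + w + w))"
  unfolding ge2.IH by (rule refl)
 also have "... = A z * (A ((z + w) + of_nat (Suc (Suc n)) * w) * dt A B w (Suc (Suc n)) (z + w)
    - B ((z + w) + of_nat (Suc (Suc n)) * w) * dt A B w (Suc n) (z + w))
   - B (z + w) * (A ((z + w + w) + of_nat (Suc n) * w) * dt A B w (Suc n) (z + w + w)
    - B ((z + w + w) + of_nat (Suc n) * w) * dt A B w n (z + w + w))"
 proof -
  have e: "(z + w) + of_nat (Suc (Suc n)) * w = z + of_nat (Suc (Suc (Suc n))) * w"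
   "(z + w + w) + of_nat (Suc n) * w = z + of_nat (Suc (Suc (Suc n))) * w"
   by (simp_all add: algebra_simps)
  show ?thesis unfolding e by (simp add: algebra_simps del: dt.simps of_nat_Suc)
 qed
 also have "... = A z * dt A B w (Suc (Suc (Suc n))) (z + w)
   - B (z + w) * dt A B w (Suc (Suc n)) (z + w + w)"
  by simp
 finally show ?case .
qed

text \<open>Laplace expansion along the one bond joining the two halves. The second term, in which
  both sites next to the cut are missing, is the obstruction to multiplicativity that
  \<open>split_ratio\<close> controls.\<close>

lemma dt_split: "dt A B w (Suc n + Suc k) z =
  dt A B w (Suc n) z * dt A B w (Suc k) (z + of_nat (Suc n) * w)
  - B (z + of_nat (Suc n) * w) * dt A B w n z * dt A B w k (z + of_nat (Suc n) * w + w)"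
proof (induction k rule: induct_nat_012)
 case 0
 then show ?case by (simp add: algebra_simps)
next
 case 1
 have "Suc n + Suc 1 = Suc (Suc (Suc n))" by simp
 then show ?case by (simp add: algebra_simps)
next
 case (ge2 k)
 have e: "z + of_nat (Suc (n + Suc (Suc k))) * w = (z + of_nat (Suc n) * w) + of_nat (Suc (Suc k)) * w"
  "(z + of_nat (Suc n) * w) + of_nat (Suc (Suc k)) * w = (z + of_nat (Suc n) * w + w) + of_nat (Suc k) * w"
  by (simp_all add: algebra_simps)
 have s: "Suc n + Suc (Suc (Suc k)) = Suc (Suc (n + Suc (Suc k)))"
  "Suc (n + Suc (Suc k)) = Suc n + Suc (Suc k)" "n + Suc (Suc k) = Suc n + Suc k" by simp_all
 show ?case
  unfolding s(1) dt.simps(3)[of _ _ _ "n + Suc (Suc k)"] e(1)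
  unfolding ge2.IH(2)[folded s(2)] ge2.IH(1)[folded s(3)] dt.simps(3)[of _ _ _ "Suc k" "z + of_nat (Suc n) * w"]
   dt.simps(3)[of _ _ _ k "z + of_nat (Suc n) * w + w"] e(2)[symmetric]
  by (simp add: algebra_simps del: dt.simps of_nat_Suc)
qed

section \<open>Ratios of determinants in the lower half-plane\<close>

lemma Im_divide_pos_real:
 assumes "\<beta> >= 0" "Im r < 0"
 shows "Im (complex_of_real \<beta> / r) >= 0"
proof -
 have "Im (complex_of_real \<beta> / r) = - (\<beta> * Im r) / ((Re r)^2 + (Im r)^2)"
  by (simp add: Im_divide)
 then show ?thesis using assms by (simp add: mult_nonneg_nonpos divide_nonpos_nonneg)
qed

text \<open>For \<open>s >= 0\<close> the term \<open>- s / r\<close> can only lower the imaginary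
  part. The deviation of \<beta> from \<open>s\<close> costs at most
  \<open>(\<eta>^2 / 8) / (\<eta> / 2) = \<eta> / 4\<close>, which is the gap between
  \<open>3/4\<close> and \<open>1/2\<close>.\<close>

lemma herglotz_step:
 assumes A: "Im \<alpha> <= - (3/4) * \<eta>" and r: "Im r <= - \<eta> / 2" and \<eta>: "\<eta> > 0"
  and B: "cmod (\<beta> - complex_of_real s) <= \<eta>^2 / 8" "s >= 0"
 shows "Im (\<alpha> - \<beta> / r) <= - \<eta> / 2"
proof -
 have nr: "cmod r >= \<eta> / 2" using abs_Im_le_cmod[of r] r \<eta> by linarith
 have "cmod ((\<beta> - of_real s) / r) <= (\<eta>^2 / 8) / (\<eta> / 2)"
  unfolding norm_divide using nr B \<eta> by (intro frac_le) auto
 also have "... = \<eta> / 4" using \<eta> by (simp add: power2_eq_square)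
 finally have e: "abs (Im ((\<beta> - of_real s) / r)) <= \<eta> / 4"
  using abs_Im_le_cmod order_trans by blast
 have "Im (complex_of_real s / r) >= 0" using r \<eta> B by (intro Im_divide_pos_real) auto
 moreover have "\<beta> / r = (\<beta> - of_real s) / r + of_real s / r" by (simp add: diff_divide_distrib)
 ultimately show ?thesis using e A by simp
qed

text \<open>In the application \<open>A\<close> is \<open>a - E - i \<eta>\<close>, whose imaginary
  part on the real line is exactly \<open>- \<eta>\<close>. The slack \<open>3/4\<close> and the
  tolerance \<open>\<eta>^2 / 8\<close> admit phases slightly off the real axis, where absence of
  zeros is needed to bound the variation of the logarithm.\<close>

locale herglotz =
 fixes A B :: "complex => complex" and w z :: complex and \<eta> CA CB :: real
 assumes eta: "0 < \<eta>" "\<eta> <= 1"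
  and ImA: "!!k. Im (A (z + of_nat k * w)) <= - (3/4) * \<eta>"
  and Bre: "!!k. \<exists>s\<ge>0. cmod (B (z + of_nat k * w) - complex_of_real s) <= \<eta>^2 / 8"
  and CA: "!!k. cmod (A (z + of_nat k * w)) <= CA"
  and CB: "!!k. cmod (B (z + of_nat k * w)) <= CB"
begin

lemma shift: "herglotz A B w (z + of_nat n * w) \<eta> CA CB"
proof
 fix k
 have e: "z + of_nat n * w + of_nat k * w = z + of_nat (n + k) * w"
  by (simp add: algebra_simps)
 show "Im (A (z + of_nat n * w + of_nat k * w)) <= - (3/4) * \<eta>"
  "\<exists>s\<ge>0. cmod (B (z + of_nat n * w + of_nat k * w) - complex_of_real s) <= \<eta>^2 / 8"
  "cmod (A (z + of_nat n * w + of_nat k * w)) <= CA"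
  "cmod (B (z + of_nat n * w + of_nat k * w)) <= CB"
  unfolding e using ImA Bre CA CB by blast+
qed (use eta in auto)

lemma ratio: "dt A B w n z ~= 0 & Im (dt A B w (Suc n) z / dt A B w n z) <= - \<eta> / 2"
proof (induction n)
 case 0
 then show ?case using ImA[of 0] eta by simp
next
 case (Suc n)
 have nz: "dt A B w (Suc n) z ~= 0" using Suc eta by auto
 obtain s where s: "s >= 0" "cmod (B (z + of_nat (Suc n) * w) - complex_of_real s) <= \<eta>^2 / 8"
  using Bre by blast
 have "dt A B w (Suc (Suc n)) z / dt A B w (Suc n) z =
   A (z + of_nat (Suc n) * w) - B (z + of_nat (Suc n) * w) / (dt A B w (Suc n) z / dt A B w n z)"
  using nz Suc by (simp add: field_simps del: of_nat_Suc)
 then show ?case using herglotz_step[OF ImA[of "Suc n"] _ eta(1) s(2,1)] Suc nz by presburger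
qed

lemma dt_nonzero: "dt A B w n z ~= 0" using ratio by blast

lemma ratio_lower: "cmod (dt A B w (Suc n) z / dt A B w n z) >= \<eta> / 2"
 using ratio[of n] abs_Im_le_cmod[of "dt A B w (Suc n) z / dt A B w n z"] eta by linarith

lemma left_ratio: "Im (dt A B w (Suc n) z / dt A B w n (z + w)) <= - \<eta> / 2"
 using herglotz_axioms
proof (induction n arbitrary: z)
 case 0
 interpret herglotz A B w z \<eta> CA CB by fact
 show ?case using ImA[of 0] eta by simp
next
 case (Suc n)
 interpret herglotz A B w z \<eta> CA CB by fact
 interpret h1: herglotz A B w "z + w" \<eta> CA CB using shift[of 1] by simp
 interpret h2: herglotz A B w "z + w + w" \<eta> CA CB using shift[of 2] by (simp add: add_ac)
 have IH: "Im (dt A B w (Suc n) (z + w) / dt A B w n (z + w + w)) <= - \<eta> / 2"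
  by (rule Suc.IH) (rule h1.herglotz_axioms)
 obtain s where s: "s >= 0" "cmod (B (z + w) - complex_of_real s) <= \<eta>^2 / 8"
  using Bre[of 1] by auto
 have "dt A B w (Suc (Suc n)) z / dt A B w (Suc n) (z + w) =
   A z - B (z + w) / (dt A B w (Suc n) (z + w) / dt A B w n (z + w + w))"
  unfolding dt_left using h1.dt_nonzero[of "Suc n"] h2.dt_nonzero[of n] by (simp add: field_simps del: dt.simps)
 moreover have "Im (A z) <= - (3/4) * \<eta>" using ImA[of 0] by simp
 ultimately show ?case using herglotz_step[OF _ IH eta(1) s(2,1)] by metis
qed

lemma left_ratio_lower: "cmod (dt A B w (Suc n) z / dt A B w n (z + w)) >= \<eta> / 2"
 using left_ratio[of n] abs_Im_le_cmod[of "dt A B w (Suc n) z / dt A B w n (z + w)"] eta by linarith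

lemma left_ratio_upper: "cmod (dt A B w (Suc n) z / dt A B w n (z + w)) <= CA + 2 * CB / \<eta>"
proof (cases n)
 case 0
 have "0 <= CB" using CB[of 0] norm_ge_zero order_trans by blast
 then show ?thesis using CA[of 0] 0 eta by (simp add: add_increasing2)
next
 case (Suc m)
 interpret h1: herglotz A B w "z + w" \<eta> CA CB using shift[of 1] by simp
 interpret h2: herglotz A B w "z + w + w" \<eta> CA CB using shift[of 2] by (simp add: add_ac)
 let ?q = "dt A B w (Suc m) (z + w) / dt A B w m (z + w + w)"
 have "dt A B w (Suc n) z / dt A B w n (z + w) = A z - B (z + w) / ?q"
  unfolding Suc dt_left using h1.dt_nonzero[of "Suc m"] h2.dt_nonzero[of m] by (simp add: field_simps del: dt.simps)
 moreover have "cmod (B (z + w) / ?q) <= CB / (\<eta> / 2)"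
  unfolding norm_divide[of "B (z + w)"] using CB[of 1] h1.left_ratio_lower[of m] eta
  by (intro frac_le) (auto intro: order_trans[OF norm_ge_zero])
 ultimately show ?thesis using CA[of 0] norm_triangle_ineq4[of "A z" "B (z + w) / ?q"]
  by (simp add: mult.commute)
qed

end

locale herglotz_real = herglotz +
 assumes Breal: "!!k. \<exists>s\<ge>0. B (z + of_nat k * w) = complex_of_real s"
begin

text \<open>With \<open>r\<close> and \<open>q\<close> the one-sided ratios at the two sides of the
  cut, the defect is \<open>1 - B / (r * q)\<close>. Rewritten as \<open>(q - s / r) / q\<close>,
  its numerator has imaginary part at most \<open>- \<eta> / 2\<close>, so the two terms cannot
  cancel; this is where \<open>B\<close> has to be a nonnegative real \<open>s\<close>.\<close>

lemma split_ratio: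
 fixes n k :: nat
 defines "\<rho> \<equiv> dt A B w (n + k) z / (dt A B w n z * dt A B w k (z + of_nat n * w))"
  and "C \<equiv> 2 * (1 + CA + 2 * CB)"
 shows "\<eta>^2 / C^2 <= cmod \<rho>" "cmod \<rho> <= C^2 / \<eta>^2"
proof -
 have C0: "CA >= 0" "CB >= 0" using CA[of 0] CB[of 0] norm_ge_zero order_trans by blast+
 have C2: "C >= 2" using C0 by (simp add: C_def)
 have CC: "C^2 >= 2 * C" using C2 by (simp add: power2_eq_square)
 have e1: "\<eta>^2 <= 1" using eta by (simp add: power_le_one)
 have triv: "\<eta>^2 / C^2 <= 1" "1 <= C^2 / \<eta>^2"
  using e1 C2 CC eta by (auto simp: divide_simps)
 have "\<eta>^2 / C^2 <= cmod \<rho> & cmod \<rho> <= C^2 / \<eta>^2"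
 proof (cases "n = 0 \<or> k = 0")
  case True
  interpret s: herglotz A B w "z + of_nat n * w" \<eta> CA CB by (rule shift)
  from True have "\<rho> = 1" unfolding \<rho>_def using dt_nonzero[of n] s.dt_nonzero[of k] by auto
  then show ?thesis using triv by simp
 next
  case False
  then obtain n' k' where nk: "n = Suc n'" "k = Suc k'" by (meson not0_implies_Suc)
  define z' where "z' = z + of_nat (Suc n') * w"
  interpret s: herglotz A B w z' \<eta> CA CB unfolding z'_def by (rule shift)
  interpret s1: herglotz A B w "z' + w" \<eta> CA CB using s.shift[of 1] by simp
  define r where "r = dt A B w (Suc n') z / dt A B w n' z"
  define q where "q = dt A B w (Suc k') z' / dt A B w k' (z' + w)"
  obtain s where s: "s >= 0" "B z' = of_real s" using Breal[of "Suc n'"] unfolding z'_def by blast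
  have rI: "Im r <= - \<eta> / 2" unfolding r_def using ratio by blast
  have qI: "Im q <= - \<eta> / 2" unfolding q_def by (rule s.left_ratio)
  have nz: "r ~= 0" "q ~= 0" using rI qI eta by auto
  have \<rho>: "\<rho> = 1 - B z' / (r * q)"
   unfolding \<rho>_def nk dt_split z'_def[symmetric] r_def q_def
   using dt_nonzero[of "Suc n'"] dt_nonzero[of n'] s.dt_nonzero[of "Suc k'"] s1.dt_nonzero[of k']
   by (simp add: field_simps del: dt.simps)
  have rq: "cmod r >= \<eta> / 2" "cmod q >= \<eta> / 2"
   using abs_Im_le_cmod[of r] rI abs_Im_le_cmod[of q] qI by linarith+
  have "cmod (B z' / (r * q)) <= CB / (\<eta> / 2 * (\<eta> / 2))"
   unfolding norm_divide norm_mult z'_def using rq eta CB[of "Suc n'"] C0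
   by (intro frac_le mult_mono) auto
  then have "cmod \<rho> <= 1 + 4 * CB / \<eta>^2"
   unfolding \<rho> using norm_triangle_ineq4[of 1 "B z' / (r * q)"] by (simp add: power2_eq_square mult.commute)
  also have "... <= (1 + 4 * CB) / \<eta>^2" using eta e1 C0 by (simp add: divide_simps)
  also have "... <= C^2 / \<eta>^2" using CC C0 C_def eta by (intro divide_right_mono) auto
  finally have up: "cmod \<rho> <= C^2 / \<eta>^2" .
  have "\<rho> = (q - of_real s / r) / q" unfolding \<rho> s(2) using nz by (simp add: field_simps)
  moreover have "cmod (q - of_real s / r) >= \<eta> / 2"
   using Im_divide_pos_real[of s r] s(1) rI qI eta abs_Im_le_cmod[of "q - of_real s / r"] by simp
  moreover have "cmod q <= C / \<eta>"
  proof -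
   have "cmod q <= CA + 2 * CB / \<eta>" unfolding q_def by (rule s.left_ratio_upper)
   also have "... <= CA / \<eta> + 2 * CB / \<eta>"
    using C0 eta mult_left_le[of \<eta> CA] by (simp add: pos_le_divide_eq)
   also have "... <= C / \<eta>"
    unfolding add_divide_distrib[symmetric] using C0 eta by (intro divide_right_mono) (auto simp: C_def)
   finally show ?thesis .
  qed
  ultimately have "cmod \<rho> >= (\<eta> / 2) / (C / \<eta>)"
   unfolding norm_divide using nz eta by (simp only: norm_divide) (intro frac_le, auto)
  moreover have "(\<eta> / 2) / (C / \<eta>) >= \<eta>^2 / C^2"
  proof -
   have "\<eta>^2 / C^2 <= \<eta>^2 / (2 * C)" using CC C2 eta by (intro divide_left_mono) auto
   then show ?thesis by (simp add: power2_eq_square)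
  qed
  ultimately show ?thesis using up by linarith
 qed
 then show "\<eta>^2 / C^2 <= cmod \<rho>" "cmod \<rho> <= C^2 / \<eta>^2" by auto
qed

lemma log_split:
 "abs (ln (cmod (dt A B w (n + k) z)) - ln (cmod (dt A B w n z)) - ln (cmod (dt A B w k (z + of_nat n * w))))
   <= 2 * ln (2 * (1 + CA + 2 * CB) / \<eta>)"
proof -
 interpret s: herglotz A B w "z + of_nat n * w" \<eta> CA CB by (rule shift)
 have C0: "CA >= 0" "CB >= 0" using CA[of 0] CB[of 0] norm_ge_zero order_trans by blast+
 define C where "C = 2 * (1 + CA + 2 * CB)"
 have C: "C > 0" using C0 by (simp add: C_def)
 define \<rho> where "\<rho> = dt A B w (n + k) z / (dt A B w n z * dt A B w k (z + of_nat n * w))"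
 have nz: "dt A B w n z ~= 0" "dt A B w k (z + of_nat n * w) ~= 0" "dt A B w (n + k) z ~= 0"
  using dt_nonzero s.dt_nonzero by auto
 have "ln (cmod \<rho>) = ln (cmod (dt A B w (n + k) z)) - ln (cmod (dt A B w n z)) - ln (cmod (dt A B w k (z + of_nat n * w)))"
  unfolding \<rho>_def norm_divide norm_mult using nz by (simp add: ln_div ln_mult)
 moreover have "ln (cmod \<rho>) <= ln (C^2 / \<eta>^2)"
  using split_ratio(2)[of n k] nz unfolding \<rho>_def[symmetric] C_def[symmetric]
  by (intro ln_mono) (auto simp: \<rho>_def)
 moreover have "ln (\<eta>^2 / C^2) <= ln (cmod \<rho>)"
  using split_ratio(1)[of n k] C eta unfolding \<rho>_def[symmetric] C_def[symmetric]
  by (intro ln_mono) auto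
 moreover have "ln (C^2 / \<eta>^2) = 2 * ln (C / \<eta>)" "ln (\<eta>^2 / C^2) = - 2 * ln (C / \<eta>)"
  using C eta by (simp_all add: ln_div ln_realpow)
 ultimately show ?thesis unfolding C_def by linarith
qed

end

section \<open>Hermitian matrices\<close>

definition hmat :: "nat => (nat => nat => complex) => complex mat" where
 "hmat n A = Matrix.mat n n (%(i, j). A i j)"

lemma hmat_carrier [simp]: "hmat n A : carrier_mat n n"
 by (simp add: hmat_def)

lemma hmat_index [simp]: "i < n ==> j < n ==> hmat n A $$ (i, j) = A i j"
 by (simp add: hmat_def)

lemma hmat_mult: "hmat n A * hmat n B = hmat n (%i j. \<Sum>k<n. A i k * B k j)"
 by (rule eq_matI) (simp_all add: hmat_def scalar_prod_def atLeast0LessThan)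

lemma sum_delta_mult:
 fixes n i :: nat
 assumes "i < n" shows "(\<Sum>k<n. (if i = k then (1::complex) else 0) * f k) = f i"
  "(\<Sum>k<n. f k * (if k = i then (1::complex) else 0)) = f i"
proof -
 have "(\<Sum>k<n. (if i = k then (1::complex) else 0) * f k) = (\<Sum>k<n. if i = k then f k else 0)"
  "(\<Sum>k<n. f k * (if k = i then (1::complex) else 0)) = (\<Sum>k<n. if k = i then f k else 0)"
  by (intro sum.cong; simp)+
 then show "(\<Sum>k<n. (if i = k then (1::complex) else 0) * f k) = f i"
  "(\<Sum>k<n. f k * (if k = i then (1::complex) else 0)) = f i"
  using assms by (simp_all add: sum.delta sum.delta')
qed

text \<open>Householder reflection; the phase of \<open>v\<close> is normalised by \<open>v 0 \<le> 0\<close>.\<close>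

lemma householder:
 fixes v :: "nat => complex"
 assumes n: "n > 0" and v: "(\<Sum>k<n. cnj (v k) * v k) = 1" and v0: "v 0 = of_real r" "r <= 0"
 obtains w where "!!i j. cnj (w i j) = w j i" "!!i. i < n ==> w i 0 = v i"
  "!!i j. i < n ==> j < n ==> (\<Sum>k<n. w i k * w k j) = (if i = j then 1 else 0)"
proof -
 define u where "u k = (if k = 0 then 1 else 0) - v k" for k :: nat
 define s where "s = 1 - complex_of_real r"
 have s: "s ~= 0" "cnj s = s"
  using v0 by (auto simp: s_def complex_eq_iff)
 have uu: "(\<Sum>k<n. cnj (u k) * u k) = 2 * s"
 proof -
  obtain m where m: "n = Suc m" using n by (cases n) auto
  have t: "(\<Sum>k<m. cnj (v (Suc k)) * v (Suc k)) = 1 - of_real r * of_real r"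
   using v unfolding m sum.lessThan_Suc_shift v0(1) by (simp add: algebra_simps)
  show ?thesis unfolding m sum.lessThan_Suc_shift u_def using t v0
   by (simp add: s_def algebra_simps)
 qed
 define w where "w i j = (if i = j then 1 else 0) - u i * cnj (u j) / s" for i j :: nat
 show ?thesis
 proof
  show "cnj (w i j) = w j i" for i j by (auto simp: w_def s(2))
  show "w i 0 = v i" if "i < n" for i
  proof -
   have "u 0 = s" using v0 by (simp add: u_def s_def)
   then show ?thesis using s by (simp add: w_def u_def)
  qed
  show "(\<Sum>k<n. w i k * w k j) = (if i = j then 1 else 0)" if ij: "i < n" "j < n" for i j
  proof -
   have "(\<Sum>k<n. w i k * w k j) = (\<Sum>k<n. (if i = k then 1 else 0) * w k j)
     - (\<Sum>k<n. (u i * cnj (u k) / s) * (if k = j then 1 else 0))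
     + (\<Sum>k<n. (u i * cnj (u j) / (s * s)) * (cnj (u k) * u k))"
    unfolding sum_subtractf[symmetric] sum.distrib[symmetric]
    by (intro sum.cong refl) (simp add: w_def algebra_simps)
   also have "... = w i j - u i * cnj (u j) / s + (u i * cnj (u j) / (s * s)) * (2 * s)"
    using ij by (simp only: sum_delta_mult uu sum_distrib_left[symmetric])
   also have "... = (if i = j then 1 else 0)" using s by (simp add: w_def field_simps)
   finally show ?thesis .
  qed
 qed
qed

text \<open>The eigenvector is multiplied by a phase that makes its entry at \<open>0\<close>
  nonpositive. The reflection taking the first basis vector to it then divides by
  \<open>1 - r >= 1\<close> and is never degenerate.\<close>

lemma unit_eigenvector:
 assumes "poly (char_poly (hmat n A)) e = 0"
 obtains v r where "(\<Sum>k<n. cnj (v k) * v k) = 1" "v 0 = complex_of_real r" "r <= 0"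
  "!!i. i < n ==> (\<Sum>k<n. A i k * v k) = e * v i"
proof -
 have "eigenvalue (hmat n A) e" using assms eigenvalue_root_char_poly[OF hmat_carrier] by blast
 then obtain x where x: "x : carrier_vec n" "x ~= 0\<^sub>v n" "hmat n A *\<^sub>v x = e \<cdot>\<^sub>v x"
  unfolding eigenvalue_def eigenvector_def by (auto simp: hmat_def)
 define u where "u k = vec_index x k" for k
 have Au: "(\<Sum>k<n. A i k * u k) = e * u i" if "i < n" for i
 proof -
  have "vec_index (hmat n A *\<^sub>v x) i = (\<Sum>k<n. A i k * u k)"
   using that x(1) by (simp add: hmat_def scalar_prod_def atLeast0LessThan u_def)
  moreover have "vec_index (hmat n A *\<^sub>v x) i = e * u i"
   unfolding x(3) using that x(1) by (simp add: u_def)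
  ultimately show ?thesis by simp
 qed
 define S where "S = (\<Sum>k<n. (cmod (u k))^2)"
 obtain k where k: "k < n" "u k ~= 0"
  using x unfolding u_def by (metis carrier_vecD eq_vecI index_zero_vec)
 have S: "S > 0" unfolding S_def using k by (intro sum_pos2[of _ k]) auto
 define c where "c = (if u 0 = 0 then 1 else - cnj (u 0) / of_real (cmod (u 0))) / complex_of_real (sqrt S)"
 have cc: "cnj c * c = 1 / of_real S"
 proof -
  have "cmod c = 1 / sqrt S" using S by (simp add: c_def norm_divide)
  then have "(cmod c)^2 = 1 / S" using S by (simp add: power_divide)
  then have "complex_of_real ((cmod c)^2) = complex_of_real (1 / S)" by (rule arg_cong)
  then show ?thesis unfolding complex_norm_square by (simp add: mult.commute)
 qed
 define v where "v k = c * u k" for k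
 have "(\<Sum>k<n. cnj (v k) * v k) = (cnj c * c) * (\<Sum>k<n. cnj (u k) * u k)"
  unfolding sum_distrib_left by (intro sum.cong) (auto simp: v_def)
 also have "(\<Sum>k<n. cnj (u k) * u k) = of_real S"
  unfolding S_def of_real_sum complex_norm_square by (simp add: mult.commute)
 finally have 1: "(\<Sum>k<n. cnj (v k) * v k) = 1" using S by (simp add: cc)
 have 2: "v 0 = complex_of_real (- cmod (u 0) / sqrt S)"
 proof (cases "u 0 = 0")
  case False
  have "cnj (u 0) * u 0 = of_real (cmod (u 0)) * of_real (cmod (u 0))"
   using complex_norm_square[of "u 0"] by (simp add: power2_eq_square mult.commute)
  then show ?thesis using False by (simp add: v_def c_def)
 qed (simp add: v_def)
 have 3: "(\<Sum>k<n. A i k * v k) = e * v i" if "i < n" for i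
 proof -
  have "(\<Sum>k<n. A i k * v k) = c * (\<Sum>k<n. A i k * u k)"
   unfolding sum_distrib_left by (intro sum.cong) (auto simp: v_def)
  then show ?thesis using Au[OF that] by (simp add: v_def)
 qed
 show ?thesis using that[OF 1 2 _ 3] S by simp
qed

lemma char_poly_deflate:
 assumes "!!i. i < Suc m ==> B i 0 = (if i = 0 then e else 0)"
 shows "char_poly (hmat (Suc m) B) = [:- e, 1:] * char_poly (hmat m (%i j. B (Suc i) (Suc j)))"
proof -
 have eq: "hmat (Suc m) B = four_block_mat (Matrix.mat 1 1 (%_. e)) (Matrix.mat 1 m (%(i, j). B 0 (Suc j)))
   (0\<^sub>m m 1) (hmat m (%i j. B (Suc i) (Suc j)))"
  by (rule eq_matI) (auto simp: hmat_def assms)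
 have "char_poly (Matrix.mat 1 1 (%_. e)) = [:- e, 1:]"
  by (subst char_poly_upper_triangular[of _ 1]) (auto simp: diag_mat_def)
 then show ?thesis unfolding eq by (subst char_poly_four_block_zeros_col) auto
qed

lemma sum_swap3:
 fixes n :: nat
 shows "(\<Sum>k<n. (\<Sum>p<n. X p k) * Y k) = (\<Sum>p<n. \<Sum>k<n. X p k * (Y k :: complex))"
 unfolding sum_distrib_right by (rule sum.swap)

text \<open>Deflation: conjugation with a reflection built from a unit eigenvector clears the first
  column, hence by symmetry the first row, and the trailing block is left to the induction. Repeated
  roots are allowed, so two indices with the same eigenvalue still receive orthogonal eigenvectors;
  separation over indices depends on this.\<close>

theorem hermitian_eigenbasis:
 assumes "!!i j. i < n ==> j < n ==> cnj (A i j) = A j i"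
  and "char_poly (hmat n A) = (\<Prod>e\<leftarrow>es. [:- e, 1:])"
 shows "\<exists>U. (\<forall>i<n. \<forall>j<n. (\<Sum>k<n. cnj (U k i) * U k j) = (if i = j then 1 else 0)) &
       (\<forall>i<n. \<forall>j<n. (\<Sum>k<n. A i k * U k j) = es ! j * U i j)"
 using assms
proof (induction es arbitrary: n A)
 case Nil
 have "degree (char_poly (hmat n A)) = n" using degree_monic_char_poly[OF hmat_carrier] by blast
 then have "n = 0" using Nil by simp
 then show ?case by simp
next
 case (Cons e es)
 have "degree (char_poly (hmat n A)) = n" using degree_monic_char_poly[OF hmat_carrier] by blast
 then obtain m where n: "n = Suc m" unfolding Cons.prems(2) degree_linear_factors
  by (cases n) auto
 have "poly (char_poly (hmat n A)) e = 0" unfolding Cons.prems(2) by simp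
 then obtain v r where v: "(\<Sum>k<n. cnj (v k) * v k) = 1" "v 0 = complex_of_real r" "r <= 0"
  "!!i. i < n ==> (\<Sum>k<n. A i k * v k) = e * v i" by (rule unit_eigenvector) blast
 obtain w where w: "!!i j. cnj (w i j) = w j i" "!!i. i < n ==> w i 0 = v i"
  "!!i j. i < n ==> j < n ==> (\<Sum>k<n. w i k * w k j) = (if i = j then 1 else 0)"
  using householder[OF _ v(1-3)] n by blast
 define B where "B i j = (\<Sum>l<n. (\<Sum>k<n. w i k * A k l) * w l j)" for i j
 have W1: "hmat n w * hmat n w = 1\<^sub>m n"
  unfolding hmat_mult by (rule eq_matI) (auto simp: w(3) hmat_def)
 have Bm: "hmat n B = hmat n w * hmat n A * hmat n w"
  unfolding hmat_mult B_def ..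
 have sim: "similar_mat (hmat n B) (hmat n A)"
  unfolding similar_mat_def similar_mat_wit_def Let_def
  using W1 Bm by (auto simp: hmat_def intro!: exI[of _ "hmat n w"])
 have cpB: "char_poly (hmat n B) = (\<Prod>e\<leftarrow>e # es. [:- e, 1:])"
  using char_poly_similar[OF sim] Cons.prems(2) by simp
 have wA: "(\<Sum>k<n. w i k * (\<Sum>l<n. A k l * x l)) = (\<Sum>l<n. (\<Sum>k<n. w i k * A k l) * x l)" for i x
  unfolding sum_distrib_left sum_distrib_right by (subst sum.swap) (simp add: mult.assoc)
 have B0: "B i 0 = (if i = 0 then e else 0)" if "i < n" for i
 proof -
  have "B i 0 = (\<Sum>k<n. w i k * (\<Sum>l<n. A k l * w l 0))"
   unfolding wA by (simp add: B_def)
  also have "... = (\<Sum>k<n. w i k * (e * w k 0))"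
   by (intro sum.cong arg_cong2[of _ _ _ _ "(*)"]) (auto simp: v(4) w(2))
  also have "... = e * (\<Sum>k<n. w i k * w k 0)"
   unfolding sum_distrib_left by (intro sum.cong) auto
  also have "... = (if i = 0 then e else 0)" using w(3)[OF that, of 0] n by simp
  finally show ?thesis .
 qed
 have Bh: "cnj (B i j) = B j i" if "i < n" "j < n" for i j
 proof -
  have "cnj (B i j) = (\<Sum>l<n. (\<Sum>k<n. cnj (A k l) * w k i) * w j l)"
   unfolding B_def by (simp add: w(1) mult.commute cong: sum.cong)
  also have "... = (\<Sum>l<n. w j l * (\<Sum>k<n. A l k * w k i))"
   using Cons.prems(1) by (intro sum.cong refl) (auto simp: mult.commute intro!: sum.cong)
  also have "... = B j i" unfolding wA B_def ..
  finally show ?thesis .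
 qed
 have "char_poly (hmat m (%i j. B (Suc i) (Suc j))) = (\<Prod>e\<leftarrow>es. [:- e, 1:])"
  using cpB char_poly_deflate[of m B e] B0 mult_left_cancel[of "[:- e, 1:]"] unfolding n
  by (metis (no_types, lifting) list.simps(9) pCons_eq_0_iff prod_list.Cons zero_neq_one)
 then have "\<exists>U. (\<forall>i<m. \<forall>j<m. (\<Sum>k<m. cnj (U k i) * U k j) = (if i = j then 1 else 0)) &
   (\<forall>i<m. \<forall>j<m. (\<Sum>k<m. B (Suc i) (Suc k) * U k j) = es ! j * U i j)"
  by (intro Cons.IH) (use Bh n in auto)
 then obtain U' where U': "!!i j. i < m ==> j < m ==> (\<Sum>k<m. cnj (U' k i) * U' k j) = (if i = j then 1 else 0)"
  "!!i j. i < m ==> j < m ==> (\<Sum>k<m. B (Suc i) (Suc k) * U' k j) = es ! j * U' i j"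
  by blast
 define V where "V i j = (case i of 0 => (case j of 0 => 1 | Suc j' => 0)
   | Suc i' => (case j of 0 => 0 | Suc j' => U' i' j'))" for i j :: nat
 have V1: "(\<Sum>k<n. cnj (V k i) * V k j) = (if i = j then 1 else 0)" if "i < n" "j < n" for i j
  using that U'(1) unfolding n sum.lessThan_Suc_shift by (cases i; cases j) (auto simp: V_def)
 have B0': "B 0 j = (if j = 0 then e else 0)" if "j < n" for j
  using Bh[of j 0] B0[of j] B0[of 0] Bh[of 0 0] that n by (auto split: if_splits)
 have V2: "(\<Sum>k<n. B i k * V k j) = (e # es) ! j * V i j" if "i < n" "j < n" for i j
  using that U'(2) B0[of i] B0' unfolding n sum.lessThan_Suc_shift
  by (cases i; cases j) (auto simp: V_def)
 define U where "U i j = (\<Sum>k<n. w i k * V k j)" for i j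
 have wU: "(\<Sum>i<n. w l i * U i j) = V l j" if "l < n" for l j
 proof -
  have "(\<Sum>i<n. w l i * U i j) = (\<Sum>k<n. (\<Sum>i<n. w l i * w i k) * V k j)"
   unfolding U_def sum_distrib_left sum_distrib_right by (subst sum.swap) (simp add: mult.assoc)
  also have "... = (\<Sum>k<n. (if l = k then 1 else 0) * V k j)"
   using that by (intro sum.cong refl) (simp add: w(3))
  also have "... = V l j" using that by (rule sum_delta_mult)
  finally show ?thesis .
 qed
 have "(\<Sum>k<n. cnj (U k i) * U k j) = (if i = j then 1 else 0)" if "i < n" "j < n" for i j
 proof -
  have "(\<Sum>k<n. cnj (U k i) * U k j) = (\<Sum>k<n. (\<Sum>l<n. w l k * cnj (V l i)) * U k j)"
   by (intro sum.cong refl) (simp add: U_def w(1))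
  also have "... = (\<Sum>l<n. cnj (V l i) * (\<Sum>k<n. w l k * U k j))"
   unfolding sum_swap3 sum_distrib_left by (intro sum.cong refl) (simp add: mult_ac)
  also have "... = (\<Sum>l<n. cnj (V l i) * V l j)"
   by (intro sum.cong refl) (simp add: wU)
  finally show ?thesis using V1[OF that] by simp
 qed
 moreover have "(\<Sum>k<n. A i k * U k j) = (e # es) ! j * U i j" if ij: "i < n" "j < n" for i j
 proof -
  have "(\<Sum>k<n. A i k * U k j) = (\<Sum>p<n. (if i = p then 1 else 0) * (\<Sum>k<n. A p k * U k j))"
   using ij by (simp only: sum_delta_mult)
  also have "... = (\<Sum>p<n. (\<Sum>q<n. w i q * w q p) * (\<Sum>k<n. A p k * U k j))"
   using ij by (intro sum.cong refl) (simp add: w(3))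
  also have "... = (\<Sum>q<n. w i q * (\<Sum>p<n. w q p * (\<Sum>k<n. A p k * U k j)))"
   unfolding sum_swap3 sum_distrib_left
   by (subst sum.swap) (intro sum.cong refl, simp add: sum_distrib_left sum_distrib_right mult_ac)
  also have "... = (\<Sum>q<n. w i q * ((e # es) ! j * V q j))"
  proof (intro sum.cong refl arg_cong2[of _ _ _ _ "(*)"])
   fix q assume q: "q : {..<n}"
   have "(\<Sum>p<n. w q p * (\<Sum>k<n. A p k * U k j)) = (\<Sum>l<n. (\<Sum>k<n. w q k * A k l) * (\<Sum>k<n. w l k * V k j))"
    unfolding wA by (simp add: U_def)
   also have "... = (\<Sum>k<n. B q k * V k j)"
    unfolding B_def sum_distrib_left sum_distrib_right
    by (subst sum.swap) (intro sum.cong refl, simp add: mult_ac)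
   finally show "(\<Sum>p<n. w q p * (\<Sum>k<n. A p k * U k j)) = (e # es) ! j * V q j"
    using V2 q ij by simp
  qed
  also have "... = (e # es) ! j * U i j"
   unfolding U_def sum_distrib_left by (intro sum.cong refl) (simp add: mult_ac)
  finally show ?thesis .
 qed
 ultimately show ?case by blast
qed


lemma unitary_parseval:
 fixes n :: nat and U :: "nat => nat => complex"
 assumes "!!i j. i < n ==> j < n ==> (\<Sum>k<n. cnj (U k i) * U k j) = (if i = j then 1 else 0)"
 shows "(\<Sum>j<n. (cmod (\<Sum>i<n. cnj (U i j) * u i))^2) = (\<Sum>i<n. (cmod (u i))^2)"
proof -
 define V where "V i j = cnj (U j i)" for i j
 have "hmat n V * hmat n U = 1\<^sub>m n"
  unfolding hmat_mult by (rule eq_matI) (auto simp: assms hmat_def V_def)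
 then have "hmat n U * hmat n V = 1\<^sub>m n"
  by (rule mat_mult_left_right_inverse[OF hmat_carrier hmat_carrier])
 then have UV: "(\<Sum>k<n. U i k * cnj (U j k)) = (if i = j then 1 else 0)" if "i < n" "j < n" for i j
  using that hmat_index[of i n j "%i j. \<Sum>k<n. U i k * V k j"] unfolding hmat_mult by (simp add: V_def)
 have "complex_of_real (\<Sum>j<n. (cmod (\<Sum>i<n. cnj (U i j) * u i))^2)
   = (\<Sum>j<n. (\<Sum>i<n. cnj (U i j) * u i) * (\<Sum>p<n. U p j * cnj (u p)))"
  unfolding of_real_sum complex_norm_square by (simp add: cnj_sum)
 also have "... = (\<Sum>j<n. \<Sum>i<n. \<Sum>p<n. (U p j * cnj (U i j)) * (u i * cnj (u p)))"
  unfolding sum_product by (simp add: mult_ac)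
 also have "... = (\<Sum>i<n. \<Sum>p<n. \<Sum>j<n. (U p j * cnj (U i j)) * (u i * cnj (u p)))"
  by (rule trans[OF sum.swap], rule sum.cong[OF refl], rule sum.swap)
 also have "... = (\<Sum>i<n. \<Sum>p<n. (if i = p then 1 else 0) * (u i * cnj (u p)))"
  by (intro sum.cong refl) (simp add: sum_distrib_right[symmetric] UV)
 also have "... = (\<Sum>i<n. u i * cnj (u i))"
  by (intro sum.cong refl) (simp only: sum_delta_mult lessThan_iff)
 also have "... = complex_of_real (\<Sum>i<n. (cmod (u i))^2)"
  unfolding of_real_sum complex_norm_square by simp
 finally show ?thesis by (simp only: of_real_eq_iff)
qed

text \<open>In an orthonormal eigenbasis the coefficients of the residual are, in modulus, those of
  \<open>u\<close> times the distances of the eigenvalues from \<open>E\<close>. If all distances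
  exceeded \<epsilon>, Parseval would make the residual too large.\<close>

lemma hermitian_spectrum_dist:
 assumes herm: "!!i j. i < n ==> j < n ==> cnj (A i j) = A j i"
  and cp: "char_poly (hmat n A) = (\<Prod>e\<leftarrow>es. [:- e, 1:])"
  and u: "(\<Sum>i<n. (cmod (u i))^2) > 0"
  and res: "(\<Sum>i<n. (cmod ((\<Sum>k<n. A i k * u k) - of_real E * u i))^2) <= \<epsilon>^2 * (\<Sum>i<n. (cmod (u i))^2)"
  and \<epsilon>: "\<epsilon> >= 0"
 shows "\<exists>e\<in>set es. cmod (e - of_real E) <= \<epsilon>"
proof (rule ccontr)
 assume "\<not> ?thesis"
 then have far: "cmod (e - of_real E) > \<epsilon>" if "e : set es" for e using that by force
 have len: "length es = n"
  using degree_monic_char_poly[OF hmat_carrier, of n A] unfolding cp degree_linear_factors by simp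
 obtain U where U: "!!i j. i < n ==> j < n ==> (\<Sum>k<n. cnj (U k i) * U k j) = (if i = j then 1 else 0)"
  and ev: "!!i j. i < n ==> j < n ==> (\<Sum>k<n. A i k * U k j) = es ! j * U i j"
  using hermitian_eigenbasis[OF herm cp] by blast
 define c where "c f j = (\<Sum>i<n. cnj (U i j) * f i)" for f :: "nat => complex" and j
 define g where "g i = (\<Sum>k<n. A i k * u k) - of_real E * u i" for i
 have cg: "c g j = (cnj (es ! j) - of_real E) * c u j" if j: "j < n" for j
 proof -
  have "(\<Sum>i<n. cnj (U i j) * (\<Sum>k<n. A i k * u k)) = (\<Sum>k<n. (\<Sum>i<n. cnj (U i j) * A i k) * u k)"
   unfolding sum_distrib_left sum_distrib_right by (subst sum.swap) (simp add: mult.assoc)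
  also have "... = (\<Sum>k<n. cnj (es ! j * U k j) * u k)"
  proof (intro sum.cong refl arg_cong2[of _ _ _ _ "(*)"])
   fix k assume k: "k : {..<n}"
   have "(\<Sum>i<n. cnj (U i j) * A i k) = (\<Sum>i<n. cnj (A k i * U i j))"
    using herm k by (intro sum.cong refl) (simp add: mult.commute)
   then show "(\<Sum>i<n. cnj (U i j) * A i k) = cnj (es ! j * U k j)"
    using ev[of k j] k j by (metis cnj_sum lessThan_iff)
  qed
  also have "... = cnj (es ! j) * c u j"
   unfolding c_def sum_distrib_left by (intro sum.cong refl) simp
  finally have 1: "(\<Sum>i<n. cnj (U i j) * (\<Sum>k<n. A i k * u k)) = cnj (es ! j) * c u j" .
  have 2: "(\<Sum>i<n. cnj (U i j) * (of_real E * u i)) = of_real E * c u j"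
   unfolding c_def sum_distrib_left by (intro sum.cong refl) simp
  show ?thesis
   unfolding c_def[of g] g_def right_diff_distrib sum_subtractf 1 2 by (simp add: algebra_simps)
 qed
 have pars: "(\<Sum>j<n. (cmod (c f j))^2) = (\<Sum>i<n. (cmod (f i))^2)" for f
  unfolding c_def by (rule unitary_parseval[OF U])
 have ge: "(cmod (c g j))^2 >= \<epsilon>^2 * (cmod (c u j))^2" and gt: "c u j ~= 0 ==> (cmod (c g j))^2 > \<epsilon>^2 * (cmod (c u j))^2"
  if "j < n" for j
 proof -
  have "cmod (cnj (es ! j) - of_real E) = cmod (es ! j - of_real E)"
   by (metis complex_cnj_complex_of_real complex_cnj_diff complex_mod_cnj)
  then have f: "cmod (cnj (es ! j) - of_real E) > \<epsilon>" using far[of "es ! j"] that len by simp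
  then have "(cmod (cnj (es ! j) - of_real E))^2 > \<epsilon>^2" using \<epsilon> by (intro power_strict_mono) auto
  then show "(cmod (c g j))^2 >= \<epsilon>^2 * (cmod (c u j))^2"
   "c u j ~= 0 ==> (cmod (c g j))^2 > \<epsilon>^2 * (cmod (c u j))^2"
   unfolding cg[OF that] norm_mult power_mult_distrib by (auto intro!: mult_right_mono)
 qed
 have "\<exists>j<n. c u j ~= 0"
 proof (rule ccontr)
  assume "\<not> (\<exists>j<n. c u j ~= 0)"
  then have "(\<Sum>j<n. (cmod (c u j))^2) = 0" by simp
  then show False using u pars by simp
 qed
 then have "(\<Sum>j<n. \<epsilon>^2 * (cmod (c u j))^2) < (\<Sum>j<n. (cmod (c g j))^2)"
  using ge gt by (intro sum_strict_mono_ex1) auto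
 then show False using res unfolding sum_distrib_left[symmetric] pars g_def by simp
qed

section \<open>Tridiagonal determinants\<close>

definition tridiag :: "nat => (nat => 'a) => (nat => 'a) => (nat => 'a) => 'a :: comm_ring_1 mat" where
 "tridiag N a b c = Matrix.mat N N (%(k, l). if k = l then a k else if l = Suc k then b k else if k = Suc l then c l else 0)"

fun tricont :: "(nat => 'a) => (nat => 'a) => nat => 'a :: comm_ring_1" where
 "tricont a d 0 = 1"
| "tricont a d (Suc 0) = a 0"
| "tricont a d (Suc (Suc n)) = a (Suc n) * tricont a d (Suc n) - d n * tricont a d n"

lemma tridiag_carrier [simp]: "tridiag N a b c : carrier_mat N N"
 by (simp add: tridiag_def)

lemma det_tridiag: "Determinant.det (tridiag N a b c) = tricont a (%n. b n * c n) N"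
proof (induction N rule: induct_nat_012)
 case 0
 then show ?case by (simp add: tridiag_def)
next
 case 1
 then show ?case by (simp add: tridiag_def det_single)
next
 case (ge2 n)
 let ?M = "tridiag (Suc (Suc n)) a b c"
 let ?D = "mat_delete ?M (Suc n) n"
 have D: "?D : carrier_mat (Suc n) (Suc n)" by (simp add: mat_delete_def tridiag_def)
 have d1: "mat_delete ?M (Suc n) (Suc n) = tridiag (Suc n) a b c"
  by (rule eq_matI) (auto simp: mat_delete_def tridiag_def)
 have d2: "mat_delete ?D n n = tridiag n a b c"
  by (rule eq_matI) (auto simp: mat_delete_def tridiag_def)
 have "Determinant.det ?D = (\<Sum>i<Suc n. ?D $$ (i, n) * cofactor ?D i n)"
  by (rule laplace_expansion_column[OF D]) simp
 also have "... = (\<Sum>i<Suc n. if i = n then b n * cofactor ?D n n else 0)"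
  by (intro sum.cong refl) (auto simp: mat_delete_def tridiag_def)
 also have "... = b n * cofactor ?D n n" by simp
 also have "... = b n * Determinant.det (tridiag n a b c)" by (simp add: cofactor_def d2)
 finally have detD: "Determinant.det ?D = b n * Determinant.det (tridiag n a b c)" .
 have "Determinant.det ?M = (\<Sum>j<Suc (Suc n). ?M $$ (Suc n, j) * cofactor ?M (Suc n) j)"
  by (rule laplace_expansion_row[OF tridiag_carrier]) simp
 also have "... = ?M $$ (Suc n, Suc n) * cofactor ?M (Suc n) (Suc n) + ?M $$ (Suc n, n) * cofactor ?M (Suc n) n
   + (\<Sum>j<n. ?M $$ (Suc n, j) * cofactor ?M (Suc n) j)"
  by simp
 also have "(\<Sum>j<n. ?M $$ (Suc n, j) * cofactor ?M (Suc n) j) = 0"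
  by (intro sum.neutral) (auto simp: tridiag_def)
 also have "cofactor ?M (Suc n) n = - Determinant.det ?D" by (simp add: cofactor_def)
 also have "cofactor ?M (Suc n) (Suc n) = Determinant.det (tridiag (Suc n) a b c)"
  by (simp add: cofactor_def d1)
 finally show ?case unfolding detD ge2.IH by (simp add: tridiag_def algebra_simps)
qed

lemma poly_char_poly_tridiag:
 fixes a b c :: "nat => 'a :: field"
 shows "poly (char_poly (tridiag N a b c)) \<zeta> = (- 1) ^ N * tricont (%k. a k - \<zeta>) (%n. b n * c n) N"
proof -
 have "poly (char_poly (tridiag N a b c)) \<zeta> = Determinant.det (- (char_matrix (tridiag N a b c) \<zeta>))"
  by (rule char_poly_matrix[OF tridiag_carrier])
 also have "- (char_matrix (tridiag N a b c) \<zeta>) = (- 1) \<cdot>\<^sub>m tridiag N (%k. a k - \<zeta>) b c"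
  by (rule eq_matI) (auto simp: char_matrix_def tridiag_def)
 also have "Determinant.det ... = (- 1) ^ N * Determinant.det (tridiag N (%k. a k - \<zeta>) b c)"
  by (simp add: det_smult tridiag_def)
 finally show ?thesis unfolding det_tridiag .
qed

text \<open>Mirrored entries enter only through their product, so the phase of \<open>b\<close> can
  be gauged away without changing the spectrum.\<close>

lemma char_poly_tridiag_cong:
 fixes a b c b' c' :: "nat => 'a :: field_char_0"
 assumes "!!n. b n * c n = b' n * c' n"
 shows "char_poly (tridiag N a b c) = char_poly (tridiag N a b' c')"
 using assms by (intro poly_ext) (simp add: poly_char_poly_tridiag)

section \<open>Zeros of bounded holomorphic functions\<close>

abbreviation zfac :: "complex list => complex => complex" where
 "zfac zs z \<equiv> (\<Prod>w\<leftarrow>zs. z - w)"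

lemma zfac_holomorphic [holomorphic_intros]: "zfac zs holomorphic_on S"
 by (induction zs) (auto intro!: holomorphic_intros)

lemma zfac_le:
 assumes "!!w. w : set zs ==> cmod (z - w) <= d"
 shows "cmod (zfac zs z) <= d ^ length zs"
 using assms by (induction zs) (auto simp: norm_mult intro!: mult_mono intro: order_trans[OF norm_ge_zero])

lemma zfac_ge:
 assumes "!!w. w : set zs ==> d <= cmod (z - w)" "d >= 0"
 shows "d ^ length zs <= cmod (zfac zs z)"
 using assms by (induction zs) (auto simp: norm_mult intro!: mult_mono)

lemma zfac_eq_0_iff: "zfac zs z = 0 \<longleftrightarrow> z : set zs"
 by (induction zs) auto

text \<open>The ratio \<open>6\<close> leaves room for two radii: zeros are split off inside radius
  \<open>2 * r\<close>, and the quotient is bounded on the circle of radius \<open>6 * r\<close>,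
  where every removed zero is at least \<open>4 * r\<close> away.\<close>

locale disc_bound =
 fixes F :: "complex => complex" and c :: complex and r R M m :: real
 assumes hol: "F holomorphic_on ball c R" and r: "r > 0" "6 * r < R"
  and M: "!!z. z : ball c R ==> cmod (F z) <= M"
  and m: "0 < m" "m <= cmod (F c)"
begin

lemma M_pos: "M > 0" "m <= M"
proof -
 have "c : ball c R" using r by auto
 from M[OF this] m show "M > 0" "m <= M" by linarith+
qed

lemma quotient_bound:
 assumes zs: "set zs \<subseteq> cball c (2 * r)" and g: "g holomorphic_on ball c R"
  and eq: "!!z. z : ball c R ==> F z = zfac zs z * g z"
  and z: "z : cball c (6 * r)"
 shows "cmod (g z) <= M / (4 * r) ^ length zs"
proof (rule maximum_modulus_frontier[where S = "cball c (6 * r)" and f = g and \<xi> = z])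
 show "g holomorphic_on interior (cball c (6 * r))"
  using r by (intro holomorphic_on_subset[OF g]) auto
 have "continuous_on (ball c R) g" using g holomorphic_on_imp_continuous_on by blast
 then show "continuous_on (closure (cball c (6 * r))) g"
  by (rule continuous_on_subset) (use r in auto)
 fix x assume "x : frontier (cball c (6 * r))"
 then have x: "dist c x = 6 * r" by (simp add: frontier_cball)
 then have xR: "x : ball c R" using r by simp
 have "(4 * r) ^ length zs <= cmod (zfac zs x)"
 proof (rule zfac_ge)
  fix w assume "w : set zs"
  then have "dist c w <= 2 * r" using zs by auto
  then show "4 * r <= cmod (x - w)" using x dist_triangle[of c x w] by (simp add: dist_norm norm_minus_commute)
 qed (use r in simp)
 moreover have "cmod (zfac zs x) * cmod (g x) <= M"
  using M[OF xR] unfolding eq[OF xR] norm_mult .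
 ultimately have "(4 * r) ^ length zs * cmod (g x) <= M"
  using mult_right_mono[of "(4 * r) ^ length zs" _ "cmod (g x)"] by force
 then show "cmod (g x) <= M / (4 * r) ^ length zs" using r by (simp add: pos_le_divide_eq mult.commute)
qed (use z in auto)

lemma centre_bound:
 assumes zs: "set zs \<subseteq> cball c (2 * r)"
  and eq: "!!z. z : ball c R ==> F z = zfac zs z * g z"
 shows "m / (2 * r) ^ length zs <= cmod (g c)"
proof -
 have "cmod (zfac zs c) <= (2 * r) ^ length zs"
  using zs by (intro zfac_le) (auto simp: dist_norm)
 then have "cmod (F c) <= (2 * r) ^ length zs * cmod (g c)"
  using eq[of c] r by (simp add: norm_mult mult_right_mono)
 then show ?thesis using m r by (simp add: pos_divide_le_eq mult.commute)
qed

text \<open>A form of Jensen's inequality: each removed zero contributes a factor of at least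
  \<open>4 * r\<close> on the outer circle but at most \<open>2 * r\<close> at the centre, so it
  gains a factor \<open>2\<close>.\<close>

lemma zeros_bound:
 assumes zs: "set zs \<subseteq> cball c (2 * r)" and g: "g holomorphic_on ball c R"
  and eq: "!!z. z : ball c R ==> F z = zfac zs z * g z"
 shows "2 ^ length zs <= M / m"
proof -
 have "m / (2 * r) ^ length zs <= M / (4 * r) ^ length zs"
  by (rule order_trans[OF centre_bound[OF zs eq] quotient_bound[OF zs g eq]]) (use r in simp_all)
 moreover have "(4 * r) ^ length zs = 2 ^ length zs * (2 * r) ^ length zs"
  by (subst power_mult_distrib[symmetric]) simp
 moreover have "(2 * r) ^ length zs > 0" using r by simp
 moreover have "m <= M / T" if "m / X <= M / Y" "Y = T * X" "X > 0" "T > 0" for T X Y :: real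
  using that by (simp add: field_simps)
 ultimately have "m <= M / 2 ^ length zs" by (meson zero_less_numeral zero_less_power)
 then show ?thesis using m by (simp add: field_simps)
qed

text \<open>Split off the largest possible number of zeros, which exists by
  \<open>zeros_bound\<close>; a further zero of the quotient would give one more factor. Zeros are
  listed with multiplicity.\<close>

lemma factorization:
 obtains zs g where "set zs \<subseteq> cball c (2 * r)" "g holomorphic_on ball c R"
  "!!z. z : ball c R ==> F z = zfac zs z * g z"
  "!!z. z : cball c (2 * r) ==> g z ~= 0"
proof -
 define P where "P n \<longleftrightarrow> (\<exists>zs g. length zs = n & set zs \<subseteq> cball c (2 * r) & g holomorphic_on ball c R &
  (\<forall>z\<in>ball c R. F z = zfac zs z * g z))" for n
 obtain b where b: "M / m < 2 ^ b" using real_arch_pow[of 2 "M / m"] by auto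
 have Pb: "n <= b" if Pn: "P n" for n
 proof -
  have "2 ^ n <= M / m" using Pn zeros_bound unfolding P_def by blast
  then have "(2::real) ^ n < 2 ^ b" using b by linarith
  then show ?thesis by simp
 qed
 have "P 0" unfolding P_def using hol by (intro exI[of _ "[]"] exI[of _ F]) auto
 then have PG: "P (Greatest P)" using Pb by (rule GreatestI_nat)
 then obtain zs g where g: "length zs = Greatest P" "set zs \<subseteq> cball c (2 * r)" "g holomorphic_on ball c R"
  "!!z. z : ball c R ==> F z = zfac zs z * g z" unfolding P_def by blast
 have "g w ~= 0" if w: "w : cball c (2 * r)" for w
 proof
  assume 0: "g w = 0"
  define h where "h z = (if z = w then deriv g w else (g z - g w) / (z - w))" for z
  have "h holomorphic_on ball c R" unfolding h_def by (rule pole_lemma_open[OF g(3)]) simp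
  moreover have "g z = (z - w) * h z" for z by (simp add: h_def 0)
  ultimately have "length (w # zs) = Suc (length zs) & set (w # zs) \<subseteq> cball c (2 * r) &
    h holomorphic_on ball c R & (\<forall>z\<in>ball c R. F z = zfac (w # zs) z * h z)"
   using g(2) g(4) w by simp
  then have "P (Suc (length zs))" unfolding P_def[of "Suc (length zs)"] by blast
  then have "P (Suc (Greatest P))" by (simp only: g(1))
  then show False using Greatest_le_nat[of P _ b] Pb by fastforce
 qed
 then show ?thesis using that g by blast
qed

text \<open>For the normalised logarithm \<open>h\<close> of \<open>g\<close> the hypothesis reads
  \<open>Re h < K\<close>. The Schwarz lemma turns this one-sided bound into
  \<open>cmod (h z) <= 6 * K\<close> on radius \<open>3 * r / 2\<close>, and Cauchy's inequality on
  discs of radius \<open>r / 2\<close> gives the logarithmic derivative.\<close>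

lemma borel_caratheodory:
 assumes g: "g holomorphic_on ball c R" and nz: "!!z. z : cball c (2 * r) ==> g z ~= 0"
  and K: "K > 0" "!!z. z : cball c (2 * r) ==> cmod (g z) < exp K * cmod (g c)"
 shows "!!z. z : cball c (3 * r / 2) ==> exp (- 6 * K) * cmod (g c) <= cmod (g z)"
  "!!z. z : cball c r ==> cmod (deriv g z / g z) <= 12 * K / r"
proof -
 have gb: "g holomorphic_on ball c (2 * r)" using r by (intro holomorphic_on_subset[OF g]) auto
 obtain l where l: "l holomorphic_on ball c (2 * r)" "!!x. x : ball c (2 * r) ==> exp (l x) = g x"
 proof (rule holomorphic_logarithm_exists[OF convex_ball open_ball gb])
  show "g x ~= 0" if "x : ball c (2 * r)" for x using nz[of x] that by simp
  show "c : ball c (2 * r)" using r by simp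
 qed blast
 define h where "h z = l z - l c" for z
 have h: "h holomorphic_on ball c (2 * r)" unfolding h_def by (intro holomorphic_intros l)
 have gc: "g c ~= 0" by (rule nz) (use r in simp)
 have lc: "exp (l c) = g c" by (rule l) (use r in simp)
 have gh: "g z = g c * exp (h z)" if "z : ball c (2 * r)" for z
  unfolding h_def exp_diff l(2)[OF that] lc using gc by simp
 have Re: "Re (h z) < K" if "z : ball c (2 * r)" for z
 proof -
  have "exp (Re (h z)) * cmod (g c) < exp K * cmod (g c)"
  proof -
   have "cmod (g z) < exp K * cmod (g c)" by (rule K) (use that in simp)
   then show ?thesis unfolding gh[OF that] norm_mult norm_exp_eq_Re by (simp only: mult.commute)
  qed
  then show ?thesis using gc by simp
 qed
 \<comment> \<open>The map \<open>h / (2 * K - h)\<close> takes the half-plane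
   \<open>Re h < K\<close> into the unit disc and fixes \<open>0\<close>, as the Schwarz lemma
   requires.\<close>
 define \<phi> where "\<phi> \<xi> = h (c + of_real (2 * r) * \<xi>) / (2 * of_real K - h (c + of_real (2 * r) * \<xi>))" for \<xi>
 have inb: "c + of_real (2 * r) * \<xi> : ball c (2 * r)" if "cmod \<xi> < 1" for \<xi>
  using that r by (simp add: dist_norm norm_mult)
 have dnz: "2 * of_real K - h z ~= 0" if "z : ball c (2 * r)" for z
 proof
  assume "2 * of_real K - h z = 0"
  then have "Re (h z) = 2 * K" by (simp add: complex_eq_iff)
  then show False using Re[OF that] K by simp
 qed
 have hb: "cmod (h z) <= 6 * K" if z: "z : cball c (3 * r / 2)" for z
 proof -
  define \<xi> where "\<xi> = (z - c) / of_real (2 * r)"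
  have zx: "z = c + of_real (2 * r) * \<xi>" using r by (simp add: \<xi>_def)
  have x: "cmod \<xi> <= 3 / 4" using z r by (simp add: \<xi>_def norm_divide dist_norm norm_minus_commute divide_simps)
  have "cmod (\<phi> \<xi>) <= cmod \<xi>"
  proof (rule Schwarz_Lemma(1))
   have "(%\<xi>. h (c + of_real (2 * r) * \<xi>)) holomorphic_on ball 0 1"
   proof (rule holomorphic_on_compose_gen[OF _ h, unfolded o_def])
    show "(%\<xi>. c + complex_of_real (2 * r) * \<xi>) holomorphic_on ball 0 1"
     by (intro holomorphic_intros)
    show "(%\<xi>. c + complex_of_real (2 * r) * \<xi>) ` ball 0 1 \<subseteq> ball c (2 * r)"
     using inb by (auto simp del: mem_ball simp: mem_ball_0)
   qed
   then show "\<phi> holomorphic_on ball 0 1"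
    unfolding \<phi>_def by (intro holomorphic_intros) (use dnz inb in auto)
   show "\<phi> 0 = 0" by (simp add: \<phi>_def h_def)
   show "cmod (\<phi> \<xi>) < 1" if "cmod \<xi> < 1" for \<xi>
   proof -
    let ?h = "h (c + of_real (2 * r) * \<xi>)"
    have "(cmod ?h)^2 < (cmod (2 * of_real K - ?h))^2"
    proof -
     have "(cmod (2 * of_real K - ?h))^2 - (cmod ?h)^2 = 4 * K * (K - Re ?h)"
      unfolding cmod_power2 by (simp add: power2_eq_square algebra_simps)
     moreover have "4 * K * (K - Re ?h) > 0" using Re[OF inb[OF that]] K by simp
     ultimately show ?thesis by linarith
    qed
    then have "cmod ?h < cmod (2 * of_real K - ?h)" by (rule power2_less_imp_less) simp
    then show ?thesis unfolding \<phi>_def norm_divide using dnz[OF inb[OF that]] by (simp add: divide_less_eq)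
   qed
   show "cmod \<xi> < 1" using x by simp
  qed
  then have "cmod (h z) <= 3 / 4 * cmod (2 * of_real K - h z)"
  proof -
   have zb: "z : ball c (2 * r)" using z r by simp
   have "cmod (h z) / cmod (2 * of_real K - h z) <= 3 / 4"
    using \<open>cmod (\<phi> \<xi>) \<le> cmod \<xi>\<close> x unfolding \<phi>_def zx[symmetric] norm_divide by linarith
   then show ?thesis using dnz[OF zb] by (simp add: pos_divide_le_eq)
  qed
  also have "... <= 3 / 4 * (2 * K + cmod (h z))"
   using norm_triangle_ineq4[of "2 * of_real K" "h z"] K by (simp add: norm_mult)
  finally show ?thesis by simp
 qed
 show "exp (- 6 * K) * cmod (g c) <= cmod (g z)" if z: "z : cball c (3 * r / 2)" for z
 proof -
  have zb: "z : ball c (2 * r)" using z r by simp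
  have "- 6 * K <= Re (h z)" using hb[OF z] abs_Re_le_cmod[of "h z"] by linarith
  then show ?thesis unfolding gh[OF zb] norm_mult by (simp add: mult.commute mult_left_mono)
 qed
 show "cmod (deriv g z / g z) <= 12 * K / r" if z: "z : cball c r" for z
 proof -
  have zb: "z : ball c (2 * r)" using z r by simp
  have dh: "(h has_field_derivative deriv h z) (at z)"
   using h zb by (intro holomorphic_derivI) auto
  have "(g has_field_derivative g c * (exp (h z) * deriv h z)) (at z)"
  proof (rule has_field_derivative_transform_within_open[of "%z. g c * exp (h z)" _ _ "ball c (2 * r)"])
   show "((%z. g c * exp (h z)) has_field_derivative g c * (exp (h z) * deriv h z)) (at z)"
    by (auto intro!: derivative_eq_intros dh)
  qed (use zb gh in auto)
  then have "deriv g z = g z * deriv h z" using gh[OF zb] by (simp add: DERIV_imp_deriv mult_ac)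
  then have eq: "deriv g z / g z = deriv h z" using nz[of z] zb by simp
  have sub: "cball z (r / 2) \<subseteq> cball c (3 * r / 2)"
  proof
   fix x assume "x : cball z (r / 2)"
   then show "x : cball c (3 * r / 2)" using z dist_triangle[of c x z] by simp
  qed
  have "norm ((deriv ^^ 1) h z) <= fact 1 * (6 * K) / (r / 2) ^ 1"
  proof (rule Cauchy_inequality)
   have s2: "cball z (r / 2) \<subseteq> ball c (2 * r)" using sub r by (auto simp: subset_iff)
   show "h holomorphic_on ball z (r / 2)"
    using s2 by (intro holomorphic_on_subset[OF h]) (meson ball_subset_cball order_trans)
   show "continuous_on (cball z (r / 2)) h"
    using s2 h holomorphic_on_imp_continuous_on continuous_on_subset by blast
   show "norm (h x) <= 6 * K" if "norm (z - x) = r / 2" for x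
    by (rule hb) (use that sub in \<open>auto simp: subset_iff dist_norm\<close>)
  qed (use r in simp)
  then show ?thesis using eq by simp
 qed
qed


lemma logderiv_zfac:
 assumes "z \<notin> set zs" "g holomorphic_on S" "open S" "z : S" "g z ~= 0"
  and "!!z. z : S ==> F z = zfac zs z * g z"
 shows "deriv F z / F z = (\<Sum>w\<leftarrow>zs. 1 / (z - w)) + deriv g z / g z"
proof -
 have dg: "(g has_field_derivative deriv g z) (at z)"
  using assms by (intro holomorphic_derivI) auto
 have dz: "(zfac zs has_field_derivative zfac zs z * (\<Sum>w\<leftarrow>zs. 1 / (z - w))) (at z)"
  using assms(1)
 proof (induction zs)
  case (Cons w zs)
  then have "(zfac zs has_field_derivative zfac zs z * (\<Sum>w\<leftarrow>zs. 1 / (z - w))) (at z)" by auto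
  from DERIV_mult[OF DERIV_diff[OF DERIV_ident DERIV_const[of w]] this]
  have "((%x. (x - w) * zfac zs x) has_field_derivative zfac (w # zs) z * (\<Sum>w\<leftarrow>w # zs. 1 / (z - w))) (at z)"
   by (rule DERIV_cong) (use Cons.prems in \<open>simp add: field_simps\<close>)
  then show ?case by simp
 qed simp
 have "((%z. zfac zs z * g z) has_field_derivative
   zfac zs z * (\<Sum>w\<leftarrow>zs. 1 / (z - w)) * g z + deriv g z * zfac zs z) (at z)"
  by (rule DERIV_mult[OF dz dg])
 then have "(F has_field_derivative
   zfac zs z * (\<Sum>w\<leftarrow>zs. 1 / (z - w)) * g z + deriv g z * zfac zs z) (at z)"
  by (rule has_field_derivative_transform_within_open[of _ _ _ S]) (use assms in auto)
 then have "deriv F z = zfac zs z * (\<Sum>w\<leftarrow>zs. 1 / (z - w)) * g z + deriv g z * zfac zs z"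
  by (rule DERIV_imp_deriv)
 moreover have "zfac zs z ~= 0" using assms(1) zfac_eq_0_iff by blast
 ultimately show ?thesis using assms by (simp add: field_simps)
qed

lemma factorization':
 assumes K: "K > 0" "M < m * exp K"
 obtains zs g where "set zs \<subseteq> cball c (2 * r)" "g holomorphic_on ball c R"
  "!!z. z : ball c R ==> F z = zfac zs z * g z"
  "!!z. z : cball c (2 * r) ==> g z ~= 0"
  "2 ^ length zs <= M / m"
  "!!z. z : cball c r ==> exp (- 6 * K) * (m / (2 * r) ^ length zs) <= cmod (g z)"
  "!!z. z : cball c r ==> cmod (deriv g z / g z) <= 12 * K / r"
proof -
 obtain zs g where g: "set zs \<subseteq> cball c (2 * r)" "g holomorphic_on ball c R"
  "!!z. z : ball c R ==> F z = zfac zs z * g z"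
  "!!z. z : cball c (2 * r) ==> g z ~= 0" by (rule factorization, rule that)
 have cen: "m / (2 * r) ^ length zs <= cmod (g c)" by (rule centre_bound[OF g(1,3)])
 have lt: "cmod (g z) < exp K * cmod (g c)" if "z : cball c (2 * r)" for z
 proof -
  have "cmod (g z) <= M / (4 * r) ^ length zs"
   by (rule quotient_bound[OF g(1,2,3)]) (use that r in auto)
  also have "... <= M / (2 * r) ^ length zs"
   using r M_pos by (intro divide_left_mono power_mono mult_pos_pos zero_less_power) auto
  also have "... < m * exp K / (2 * r) ^ length zs"
   using K r by (intro divide_strict_right_mono) auto
  also have "... = exp K * (m / (2 * r) ^ length zs)" by simp
  also have "... <= exp K * cmod (g c)" using cen by (intro mult_left_mono) auto
  finally show ?thesis .
 qed
 note bc = borel_caratheodory[OF g(2,4) K(1) lt]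
 have low: "exp (- 6 * K) * (m / (2 * r) ^ length zs) <= cmod (g z)" if "z : cball c r" for z
 proof -
  have "exp (- 6 * K) * (m / (2 * r) ^ length zs) <= exp (- 6 * K) * cmod (g c)"
   using cen by (intro mult_left_mono) auto
  also have "... <= cmod (g z)" by (rule bc(1)) (use that r in auto)
  finally show ?thesis .
 qed
 show ?thesis
  by (rule that[OF g(1-4) zeros_bound[OF g(1-3)] low bc(2)]) auto
qed

end

section \<open>Total variation of the logarithm on the real axis\<close>

lemma integral_inverse_dist_le:
 fixes a b p \<kappa> d :: real
 assumes "\<kappa> > 0" "a <= b" "abs (a - p) <= d" "abs (b - p) <= d"
 shows "(%x. 1 / sqrt ((x - p)^2 + \<kappa>^2)) integrable_on {a..b}"
  "integral {a..b} (%x. 1 / sqrt ((x - p)^2 + \<kappa>^2)) <= 2 * ln (1 + 2 * d / \<kappa>)"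
proof -
 have D: "((%x. arsinh ((x - p) / \<kappa>)) has_vector_derivative 1 / sqrt ((x - p)^2 + \<kappa>^2)) (at x within {a..b})" for x
 proof -
  have "sqrt (((x - p) / \<kappa>)^2 + 1) = sqrt ((x - p)^2 + \<kappa>^2) / \<kappa>"
  proof -
   have "((x - p) / \<kappa>)^2 + 1 = ((x - p)^2 + \<kappa>^2) / \<kappa>^2"
    using assms by (simp add: field_simps)
   then show ?thesis using assms by (simp add: real_sqrt_divide)
  qed
  moreover have "((%x. (x - p) / \<kappa>) has_real_derivative 1 / \<kappa>) (at x within {a..b})"
   using assms by (auto intro!: derivative_eq_intros)
  ultimately have "((%x. arsinh ((x - p) / \<kappa>)) has_real_derivative 1 / sqrt ((x - p)^2 + \<kappa>^2)) (at x within {a..b})"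
   using assms(1) by (intro DERIV_cong[OF DERIV_chain2[OF arsinh_real_has_field_derivative]]) auto
  then show ?thesis unfolding has_real_derivative_iff_has_vector_derivative[symmetric] .
 qed
 have I: "((%x. 1 / sqrt ((x - p)^2 + \<kappa>^2)) has_integral
   arsinh ((b - p) / \<kappa>) - arsinh ((a - p) / \<kappa>)) {a..b}"
  by (rule fundamental_theorem_of_calculus[OF assms(2) D])
 then show "(%x. 1 / sqrt ((x - p)^2 + \<kappa>^2)) integrable_on {a..b}" by blast
 have "arsinh y <= ln (1 + 2 * (d / \<kappa>))" if "abs y <= d / \<kappa>" for y :: real
 proof -
  have d: "0 <= d / \<kappa>" using that by linarith
  have "sqrt (y^2 + 1) <= d / \<kappa> + 1"
  proof (rule real_le_lsqrt)
   have "y^2 <= (d / \<kappa>)^2" using that abs_le_square_iff d by (metis abs_of_nonneg)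
   then show "y^2 + 1 <= (d / \<kappa> + 1)^2" using d by (simp add: power2_sum)
  qed (use d in auto)
  then have "y + sqrt (y^2 + 1) <= 1 + 2 * (d / \<kappa>)" using that by linarith
  then show ?thesis unfolding arsinh_real_def by (intro ln_mono arsinh_real_aux)
 qed
 note ar = this
 have "abs ((b - p) / \<kappa>) <= d / \<kappa>" "abs (- ((a - p) / \<kappa>)) <= d / \<kappa>"
  using assms by (auto simp: abs_divide intro!: divide_right_mono)
 then have "arsinh ((b - p) / \<kappa>) - arsinh ((a - p) / \<kappa>) <= 2 * ln (1 + 2 * d / \<kappa>)"
  using ar[of "(b - p) / \<kappa>"] ar[of "- ((a - p) / \<kappa>)"] by simp
 then show "integral {a..b} (%x. 1 / sqrt ((x - p)^2 + \<kappa>^2)) <= 2 * ln (1 + 2 * d / \<kappa>)"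
  using I integral_unique by metis
qed

text \<open>Each zero \<open>w\<close> contributes \<open>1 / cmod (x - w)\<close>, whose integral
  is logarithmic in the distance \<kappa> from the axis; there are at most \<open>3 * K / 2\<close>
  zeros because \<open>2 / 3 <= ln 2\<close>. The zero-free factor adds \<open>12 * K / r\<close>
  over a length \<open>2 * r\<close>. A loss only logarithmic in \<kappa> is what makes an energy
  shift as small as about \<open>1 / N\<close> affordable.\<close>

lemma log_variation:
 fixes x0 r R M m K \<kappa> :: real
 assumes db: "disc_bound F (of_real x0) r R M m"
  and nz: "!!z. z : ball (of_real x0) R ==> abs (Im z) < \<kappa> ==> F z ~= 0" and \<kappa>: "\<kappa> > 0"
  and K: "K > 0" "M < m * exp K"
 shows "(%x. cmod (deriv F (of_real x) / F (of_real x))) integrable_on {x0 - r..x0 + r}"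
  "integral {x0 - r..x0 + r} (%x. cmod (deriv F (of_real x) / F (of_real x)))
   <= 24 * K + 3 * K * ln (1 + 6 * r / \<kappa>)"
proof -
 interpret disc_bound F "of_real x0" r R M m by fact
 let ?c = "complex_of_real x0" and ?I = "{x0 - r..x0 + r}"
 obtain zs g where g: "set zs \<subseteq> cball ?c (2 * r)" "g holomorphic_on ball ?c R"
  "!!z. z : ball ?c R ==> F z = zfac zs z * g z"
  "!!z. z : cball ?c (2 * r) ==> g z ~= 0" "2 ^ length zs <= M / m"
  "!!z. z : cball ?c r ==> cmod (deriv g z / g z) <= 12 * K / r"
  by (rule factorization'[OF K]) blast
 have Ir: "of_real x : ball ?c R" "of_real x : cball ?c r" if "x : ?I" for x
  using that r by (auto simp: dist_of_real dist_real_def)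
 have Fnz: "F (of_real x) ~= 0" if "x : ?I" for x using nz[OF Ir(1)[OF that]] \<kappa> by simp
 have dF: "deriv F holomorphic_on ball ?c R" by (rule holomorphic_deriv[OF hol]) simp
 have cF: "continuous_on ?I (%x. F (of_real x))" "continuous_on ?I (%x. deriv F (of_real x))"
  using Ir(1) by (intro continuous_on_compose2[OF holomorphic_on_imp_continuous_on[OF hol]]
    continuous_on_compose2[OF holomorphic_on_imp_continuous_on[OF dF]] continuous_intros; blast)+
 show int: "(%x. cmod (deriv F (of_real x) / F (of_real x))) integrable_on ?I"
  by (intro integrable_continuous_real continuous_intros cF) (use Fnz in auto)
 let ?B = "%x. (\<Sum>w\<leftarrow>zs. 1 / sqrt ((x - Re w)^2 + \<kappa>^2)) + 12 * K / r"
 have w: "abs (Im w) >= \<kappa>" "abs (x0 - r - Re w) <= 3 * r" "abs (x0 + r - Re w) <= 3 * r" if "w : set zs" for w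
 proof -
  have wc: "cmod (?c - w) <= 2 * r" using that g(1) by (auto simp: dist_norm)
  have wR: "w : ball ?c R" using wc r by (simp add: dist_norm)
  have "zfac zs w = 0" using that zfac_eq_0_iff by blast
  then have "F w = 0" unfolding g(3)[OF wR] by (simp only: mult_zero_left)
  then show "abs (Im w) >= \<kappa>" using nz[OF wR] by linarith
  have "abs (x0 - Re w) <= 2 * r" using abs_Re_le_cmod[of "?c - w"] wc by simp
  then show "abs (x0 - r - Re w) <= 3 * r" "abs (x0 + r - Re w) <= 3 * r" using r by linarith+
 qed
 have le: "cmod (deriv F (of_real x) / F (of_real x)) <= ?B x" if x: "x : ?I" for x
 proof -
  have "zfac zs (of_real x) ~= 0" using Fnz[OF x] unfolding g(3)[OF Ir(1)[OF x]] by (metis mult_zero_left)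
  then have xz: "of_real x \<notin> set zs" using zfac_eq_0_iff by blast
  have gx: "g (of_real x) ~= 0" by (rule g(4)) (use Ir(2)[OF x] r in auto)
  have "deriv F (of_real x) / F (of_real x) = (\<Sum>w\<leftarrow>zs. 1 / (of_real x - w)) + deriv g (of_real x) / g (of_real x)"
   by (rule logderiv_zfac[OF xz g(2) open_ball Ir(1)[OF x] gx g(3)])
  also have "cmod ... <= cmod (\<Sum>w\<leftarrow>zs. 1 / (of_real x - w)) + 12 * K / r"
   using norm_triangle_ineq g(6)[OF Ir(2)[OF x]] by (rule order_trans[OF _ add_left_mono])
  also have "cmod (\<Sum>w\<leftarrow>zs. 1 / (of_real x - w)) <= (\<Sum>w\<leftarrow>zs. 1 / sqrt ((x - Re w)^2 + \<kappa>^2))"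
   using w(1)
  proof (induction zs)
   case (Cons w zs)
   have "\<kappa>^2 <= (Im w)^2" using Cons.prems[of w] \<kappa> by (simp add: abs_le_square_iff[symmetric])
   then have "sqrt ((x - Re w)^2 + \<kappa>^2) <= cmod (of_real x - w)" by (simp add: cmod_def)
   moreover have "0 < sqrt ((x - Re w)^2 + \<kappa>^2)" using \<kappa> by (simp add: add_nonneg_pos)
   ultimately have "cmod (1 / (of_real x - w)) <= 1 / sqrt ((x - Re w)^2 + \<kappa>^2)"
    unfolding norm_divide by (intro frac_le) auto
   then show ?case using Cons norm_triangle_ineq[of "1 / (of_real x - w)" "\<Sum>w\<leftarrow>zs. 1 / (of_real x - w)"]
    by fastforce
  qed simp
  finally show ?thesis by simp
 qed
 have "x0 - r <= x0 + r" using r by simp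
 note J = integral_inverse_dist_le[OF \<kappa> this]
 have S: "((%x. \<Sum>w\<leftarrow>ws. 1 / sqrt ((x - Re w)^2 + \<kappa>^2)) integrable_on ?I) &
   integral ?I (%x. \<Sum>w\<leftarrow>ws. 1 / sqrt ((x - Re w)^2 + \<kappa>^2)) <= real (length ws) * (2 * ln (1 + 2 * (3 * r) / \<kappa>))"
  if "set ws \<subseteq> set zs" for ws
  using that
 proof (induction ws)
  case (Cons v ws)
  then have v: "v : set zs" by simp
  show ?case using Cons J[OF w(2,3)[OF v]]
   by (auto simp: algebra_simps integral_add intro!: integrable_add)
 qed (simp add: integrable_0)
 have "integral ?I (%x. cmod (deriv F (of_real x) / F (of_real x))) <= integral ?I ?B"
  using S[of zs] by (intro integral_le int le integrable_add) auto
 also have "... = integral ?I (%x. \<Sum>w\<leftarrow>zs. 1 / sqrt ((x - Re w)^2 + \<kappa>^2)) + 24 * K"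
  using S[of zs] r by (subst integral_add) auto
 also have "... <= real (length zs) * (2 * ln (1 + 6 * r / \<kappa>)) + 24 * K" using S[of zs] by simp
 also have "... <= 24 * K + 3 * K * ln (1 + 6 * r / \<kappa>)"
 proof -
  have "M / m <= exp K" using K m by (simp add: pos_divide_le_eq mult.commute)
  then have "(2::real) ^ length zs <= exp K" using g(5) by linarith
  then have "ln ((2::real) ^ length zs) <= K" by (metis ln_exp ln_mono zero_less_numeral zero_less_power)
  then have "real (length zs) * ln 2 <= K" by (simp add: ln_realpow)
  moreover have "2 / 3 <= ln (2::real)" using ln2_ge_two_thirds by simp
  ultimately have "real (length zs) * (2 / 3) <= K"
   using mult_left_mono[of "2 / 3" "ln 2" "real (length zs)"] by linarith
  then have "real (length zs) * 2 <= 3 * K" by simp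
  moreover have "0 <= ln (1 + 6 * r / \<kappa>)" using r \<kappa> by simp
  ultimately show ?thesis using mult_right_mono[of "real (length zs) * 2" "3 * K" "ln (1 + 6 * r / \<kappa>)"] by simp
 qed
 finally show "integral ?I (%x. cmod (deriv F (of_real x) / F (of_real x)))
   <= 24 * K + 3 * K * ln (1 + 6 * r / \<kappa>)" .
qed

section \<open>Periodic functions and irrational rotations\<close>

definition per :: "(real => 'a) => bool" where
 "per f \<longleftrightarrow> (\<forall>x. f (x + 1) = f x)"

lemma per_int:
 assumes "per f" shows "f (x + of_int k) = f x"
proof (induction k arbitrary: x rule: int_induct[where k = 0])
 case (step1 i)
 have "f (x + of_int (i + 1)) = f ((x + of_int i) + 1)" by (simp add: algebra_simps)
 then show ?case using assms step1 unfolding per_def by metis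
next
 case (step2 i)
 have "f (x + of_int (i - 1)) = f ((x + of_int (i - 1)) + 1)" using assms unfolding per_def by metis
 also have "... = f (x + of_int i)" by (simp add: algebra_simps)
 finally show ?case using step2 by metis
qed simp

lemma has_integral_translate:
 fixes f :: "real => real"
 assumes "(f has_integral i) {a..b}"
 shows "((%x. f (x + c)) has_integral i) {a - c..b - c}"
 using has_integral_affinity[of f i a b 1 c] assms by simp

lemma per_has_integral:
 fixes f :: "real => real"
 assumes p: "per f" and i: "(f has_integral i) {0..1}"
 shows "(f has_integral i) {t..t + 1}"
proof -
 define s where "s = t - of_int \<lfloor>t\<rfloor>"
 have s: "0 <= s" "s <= 1" unfolding s_def by linarith+
 have fi: "f integrable_on {0..1}" using i by blast
 obtain j0 j1 where j: "(f has_integral j0) {0..s}" "(f has_integral j1) {s..1}"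
  using integrable_subinterval_real[OF fi] s by (metis atLeastatMost_subset_iff integrable_integral order_refl)
 have ij: "i = j0 + j1" using has_integral_combine[OF s j] i has_integral_unique by blast
 have "f (x + - 1) = f x" for x using per_int[OF p, of x "-1"] by simp
 then have "(f has_integral j0) {1..s + 1}" using has_integral_translate[OF j(1), of "-1"] by simp
 then have "(f has_integral j1 + j0) {s..s + 1}" using has_integral_combine[OF _ _ j(2)] s by simp
 from has_integral_translate[OF this, of "of_int (- \<lfloor>t\<rfloor>)"]
 have "(f has_integral j1 + j0) {s + of_int \<lfloor>t\<rfloor>..s + 1 + of_int \<lfloor>t\<rfloor>}"
  unfolding per_int[OF p] by simp
 then show ?thesis unfolding ij s_def by (simp add: add.commute)
qed

lemma per_has_integral_shift:
 fixes f :: "real => real"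
 assumes "per f" "(f has_integral i) {0..1}"
 shows "((%x. f (x + t)) has_integral i) {0..1}"
 using has_integral_translate[OF per_has_integral[OF assms, of t], of t] by simp

lemma integral_arcs:
 fixes g :: "real => real"
 assumes "!!a b. g integrable_on {a..b}" "d >= 0"
 shows "(\<Sum>j<n. integral {y + real j * d..y + (real j + 1) * d} g) = integral {y..y + real n * d} g"
proof (induction n)
 case (Suc n)
 have "integral {y..y + real n * d} g + integral {y + real n * d..y + (real n + 1) * d} g = integral {y..y + (real n + 1) * d} g"
  using assms by (intro Henstock_Kurzweil_Integration.integral_combine) (auto intro!: mult_right_mono)
 then show ?case using Suc by (simp add: add.commute)
qed simp

section \<open>The Denjoy-Koksma inequality\<close>

locale C1_per =
 fixes U U' :: "real => real"
 assumes per: "per U" and der: "!!x. (U has_real_derivative U' x) (at x)"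
  and cont: "continuous_on UNIV U'"
begin

lemma contU: "continuous_on S U"
 using der by (meson DERIV_isCont continuous_at_imp_continuous_on)

lemma per': "per (%x. abs (U' x))"
 unfolding per_def
proof
 fix x
 have "((%x. U (x + 1)) has_real_derivative U' (x + 1)) (at x)"
  using der[of "x + 1"] by (simp add: DERIV_shift)
 moreover have "(%x. U (x + 1)) = U" using per unfolding per_def by auto
 ultimately show "abs (U' (x + 1)) = abs (U' x)" using der DERIV_unique by metis
qed

abbreviation "V \<equiv> integral {0..1} (%x. abs (U' x))"

lemma int'[simp]: "(%x. abs (U' x)) integrable_on {a..b}"
 by (intro integrable_continuous_real continuous_intros continuous_on_subset[OF cont]) auto

lemma intU[simp]: "U integrable_on {a..b}"
 by (intro integrable_continuous_real contU)

lemma osc_le: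
 assumes "s : {a..b}" "t : {a..b}"
 shows "abs (U s - U t) <= integral {a..b} (%x. abs (U' x))"
proof -
 have "abs (U s - U t) <= integral {a..b} (%x. abs (U' x))" if "s <= t" "s : {a..b}" "t : {a..b}" for s t
 proof -
  have "(U' has_integral U t - U s) {s..t}"
   using that der by (intro fundamental_theorem_of_calculus)
    (auto simp: has_real_derivative_iff_has_vector_derivative[symmetric] intro: has_field_derivative_at_within)
  then have "U t - U s = integral {s..t} U'" "U' integrable_on {s..t}" by (auto simp: integral_unique)
  then have "abs (U t - U s) <= integral {s..t} (%x. abs (U' x))"
   using integral_norm_bound_integral[of U' "{s..t}" "%x. abs (U' x)"] by simp
  also have "... <= integral {a..b} (%x. abs (U' x))"
   using that by (intro integral_subset_le) auto
  finally show ?thesis by linarith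
 qed
 from this[of s t] this[of t s] assms show ?thesis by linarith
qed

lemma arc_average:
 assumes "d > 0" "x : {a - d..a + d}"
 shows "abs (U x - integral {a..a + d} U / d) <= integral {a - d..a + d} (%x. abs (U' x))"
proof -
 let ?W = "integral {a - d..a + d} (%x. abs (U' x))"
 have "norm (integral {a..a + d} (%s. U x - U s)) <= integral {a..a + d} (%s. ?W)"
 proof (rule integral_norm_bound_integral)
  show "(%s. U x - U s) integrable_on {a..a + d}" by (intro integrable_diff) auto
  show "norm (U x - U s) <= ?W" if "s : {a..a + d}" for s
   unfolding real_norm_def by (rule osc_le) (use that assms in auto)
 qed auto
 moreover have "integral {a..a + d} (%s. U x - U s) = d * U x - integral {a..a + d} U"
  using assms by (subst integral_diff) auto
 ultimately have "abs (d * U x - integral {a..a + d} U) <= d * ?W" using assms by simp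
 moreover have "d * U x - integral {a..a + d} U = d * (U x - integral {a..a + d} U / d)"
  using assms by (simp add: field_simps)
 ultimately show ?thesis using assms by (simp add: abs_mult)
qed

text \<open>Coprimality makes \<open>k * p mod q\<close> a permutation, so the orbit visits each of
  the \<open>q\<close> arcs of length \<open>1 / q\<close> once, up to a displacement of at most
  \<open>1 / q\<close> in either direction. Each value is compared with the mean over its arc at the
  cost of the variation over a doubled arc; the doubled arcs cover the circle twice, whence
  \<open>2 * V\<close>.\<close>

theorem denjoy_koksma:
 fixes p :: int and q :: nat
 assumes q: "q > 0" and cop: "coprime p (int q)" and close: "abs (real q * om - of_int p) <= 1 / real q"
 shows "abs ((\<Sum>k<q. U (y + real k * om)) - real q * integral {0..1} U) <= 2 * V"
proof -
 define j where "j k = nat ((int k * p) mod int q)" for k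
 define d where "d = 1 / real q"
 have d: "d > 0" "real q * d = 1" using q by (auto simp: d_def)
 have jq: "j k < q" for k unfolding j_def using q by (simp add: nat_less_iff)
 have inj: "inj_on j {..<q}"
 proof (rule inj_onI)
  fix k l assume kl: "k : {..<q}" "l : {..<q}" "j k = j l"
  then have "(int k * p) mod int q = (int l * p) mod int q" unfolding j_def using q by (subst (asm) eq_nat_nat_iff) auto
  then have "int q dvd (int k - int l) * p" by (simp add: mod_eq_dvd_iff left_diff_distrib)
  then have "int q dvd int k - int l" using cop by (simp add: coprime_dvd_mult_left_iff coprime_commute)
  then have "int k mod int q = int l mod int q" by (simp add: mod_eq_dvd_iff)
  then show "k = l" using kl by simp
 qed
 have bij: "bij_betw j {..<q} {..<q}"
  using inj jq by (simp add: bij_betw_def endo_inj_surj image_subset_iff)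
 have trm: "abs (U (y + real k * om) - integral {y + real (j k) * d..y + real (j k) * d + d} U / d)
   <= integral {y + real (j k) * d - d..y + real (j k) * d + d} (%x. abs (U' x))" if k: "k < q" for k
 proof -
  define m where "m = (int k * p) div int q"
  have e: "real k * of_int p = of_int m * real q + real (j k)"
  proof -
   have "int k * p = m * int q + int (j k)" unfolding m_def j_def using q by simp
   then have "real_of_int (int k * p) = real_of_int (m * int q + int (j k))" by (rule arg_cong)
   then show ?thesis by simp
  qed
  define t where "t = real k * om - of_int m - real (j k) * d"
  have "real q * t = real k * (real q * om - of_int p)"
  proof -
   have "real q * t = real k * (real q * om) - (of_int m * real q + real (j k) * (real q * d))"
    unfolding t_def by (simp add: algebra_simps)
   then show ?thesis unfolding d using e by (simp add: algebra_simps)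
  qed
  then have "real q * abs t = real k * abs (real q * om - of_int p)" by (metis abs_mult abs_of_nat)
  also have "... <= real q * (1 / real q)" using k close by (intro mult_mono) auto
  finally have "abs t <= d" using q by (simp add: d_def field_simps)
  then have "y + real (j k) * d + t : {y + real (j k) * d - d..y + real (j k) * d + d}" by auto
  from arc_average[OF d(1) this]
  have "abs (U (y + real (j k) * d + t) - integral {y + real (j k) * d..y + real (j k) * d + d} U / d)
   <= integral {y + real (j k) * d - d..y + real (j k) * d + d} (%x. abs (U' x))" .
  moreover have "U (y + real k * om) = U (y + real (j k) * d + t)"
   using per_int[OF per, of "y + real (j k) * d + t" m] by (simp add: t_def algebra_simps)
  ultimately show ?thesis by simp
 qed
 have s1: "(\<Sum>k<q. integral {y + real (j k) * d..y + real (j k) * d + d} U / d) = real q * integral {0..1} U"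
 proof -
  have "(\<Sum>k<q. integral {y + real (j k) * d..y + real (j k) * d + d} U / d)
    = (\<Sum>i<q. integral {y + real i * d..y + real i * d + d} U / d)"
   by (rule sum.reindex_bij_betw[OF bij])
  also have "... = (\<Sum>i<q. integral {y + real i * d..y + (real i + 1) * d} U) / d"
   unfolding sum_divide_distrib by (simp add: algebra_simps)
  also have "... = integral {y..y + 1} U / d"
   using integral_arcs[OF intU less_imp_le[OF d(1)]] d(2) by simp
  also have "integral {y..y + 1} U = integral {0..1} U"
   by (rule integral_unique[OF per_has_integral[OF per integrable_integral[OF intU]]])
  finally show ?thesis by (simp add: d_def)
 qed
 have Vy: "integral {z..z + 1} (%x. abs (U' x)) = V" for z
  by (rule integral_unique[OF per_has_integral[OF per' integrable_integral[OF int']]])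
 have s2: "(\<Sum>k<q. integral {y + real (j k) * d - d..y + real (j k) * d + d} (%x. abs (U' x))) = 2 * V"
 proof -
  have "(\<Sum>k<q. integral {y + real (j k) * d - d..y + real (j k) * d + d} (%x. abs (U' x)))
    = (\<Sum>i<q. integral {y + real i * d - d..y + real i * d + d} (%x. abs (U' x)))"
   by (rule sum.reindex_bij_betw[OF bij])
  also have "... = (\<Sum>i<q. integral {y - d + real i * d..y - d + (real i + 1) * d} (%x. abs (U' x))
     + integral {y + real i * d..y + (real i + 1) * d} (%x. abs (U' x)))"
  proof (rule sum.cong[OF refl])
   fix i
   have "integral {y + real i * d - d..y + real i * d} (%x. abs (U' x)) + integral {y + real i * d..y + real i * d + d} (%x. abs (U' x))
    = integral {y + real i * d - d..y + real i * d + d} (%x. abs (U' x))"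
    using d by (intro Henstock_Kurzweil_Integration.integral_combine) auto
   then show "integral {y + real i * d - d..y + real i * d + d} (%x. abs (U' x)) =
     integral {y - d + real i * d..y - d + (real i + 1) * d} (%x. abs (U' x))
     + integral {y + real i * d..y + (real i + 1) * d} (%x. abs (U' x))"
    by (simp add: algebra_simps)
  qed
  also have "... = V + V"
   unfolding sum.distrib integral_arcs[OF int' less_imp_le[OF d(1)]] d(2) Vy ..
  finally show ?thesis by simp
 qed
 have "abs ((\<Sum>k<q. U (y + real k * om)) - real q * integral {0..1} U)
   = abs (\<Sum>k<q. U (y + real k * om) - integral {y + real (j k) * d..y + real (j k) * d + d} U / d)"
  unfolding s1[symmetric] sum_subtractf ..
 also have "... <= 2 * V"
  unfolding s2[symmetric] by (rule order_trans[OF sum_abs sum_mono]) (use trm in auto)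
 finally show ?thesis .
qed

end

section \<open>Denominators of Diophantine frequencies\<close>

lemma infdist_Ints_le: "infdist (x::real) \<int> <= abs (x - of_int k)"
 using infdist_le[of "of_int k" "\<int>" x] by (simp add: dist_real_def)

text \<open>Dirichlet gives \<open>q <= Q\<close> with error below \<open>1 / Q\<close>, and the
  Diophantine lower bound on the error keeps \<open>q\<close> from being much smaller than
  \<open>Q\<close>. For \<open>q = 1\<close>, where that bound says nothing, it is applied at
  \<open>n = 2\<close>; this produces the term with \<open>ln 2\<close>.\<close>

lemma diophantine_denominator:
 fixes om c \<alpha> :: real
 assumes w: "om : diophantine c \<alpha>" and c: "0 < c" "c < 1" and a: "\<alpha> > 1" and Q: "Q >= 2"
 obtains p q where "q > 0" "coprime p (int q)" "abs (real q * om - of_int p) <= 1 / real q"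
  "q <= Q" "c * real Q / (4 * ln (real Q) powr \<alpha> + 4 * (ln 2) powr \<alpha>) <= real q"
proof -
 obtain h k where hk: "coprime h k" "0 < k" "k <= int Q" "abs (of_int k * om - of_int h) < 1 / Q"
  using Dirichlet_approx_coprime[of Q om] Q by auto
 define q where "q = nat k"
 have q: "k = int q" "q > 0" "q <= Q" using hk by (auto simp: q_def)
 have cl: "abs (real q * om - of_int h) < 1 / Q" using hk(4) q by simp
 have dio: "!!n. n >= 2 ==> infdist (real n * om) \<int> >= c / (real n * ln (real n) powr \<alpha>)"
  using w unfolding diophantine_def by auto
 let ?L = "4 * ln (real Q) powr \<alpha> + 4 * (ln 2) powr \<alpha>"
 have L2: "(ln 2) powr \<alpha> > (0::real)" by simp
 have LQ: "ln (real Q) powr \<alpha> >= 0" by simp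
 have low: "c * real Q / ?L <= real q"
 proof (cases "q >= 2")
  case True
  have "c / (real q * ln (real q) powr \<alpha>) <= 1 / Q"
   using dio[OF True] infdist_Ints_le[of "real q * om" h] cl by linarith
  moreover have "real q * ln (real q) powr \<alpha> > 0" using True by simp
  ultimately have "c * Q <= real q * ln (real q) powr \<alpha>" using Q by (simp add: field_simps)
  also have "... <= real q * ln (real Q) powr \<alpha>"
   using True q a by (intro mult_left_mono powr_mono2) auto
  also have "... <= real q * ?L" using L2 LQ by (intro mult_left_mono) linarith+
  finally show ?thesis by (subst pos_divide_le_eq) (use L2 LQ in linarith)+
 next
  case False
  then have q1: "q = 1" using q by simp
  have "c / (2 * ln 2 powr \<alpha>) <= abs (2 * om - of_int (2 * h))"
   using dio[of 2] infdist_Ints_le[of "2 * om" "2 * h"] by simp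
  also have "2 * om - of_int (2 * h) = 2 * (om - of_int h)" by simp
  also have "abs (2 * (om - of_int h)) = 2 * abs (om - of_int h)" by (simp only: abs_mult abs_numeral)
  also have "... <= 2 / Q" using cl q1 by simp
  finally have "c * Q <= 4 * ln 2 powr \<alpha>" using Q L2 by (simp add: field_simps)
  then have "c * Q <= ?L" using LQ by linarith
  moreover have "?L > 0" using L2 LQ by linarith
  ultimately show ?thesis using q1 by (subst pos_divide_le_eq) auto
 qed
 have "1 / real Q <= 1 / real q" using q by (intro divide_left_mono) auto
 then show ?thesis using that[of q h] q hk(1) cl low by simp
qed


text \<open>A bound for \<open>Q / q\<close> that serves all \<open>Q\<close> up to
  \<open>Y\<close>. It is polylogarithmic in \<open>Y\<close>, so the Diophantine loss never
  competes with a power.\<close>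

definition Dn :: "real => real => real => real" where
 "Dn c \<alpha> Y = (4 * ln Y powr \<alpha> + 4) / c + 1"

lemma diophantine_denominator':
 fixes om c \<alpha> Y :: real
 assumes w: "om : diophantine c \<alpha>" and c: "0 < c" "c < 1" and \<alpha>: "\<alpha> > 1" and Q: "2 <= Q" "real Q <= Y"
 obtains p q where "q > 0" "coprime p (int q)" "abs (real q * om - of_int p) <= 1 / real q"
  "q <= Q" "real Q <= Dn c \<alpha> Y * real q"
proof -
 obtain p q where q: "q > 0" "coprime p (int q)" "abs (real q * om - of_int p) <= 1 / real q"
  "q <= Q" "c * real Q / (4 * ln (real Q) powr \<alpha> + 4 * (ln 2) powr \<alpha>) <= real q"
  by (rule diophantine_denominator[OF w c \<alpha> Q(1)])
 have l2: "(ln 2 :: real) powr \<alpha> <= 1" using ln_2_less_1 \<alpha>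
  by (intro powr_le1) (auto simp: less_imp_le)
 have p2: "(ln 2 :: real) powr \<alpha> > 0" by simp
 have p0: "ln (real Q) powr \<alpha> >= 0" by simp
 have lQ: "ln (real Q) powr \<alpha> <= ln Y powr \<alpha>"
  using Q \<alpha> by (intro powr_mono2 ln_mono) auto
 have "c * real Q <= real q * (4 * ln (real Q) powr \<alpha> + 4 * (ln 2) powr \<alpha>)"
  using q(5) p0 p2 by (subst (asm) pos_divide_le_eq) linarith+
 also have "... <= real q * (4 * ln Y powr \<alpha> + 4)"
  using lQ l2 by (intro mult_left_mono) auto
 finally have "real Q <= (4 * ln Y powr \<alpha> + 4) / c * real q"
  using c by (simp add: field_simps)
 also have "... <= Dn c \<alpha> Y * real q" unfolding Dn_def by (intro mult_right_mono) auto
 finally show ?thesis using that q by blast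
qed

section \<open>Quasiperiodic continuants\<close>

text \<open>The holomorphic extension of \<open>(cmod b)^2\<close> from the real line, expressed
  through \<open>b\<close> alone; determinants see the off-diagonal coefficient only in this
  form.\<close>

definition B2 :: "(complex => complex) => complex => complex" where
 "B2 b z = b z * cnj (b (cnj z))"

section \<open>Holomorphic functions on the strip\<close>

lemma convex_strip: "convex (strip \<rho>)"
proof -
 have "strip \<rho> = {z. Im z < \<rho>} \<inter> {z. Im z > - \<rho>}" by (auto simp: strip_def abs_less_iff)
 then show ?thesis by (metis convex_Int convex_halfspace_Im_gt convex_halfspace_Im_lt)
qed

lemma open_strip: "open (strip \<rho>)"
 unfolding strip_def by (intro open_Collect_less continuous_intros)

lemma strip_real [simp]: "\<rho> > 0 ==> complex_of_real x : strip \<rho>"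
 by (simp add: strip_def)

lemma ball_subset_strip: "ball (complex_of_real x) \<rho> \<subseteq> strip \<rho>"
proof
 fix z assume "z : ball (complex_of_real x) \<rho>"
 then have "cmod (of_real x - z) < \<rho>" by (simp add: dist_norm)
 then show "z : strip \<rho>" using abs_Im_le_cmod[of "of_real x - z"] by (simp add: strip_def)
qed

lemma strip_Lipschitz:
 assumes f: "f holomorphic_on strip \<rho>" and bd: "!!z. z : strip \<rho> ==> cmod (f z) <= C"
  and \<rho>: "\<rho> > 0" and z: "z : strip (\<rho>/2)" "w : strip (\<rho>/2)"
 shows "cmod (f z - f w) <= 2 * C / \<rho> * cmod (z - w)"
proof (rule field_differentiable_bound[OF convex_strip _ _ z(1) z(2)])
 fix x assume x: "x : strip (\<rho>/2)"
 then have xs: "x : strip \<rho>" using \<rho> by (simp add: strip_def)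
 show "(f has_field_derivative deriv f x) (at x within strip (\<rho>/2))"
  by (rule has_field_derivative_at_within[OF holomorphic_derivI[OF f open_strip xs]])
 have sub: "ball x (\<rho>/2) \<subseteq> strip \<rho>"
 proof
  fix y assume "y : ball x (\<rho>/2)"
  then have "abs (Im (x - y)) < \<rho>/2" using abs_Im_le_cmod[of "x - y"] by (simp add: dist_norm)
  then have "abs (Im x - Im y) < \<rho>/2" by simp
  moreover have "abs (Im x) < \<rho>/2" using x by (simp add: strip_def)
  ultimately have "abs (Im y) < \<rho>" by linarith
  then show "y : strip \<rho>" by (simp add: strip_def)
 qed
 \<comment> \<open>Closed discs of radius \<open>s * \<rho> / 2\<close> with \<open>s < 1\<close>
   stay inside the strip, so Cauchy's inequality gives the bound up to the factor \<open>s\<close>,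
   which then tends to \<open>1\<close>.\<close>
 show "cmod (deriv f x) <= 2 * C / \<rho>"
 proof (rule field_le_mult_one_interval)
  fix s :: real assume s: "0 < s" "s < 1"
  have "s * \<rho> < \<rho>" using s \<rho> by simp
  then have "cball x (s * \<rho>/2) \<subseteq> ball x (\<rho>/2)" by auto
  then have sub': "cball x (s * \<rho>/2) \<subseteq> strip \<rho>" using sub by blast
  have "norm ((deriv ^^ 1) f x) <= fact 1 * C / (s * \<rho>/2) ^ 1"
  proof (rule Cauchy_inequality)
   show "f holomorphic_on ball x (s * \<rho>/2)"
    using sub' by (intro holomorphic_on_subset[OF f]) (meson ball_subset_cball order_trans)
   show "continuous_on (cball x (s * \<rho>/2)) f"
    using sub' f holomorphic_on_imp_continuous_on continuous_on_subset by blast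
   show "norm (f y) <= C" if "norm (x - y) = s * \<rho>/2" for y
    by (rule bd) (use that sub' in \<open>auto simp: dist_norm\<close>)
  qed (use s \<rho> in simp)
  then show "s * cmod (deriv f x) <= 2 * C / \<rho>"
   using s \<rho> by (simp add: field_simps)
 qed
qed

lemma strip_log_C1:
 assumes G: "G holomorphic_on strip \<rho>" and \<rho>: "\<rho> > 0"
  and Gper: "!!x. G (of_real (x + 1)) = G (of_real x)" and nz: "!!x. G (of_real x) ~= 0"
 shows "C1_per (%x. ln (cmod (G (of_real x)))) (%x. Re (deriv G (of_real x) / G (of_real x)))"
proof
 show "per (%x. ln (cmod (G (complex_of_real x))))" unfolding per_def Gper by simp
 fix x
 have dG: "(G has_field_derivative deriv G (of_real x)) (at (of_real x))"
  by (rule holomorphic_derivI[OF G open_strip strip_real[OF \<rho>]])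
 have "((%x. G (of_real x)) has_vector_derivative deriv G (of_real x)) (at x)"
  using has_vector_derivative_real_field[OF dG] .
 then have 1: "((%x. (cmod (G (of_real x)))^2) has_real_derivative 2 * (G (of_real x) \<bullet> deriv G (of_real x))) (at x)"
  unfolding power2_norm_eq_inner has_real_derivative_iff_has_vector_derivative
  by (auto intro!: derivative_eq_intros simp: has_vector_derivative_def inner_commute algebra_simps)
 have pos: "(cmod (G (of_real x)))^2 > 0" for x using nz by simp
 have "((%x. ln ((cmod (G (of_real x)))^2) / 2) has_real_derivative
   (G (of_real x) \<bullet> deriv G (of_real x)) / (cmod (G (of_real x)))^2) (at x)"
  by (rule DERIV_cong[OF DERIV_cdivide[OF DERIV_chain2[OF DERIV_ln[OF pos] 1]]]) (simp add: field_simps)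
 moreover have "(%x. ln ((cmod (G (of_real x)))^2) / 2) = (%x. ln (cmod (G (of_real x))))"
  using nz by (auto simp: ln_realpow)
 moreover have "(G (of_real x) \<bullet> deriv G (of_real x)) / (cmod (G (of_real x)))^2 = Re (deriv G (of_real x) / G (of_real x))"
  by (simp add: Re_divide inner_complex_def cmod_power2 algebra_simps)
 ultimately show "((%x. ln (cmod (G (of_real x)))) has_real_derivative Re (deriv G (of_real x) / G (of_real x))) (at x)"
  by simp
next
 have dG: "deriv G holomorphic_on strip \<rho>" by (rule holomorphic_deriv[OF G open_strip])
 have "continuous_on UNIV (%x. G (of_real x))" "continuous_on UNIV (%x. deriv G (of_real x))"
  using \<rho> by (intro continuous_on_compose2[OF holomorphic_on_imp_continuous_on[OF G]]
    continuous_on_compose2[OF holomorphic_on_imp_continuous_on[OF dG]] continuous_intros; auto)+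
 then show "continuous_on UNIV (%x. Re (deriv G (of_real x) / G (of_real x)))"
  by (intro continuous_intros) (use nz in auto)
qed

text \<open>Midpoints of consecutive intervals of length \<open>\<rho> / 4\<close>; the first
  \<open>nc \<rho>\<close> of them cover \<open>[0, 1]\<close>. Lower bounds at these finitely many
  phases are the only nondegeneracy that the variation and zero-counting estimates require.\<close>

definition ctr :: "real => nat => real" where "ctr \<rho> i = (2 * real i + 1) * \<rho> / 8"
definition nc :: "real => nat" where "nc \<rho> = nat \<lceil>4 / \<rho>\<rceil>"

lemma nc_ge: "\<rho> > 0 ==> 4 / \<rho> <= real (nc \<rho>)"
 unfolding nc_def by (simp add: le_nat_iff)

lemma strip_log_variation:
 assumes G: "G holomorphic_on strip \<rho>" and \<rho>: "\<rho> > 0"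
  and Gper: "!!x. G (of_real (x + 1)) = G (of_real x)"
  and nz: "!!z. z : strip \<rho> ==> abs (Im z) < \<kappa> ==> G z ~= 0" and \<kappa>: "\<kappa> > 0"
  and M: "!!z. z : strip \<rho> ==> cmod (G z) <= M"
  and m: "m > 0" "!!i. i < nc \<rho> ==> m <= cmod (G (of_real (ctr \<rho> i)))"
  and K: "K > 0" "M < m * exp K"
 shows "integral {0..1} (%x. abs (Re (deriv G (of_real x) / G (of_real x))))
  <= real (nc \<rho>) * (24 * K + 3 * K * ln (1 + 3 * \<rho> / (4 * \<kappa>)))"
proof -
 interpret C1_per "%x. ln (cmod (G (of_real x)))" "%x. Re (deriv G (of_real x) / G (of_real x))"
  by (rule strip_log_C1[OF G \<rho> Gper]) (use nz[of "of_real _"] \<kappa> \<rho> in auto)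
 define r where "r = \<rho> / 8"
 have r: "r > 0" using \<rho> by (simp add: r_def)
 let ?B = "24 * K + 3 * K * ln (1 + 3 * \<rho> / (4 * \<kappa>))"
 have piece: "integral {ctr \<rho> i - r..ctr \<rho> i + r} (%x. abs (Re (deriv G (of_real x) / G (of_real x)))) <= ?B" if i: "i < nc \<rho>" for i
 proof -
  have db: "disc_bound G (of_real (ctr \<rho> i)) r \<rho> M m"
  proof
   show "G holomorphic_on ball (of_real (ctr \<rho> i)) \<rho>"
    by (rule holomorphic_on_subset[OF G ball_subset_strip])
   show "cmod (G z) <= M" if "z : ball (of_real (ctr \<rho> i)) \<rho>" for z
    by (rule M) (use that ball_subset_strip in blast)
  qed (use r \<rho> m i in \<open>auto simp: r_def\<close>)
  have nz': "G z ~= 0" if "z : ball (of_real (ctr \<rho> i)) \<rho>" "abs (Im z) < \<kappa>" for z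
   using nz that ball_subset_strip by blast
  note lv = log_variation[OF db nz' \<kappa> K]
  have "integral {ctr \<rho> i - r..ctr \<rho> i + r} (%x. abs (Re (deriv G (of_real x) / G (of_real x)))) <=
    integral {ctr \<rho> i - r..ctr \<rho> i + r} (%x. cmod (deriv G (of_real x) / G (of_real x)))"
   by (rule integral_le) (use lv(1) int' in \<open>auto simp: abs_Re_le_cmod\<close>)
  also have "... <= 24 * K + 3 * K * ln (1 + 6 * r / \<kappa>)" by (rule lv(2)) auto
  also have "6 * r / \<kappa> = 3 * \<rho> / (4 * \<kappa>)" by (simp add: r_def)
  finally show ?thesis .
 qed
 have "integral {0..1} (%x. abs (Re (deriv G (of_real x) / G (of_real x))))
   <= integral {0..0 + real (nc \<rho>) * (2 * r)} (%x. abs (Re (deriv G (of_real x) / G (of_real x))))"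
 proof (rule integral_subset_le)
  have "1 <= real (nc \<rho>) * (2 * r)" using nc_ge[OF \<rho>] \<rho> unfolding r_def by (simp add: field_simps)
  then show "{0..1} \<subseteq> {0..0 + real (nc \<rho>) * (2 * r)}" by auto
 qed auto
 also have "... = (\<Sum>i<nc \<rho>. integral {0 + real i * (2 * r)..0 + (real i + 1) * (2 * r)} (%x. abs (Re (deriv G (of_real x) / G (of_real x)))))"
  by (rule integral_arcs[symmetric]) (use r in auto)
 also have "... <= (\<Sum>i<nc \<rho>. ?B)"
 proof (rule sum_mono)
  fix i assume "i : {..<nc \<rho>}"
  then have "i < nc \<rho>" by simp
  moreover have "0 + real i * (2 * r) = ctr \<rho> i - r" "0 + (real i + 1) * (2 * r) = ctr \<rho> i + r"
   unfolding ctr_def r_def by (simp_all add: field_simps)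
  ultimately show "integral {0 + real i * (2 * r)..0 + (real i + 1) * (2 * r)} (%x. abs (Re (deriv G (of_real x) / G (of_real x)))) <= ?B"
   using piece by simp
 qed
 also have "... = real (nc \<rho>) * ?B" by simp
 finally show ?thesis .
qed

text \<open>A single number \<open>A\<close> bounds both coefficients above and the mean of
  \<open>ln (cmod b)\<close> below. Everything derived here is explicit in \<rho> and
  \<open>A\<close>, so that the threshold for \<open>N\<close> depends on the coefficients only
  through norms.\<close>

locale jac =
 fixes \<rho> A :: real and a b :: "complex => complex"
 assumes \<rho>: "\<rho> > 0" and A: "A >= 1"
  and ahol: "a holomorphic_on strip \<rho>" and bhol: "b holomorphic_on strip \<rho>"
  and aper: "!!z. z : strip \<rho> ==> a (z + 1) = a z"
  and bper: "!!z. z : strip \<rho> ==> b (z + 1) = b z"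
  and abd: "!!z. z : strip \<rho> ==> cmod (a z) <= A"
  and bbd: "!!z. z : strip \<rho> ==> cmod (b z) <= A"
  and areal: "!!x::real. a (of_real x) : \<real>"
  and bnz: "\<exists>x::real. b (of_real x) ~= 0"
  and bint: "integral {0..1} (%x. ln (cmod (b (of_real x)))) >= - A"
begin

definition F :: "real => complex => nat => complex => complex" where
 "F om \<zeta> n z = dt (%z. a z - \<zeta>) (B2 b) (of_real om) n z"

lemma strip_shift [simp]: "z + of_nat k * of_real om : strip \<rho> \<longleftrightarrow> z : strip \<rho>"
 by (simp add: strip_def)

lemma cnj_strip [simp]: "cnj z : strip \<rho> \<longleftrightarrow> z : strip \<rho>"
 by (simp add: strip_def)

lemma B2_real: "B2 b (of_real x) = of_real ((cmod (b (of_real x)))^2)"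
 unfolding B2_def complex_norm_square by simp

lemma B2_hol: "B2 b holomorphic_on strip \<rho>"
proof -
 have "(cnj \<circ> b \<circ> cnj) holomorphic_on strip \<rho>"
 proof -
  have img: "cnj ` strip \<rho> = strip \<rho>"
   using cnj_strip complex_cnj_cnj by (auto intro: image_eqI[of _ cnj "cnj _"])
  show ?thesis using bhol holomorphic_on_compose_cnj_cnj[of b "strip \<rho>"] open_strip unfolding img by simp
 qed
 then have "(%z. cnj (b (cnj z))) holomorphic_on strip \<rho>" by (simp add: o_def)
 then show ?thesis unfolding B2_def by (intro holomorphic_intros bhol)
qed

lemma B2_bd: "z : strip \<rho> ==> cmod (B2 b z) <= A^2"
 unfolding B2_def norm_mult power2_eq_square using bbd[of z] bbd[of "cnj z"] A
 by (intro mult_mono) auto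

lemma B2_per: "z : strip \<rho> ==> B2 b (z + 1) = B2 b z"
 using bper[of z] bper[of "cnj z"] by (simp add: B2_def)

lemma F_hol: "F om \<zeta> n holomorphic_on strip \<rho>"
proof -
 have s: "(%z. f (z + of_nat k * of_real om)) holomorphic_on strip \<rho>" if "f holomorphic_on strip \<rho>" for f k
  by (rule holomorphic_on_compose_gen[OF _ that, unfolded o_def]) (auto intro!: holomorphic_intros)
 show ?thesis unfolding F_def
 proof (induction n rule: induct_nat_012)
  case (ge2 n)
  then show ?case unfolding dt.simps
   using s[OF ahol, of "Suc n"] s[OF B2_hol, of "Suc n"] by (intro holomorphic_intros) auto
 qed (auto intro!: holomorphic_intros ahol)
qed

lemma F_per: "z : strip \<rho> ==> F om \<zeta> n (z + 1) = F om \<zeta> n z"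
proof (induction n rule: induct_nat_012)
 case (ge2 n)
 have e: "z + 1 + of_nat (Suc n) * of_real om = (z + of_nat (Suc n) * of_real om) + 1" by simp
 have s: "z + of_nat (Suc n) * of_real om : strip \<rho>" using ge2.prems by (simp only: strip_shift)
 show ?case using ge2 unfolding F_def dt.simps e aper[OF s] B2_per[OF s] by simp
qed (simp_all add: F_def aper)

lemma F_bd:
 assumes "z : strip \<rho>" "cmod \<zeta> <= A + 1"
 shows "cmod (F om \<zeta> n z) <= (4 * A^2) ^ n"
proof -
 have A2: "A <= A^2" "1 <= A^2" using A by (simp_all add: power2_eq_square mult_ge1_I)
 have ab: "cmod (a (z + of_nat k * of_real om) - \<zeta>) <= 2 * A + 1" for k
  using norm_triangle_ineq4[of "a (z + of_nat k * of_real om)" \<zeta>] abd[of "z + of_nat k * of_real om"] assms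
  by simp
 show ?thesis
 proof (induction n rule: induct_nat_012)
  case 1
  then show ?case using ab[of 0] A2 by (simp add: F_def)
 next
  case (ge2 n)
  have "cmod (F om \<zeta> (Suc (Suc n)) z) <= (2 * A + 1) * (4 * A^2) ^ Suc n + A^2 * (4 * A^2) ^ n"
  proof -
   have Bz: "cmod (B2 b (z + of_nat (Suc n) * of_real om)) <= A^2"
    by (rule B2_bd) (use assms in \<open>simp only: strip_shift\<close>)
   have "cmod (F om \<zeta> (Suc (Suc n)) z) <= cmod (a (z + of_nat (Suc n) * of_real om) - \<zeta>) * cmod (F om \<zeta> (Suc n) z)
     + cmod (B2 b (z + of_nat (Suc n) * of_real om)) * cmod (F om \<zeta> n z)"
    unfolding F_def dt.simps norm_mult[symmetric] by (rule norm_triangle_ineq4)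
   also have "... <= (2 * A + 1) * (4 * A^2) ^ Suc n + A^2 * (4 * A^2) ^ n"
    using A by (intro add_mono mult_mono ge2.IH ab Bz) auto
   finally show ?thesis .
  qed
  also have "... <= 3 * A^2 * (4 * A^2) ^ Suc n + A^2 * (4 * A^2) ^ Suc n"
  proof (intro add_mono mult_right_mono mult_left_mono)
   show "(4 * A^2) ^ n <= (4 * A^2) ^ Suc n" using A2 by (intro power_increasing) auto
  qed (use A2 in auto)
  also have "3 * A^2 * P + A^2 * P = 4 * A^2 * P" for P by simp
  finally show ?case by (simp only: power_Suc)
 qed (simp add: F_def)
qed

text \<open>Half-width of the strip on which the determinants at height \<eta> have no zeros. The
  Lipschitz constant of \<open>B2 b\<close> is \<open>2 * A^2 / \<rho>\<close>, so at this distance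
  from the real axis it moves by at most \<open>\<eta>^2 / 8\<close>, the tolerance of
  \<open>herglotz\<close>.\<close>

definition \<kappa> :: "real => real" where "\<kappa> \<eta> = \<rho> * \<eta>^2 / (16 * A^2)"

text \<open>The unit of loss: one cut of a determinant costs \<open>2 * \<Lambda> \<eta>\<close>.
  The factor \<open>12\<close> absorbs the constants of \<open>log_split\<close>, of
  \<open>U_ge_1\<close> and of the variation bound.\<close>

definition \<Lambda> :: "real => real" where "\<Lambda> \<eta> = ln (12 * A^2 / \<eta>)"

lemma A2: "A <= A^2" "1 <= A^2"
 using A by (simp_all add: power2_eq_square mult_ge1_I)

lemma \<Lambda>_ge: assumes "0 < \<eta>" "\<eta> <= 1" shows "\<Lambda> \<eta> >= 1"
proof -
 have "exp 1 <= (3::real)" using exp_le by simp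
 also have "3 <= 12 * A^2 / \<eta>" using assms A2 by (simp add: field_simps)
 finally show ?thesis unfolding \<Lambda>_def using assms A2 A by (subst ln_ge_iff) auto
qed

lemma Lipschitz_real:
 assumes f: "f holomorphic_on strip \<rho>" and bd: "!!z. z : strip \<rho> ==> cmod (f z) <= C"
  and z: "abs (Im z) < \<rho>/2"
 shows "cmod (f z - f (of_real (Re z))) <= 2 * C / \<rho> * abs (Im z)"
proof -
 have "cmod (f z - f (of_real (Re z))) <= 2 * C / \<rho> * cmod (z - of_real (Re z))"
  by (rule strip_Lipschitz[OF f bd \<rho>]) (use z \<rho> in \<open>auto simp: strip_def\<close>)
 moreover have "cmod (z - of_real (Re z)) = abs (Im z)" by (simp add: cmod_def)
 ultimately show ?thesis by simp
qed

lemma herglotz_F: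
 assumes \<eta>: "0 < \<eta>" "\<eta> <= 1" and E: "abs E <= A" and z: "abs (Im z) < \<kappa> \<eta>"
 shows "herglotz (%z. a z - Complex E \<eta>) (B2 b) (of_real om) z \<eta> (2 * A + 1) (A^2)"
proof
 have e2: "\<eta>^2 <= \<eta>" using \<eta> by (simp add: power2_eq_square mult_left_le)
 have k1: "\<kappa> \<eta> <= \<rho> / 16"
 proof -
  have "\<eta>^2 <= A^2" using e2 \<eta> A2 by linarith
  then have "\<eta>^2 / A^2 <= 1" using A2 by (subst divide_le_eq_1_pos) auto
  then have "\<rho> / 16 * (\<eta>^2 / A^2) <= \<rho> / 16 * 1" using \<rho> by (intro mult_left_mono) auto
  then show ?thesis unfolding \<kappa>_def by simp
 qed
 fix k
 let ?z = "z + of_nat k * complex_of_real om"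
 have Iz: "Im ?z = Im z" by simp
 have zs: "?z : strip \<rho>" "abs (Im ?z) < \<rho>/2" using z k1 \<rho> by (simp_all add: strip_def)
 have "cmod (a ?z - a (of_real (Re ?z))) <= 2 * A / \<rho> * abs (Im z)"
  using Lipschitz_real[OF ahol abd zs(2)] by simp
 also have "... <= 2 * A / \<rho> * \<kappa> \<eta>" using z A \<rho> by (intro mult_left_mono) auto
 also have "... = \<eta>^2 / (8 * A)" using \<rho> A by (simp add: \<kappa>_def power2_eq_square)
 also have "... <= \<eta> / 4" using e2 A \<eta> by (simp add: field_simps) (smt (verit) mult_le_cancel_right1)
 finally have "abs (Im (a ?z - a (of_real (Re ?z)))) <= \<eta> / 4" using abs_Im_le_cmod order_trans by blast
 moreover have "Im (a (of_real (Re ?z))) = 0" using areal complex_is_Real_iff by blast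
 ultimately show "Im (a ?z - Complex E \<eta>) <= - (3 / 4) * \<eta>" by simp
 have "cmod (B2 b ?z - B2 b (of_real (Re ?z))) <= 2 * A^2 / \<rho> * abs (Im z)"
  using Lipschitz_real[OF B2_hol B2_bd zs(2)] by simp
 also have "... <= 2 * A^2 / \<rho> * \<kappa> \<eta>" using z A \<rho> by (intro mult_left_mono) auto
 also have "... = \<eta>^2 / 8" using \<rho> A by (simp add: \<kappa>_def power2_eq_square)
 finally show "\<exists>s\<ge>0. cmod (B2 b ?z - complex_of_real s) <= \<eta>^2 / 8"
  unfolding B2_real by (intro exI[of _ "(cmod (b (of_real (Re ?z))))^2"]) auto
 have "cmod (Complex E \<eta>) <= abs E + abs \<eta>" using cmod_le[of "Complex E \<eta>"] by simp
 then show "cmod (a ?z - Complex E \<eta>) <= 2 * A + 1"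
  using norm_triangle_ineq4[of "a ?z" "Complex E \<eta>"] abd[OF zs(1)] E \<eta> by linarith
 show "cmod (B2 b ?z) <= A^2" by (rule B2_bd[OF zs(1)])
qed (use \<eta> in auto)

lemma \<kappa>_pos: "\<eta> > 0 ==> \<kappa> \<eta> > 0"
 unfolding \<kappa>_def using \<rho> A by simp

lemma herglotz_real_F:
 assumes \<eta>: "0 < \<eta>" "\<eta> <= 1" and E: "abs E <= A"
 shows "herglotz_real (%z. a z - Complex E \<eta>) (B2 b) (of_real om) (of_real x) \<eta> (2 * A + 1) (A^2)"
proof -
 interpret herglotz "%z. a z - Complex E \<eta>" "B2 b" "of_real om" "of_real x" \<eta> "2 * A + 1" "A^2"
  by (rule herglotz_F) (use assms \<kappa>_pos in auto)
 show ?thesis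
 proof
  fix k
  have e: "of_real x + of_nat k * complex_of_real om = of_real (x + real k * om)" by simp
  show "\<exists>s\<ge>0. B2 b (of_real x + of_nat k * complex_of_real om) = complex_of_real s"
   unfolding e B2_real by (rule exI[of _ "(cmod (b (of_real (x + real k * om))))^2"]) simp
 qed
qed

definition U :: "real => real => real => nat => real => real" where
 "U om E \<eta> n x = ln (cmod (F om (Complex E \<eta>) n (of_real x)))"

definition U' :: "real => real => real => nat => real => real" where
 "U' om E \<eta> n x = Re (deriv (F om (Complex E \<eta>) n) (of_real x) / F om (Complex E \<eta>) n (of_real x))"

lemma U_0 [simp]: "U om E \<eta> 0 x = 0"
 by (simp add: U_def F_def)

context
 fixes om E \<eta> :: real
 assumes \<eta>: "0 < \<eta>" "\<eta> <= 1" and E: "abs E <= A"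
begin

lemma F_nz: "F om (Complex E \<eta>) n (of_real x) ~= 0"
proof -
 interpret herglotz_real "%z. a z - Complex E \<eta>" "B2 b" "of_real om" "of_real x" \<eta> "2 * A + 1" "A^2"
  by (rule herglotz_real_F[OF \<eta> E])
 show ?thesis unfolding F_def by (rule dt_nonzero)
qed

lemma F_nz': "abs (Im z) < \<kappa> \<eta> ==> F om (Complex E \<eta>) n z ~= 0"
 unfolding F_def by (rule herglotz.dt_nonzero[OF herglotz_F[OF \<eta> E]])

lemma \<Lambda>_C: "ln (2 * (1 + (2 * A + 1) + 2 * A^2) / \<eta>) <= \<Lambda> \<eta>"
 unfolding \<Lambda>_def using \<eta> A2 A by (intro ln_mono divide_right_mono) (auto simp: field_simps add_pos_pos)

lemma U_split: "abs (U om E \<eta> (n + k) x - U om E \<eta> n x - U om E \<eta> k (x + real n * om)) <= 2 * \<Lambda> \<eta>"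
proof -
 interpret herglotz_real "%z. a z - Complex E \<eta>" "B2 b" "of_real om" "of_real x" \<eta> "2 * A + 1" "A^2"
  by (rule herglotz_real_F[OF \<eta> E])
 have e: "of_real x + of_nat n * complex_of_real om = of_real (x + real n * om)" by simp
 from log_split[of n k] \<Lambda>_C show ?thesis unfolding U_def F_def e by linarith
qed

lemma U_C1: "C1_per (U om E \<eta> n) (U' om E \<eta> n)"
 unfolding U_def[abs_def] U'_def[abs_def]
 by (rule strip_log_C1[OF F_hol \<rho>]) (use F_nz F_per \<rho> in auto)

end

end

section \<open>Large deviations\<close>

lemma (in C1_per) osc_per: "abs (U y - U y') <= V"
proof -
 define k where "k = \<lfloor>y' - y\<rfloor>"
 have "U y' = U (y' + of_int (- k))" by (rule per_int[OF per, symmetric])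
 moreover have "abs (U y - U (y' + of_int (- k))) <= integral {y..y + 1} (%x. abs (U' x))"
  by (rule osc_le) (auto simp: k_def, linarith+)
 moreover have "integral {y..y + 1} (%x. abs (U' x)) = V"
  by (rule integral_unique[OF per_has_integral[OF per' integrable_integral[OF int']]])
 ultimately show ?thesis by simp
qed

lemma (in C1_per) mean_le:
 assumes "!!y y'. abs (U y - U y') <= c"
 shows "abs (U y - integral {0..1} U) <= c"
proof -
 have "norm (integral {0..1} (%s. U y - U s)) <= integral {0..1::real} (%s. c)"
  by (rule integral_norm_bound_integral) (auto intro!: integrable_diff assms)
 moreover have "integral {0..1} (%s. U y - U s) = U y - integral {0..1} U"
  by (subst integral_diff) auto
 ultimately show ?thesis by simp
qed

text \<open>Denjoy-Koksma applied directly to \<open>U n\<close> would leave an error proportional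
  to \<open>n * V\<close>. Instead, orbit averages of length about \<open>x ^ i\<close> treat all
  \<open>n\<close> up to \<open>x ^ (i + 1)\<close>: the orbit average is close to the value at one
  point because the difference involves only shorter functions, already controlled. Each stage costs
  a factor \<open>4\<close>, so the oscillation is of order \<open>x * D * V\<close> with
  \<open>x\<close> about the \<open>s\<close>-th root of the length.\<close>

lemma osc_iteration:
 fixes U U' :: "nat => real => real" and L V D om :: real and x s l :: nat
 assumes C1: "!!n. C1_per (U n) (U' n)"
  and split: "!!n k y. abs (U (n + k) y - U n y - U k (y + real n * om)) <= 2 * L"
  and var: "!!n. n <= l ==> integral {0..1} (%x. abs (U' n x)) <= real n * V"
  and den: "!!Q. 2 <= Q ==> Q <= x ^ s ==> \<exists>p q. q > 0 & coprime p (int q) &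
   abs (real q * om - of_int p) <= 1 / real q & q <= Q & real Q <= D * real q"
  and x: "x >= 2" and pos: "L >= 0" "V >= 0" "D >= 1" and l: "l <= x ^ s" and s: "s >= 1" and n: "n <= l"
 shows "abs (U n y - integral {0..1} (U n)) <= 4 ^ s * (8 * L + 4 * real x * D * V)"
proof -
 define T where "T = 8 * L + 4 * real x * D * V"
 have xDV: "real x * V <= real x * D * V" using pos x by (simp add: mult_right_mono)
 have T0: "T >= 0" unfolding T_def using pos by simp
 have claim: "abs (U n y - U n y') <= 4 ^ i * T"
  if "1 <= i" "i <= s" "n <= x ^ i" "n <= l" for i n y y'
  using that
 proof (induction i arbitrary: n y y')
  case (Suc i)
  interpret Un: C1_per "U n" "U' n" by (rule C1)
  show ?case
  proof (cases "i = 0")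
   case True
   have "abs (U n y - U n y') <= real n * V" using Un.osc_per var[OF Suc.prems(4)] by (rule order_trans)
   also have "... <= real x * V" using Suc.prems True pos by (intro mult_right_mono) auto
   also have "... <= 4 ^ Suc i * T" proof -
     have "0 <= real x * D * V" using pos by simp
     then have "real x * V <= T" using xDV pos unfolding T_def by linarith
     then show ?thesis using T0 True by simp
    qed
   finally show ?thesis .
  next
   case False
   show ?thesis
   proof (cases "n <= x ^ i")
    case True
    then have "abs (U n y - U n y') <= 4 ^ i * T" using Suc False by simp
    also have "... <= 4 ^ Suc i * T" using T0 by simp
    finally show ?thesis .
   next
    case big: False
    define Q where "Q = x ^ i"
    have "x ^ 1 <= Q" unfolding Q_def using x False by (intro power_increasing) auto
    moreover have "Q <= x ^ s" unfolding Q_def using x Suc.prems by (intro power_increasing) auto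
    ultimately obtain p q where q: "q > 0" "coprime p (int q)" "abs (real q * om - of_int p) <= 1 / real q"
      "q <= Q" "real Q <= D * real q"
     using den[of Q] x by auto
    \<comment> \<open>\<open>U (n + k)\<close> is cut after \<open>n\<close> and after
      \<open>k\<close> sites. Comparing the two cuts trades a shift of the long function by
      \<open>k\<close> steps for a shift of the short one by \<open>n\<close> steps, at the price of
      two errors \<open>2 * L\<close>.\<close>
    have diff: "abs (U n (y + real k * om) - U n y) <= 4 ^ i * T + 4 * L" if k: "k < q" for k y
    proof -
     have "abs (U k (y + real n * om) - U k y) <= 4 ^ i * T"
      by (rule Suc.IH) (use Suc.prems False k q(4) big in \<open>auto simp: Q_def\<close>)
     then show ?thesis using split[of k n y] split[of n k y] by (simp add: add.commute)
    qed
    \<comment> \<open>The orbit average of \<open>U n\<close> is within \<open>2 * n * V / q\<close>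
      of the mean by Denjoy-Koksma and within the bound of \<open>diff\<close> of the value at
      \<open>y\<close>; \<open>n / q\<close> is at most \<open>x * D\<close>.\<close>
    have main: "abs (U n y - integral {0..1} (U n)) <= 4 ^ i * T + T / 2" for y
    proof -
     have "real q * (U n y - integral {0..1} (U n)) =
       ((\<Sum>k<q. U n (y + real k * om)) - real q * integral {0..1} (U n)) - (\<Sum>k<q. U n (y + real k * om) - U n y)"
      by (simp add: sum_subtractf algebra_simps)
     also have "\<bar>...\<bar> <= 2 * (real n * V) + real q * (4 ^ i * T + 4 * L)"
     proof -
      have "abs ((\<Sum>k<q. U n (y + real k * om)) - real q * integral {0..1} (U n)) <= 2 * (real n * V)"
       using Un.denjoy_koksma[OF q(1-3), of y] var[OF Suc.prems(4)] by linarith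
      moreover have "abs (\<Sum>k<q. U n (y + real k * om) - U n y) <= (\<Sum>k<q. 4 ^ i * T + 4 * L)"
       by (rule order_trans[OF sum_abs sum_mono]) (use diff in auto)
      ultimately show ?thesis by simp
     qed
     also have "2 * (real n * V) <= real q * (2 * real x * D * V)"
     proof -
      have "real n <= real x * real Q" using Suc.prems(3) by (simp add: Q_def flip: of_nat_mult of_nat_power)
      also have "... <= real x * (D * real q)" using q(5) by (intro mult_left_mono) auto
      finally have "real n * V <= real x * (D * real q) * V" using pos by (intro mult_right_mono) auto
      then show ?thesis by (simp add: mult_ac)
     qed
     finally have "real q * abs (U n y - integral {0..1} (U n)) <= real q * (2 * real x * D * V + (4 ^ i * T + 4 * L))"
      by (simp add: abs_mult distrib_left)
     then have "abs (U n y - integral {0..1} (U n)) <= 2 * real x * D * V + (4 ^ i * T + 4 * L)" using q by simp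
     moreover have "T / 2 = 4 * L + 2 * real x * D * V" unfolding T_def by simp
     ultimately show ?thesis by linarith
    qed
    have "abs (U n y - U n y') <= 2 * (4 ^ i * T) + T" using main[of y] main[of y'] by linarith
    also have "... <= 4 ^ Suc i * T"
    proof -
     have "1 * T <= 4 ^ i * T" using T0 by (intro mult_right_mono) auto
     then have "2 * (4 ^ i * T) + T <= 4 * (4 ^ i * T)" using T0 by linarith
     then show ?thesis by simp
    qed
    finally show ?thesis .
   qed
  qed
 qed simp
 show ?thesis
  by (rule C1_per.mean_le[OF C1]) (use claim[of s n] s n l in \<open>auto simp: T_def\<close>)
qed

context jac
begin

text \<open>Variation per site. The bound \<open>24 * K + 3 * K * (2 * \<Lambda>)\<close> is at most
  \<open>30 * K * \<Lambda>\<close> since \<open>1 <= \<Lambda>\<close>; \<open>t\<close> is the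
  lower bound per site on the determinants at the centres \<open>ctr\<close>.\<close>

definition V1 :: "real => real => real" where "V1 t \<eta> = 30 * real (nc \<rho>) * ln (6 * A^2 / t) * \<Lambda> \<eta>"

lemma U_var:
 assumes \<eta>: "0 < \<eta>" "\<eta> <= 1" and E: "abs E <= A" and t: "0 < t" "t <= 1"
  and low: "!!i. i < nc \<rho> ==> t ^ n <= cmod (F om (Complex E \<eta>) n (of_real (ctr \<rho> i)))"
 shows "integral {0..1} (%x. abs (U' om E \<eta> n x)) <= real n * V1 t \<eta>"
proof (cases "n = 0")
 case True
 have "F om (Complex E \<eta>) 0 = (%z. 1)" by (auto simp: F_def)
 then have "U' om E \<eta> n = (%x. 0)" unfolding True U'_def by simp
 then show ?thesis using True by simp
next
 case False
 \<comment> \<open>The \<open>6\<close> exceeds the \<open>4\<close> of \<open>F_bd\<close>, which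
   makes the inequality between upper and lower bound strict, as the factorization lemmas
   demand.\<close>
 define K where "K = real n * ln (6 * A^2 / t)"
 have At: "6 * A^2 / t >= 6 * A^2" using t A2 by (simp add: field_simps mult_left_le_one_le)
 then have lpos: "ln (6 * A^2 / t) > 0" using A2 t by (intro ln_gt_zero) linarith
 then have K: "K > 0" using False by (simp add: K_def)
 have expK: "t ^ n * exp K = (6 * A^2) ^ n"
 proof -
  have "exp K = (6 * A^2 / t) ^ n"
   unfolding K_def exp_of_nat_mult using A2 t A by (subst exp_ln) auto
  then show ?thesis using t by (simp add: power_divide)
 qed
 have lt: "(4 * A^2) ^ n < t ^ n * exp K" unfolding expK using False A by (intro power_strict_mono) auto
 have normE: "cmod (Complex E \<eta>) <= A + 1" using cmod_le[of "Complex E \<eta>"] \<eta> E by simp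
 have "integral {0..1} (%x. abs (U' om E \<eta> n x)) <= real (nc \<rho>) * (24 * K + 3 * K * ln (1 + 3 * \<rho> / (4 * \<kappa> \<eta>)))"
  unfolding U'_def
  by (rule strip_log_variation[OF F_hol \<rho> _ F_nz'[OF \<eta> E] \<kappa>_pos[OF \<eta>(1)] F_bd[OF _ normE] _ low K lt])
   (use t F_per \<rho> in auto)
 also have "ln (1 + 3 * \<rho> / (4 * \<kappa> \<eta>)) <= 2 * \<Lambda> \<eta>"
 proof -
  have e: "3 * \<rho> / (4 * \<kappa> \<eta>) = 12 * (A^2 / \<eta>^2)" unfolding \<kappa>_def using \<rho> by simp
  have A4: "A^2 <= (A^2)^2"
   using mult_left_mono[of 1 "A^2" "A^2"] A2 unfolding power2_eq_square[of "A^2"] by simp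
  have "\<eta>^2 <= 1" using \<eta> by (simp add: power_le_one)
  then have one: "1 <= (A^2)^2 / \<eta>^2" using \<eta> A2 A4 by (subst le_divide_eq_1_pos) auto
  have "12 * (A^2 / \<eta>^2) <= 12 * ((A^2)^2 / \<eta>^2)" using A4 by (intro mult_left_mono divide_right_mono) auto
  then have "1 + 12 * (A^2 / \<eta>^2) <= 144 * ((A^2)^2 / \<eta>^2)" using one by linarith
  also have "... = (12 * A^2 / \<eta>)^2" by (simp add: power_divide power_mult_distrib)
  finally have "ln (1 + 12 * (A^2 / \<eta>^2)) <= ln ((12 * A^2 / \<eta>)^2)"
   using \<eta> by (intro ln_mono) (auto intro!: add_pos_nonneg)
  also have "... = 2 * \<Lambda> \<eta>" unfolding \<Lambda>_def using \<eta> A by (simp add: ln_realpow)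
  finally show ?thesis unfolding e .
 qed
 finally have "integral {0..1} (%x. abs (U' om E \<eta> n x)) <= real (nc \<rho>) * (24 * K + 3 * K * (2 * \<Lambda> \<eta>))"
  using K by (simp add: mult_left_mono)
 also have "... <= real (nc \<rho>) * (30 * K * \<Lambda> \<eta>)"
  using \<Lambda>_ge[OF \<eta>] K by (intro mult_left_mono) (auto simp: algebra_simps)
 also have "... = real n * V1 t \<eta>" unfolding V1_def K_def by simp
 finally show ?thesis .
qed

text \<open>For \<open>l\<close> close to \<open>x ^ s\<close> this grows only like
  \<open>l powr (1 / s)\<close> times logarithms, against a Lyapunov gain proportional to
  \<open>l\<close>.\<close>

definition OSC :: "nat => nat => real => real => real => real => real" where
 "OSC s x c \<alpha> t \<eta> = 4 ^ s * (8 * \<Lambda> \<eta> + 4 * real x * Dn c \<alpha> (real x ^ s) * V1 t \<eta>)"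

theorem large_deviation:
 assumes \<eta>: "0 < \<eta>" "\<eta> <= 1" and E: "abs E <= A" and t: "0 < t" "t <= 1"
  and w: "om : diophantine c \<alpha>" and c: "0 < c" "c < 1" and \<alpha>: "\<alpha> > 1"
  and low: "!!i n. i < nc \<rho> ==> n <= l ==> t ^ n <= cmod (F om (Complex E \<eta>) n (of_real (ctr \<rho> i)))"
  and x: "x >= 2" and s: "s >= 1" and l: "l <= x ^ s" and n: "n <= l"
 shows "abs (U om E \<eta> n y - integral {0..1} (U om E \<eta> n)) <= OSC s x c \<alpha> t \<eta>"
 unfolding OSC_def
proof (rule osc_iteration[where U' = "U' om E \<eta>", OF U_C1[OF \<eta> E] U_split[OF \<eta> E]])
 show "integral {0..1} (%x. abs (U' om E \<eta> n x)) <= real n * V1 t \<eta>" if "n <= l" for n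
  by (rule U_var[OF \<eta> E t low]) (use that in auto)
 show "0 <= \<Lambda> \<eta>" using \<Lambda>_ge[OF \<eta>] by simp
 have "6 * A^2 / t >= 6 * A^2" using t A2 by (simp add: field_simps mult_left_le_one_le)
 then have "ln (6 * A^2 / t) >= 0" using A2 by (intro ln_ge_zero) linarith
 then show "0 <= V1 t \<eta>" unfolding V1_def using \<Lambda>_ge[OF \<eta>] by simp
 show "1 <= Dn c \<alpha> (real x ^ s)" unfolding Dn_def using c by simp
 fix Q assume Q: "2 <= Q" "Q <= x ^ s"
 have "real Q <= real x ^ s" using Q(2) by (metis of_nat_le_iff of_nat_power)
 from diophantine_denominator'[OF w c \<alpha> Q(1) this]
 show "\<exists>p q. q > 0 & coprime p (int q) & abs (real q * om - of_int p) <= 1 / real q & q <= Q &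
   real Q <= Dn c \<alpha> (real x ^ s) * real q" by metis
qed (use x s l n in auto)

end

section \<open>The logarithm of the off-diagonal coefficient\<close>

lemma integrable_ln_dist:
 assumes "u <= v"
 shows "(%x. ln (cmod (complex_of_real x - z))) integrable_on {u..v}"
proof (cases "Im z = 0")
 case False
 then have "complex_of_real x - z ~= 0" for x by (auto simp: complex_eq_iff)
 then show ?thesis by (intro integrable_continuous_real continuous_intros) auto
next
 case True
 define p where "p = Re z"
 have z: "z = of_real p" using True by (simp add: p_def complex_eq_iff)
 have e: "cmod (complex_of_real x - z) = abs (x - p)" for x
  unfolding z by (metis norm_of_real of_real_diff)
 define G where "G x = (x - p) * ln (abs (x - p)) - x" for x
 have "((%x. ln (abs (x - p))) has_integral (G v - G u)) {u..v}"
 proof (rule fundamental_theorem_of_calculus_interior_strong[where S = "{p}"])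
  fix x assume "x : {u<..<v} - {p}"
  then have x: "x ~= p" by simp
  have "((%x. ln (abs (x - p))) has_real_derivative 1 / (x - p)) (at x)"
  proof (cases "x > p")
   case True
   have "((%x. ln (x - p)) has_real_derivative 1 / (x - p)) (at x)"
    using True by (auto intro!: derivative_eq_intros)
   then show ?thesis
    by (rule has_field_derivative_transform_within_open[where S = "{p<..}"]) (use True in auto)
  next
   case False
   have "((%x. ln (p - x)) has_real_derivative 1 / (x - p)) (at x)"
    using False x by (auto intro!: derivative_eq_intros simp: field_simps)
   then show ?thesis
    by (rule has_field_derivative_transform_within_open[where S = "{..<p}"]) (use False x in auto)
  qed
  then have "(G has_real_derivative ln (abs (x - p))) (at x)" unfolding G_def
   by (intro DERIV_cong[OF DERIV_diff[OF DERIV_mult[OF DERIV_diff[OF DERIV_ident DERIV_const]] DERIV_ident]])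
    (use x in auto)
  then show "(G has_vector_derivative ln (abs (x - p))) (at x)"
   by (simp add: has_real_derivative_iff_has_vector_derivative)
 next
  have "isCont (%t::real. t * ln (abs t)) t" for t
  proof (cases "t = 0")
   case True
   have "((%t::real. t * ln (abs t)) \<longlongrightarrow> 0) (at 0)"
   proof (subst filterlim_at_split, intro conjI)
    show "((%t::real. t * ln (abs t)) \<longlongrightarrow> 0) (at_right 0)" by real_asymp
    show "((%t::real. t * ln (abs t)) \<longlongrightarrow> 0) (at_left 0)" by real_asymp
   qed
   then show ?thesis unfolding True isCont_def by simp
  next
   case False
   then show ?thesis by (intro continuous_intros) auto
  qed
  then have "continuous_on UNIV (%t::real. t * ln (abs t))" by (simp add: continuous_at_imp_continuous_on)
  then have "continuous_on {u..v} (%x. (x - p) * ln (abs (x - p)))"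
   by (rule continuous_on_compose2) (auto intro!: continuous_intros)
  then show "continuous_on {u..v} G" unfolding G_def by (intro continuous_on_diff continuous_on_id)
 qed (use assms in auto)
 then show ?thesis unfolding e by blast
qed

lemma integral_inverse_sqrt:
 fixes u v p :: real
 assumes "u <= v" "v <= u + 1"
 shows "(%x. 1 / sqrt (abs (x - p))) integrable_on {u..v}" "integral {u..v} (%x. 1 / sqrt (abs (x - p))) <= 4"
proof -
 define G where "G x = 2 * sgn (x - p) * sqrt (abs (x - p))" for x
 have "((%x. 1 / sqrt (abs (x - p))) has_integral (G v - G u)) {u..v}"
 proof (rule fundamental_theorem_of_calculus_interior_strong[where S = "{p}"])
  fix x assume "x : {u<..<v} - {p}"
  then have x: "x ~= p" by simp
  have "(G has_real_derivative 1 / sqrt (abs (x - p))) (at x)"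
  proof (cases "x > p")
   case True
   have "((%x. 2 * sqrt (x - p)) has_real_derivative 1 / sqrt (abs (x - p))) (at x)"
    using True by (auto intro!: derivative_eq_intros simp: field_simps)
   then show ?thesis
    by (rule has_field_derivative_transform_within_open[where S = "{p<..}"]) (use True in \<open>auto simp: G_def\<close>)
  next
   case False
   have "((%x. - 2 * sqrt (p - x)) has_real_derivative 1 / sqrt (abs (x - p))) (at x)"
    using False x by (auto intro!: derivative_eq_intros simp: field_simps)
   then show ?thesis
    by (rule has_field_derivative_transform_within_open[where S = "{..<p}"]) (use False x in \<open>auto simp: G_def\<close>)
  qed
  then show "(G has_vector_derivative 1 / sqrt (abs (x - p))) (at x)"
   by (simp add: has_real_derivative_iff_has_vector_derivative)
 next
  have Gc: "G = (%x. 2 * sqrt (max 0 (x - p)) - 2 * sqrt (max 0 (p - x)))"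
   unfolding G_def by (auto simp: fun_eq_iff sgn_if max_def)
  show "continuous_on {u..v} G" unfolding Gc by (intro continuous_intros)
 qed (use assms in auto)
 note I = this
 then show "(%x. 1 / sqrt (abs (x - p))) integrable_on {u..v}" by blast
 have "G v - G u <= 4"
 proof -
  have s: "sqrt x <= sqrt y + 1" if "0 <= y" "x <= y + 1" for x y :: real
  proof -
   have "sqrt x <= sqrt (y + 1)" using that by simp
   also have "... <= sqrt y + sqrt 1" by (rule sqrt_add_le_add_sqrt) (use that in auto)
   finally show ?thesis by simp
  qed
  consider "p < u" | "p = u" | "u < p" "p < v" | "p = v" "u < v" | "v < p" using assms by linarith
  then show ?thesis
  proof cases
   case 1 then show ?thesis using s[of "u - p" "v - p"] assms by (simp add: G_def)
  next
   case 2
   have "sqrt (v - u) <= 1" using assms by simp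
   then have "sqrt (v - u) <= 2" by linarith
   then show ?thesis using 2 assms by (auto simp: G_def sgn_if)
  next
   case 3
   then have "G v - G u = 2 * sqrt (v - p) + 2 * sqrt (p - u)" by (simp add: G_def)
   moreover have "sqrt (v - p) <= 1" "sqrt (p - u) <= 1" using 3 assms by auto
   ultimately show ?thesis by linarith
  next
   case 4
   then have "G v - G u = 2 * sqrt (p - u)" by (simp add: G_def)
   moreover have "sqrt (p - u) <= 1" using 4 assms by auto
   ultimately show ?thesis by linarith
  next
   case 5 then show ?thesis using s[of "p - v" "p - u"] assms by (simp add: G_def)
  qed
 qed
 then show "integral {u..v} (%x. 1 / sqrt (abs (x - p))) <= 4" using I integral_unique by metis
qed

text \<open>Trades the logarithm for an arbitrarily small power, so that a zero of high order leaves
  only an integrable singularity.\<close>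

lemma ln_one_plus_le_root:
 assumes "N > 0" "u >= 0"
 shows "ln (1 + u) <= real N * root N u"
proof -
 have pw: "1 + v ^ N <= (1 + v) ^ N" if "v >= 0" for v :: real
  using assms(1)
 proof (induction N rule: nat_induct_non_zero)
  case (Suc N)
  have "1 + v ^ Suc N <= (1 + v) * (1 + v ^ N)" using that by (simp add: algebra_simps)
  also have "... <= (1 + v) ^ Suc N" using Suc that by simp
  finally show ?case .
 qed simp
 define v where "v = root N u"
 have v: "v >= 0" "v ^ N = u" using assms by (simp_all add: v_def)
 have "ln (1 + u) <= ln ((1 + v) ^ N)" using pw[OF v(1)] v assms by (intro ln_mono) auto
 also have "... = real N * ln (1 + v)" using v by (simp add: ln_realpow)
 also have "... <= real N * v" using v ln_add_one_self_le_self by (intro mult_left_mono) auto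
 finally show ?thesis by (simp add: v_def)
qed

text \<open>If no factor is below \<open>1\<close> the left side is at most \<open>1\<close>.
  Otherwise the smallest factor \<open>m\<close> bounds the product below by \<open>m ^ n\<close>,
  and the root is at most \<open>1 / sqrt m\<close>, one of the summands. A product of singularities
  thus becomes a sum of integrable ones.\<close>

lemma inverse_prod_root_le:
 fixes ss :: "real list"
 assumes "length ss <= n" "n > 0" "!!s. s : set ss ==> s > 0"
 shows "root (2 * n) (1 / prod_list ss) <= 1 + (\<Sum>s\<leftarrow>ss. 1 / sqrt s)"
proof (cases "\<forall>s\<in>set ss. s >= 1")
 case True
 then have "prod_list ss >= 1"
  by (induction ss) (auto intro: mult_ge1_I)
 then have "1 / prod_list ss <= 1" by simp
 then have "root (2 * n) (1 / prod_list ss) <= 1" using assms by simp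
 moreover have "0 <= (\<Sum>s\<leftarrow>ss. 1 / sqrt s)" using assms(3) by (intro sum_list_nonneg) (auto simp: less_imp_le)
 ultimately show ?thesis by linarith
next
 case False
 define m where "m = Min (set ss)"
 have ne: "set ss ~= {}" using False by auto
 have m: "m : set ss" "!!s. s : set ss ==> m <= s" unfolding m_def using ne by auto
 have m1: "0 < m" "m < 1" using False m assms(3) by force+
 have "m ^ length ts <= prod_list ts" if "!!s. s : set ts ==> m <= s" for ts
  using that
 proof (induction ts)
  case (Cons a ts)
  have "m <= a" "m ^ length ts <= prod_list ts" using Cons by auto
  then show ?case using m1 by (auto intro!: mult_mono)
 qed simp
 then have "m ^ length ss <= prod_list ss" using m by blast
 moreover have "m ^ n <= m ^ length ss" using assms m1 by (intro power_decreasing) auto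
 ultimately have "m ^ n <= prod_list ss" by linarith
 moreover have "0 < m ^ n" using m1 by simp
 ultimately have "1 / prod_list ss <= 1 / m ^ n" by (intro divide_left_mono mult_pos_pos) linarith+
 then have "root (2 * n) (1 / prod_list ss) <= root (2 * n) (1 / m ^ n)" using assms by simp
 also have "root (2 * n) (1 / m ^ n) = 1 / sqrt m"
 proof (rule real_root_pos_unique)
  show "(1 / sqrt m) ^ (2 * n) = 1 / m ^ n"
   using m1 by (simp add: power_mult power_divide)
 qed (use assms m1 in auto)
 also have "1 / sqrt m <= (\<Sum>s\<leftarrow>ss. 1 / sqrt s)"
  using m(1) assms(3)
 proof (induction ss)
  case (Cons s ss)
  have "0 <= (\<Sum>s\<leftarrow>ss. 1 / sqrt s)" using Cons.prems(2) by (intro sum_list_nonneg) (auto simp: less_imp_le)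
  moreover have "0 <= 1 / sqrt s" using Cons.prems by (simp add: less_imp_le)
  moreover have "1 / sqrt m <= (\<Sum>s\<leftarrow>ss. 1 / sqrt s)" if "m ~= s" using Cons that by auto
  ultimately have "1 / sqrt m <= 1 / sqrt s + (\<Sum>s\<leftarrow>ss. 1 / sqrt s)" by (cases "m = s"; simp del: zero_le_divide_1_iff; linarith)
  then show ?case by simp
 qed simp
 finally show ?thesis by simp
qed

text \<open>\<open>d0\<close> is an interval length and \<open>nb\<close> the number of such
  intervals per period; in each one \<open>cmod b\<close> reaches \<open>mb\<close>.
  \<open>Kb\<close> bounds \<open>ln (A / mb)\<close>, \<open>zb\<close> the number of zeros nearby,
  and \<open>cb\<close> is the constant of the resulting lower bound. They depend on \<rho> and
  \<open>A\<close> only.\<close>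

definition d0 :: "real => real" where "d0 \<rho> = min 1 (\<rho> / 8)"
definition nb :: "real => nat" where "nb \<rho> = nat \<lceil>1 / d0 \<rho>\<rceil>"
definition mb :: "real => real => real" where "mb \<rho> A = exp (- ((2 * A + 1) / d0 \<rho>))"
definition Kb :: "real => real => real" where "Kb \<rho> A = A + (2 * A + 1) / d0 \<rho>"
definition zb :: "real => real => nat" where "zb \<rho> A = nat \<lceil>2 * Kb \<rho> A\<rceil>"
definition cb :: "real => real => real" where
 "cb \<rho> A = exp (- 6 * Kb \<rho> A) * (mb \<rho> A / (max 1 (\<rho> / 4)) ^ zb \<rho> A)"

section \<open>Quantitative lower bounds for \<open>b\<close>\<close>

context jac
begin

abbreviation "bl x \<equiv> ln (cmod (b (complex_of_real x)))"

lemma d0: "0 < d0 \<rho>" "d0 \<rho> <= 1" "d0 \<rho> <= \<rho> / 8"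
 using \<rho> by (auto simp: d0_def)

lemma b_zeros_finite: "finite {x : {u..v}. b (complex_of_real x) = 0}"
proof (cases "b constant_on strip \<rho>")
 case True
 then have "b (complex_of_real x) ~= 0" for x
  using bnz \<rho> unfolding constant_on_def by (metis strip_real)
 then show ?thesis by simp
next
 case False
 have "finite {z : complex_of_real ` {u..v}. b z = 0}"
  by (rule holomorphic_compact_finite_zeros[OF bhol open_strip convex_connected[OF convex_strip] _ _ False])
   (use \<rho> in \<open>auto intro!: compact_continuous_image continuous_intros\<close>)
 moreover have "complex_of_real ` {x : {u..v}. b (complex_of_real x) = 0} \<subseteq> {z : complex_of_real ` {u..v}. b z = 0}"
  by auto
 ultimately show ?thesis by (meson finite_imageD finite_subset inj_of_real inj_on_subset subset_UNIV)
qed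

lemma b_disc:
 assumes "m > 0" "m <= cmod (b (of_real p))"
 shows "disc_bound b (of_real p) (\<rho> / 8) \<rho> A m"
proof
 show "b holomorphic_on ball (of_real p) \<rho>" by (rule holomorphic_on_subset[OF bhol ball_subset_strip])
 show "cmod (b z) <= A" if "z : ball (of_real p) \<rho>" for z
  by (rule bbd) (use that ball_subset_strip in blast)
qed (use assms \<rho> in auto)

text \<open>Integrability is local. On a short interval \<open>b\<close> is a product of linear
  factors with a zero-free function, so its logarithm is, off finitely many points, a sum of
  integrable logarithmic singularities and a continuous function.\<close>

lemma bl_integrable: "bl integrable_on {u..v}"
proof -
 have "bl integrable_on cbox u v"
 proof (rule integrable_on_little_subintervals, intro ballI exI conjI allI impI)
  fix x s t :: real
  assume st: "x : cbox s t & cbox s t \<subseteq> ball x (\<rho> / 16) & cbox s t \<subseteq> cbox u v"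
  show "bl integrable_on cbox s t"
  proof (cases "s < t")
   case False
   then have "s = t" using st by auto
   then show ?thesis using integrable_on_refl[of bl t] by simp
  next
   case True
   have "infinite {s..t}" using True by (simp add: infinite_Icc)
   then have "\<not> {s..t} \<subseteq> {x : {s..t}. b (complex_of_real x) = 0}"
    using b_zeros_finite[of s t] finite_subset by blast
   then obtain p where p: "p : {s..t}" "b (complex_of_real p) ~= 0" by blast
   interpret disc_bound b "of_real p" "\<rho> / 8" \<rho> A "cmod (b (of_real p))"
    by (rule b_disc) (use p in auto)
   obtain zs g where g: "set zs \<subseteq> cball (of_real p) (2 * (\<rho> / 8))" "g holomorphic_on ball (of_real p) \<rho>"
    "!!z. z : ball (of_real p) \<rho> ==> b z = zfac zs z * g z"
    "!!z. z : cball (of_real p) (2 * (\<rho> / 8)) ==> g z ~= 0" by (rule factorization, rule that)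
   have near: "dist (complex_of_real p) (of_real y) < \<rho> / 8" if "y : {s..t}" for y
   proof -
    have "y : ball x (\<rho> / 16)" "p : ball x (\<rho> / 16)" using st that p by auto
    then have "abs (p - y) < \<rho> / 8" unfolding mem_ball dist_real_def by linarith
    then show ?thesis by (simp add: dist_of_real dist_real_def)
   qed
   have gc: "continuous_on {s..t} (%y. ln (cmod (g (of_real y))))"
   proof (intro continuous_intros continuous_on_compose2[OF holomorphic_on_imp_continuous_on[OF g(2)]])
    show "complex_of_real ` {s..t} \<subseteq> ball (complex_of_real p) \<rho>" using near \<rho> by force
    show "\<forall>x\<in>{s..t}. cmod (g (complex_of_real x)) ~= 0"
    proof
     fix y assume "y : {s..t}"
     from near[OF this] show "cmod (g (complex_of_real y)) ~= 0" using g(4)[of "of_real y"] \<rho> by simp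
    qed
   qed
   have si: "(%y. \<Sum>z\<leftarrow>ws. ln (cmod (complex_of_real y - z))) integrable_on {s..t}" for ws
   proof (induction ws)
    case (Cons w ws)
    have "(%y. ln (cmod (complex_of_real y - w)) + (\<Sum>z\<leftarrow>ws. ln (cmod (complex_of_real y - z)))) integrable_on {s..t}"
     by (rule integrable_add[OF integrable_ln_dist[OF less_imp_le[OF True]] Cons])
    then show ?case by simp
   qed (simp add: integrable_0)
   have lnz: "ln (cmod (zfac ws y)) = (\<Sum>z\<leftarrow>ws. ln (cmod (y - z)))" if "y \<notin> set ws" for ws and y :: complex
    using that
   proof (induction ws)
    case (Cons w ws)
    then have "zfac ws y ~= 0" using zfac_eq_0_iff by (metis list.set_intros(2))
    moreover have "y - w ~= 0" using Cons.prems by auto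
    moreover have "ln (cmod (zfac ws y)) = (\<Sum>z\<leftarrow>ws. ln (cmod (y - z)))" using Cons by auto
    ultimately show ?case by (simp add: norm_mult ln_mult)
   qed simp
   have "bl integrable_on {s..t}"
   proof (rule integrable_spike_finite[OF b_zeros_finite[of s t]])
    show "(%y. (\<Sum>z\<leftarrow>zs. ln (cmod (complex_of_real y - z))) + ln (cmod (g (of_real y)))) integrable_on {s..t}"
     by (intro integrable_add si integrable_continuous_real gc)
    fix y assume y: "y : {s..t} - {x : {s..t}. b (complex_of_real x) = 0}"
    then have bz: "b (of_real y) = zfac zs (of_real y) * g (of_real y)" "b (of_real y) ~= 0"
     using g(3)[of "of_real y"] near[of y] \<rho> by auto
    then have nz: "zfac zs (of_real y) ~= 0" "g (of_real y) ~= 0" by (metis mult_zero_left mult_zero_right)+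
    then have "of_real y \<notin> set zs" using zfac_eq_0_iff by blast
    then show "bl y = (\<Sum>z\<leftarrow>zs. ln (cmod (complex_of_real y - z))) + ln (cmod (g (of_real y)))"
     unfolding bz(1) norm_mult using nz lnz[of "of_real y" zs] by (subst ln_mult) auto
   qed
   then show ?thesis by simp
  qed
 qed (use \<rho> in auto)
 then show ?thesis by simp
qed

lemma bl_per: "per bl"
 unfolding per_def using bper \<rho> by simp

lemma bl_le: "bl x <= A"
proof (cases "b (of_real x) = 0")
 case False
 then have "bl x <= cmod (b (of_real x)) - 1" by (intro ln_le_minus_one) auto
 then show ?thesis using bbd[of "of_real x"] \<rho> by simp
qed (use A in simp)

text \<open>If \<open>cmod b\<close> stayed below \<open>mb\<close> on the whole interval, this
  interval would contribute at most \<open>- (2 * A + 1)\<close> to the mean of \<open>bl\<close>,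
  which is at most \<open>A\<close> elsewhere; the mean would fall below the \<open>- A\<close> of
  \<open>bint\<close>.\<close>

lemma b_large_point:
 obtains p where "p : {u..u + d0 \<rho>}" "mb \<rho> A <= cmod (b (of_real p))"
proof -
 have "\<exists>p\<in>{u..u + d0 \<rho>}. mb \<rho> A <= cmod (b (of_real p))"
 proof (rule ccontr)
  assume "\<not> ?thesis"
  then have small: "cmod (b (of_real p)) < mb \<rho> A" if "p : {u..u + d0 \<rho>}" for p using that by force
  define K where "K = (2 * A + 1) / d0 \<rho>"
  have i1: "integral {u..u + d0 \<rho>} bl <= integral {u..u + d0 \<rho>} (%x. - K)"
  proof -
   let ?Z = "{x : {u..u + d0 \<rho>}. b (complex_of_real x) = 0}"
   have "(bl has_integral (integral {u..u + d0 \<rho>} bl)) {u..u + d0 \<rho>}" by (rule integrable_integral[OF bl_integrable])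
   then have "((%x. if x : ?Z then - K else bl x) has_integral (integral {u..u + d0 \<rho>} bl)) {u..u + d0 \<rho>}"
    by (rule has_integral_spike_finite[OF b_zeros_finite, rotated]) auto
   moreover have "((%x. - K) has_integral integral {u..u + d0 \<rho>} (%x. - K)) {u..u + d0 \<rho>}"
    by (rule integrable_integral) auto
   ultimately show ?thesis
   proof (rule has_integral_le)
    fix x assume x: "x : {u..u + d0 \<rho>}"
    have "bl x <= - K" if "b (of_real x) ~= 0"
    proof -
     have "bl x <= ln (mb \<rho> A)" using small[OF x] that by (intro ln_mono) auto
     then show ?thesis by (simp add: mb_def K_def)
    qed
    then show "(if x : ?Z then - K else bl x) <= - K" using x by auto
   qed
  qed
  have i2: "integral {u + d0 \<rho>..u + 1} bl <= integral {u + d0 \<rho>..u + 1} (%x. A)"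
   by (intro integral_le bl_integrable bl_le) auto
  have "integral {u..u + 1} bl = integral {u..u + d0 \<rho>} bl + integral {u + d0 \<rho>..u + 1} bl"
   by (rule Henstock_Kurzweil_Integration.integral_combine[symmetric]) (use d0 bl_integrable in auto)
  also have "... <= - (K * d0 \<rho>) + (1 - d0 \<rho>) * A" using i1 i2 d0 by (simp add: mult.commute)
  also have "K * d0 \<rho> = 2 * A + 1" using d0 by (simp add: K_def)
  also have "- (2 * A + 1) + (1 - d0 \<rho>) * A <= - (2 * A + 1) + A" using d0 A by (simp add: algebra_simps)
  finally have "integral {u..u + 1} bl < - A" by simp
  moreover have "integral {u..u + 1} bl = integral {0..1} bl"
   by (rule integral_unique[OF per_has_integral[OF bl_per integrable_integral[OF bl_integrable]]])
  ultimately show False using bint by simp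
 qed
 then show ?thesis using that by blast
qed

text \<open>Factorization about a point supplied by \<open>b_large_point\<close>. On the real axis
  the distance to a zero is at least the distance to its real part, so the bound only involves
  points of the line.\<close>

lemma b_lower:
 obtains zs where "length zs <= zb \<rho> A"
  "!!x. x : {u..u + d0 \<rho>} ==> cb \<rho> A * prod_list (map (%z. abs (x - Re z)) zs) <= cmod (b (of_real x))"
proof -
 obtain p where p: "p : {u..u + d0 \<rho>}" "mb \<rho> A <= cmod (b (of_real p))" by (rule b_large_point)
 have mb: "mb \<rho> A > 0" by (simp add: mb_def)
 have K: "Kb \<rho> A > 0" "A < mb \<rho> A * exp (Kb \<rho> A)"
 proof -
  show "Kb \<rho> A > 0" unfolding Kb_def using A d0 by (intro add_pos_pos) auto
  have "mb \<rho> A * exp (Kb \<rho> A) = exp A" unfolding mb_def Kb_def exp_add[symmetric] by simp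
  then show "A < mb \<rho> A * exp (Kb \<rho> A)" using exp_ge_add_one_self[of A] by linarith
 qed
 interpret disc_bound b "of_real p" "\<rho> / 8" \<rho> A "mb \<rho> A" by (rule b_disc[OF mb p(2)])
 obtain zs g where g: "set zs \<subseteq> cball (of_real p) (2 * (\<rho> / 8))" "g holomorphic_on ball (of_real p) \<rho>"
  "!!z. z : ball (of_real p) \<rho> ==> b z = zfac zs z * g z"
  "2 ^ length zs <= A / mb \<rho> A"
  "!!z. z : cball (of_real p) (\<rho> / 8) ==> exp (- 6 * Kb \<rho> A) * (mb \<rho> A / (2 * (\<rho> / 8)) ^ length zs) <= cmod (g z)"
  by (rule factorization'[OF K]) blast
 have len: "length zs <= zb \<rho> A"
 proof -
  have "A / mb \<rho> A <= exp (Kb \<rho> A)" using K mb by (simp add: pos_divide_le_eq mult.commute)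
  then have "(2::real) ^ length zs <= exp (Kb \<rho> A)" using g(4) by linarith
  then have "ln ((2::real) ^ length zs) <= Kb \<rho> A" by (metis ln_exp ln_mono zero_less_numeral zero_less_power)
  then have "real (length zs) * ln 2 <= Kb \<rho> A" by (simp add: ln_realpow)
  moreover have "1 / 2 <= ln (2::real)" using ln2_ge_two_thirds by simp
  ultimately have "real (length zs) * (1 / 2) <= Kb \<rho> A"
   using mult_left_mono[of "1 / 2" "ln 2" "real (length zs)"] by linarith
  then show ?thesis unfolding zb_def by linarith
 qed
 have low: "cb \<rho> A * prod_list (map (%z. abs (x - Re z)) zs) <= cmod (b (of_real x))" if x: "x : {u..u + d0 \<rho>}" for x
 proof -
  have "abs (p - x) <= d0 \<rho>" using x p unfolding atLeastAtMost_iff by linarith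
  then have "abs (p - x) <= \<rho> / 8" using d0 by linarith
  then have xc: "complex_of_real x : cball (of_real p) (\<rho> / 8)" by (simp add: dist_of_real dist_real_def)
  then have xb: "complex_of_real x : ball (of_real p) \<rho>" using \<rho> by auto
  have "(2 * (\<rho> / 8)) ^ length zs <= (max 1 (\<rho> / 4)) ^ length zs" using \<rho> by (intro power_mono) auto
  also have "... <= (max 1 (\<rho> / 4)) ^ zb \<rho> A" using len by (intro power_increasing) auto
  finally have "cb \<rho> A <= exp (- 6 * Kb \<rho> A) * (mb \<rho> A / (2 * (\<rho> / 8)) ^ length zs)"
   unfolding cb_def using \<rho> mb by (intro mult_left_mono divide_left_mono mult_pos_pos zero_less_power) auto
  then have cg: "cb \<rho> A <= cmod (g (of_real x))" using g(5)[OF xc] by linarith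
  have "prod_list (map (%z. abs (x - Re z)) zs) <= cmod (zfac zs (of_real x))" for zs
  proof (induction zs)
   case (Cons z zs)
   have "abs (x - Re z) <= cmod (of_real x - z)" using abs_Re_le_cmod[of "of_real x - z"] by simp
   moreover have "0 <= prod_list (map (%z. abs (x - Re z)) zs)" by (induction zs) auto
   ultimately show ?case using Cons by (auto simp: norm_mult intro!: mult_mono)
  qed simp
  moreover have "0 <= prod_list (map (%z. abs (x - Re z)) zs)" by (induction zs) auto
  moreover have "0 <= cb \<rho> A" unfolding cb_def using mb by simp
  ultimately show ?thesis unfolding g(3)[OF xb] norm_mult using cg
   by (subst mult.commute) (intro mult_mono, auto)
 qed
 show ?thesis by (rule that[OF len low])
qed

end

text \<open>Excess of the mean of \<open>ln ((cmod b)^2 + \<tau>^2)\<close> over twice the mean of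
  \<open>ln (cmod b)\<close>: a fixed positive power of \<tau>, with constants depending on \<rho>
  and \<open>A\<close>.\<close>

definition eb :: "real => real => real => real" where
 "eb \<rho> A \<tau> = 2 * real (nb \<rho>) * real (2 * zb \<rho> A) * root (2 * zb \<rho> A) (\<tau> / cb \<rho> A) * (1 + 4 * real (zb \<rho> A))"

definition KW :: "real => real => real" where
 "KW A \<tau> = ln ((A^2 + 1) / \<tau>^2) + 1"

definition VW :: "real => real => real => real" where
 "VW \<rho> A \<tau> = real (nc \<rho>) * (24 * KW A \<tau> + 3 * KW A \<tau> * ln (1 + 3 * \<rho> / (4 * (\<rho> * \<tau>^2 / (4 * A^2)))))"

context jac
begin

lemma cb_pos: "cb \<rho> A > 0"
 by (simp add: cb_def mb_def)

lemma zb_pos: "zb \<rho> A > 0"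
proof -
 have "Kb \<rho> A > 0" unfolding Kb_def using A d0 by (intro add_pos_pos) auto
 then show ?thesis by (simp add: zb_def)
qed

lemma nb_ge: "1 / d0 \<rho> <= real (nb \<rho>)" "nb \<rho> > 0"
proof -
 have "1 / d0 \<rho> > 0" using d0 by simp
 then show "1 / d0 \<rho> <= real (nb \<rho>)" "nb \<rho> > 0" unfolding nb_def by (simp_all add: le_nat_iff)
qed

text \<open>A point at distance at least \<tau> from all the real parts in \<open>b_lower\<close>
  makes the product at least \<open>\<tau> ^ zb\<close>. The exceptional centres do not depend on
  \<tau>; later they locate the windows whose cluster could meet a near-zero of
  \<open>b\<close>.\<close>

lemma small_b:
 obtains X where "finite X" "card X <= nb \<rho> * zb \<rho> A"
  "!!x \<tau>. 0 < \<tau> ==> \<tau> <= 1 ==> cmod (b (of_real x)) < cb \<rho> A * \<tau> ^ zb \<rho> A ==>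
    \<exists>\<xi>\<in>X. \<exists>k::int. abs (x - \<xi> - of_int k) < \<tau>"
proof -
 have "\<exists>zs. length zs <= zb \<rho> A & (\<forall>x\<in>{real j * d0 \<rho>..real j * d0 \<rho> + d0 \<rho>}.
   cb \<rho> A * prod_list (map (%z. abs (x - Re z)) zs) <= cmod (b (of_real x)))" for j :: nat
  by (rule b_lower[of "real j * d0 \<rho>"]) blast
 then obtain zs where zs: "!!j. length (zs j) <= zb \<rho> A"
  "!!j x. x : {real j * d0 \<rho>..real j * d0 \<rho> + d0 \<rho>} ==>
   cb \<rho> A * prod_list (map (%z. abs (x - Re z)) (zs j)) <= cmod (b (of_real x))"
  by metis
 define X where "X = (\<Union>j<nb \<rho>. Re ` set (zs j))"
 have "card X <= (\<Sum>j<nb \<rho>. card (Re ` set (zs j)))" unfolding X_def by (rule card_UN_le) simp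
 also have "... <= (\<Sum>j<nb \<rho>. zb \<rho> A)"
  by (intro sum_mono order_trans[OF card_image_le] order_trans[OF card_length] zs(1)) auto
 finally have card: "card X <= nb \<rho> * zb \<rho> A" by simp
 have near: "\<exists>\<xi>\<in>X. \<exists>k::int. abs (x - \<xi> - of_int k) < \<tau>"
  if \<tau>: "0 < \<tau>" "\<tau> <= 1" and sm: "cmod (b (of_real x)) < cb \<rho> A * \<tau> ^ zb \<rho> A" for x \<tau>
 proof (rule ccontr)
  assume far: "\<not> ?thesis"
  define y where "y = x + of_int (- \<lfloor>x\<rfloor>)"
  have y: "0 <= y" "y < 1" unfolding y_def by (simp_all, linarith+)
  define j where "j = nat \<lfloor>y / d0 \<rho>\<rfloor>"
  have yd: "0 <= y / d0 \<rho>" "y / d0 \<rho> < 1 / d0 \<rho>" using y d0 by (auto intro: divide_strict_right_mono)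
  have j: "real j <= y / d0 \<rho>" "y / d0 \<rho> < real j + 1" unfolding j_def using yd by linarith+
  have jn: "j < nb \<rho>" using j yd nb_ge by linarith
  have yI: "y : {real j * d0 \<rho>..real j * d0 \<rho> + d0 \<rho>}" using j d0 by (simp add: field_simps)
  have far': "\<tau> <= abs (y - Re z)" if "z : set (zs j)" for z
  proof -
   have "Re z : X" unfolding X_def using that jn by auto
   then have "\<not> abs (x - Re z - of_int \<lfloor>x\<rfloor>) < \<tau>" using far by blast
   then show ?thesis unfolding y_def by (simp add: algebra_simps)
  qed
  have "\<tau> ^ length ts <= prod_list (map (%z. abs (y - Re z)) ts)" if "set ts \<subseteq> set (zs j)" for ts
   using that far' \<tau> by (induction ts) (auto intro!: mult_mono)
  then have "\<tau> ^ length (zs j) <= prod_list (map (%z. abs (y - Re z)) (zs j))" by blast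
  moreover have "\<tau> ^ zb \<rho> A <= \<tau> ^ length (zs j)" using \<tau> zs(1) by (intro power_decreasing) auto
  ultimately have "cb \<rho> A * \<tau> ^ zb \<rho> A <= cb \<rho> A * prod_list (map (%z. abs (y - Re z)) (zs j))"
   using cb_pos by (intro mult_left_mono) linarith+
  also have "... <= cmod (b (of_real y))" by (rule zs(2)[OF yI])
  also have "b (of_real y) = b (of_real x)"
   unfolding y_def by (rule per_int[of "%x. b (of_real x)"]) (use bper \<rho> in \<open>simp add: per_def\<close>)
  finally show False using sm by simp
 qed
 have "finite X" unfolding X_def by auto
 from that[OF this card near] show ?thesis by blast
qed

section \<open>A smooth substitute for the logarithm of \<open>b\<close>, and bounds for products of
  \<open>b\<close> along orbits\<close>

definition G :: "real => complex => complex" where "G \<tau> z = B2 b z + of_real (\<tau>^2)"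

lemma G_real: "G \<tau> (of_real x) = of_real ((cmod (b (of_real x)))^2 + \<tau>^2)"
 by (simp add: G_def B2_real)

lemma cmod_G: "cmod (G \<tau> (of_real x)) = (cmod (b (of_real x)))^2 + \<tau>^2"
 unfolding G_real norm_of_real by simp

lemma G_hol: "G \<tau> holomorphic_on strip \<rho>"
 unfolding G_def by (intro holomorphic_intros B2_hol)

lemma G_per: "G \<tau> (of_real (x + 1)) = G \<tau> (of_real x)"
 using B2_per \<rho> by (simp add: G_def)

abbreviation "W \<tau> x \<equiv> ln (cmod (G \<tau> (complex_of_real x)))"

lemma W_C1:
 assumes "\<tau> > 0"
 shows "C1_per (W \<tau>) (%x. Re (deriv (G \<tau>) (of_real x) / G \<tau> (of_real x)))"
proof (rule strip_log_C1[OF G_hol \<rho> G_per])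
 show "G \<tau> (of_real x) ~= 0" for x
  using cmod_G[of \<tau> x] assms by (metis add_nonneg_pos norm_zero zero_le_power2 zero_less_norm_iff zero_less_power less_irrefl)
qed

lemma W_var:
 assumes \<tau>: "0 < \<tau>" "\<tau> <= 1"
 shows "integral {0..1} (%x. abs (Re (deriv (G \<tau>) (of_real x) / G \<tau> (of_real x)))) <= VW \<rho> A \<tau>"
 unfolding VW_def
proof (rule strip_log_variation[OF G_hol \<rho> G_per, where M = "A^2 + 1" and m = "\<tau>^2"])
 have t1: "\<tau>^2 <= 1" using \<tau> by (simp add: power_le_one)
 show "0 < \<rho> * \<tau>^2 / (4 * A^2)" using \<rho> \<tau> A by simp
 have k1: "\<rho> * \<tau>^2 / (4 * A^2) <= \<rho> / 4"
 proof -
  have "\<tau>^2 / A^2 <= 1" using A2 t1 by (subst divide_le_eq_1_pos) auto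
  then have "\<rho> / 4 * (\<tau>^2 / A^2) <= \<rho> / 4 * 1" using \<rho> by (intro mult_left_mono) auto
  then show ?thesis by simp
 qed
 show "G \<tau> z ~= 0" if z: "z : strip \<rho>" "abs (Im z) < \<rho> * \<tau>^2 / (4 * A^2)" for z
 proof
  assume "G \<tau> z = 0"
  then have "cmod (B2 b z - B2 b (of_real (Re z))) = (cmod (b (of_real (Re z))))^2 + \<tau>^2"
   unfolding G_def B2_real
   by (metis (no_types, lifting) add_diff_cancel_left' add_eq_0_iff2 add_nonneg_nonneg diff_minus_eq_add minus_diff_eq norm_minus_cancel norm_of_real of_real_add zero_le_power2 abs_of_nonneg add.commute)
  then have "\<tau>^2 <= cmod (B2 b z - B2 b (of_real (Re z)))" by simp
  also have "... <= 2 * A^2 / \<rho> * abs (Im z)"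
   by (rule Lipschitz_real[OF B2_hol B2_bd]) (use z k1 \<rho> in auto)
  also have "... <= 2 * A^2 / \<rho> * (\<rho> * \<tau>^2 / (4 * A^2))" using z \<rho> A by (intro mult_left_mono) auto
  also have "... = \<tau>^2 / 2" using \<rho> A by (simp add: field_simps)
  finally show False using \<tau> by simp
 qed
 show "cmod (G \<tau> z) <= A^2 + 1" if "z : strip \<rho>" for z
  using norm_triangle_ineq[of "B2 b z" "of_real (\<tau>^2)"] B2_bd[OF that] t1 unfolding G_def norm_of_real by simp
 show "\<tau>^2 <= cmod (G \<tau> (of_real (ctr \<rho> i)))" if "i < nc \<rho>" for i unfolding cmod_G by simp
 show "0 < \<tau>^2" using \<tau> by simp
 have q: "(A^2 + 1) / \<tau>^2 >= 1" using \<tau> t1 A2 by (subst le_divide_eq_1_pos) auto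
 then show "0 < KW A \<tau>" unfolding KW_def using ln_ge_zero[OF q] by linarith
 have "\<tau>^2 * exp (KW A \<tau>) = \<tau>^2 * ((A^2 + 1) / \<tau>^2 * exp 1)"
  unfolding KW_def exp_add using q by (subst exp_ln) auto
 also have "... = (A^2 + 1) * exp 1" using \<tau> by simp
 also have "... > (A^2 + 1) * 1" by (intro mult_strict_left_mono) (auto intro: add_nonneg_pos)
 finally show "A^2 + 1 < \<tau>^2 * exp (KW A \<tau>)" by simp
qed

text \<open>With \<beta> the modulus of \<open>b\<close>,
  \<open>W \<tau> = 2 * ln \<beta> + ln (1 + (\<tau> / \<beta>)^2)\<close>. The second term is at
  most a small root of \<open>\<tau> / \<beta>\<close>, and \<open>b_lower\<close> with
  \<open>inverse_prod_root_le\<close> dominates that root by inverse square roots of distances to at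
  most \<open>zb\<close> points.\<close>

lemma W_integral_piece:
 assumes \<tau>: "\<tau> > 0" and d: "0 < d" "d <= d0 \<rho>"
 shows "integral {u..u + d} (W \<tau>) <= 2 * integral {u..u + d} bl + eb \<rho> A \<tau> / real (nb \<rho>)"
proof -
 interpret W: C1_per "W \<tau>" "%x. Re (deriv (G \<tau>) (of_real x) / G \<tau> (of_real x))" by (rule W_C1[OF \<tau>])
 obtain zs where zs: "length zs <= zb \<rho> A"
  "!!x. x : {u..u + d0 \<rho>} ==> cb \<rho> A * prod_list (map (%z. abs (x - Re z)) zs) <= cmod (b (of_real x))"
  by (rule b_lower[of u], rule that)
 define N where "N = 2 * zb \<rho> A"
 have N: "N > 0" using zb_pos by (simp add: N_def)
 define R where "R = root N (\<tau> / cb \<rho> A)"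
 have R: "R >= 0" unfolding R_def using \<tau> cb_pos N by simp
 let ?h = "%x. \<Sum>z\<leftarrow>zs. 1 / sqrt (abs (x - Re z))"
 have h: "?h integrable_on {u..u + d} & integral {u..u + d} ?h <= 4 * real (length zs)"
 proof -
  have "(%x. \<Sum>z\<leftarrow>ws. 1 / sqrt (abs (x - Re z))) integrable_on {u..u + d} &
    integral {u..u + d} (%x. \<Sum>z\<leftarrow>ws. 1 / sqrt (abs (x - Re z))) <= 4 * real (length ws)" for ws
  proof (induction ws)
   case (Cons w ws)
   have "u <= u + d" "u + d <= u + 1" using d d0 by auto
   note J = integral_inverse_sqrt[OF this, of "Re w"]
   show ?case using Cons J by (auto simp: integral_add intro!: integrable_add)
  qed (simp add: integrable_0)
  then show ?thesis by blast
 qed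
 have "integral {u..u + d} (W \<tau>) <= integral {u..u + d} (%x. 2 * bl x + 2 * real N * R * (1 + ?h x))"
 proof -
  let ?Z = "{x : {u..u + d}. b (complex_of_real x) = 0} \<union> Re ` set zs"
  let ?g = "%x. 2 * bl x + 2 * real N * R * (1 + ?h x)"
  have gi: "?g integrable_on {u..u + d}"
  proof -
   have i1: "(%x. 2 * bl x) integrable_on {u..u + d}"
    using integrable_cmul[OF bl_integrable, of 2] by simp
   have i2: "(%x. 1 + ?h x) integrable_on {u..u + d}" using h by (intro integrable_add) auto
   have i3: "(%x. 2 * real N * R * (1 + ?h x)) integrable_on {u..u + d}"
    using integrable_cmul[OF i2, of "2 * real N * R"] by simp
   show ?thesis by (rule integrable_add[OF i1 i3])
  qed
  have h1: "((%x. if x : ?Z then W \<tau> x else ?g x) has_integral integral {u..u + d} ?g) {u..u + d}"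
   by (rule has_integral_spike_finite[OF _ _ integrable_integral[OF gi], of ?Z]) (use b_zeros_finite in auto)
  have h2: "(W \<tau> has_integral integral {u..u + d} (W \<tau>)) {u..u + d}"
   by (rule integrable_integral[OF W.intU])
  show ?thesis
  proof (rule has_integral_le[OF h2 h1])
   fix x assume x: "x : {u..u + d}"
   have "W \<tau> x <= ?g x" if "x \<notin> ?Z"
   proof -
    define \<beta> where "\<beta> = cmod (b (of_real x))"
    have \<beta>: "\<beta> > 0" unfolding \<beta>_def using that x by auto
    have sp: "s > 0" if "s : set (map (%z. abs (x - Re z)) zs)" for s
     using \<open>x \<notin> ?Z\<close> that by auto
    define P where "P = prod_list (map (%z. abs (x - Re z)) zs)"
    have P: "P > 0" unfolding P_def using sp
    proof (induction zs)
     case (Cons a zs)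
     have "0 < abs (x - Re a)" by (rule Cons.prems) simp
     moreover have "0 < prod_list (map (%z. abs (x - Re z)) zs)"
      by (rule Cons.IH) (use Cons.prems in auto)
     ultimately show ?case by simp
    qed simp
    have low: "cb \<rho> A * P <= \<beta>" unfolding \<beta>_def P_def by (rule zs(2)) (use x d in auto)
    have "W \<tau> x = 2 * ln \<beta> + ln (1 + (\<tau> / \<beta>)^2)"
    proof -
     have "\<beta>^2 + \<tau>^2 = \<beta>^2 * (1 + (\<tau> / \<beta>)^2)" using \<beta> by (simp add: field_simps)
     moreover have "0 < 1 + (\<tau> / \<beta>)^2" by (intro add_pos_nonneg) auto
     ultimately show ?thesis unfolding cmod_G \<beta>_def[symmetric] using \<beta> by (simp add: ln_mult ln_realpow)
    qed
    also have "ln (1 + (\<tau> / \<beta>)^2) <= ln ((1 + \<tau> / \<beta>)^2)"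
     using \<tau> \<beta> by (intro ln_mono) (auto intro: add_pos_nonneg simp: power2_sum)
    also have "... = 2 * ln (1 + \<tau> / \<beta>)" using \<tau> \<beta> by (simp add: ln_realpow add_pos_pos)
    also have "... <= 2 * (real N * root N (\<tau> / \<beta>))"
     using ln_one_plus_le_root[OF N, of "\<tau> / \<beta>"] \<tau> \<beta> by simp
    also have "root N (\<tau> / \<beta>) <= R * (1 + ?h x)"
    proof -
     have "\<tau> / \<beta> <= \<tau> / (cb \<rho> A * P)" using low \<tau> cb_pos P \<beta> by (intro divide_left_mono) auto
     then have "\<tau> / \<beta> <= \<tau> / cb \<rho> A * (1 / P)" by simp
     then have "root N (\<tau> / \<beta>) <= root N (\<tau> / cb \<rho> A * (1 / P))" using N real_root_le_mono by blast
     also have "... = R * root N (1 / P)" unfolding R_def by (rule real_root_mult)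
     also have "root N (1 / P) <= 1 + (\<Sum>s\<leftarrow>map (%z. abs (x - Re z)) zs. 1 / sqrt s)"
      unfolding N_def P_def by (rule inverse_prod_root_le) (use zs(1) zb_pos sp in auto)
     finally show ?thesis using R by (simp add: mult_left_mono o_def)
    qed
    finally show ?thesis using N by (simp add: \<beta>_def mult.assoc)
   qed
   then show "W \<tau> x <= (if x : ?Z then W \<tau> x else ?g x)" by auto
  qed
 qed
 also have "... = 2 * integral {u..u + d} bl + 2 * real N * R * (d + integral {u..u + d} ?h)"
 proof -
  have i2: "(%x. 1 + ?h x) integrable_on {u..u + d}" using h by (intro integrable_add) auto
  have "integral {u..u + d} (%x. 2 * bl x + 2 * real N * R * (1 + ?h x)) =
    integral {u..u + d} (%x. 2 * bl x) + integral {u..u + d} (%x. 2 * real N * R * (1 + ?h x))"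
  proof (rule integral_add)
   show "(%x. 2 * bl x) integrable_on {u..u + d}" using integrable_cmul[OF bl_integrable, of 2] by simp
   show "(%x. 2 * real N * R * (1 + ?h x)) integrable_on {u..u + d}"
    using integrable_cmul[OF i2, of "2 * real N * R"] by simp
  qed
  also have "integral {u..u + d} (%x. 1 + ?h x) = d + integral {u..u + d} ?h"
   using h d by (subst integral_add) auto
  then have "integral {u..u + d} (%x. 2 * real N * R * (1 + ?h x)) = 2 * real N * R * (d + integral {u..u + d} ?h)"
   by (simp only: integral_mult_right)
  finally show ?thesis by simp
 qed
 also have "... <= 2 * integral {u..u + d} bl + 2 * real N * R * (1 + 4 * real (zb \<rho> A))"
 proof -
  have "d + integral {u..u + d} ?h <= 1 + 4 * real (zb \<rho> A)" using h d d0 zs(1) by linarith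
  then show ?thesis using R by (intro add_left_mono mult_left_mono) auto
 qed
 also have "2 * real N * R * (1 + 4 * real (zb \<rho> A)) = eb \<rho> A \<tau> / real (nb \<rho>)"
  unfolding eb_def N_def R_def using nb_ge by simp
 finally show ?thesis .
qed

lemma W_integral:
 assumes \<tau>: "\<tau> > 0"
 shows "integral {0..1} (W \<tau>) <= 2 * integral {0..1} bl + eb \<rho> A \<tau>"
proof -
 interpret W: C1_per "W \<tau>" "%x. Re (deriv (G \<tau>) (of_real x) / G \<tau> (of_real x))" by (rule W_C1[OF \<tau>])
 define d where "d = 1 / real (nb \<rho>)"
 have d: "0 < d" "d <= d0 \<rho>" "real (nb \<rho>) * d = 1"
  using nb_ge d0 by (auto simp: d_def field_simps)
 have "integral {0..1} (W \<tau>) = (\<Sum>j<nb \<rho>. integral {0 + real j * d..0 + (real j + 1) * d} (W \<tau>))"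
  using integral_arcs[of "W \<tau>" d 0 "nb \<rho>"] d by simp
 also have "... <= (\<Sum>j<nb \<rho>. 2 * integral {0 + real j * d..0 + (real j + 1) * d} bl + eb \<rho> A \<tau> / real (nb \<rho>))"
 proof (rule sum_mono)
  fix j
  show "integral {0 + real j * d..0 + (real j + 1) * d} (W \<tau>) <= 2 * integral {0 + real j * d..0 + (real j + 1) * d} bl + eb \<rho> A \<tau> / real (nb \<rho>)"
   using W_integral_piece[OF \<tau> d(1,2), of "real j * d"] by (simp add: algebra_simps)
 qed
 also have "... = 2 * (\<Sum>j<nb \<rho>. integral {0 + real j * d..0 + (real j + 1) * d} bl) + eb \<rho> A \<tau>"
  using nb_ge by (simp add: sum.distrib sum_distrib_left)
 also have "(\<Sum>j<nb \<rho>. integral {0 + real j * d..0 + (real j + 1) * d} bl) = integral {0..1} bl"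
  using integral_arcs[of bl d 0 "nb \<rho>"] bl_integrable d by simp
 finally show ?thesis .
qed

definition \<D> :: real where "\<D> = integral {0..1} bl"

lemma \<D>_bounds: "- A <= \<D>" "\<D> <= A"
proof -
 show "- A <= \<D>" using bint by (simp add: \<D>_def)
 have "integral {0..1} bl <= integral {0..1::real} (%x. A)" by (intro integral_le bl_integrable bl_le) auto
 then show "\<D> <= A" by (simp add: \<D>_def)
qed

text \<open>Denjoy-Koksma does not apply to \<open>ln (cmod b)\<close>, which may have poles, but it
  is dominated by half of the smooth \<open>W \<tau>\<close>. Orbits are cut into blocks of one
  fixed denominator \<open>q\<close>, each costing the variation of \<open>W \<tau>\<close>. Zeros
  of \<open>b\<close> make the product vanish, which is harmless for an upper bound.\<close>

lemma b_prod_bound: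
 assumes \<tau>: "0 < \<tau>" "\<tau> <= 1" and w: "om : diophantine c \<alpha>" and c: "0 < c" "c < 1" and \<alpha>: "\<alpha> > 1" and Q: "2 <= Q"
 shows "(\<Prod>k<s. cmod (b (of_real (y + real k * om)))) <=
   exp (real s * (\<D> + (eb \<rho> A \<tau> + 2 * VW \<rho> A \<tau> * Dn c \<alpha> (real Q) / real Q)) + 2 * A * real Q)"
proof -
 interpret W: C1_per "W \<tau>" "%x. Re (deriv (G \<tau>) (of_real x) / G \<tau> (of_real x))" by (rule W_C1[OF \<tau>(1)])
 obtain p q where q: "q > 0" "coprime p (int q)" "abs (real q * om - of_int p) <= 1 / real q"
  "q <= Q" "real Q <= Dn c \<alpha> (real Q) * real q"
  by (rule diophantine_denominator'[OF w c \<alpha> Q order_refl])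
 let ?V = "VW \<rho> A \<tau>" let ?D = "Dn c \<alpha> (real Q)"
 have Vn: "0 <= W.V" by (intro integral_nonneg) auto
 have VV: "W.V <= ?V" by (rule W_var[OF \<tau>])
 have D0: "0 < ?D * real q" using q Q by linarith
 have "?D > 0" using D0 q(1) by (simp add: zero_less_mult_iff)
 moreover have "?V >= 0" using Vn VV by linarith
 ultimately have Y0: "0 <= 2 * ?V * ?D / real Q" by simp
 define I where "I = integral {0..1} (W \<tau>)"
 have blW: "2 * bl x <= W \<tau> x" if "b (of_real x) ~= 0" for x
 proof -
  have "2 * bl x = ln ((cmod (b (of_real x)))^2)" using that by (simp add: ln_realpow)
  also have "... <= W \<tau> x" unfolding cmod_G using that by (intro ln_mono) auto
  finally show ?thesis .
 qed
 have I_ge: "2 * \<D> <= I"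
 proof -
  have "((%x. if b (of_real x) = 0 then W \<tau> x else 2 * bl x) has_integral 2 * \<D>) {0..1}"
  proof (rule has_integral_spike_finite[OF b_zeros_finite[of 0 1]])
   show "((%x. 2 * bl x) has_integral 2 * \<D>) {0..1}"
    using has_integral_mult_right[OF integrable_integral[OF bl_integrable], of 2 0 1] unfolding \<D>_def by simp
  qed auto
  moreover have "(W \<tau> has_integral I) {0..1}" unfolding I_def by (rule integrable_integral[OF W.intU])
  ultimately show ?thesis by (rule has_integral_le) (use blW in auto)
 qed
 have W_le: "W \<tau> x <= 2 * A" for x
 proof -
  have "cmod (G \<tau> (of_real x)) <= A^2 + 1"
   unfolding cmod_G using bbd[of "of_real x"] \<rho> \<tau> by (intro add_mono power_mono) (auto simp: power_le_one)
  moreover have "A^2 + 1 <= (1 + A)^2" using A by (simp add: power2_sum)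
  moreover have "0 < cmod (G \<tau> (of_real x))" unfolding cmod_G using \<tau> by (simp add: add_nonneg_pos)
  ultimately have "W \<tau> x <= ln ((1 + A)^2)" by (intro ln_mono) auto
  also have "... = 2 * ln (1 + A)" using A by (simp add: ln_realpow)
  also have "... <= 2 * A" using ln_add_one_self_le_self[of A] A by simp
  finally show ?thesis .
 qed
 have block: "(\<Sum>k<q. W \<tau> (y + real k * om)) <= real q * I + 2 * ?V" for y
  using W.denjoy_koksma[OF q(1-3), of y] VV unfolding I_def by linarith
 have sumW: "(\<Sum>k<s. W \<tau> (y + real k * om)) <= real s * (I + 2 * ?V * ?D / real Q) + 4 * A * real Q" for s y
 proof (induction s arbitrary: y rule: less_induct)
  case (less s)
  have VD: "2 * ?V <= real q * (2 * ?V * ?D / real Q)"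
  proof -
   have "?V * real Q <= ?V * (?D * real q)" using q(5) Vn VV by (intro mult_left_mono) auto
   then show ?thesis using Q by (simp add: field_simps)
  qed
  show ?case
  proof (cases "s < q")
   case True
   \<comment> \<open>An incomplete block has at most \<open>2 * A\<close> per site while the mean
     \<open>I\<close> is at least \<open>- 2 * A\<close>; replacing one by the other costs
     \<open>4 * A\<close> for each of fewer than \<open>Q\<close> sites.\<close>
   have "(\<Sum>k<s. W \<tau> (y + real k * om)) <= (\<Sum>k<s. 2 * A)" by (intro sum_mono W_le)
   also have "... = real s * (- 2 * A) + 4 * A * real s" by simp
   also have "... <= real s * I + 4 * A * real Q"
    using I_ge \<D>_bounds True q(4) A by (intro add_mono mult_left_mono) auto
   also have "real s * I <= real s * (I + 2 * ?V * ?D / real Q)"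
    using Y0 by (intro mult_left_mono) auto
   finally show ?thesis by simp
  next
   case False
   define t where "t = s - q"
   have st: "s = q + t" using False by (simp add: t_def)
   have "(\<Sum>k<s. W \<tau> (y + real k * om)) = (\<Sum>k<q. W \<tau> (y + real k * om)) + (\<Sum>k<t. W \<tau> ((y + real q * om) + real k * om))"
   proof -
    have "(\<Sum>k<q + t. f k) = (\<Sum>k<q. f k) + (\<Sum>k<t. f (q + k))" for f :: "nat => real"
     by (induction t) auto
    then show ?thesis unfolding st by (simp add: algebra_simps)
   qed
   also have "... <= (real q * I + 2 * ?V) + (real t * (I + 2 * ?V * ?D / real Q) + 4 * A * real Q)"
    by (intro add_mono block less.IH) (use q(1) st in auto)
   also have "... <= (real q * I + real q * (2 * ?V * ?D / real Q)) + (real t * (I + 2 * ?V * ?D / real Q) + 4 * A * real Q)"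
    using VD by simp
   also have "... = real s * (I + 2 * ?V * ?D / real Q) + 4 * A * real Q"
    unfolding st by (simp add: algebra_simps add_divide_distrib)
   finally show ?thesis .
  qed
 qed
 have up: "I + 2 * ?V * ?D / real Q <= 2 * (\<D> + (eb \<rho> A \<tau> + 2 * ?V * ?D / real Q))"
 proof -
  have "I <= 2 * \<D> + eb \<rho> A \<tau>" using W_integral[OF \<tau>(1)] by (simp add: I_def \<D>_def)
  moreover have "0 <= eb \<rho> A \<tau>" unfolding eb_def using \<tau> cb_pos zb_pos by simp
  ultimately have "I + y <= 2 * (\<D> + (eb \<rho> A \<tau> + y))" if "0 <= y" for y using that by (simp add: algebra_simps)
  then show ?thesis using Y0 by blast
 qed
 show ?thesis
 proof (cases "\<exists>k<s. b (of_real (y + real k * om)) = 0")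
  case True
  then have "(\<Prod>k<s. cmod (b (of_real (y + real k * om)))) = 0" by (auto intro!: prod_zero)
  then show ?thesis by (metis exp_ge_zero)
 next
  case False
  then have nz: "!!k. k < s ==> b (of_real (y + real k * om)) ~= 0" by blast
  have "2 * ln (\<Prod>k<s. cmod (b (of_real (y + real k * om)))) = (\<Sum>k<s. 2 * bl (y + real k * om))"
   using nz by (subst ln_prod) (auto simp: sum_distrib_left)
  also have "... <= (\<Sum>k<s. W \<tau> (y + real k * om))" by (intro sum_mono blW nz) auto
  also have "... <= real s * (I + 2 * ?V * ?D / real Q) + 4 * A * real Q" by (rule sumW)
  also have "... <= real s * (2 * (\<D> + (eb \<rho> A \<tau> + 2 * ?V * ?D / real Q))) + 4 * A * real Q"
   using up by (intro add_right_mono mult_left_mono) auto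
  finally have 2: "2 * ln (\<Prod>k<s. cmod (b (of_real (y + real k * om)))) <=
   real s * (2 * (\<D> + (eb \<rho> A \<tau> + 2 * ?V * ?D / real Q))) + 4 * A * real Q" .
  have "X <= real s * Z + 2 * A * real Q" if "2 * X <= real s * (2 * Z) + 4 * A * real Q" for X Z
   using that by (simp only: mult.left_commute[of "real s"])
  from this[OF 2] have "ln (\<Prod>k<s. cmod (b (of_real (y + real k * om)))) <=
   real s * (\<D> + (eb \<rho> A \<tau> + 2 * ?V * ?D / real Q)) + 2 * A * real Q" .
  moreover have "(\<Prod>k<s. cmod (b (of_real (y + real k * om)))) > 0" using nz by (intro prod_pos) auto
  ultimately show ?thesis by (metis exp_ln exp_le_cancel_iff)
 qed
qed

end

lemma eb_tendsto: "(eb \<rho> A \<longlongrightarrow> 0) (at_right 0)" if "zb \<rho> A > 0"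
proof -
 have "((%\<tau>. root (2 * zb \<rho> A) (\<tau> / cb \<rho> A)) \<longlongrightarrow> root (2 * zb \<rho> A) (0 / cb \<rho> A)) (at_right 0)"
  by (intro tendsto_intros) (simp add: cb_def mb_def)
 from tendsto_mult[OF tendsto_mult[OF tendsto_const this] tendsto_const]
 have "((%\<tau>. 2 * real (nb \<rho>) * real (2 * zb \<rho> A) * root (2 * zb \<rho> A) (\<tau> / cb \<rho> A) * (1 + 4 * real (zb \<rho> A)))
  \<longlongrightarrow> 2 * real (nb \<rho>) * real (2 * zb \<rho> A) * root (2 * zb \<rho> A) (0 / cb \<rho> A) * (1 + 4 * real (zb \<rho> A))) (at_right 0)" .
 then show ?thesis unfolding eb_def[abs_def] by simp
qed

lemma Dn_sublinear: "((%Q. Dn c \<alpha> Q / Q) \<longlongrightarrow> 0) at_top" if "c > 0"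
 unfolding Dn_def using that by real_asymp

text \<open>The order matters: \<tau> is taken small for \<open>eb\<close>, and only then
  \<open>Q\<close> large, because \<open>VW\<close> may grow as \<tau> shrinks while
  \<open>Dn / Q\<close> tends to \<open>0\<close>.\<close>

lemma b_prod_constants:
 assumes "\<epsilon> > 0" "c > 0" "zb \<rho> A > 0"
 obtains \<tau> Q where "0 < \<tau>" "\<tau> <= 1" "2 <= (Q::nat)" "eb \<rho> A \<tau> + 2 * VW \<rho> A \<tau> * Dn c \<alpha> (real Q) / real Q <= \<epsilon>"
proof -
 have "eventually (%\<tau>. eb \<rho> A \<tau> < \<epsilon> / 2) (at_right 0)"
  using order_tendstoD(2)[OF eb_tendsto[OF assms(3)], of "\<epsilon> / 2"] assms by simp
 moreover have "eventually (%\<tau>::real. \<tau> : {0<..<1}) (at_right 0)" by (rule eventually_at_right_real) simp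
 ultimately have "eventually (%\<tau>. eb \<rho> A \<tau> < \<epsilon> / 2 & \<tau> : {0<..<1}) (at_right 0)" by (rule eventually_conj)
 then have "\<exists>\<tau>. eb \<rho> A \<tau> < \<epsilon> / 2 & \<tau> : {0<..<1}"
  by (rule eventually_happens'[OF trivial_limit_at_right_real])
 then obtain \<tau> where \<tau>: "eb \<rho> A \<tau> < \<epsilon> / 2" "0 < \<tau>" "\<tau> < 1" by auto
 have "((%Q. 2 * VW \<rho> A \<tau> * (Dn c \<alpha> Q / Q)) \<longlongrightarrow> 2 * VW \<rho> A \<tau> * 0) at_top"
  by (intro tendsto_intros Dn_sublinear assms)
 then have "eventually (%Q. 2 * VW \<rho> A \<tau> * (Dn c \<alpha> Q / Q) < \<epsilon> / 2) at_top"
  by (rule order_tendstoD) (use assms in simp)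
 then have "eventually (%Q::nat. 2 * VW \<rho> A \<tau> * (Dn c \<alpha> (real Q) / real Q) < \<epsilon> / 2) at_top"
  using filterlim_real_sequentially by (rule eventually_compose_filterlim)
 then have "eventually (%Q::nat. 2 * VW \<rho> A \<tau> * (Dn c \<alpha> (real Q) / real Q) < \<epsilon> / 2 & 2 <= Q) at_top"
  by (rule eventually_conj) (rule eventually_ge_at_top)
 then obtain Q where "2 * VW \<rho> A \<tau> * (Dn c \<alpha> (real Q) / real Q) < \<epsilon> / 2" "2 <= Q"
  using eventually_happens'[OF sequentially_bot] by blast
 with \<tau> that[of \<tau> Q] show ?thesis by simp
qed

section \<open>Spectra of finite volume operators\<close>

lemma hermitian_real_spectrum:
 assumes herm: "!!i j. i < n ==> j < n ==> cnj (A i j) = A j i"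
 obtains es :: "real list" where "length es = n"
  "char_poly (hmat n A) = (\<Prod>e\<leftarrow>map complex_of_real es. [:- e, 1:])"
proof -
 obtain as where as: "char_poly (hmat n A) = (\<Prod>a\<leftarrow>as. [:- a, 1:])" "length as = n"
  using char_poly_factorized[OF hmat_carrier] by blast
 have real: "of_real (Re e) = e" if "e : set as" for e
 proof -
  have "poly (char_poly (hmat n A)) e = 0" unfolding as(1) using that by (auto simp: poly_prod_list prod_list_zero_iff)
  then obtain v r where v: "(\<Sum>k<n. cnj (v k) * v k) = 1" "!!i. i < n ==> (\<Sum>k<n. A i k * v k) = e * v i"
   by (rule unit_eigenvector) blast
  define S where "S = (\<Sum>i<n. \<Sum>k<n. cnj (v i) * A i k * v k)"
  have "S = (\<Sum>i<n. cnj (v i) * (\<Sum>k<n. A i k * v k))"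
   unfolding S_def sum_distrib_left by (simp add: mult.assoc)
  also have "... = (\<Sum>i<n. e * (cnj (v i) * v i))" by (intro sum.cong refl) (simp add: v(2))
  also have "... = e" unfolding sum_distrib_left[symmetric] v(1) by simp
  finally have Se: "S = e" .
  have "cnj S = (\<Sum>i<n. \<Sum>k<n. v i * A k i * cnj (v k))"
   unfolding S_def cnj_sum using herm by (intro sum.cong refl) simp
  also have "... = S" unfolding S_def by (subst sum.swap) (simp add: mult_ac)
  finally show ?thesis using Se by (simp add: complex_eq_iff)
 qed
 show ?thesis
 proof (rule that[of "map Re as"])
  have "map complex_of_real (map Re as) = as" using real by (induction as) auto
  then show "char_poly (hmat n A) = (\<Prod>e\<leftarrow>map complex_of_real (map Re as). [:- e, 1:])" using as by simp
 qed (use as in simp)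
qed

text \<open>Schur's test: rows and columns have at most three nonzero entries, so their absolute
  sums are at most \<open>3 * \<delta>\<close>.\<close>

lemma tridiagonal_norm:
 fixes D :: "nat => nat => complex" and v :: "nat => complex"
 assumes D: "!!i k. cmod (D i k) <= \<delta>" "!!i k. Suc i < k ==> D i k = 0" "!!i k. Suc k < i ==> D i k = 0"
 shows "(\<Sum>i<n. (cmod (\<Sum>k<n. D i k * v k))^2) <= (3 * \<delta>)^2 * (\<Sum>k<n. (cmod (v k))^2)"
proof -
 have \<delta>: "\<delta> >= 0" using D(1)[of 0 0] norm_ge_zero order_trans by blast
 have cnt: "(\<Sum>k<n. if i <= Suc k & k <= Suc i then \<delta> else 0) <= 3 * \<delta>" for i
 proof -
  have "{k. k < n & i <= Suc k & k <= Suc i} \<subseteq> {i - 1, i, Suc i}" by auto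
  then have "card {k. k < n & i <= Suc k & k <= Suc i} <= card {i - 1, i, Suc i}" by (intro card_mono) auto
  also have "... <= 3" by (simp add: card_insert_if)
  finally have "real (card {k. k < n & i <= Suc k & k <= Suc i}) * \<delta> <= 3 * \<delta>"
   using \<delta> by (intro mult_right_mono) auto
  moreover have "{k. k < n} \<inter> {k. i <= Suc k & k <= Suc i} = {k. k < n & i <= Suc k & k <= Suc i}" by auto
  ultimately show ?thesis by (simp add: sum.If_cases lessThan_def)
 qed
 have bd: "cmod (D i k) <= (if i <= Suc k & k <= Suc i then \<delta> else 0)" for i k
  using D(1)[of i k] D(2)[of i k] D(3)[of k i] by (auto simp: not_le)
 have row: "(\<Sum>k<n. cmod (D i k)) <= 3 * \<delta>" for i
  by (rule order_trans[OF sum_mono[OF bd] cnt])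
 have col: "(\<Sum>i<n. cmod (D i k)) <= 3 * \<delta>" for k
 proof -
  have "(\<Sum>i<n. cmod (D i k)) <= (\<Sum>i<n. if k <= Suc i & i <= Suc k then \<delta> else 0)"
   using bd by (intro sum_mono) (auto simp: conj_commute)
  then show ?thesis using cnt[of k] by linarith
 qed
 have "(cmod (\<Sum>k<n. D i k * v k))^2 <= 3 * \<delta> * (\<Sum>k<n. cmod (D i k) * (cmod (v k))^2)" for i
 proof -
  have "cmod (\<Sum>k<n. D i k * v k) <= (\<Sum>k<n. cmod (D i k) * cmod (v k))"
   by (rule order_trans[OF norm_sum]) (simp add: norm_mult)
  then have "(cmod (\<Sum>k<n. D i k * v k))^2 <= (\<Sum>k<n. cmod (D i k) * cmod (v k))^2" by (intro power_mono) auto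
  also have "... = (\<Sum>k<n. sqrt (cmod (D i k)) * (sqrt (cmod (D i k)) * cmod (v k)))^2"
   by (simp add: mult.assoc[symmetric])
  also have "... <= (\<Sum>k<n. (sqrt (cmod (D i k)))^2) * (\<Sum>k<n. (sqrt (cmod (D i k)) * cmod (v k))^2)"
   by (rule Cauchy_Schwarz_ineq_sum)
  also have "... = (\<Sum>k<n. cmod (D i k)) * (\<Sum>k<n. cmod (D i k) * (cmod (v k))^2)"
   by (simp add: power_mult_distrib)
  also have "... <= 3 * \<delta> * (\<Sum>k<n. cmod (D i k) * (cmod (v k))^2)"
   by (intro mult_right_mono row sum_nonneg) auto
  finally show ?thesis .
 qed
 then have "(\<Sum>i<n. (cmod (\<Sum>k<n. D i k * v k))^2) <= (\<Sum>i<n. 3 * \<delta> * (\<Sum>k<n. cmod (D i k) * (cmod (v k))^2))"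
  by (rule sum_mono)
 also have "... = 3 * \<delta> * (\<Sum>k<n. (\<Sum>i<n. cmod (D i k)) * (cmod (v k))^2)"
  unfolding sum_distrib_left[symmetric] sum_distrib_right by (subst sum.swap) simp
 also have "... <= 3 * \<delta> * (\<Sum>k<n. 3 * \<delta> * (cmod (v k))^2)"
  using \<delta> by (intro mult_left_mono sum_mono mult_right_mono col) auto
 also have "... = (3 * \<delta>)^2 * (\<Sum>k<n. (cmod (v k))^2)"
  by (simp add: sum_distrib_left[symmetric] power2_eq_square mult_ac)
 finally show ?thesis .
qed

context jac
begin

definition \<beta> :: "real => real => nat => real" where
 "\<beta> om x k = cmod (b (of_real (x + real k * om)))"

text \<open>Only \<open>cmod b\<close> enters the spectrum, so the phases of \<open>b\<close> are dropped.\<close>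

definition TM :: "real => real => nat => nat => complex" where
 "TM om x i j = (if i = j then a (of_real (x + real i * om)) else if j = Suc i then - of_real (\<beta> om x j)
   else if i = Suc j then - of_real (\<beta> om x i) else 0)"

lemma TM_herm: "cnj (TM om x i j) = TM om x j i"
proof -
 have "cnj (a (of_real y)) = a (of_real y)" for y using areal[of y] by (simp add: Reals_cnj_iff)
 then show ?thesis unfolding TM_def by (auto simp del: of_real_add of_real_mult)
qed

lemma TM_tridiag: "hmat n (TM om x) = tridiag n (%k. a (of_real (x + real k * om)))
  (%k. - of_real (\<beta> om x (Suc k))) (%k. - of_real (\<beta> om x (Suc k)))"
 by (rule eq_matI) (auto simp: tridiag_def hmat_def TM_def)

lemma F_tricont: "F om \<zeta> n (of_real x) =
  tricont (%k. a (of_real (x + real k * om)) - \<zeta>) (%k. of_real ((\<beta> om x (Suc k))^2)) n"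
proof (induction n rule: induct_nat_012)
 case (ge2 n)
 have e: "complex_of_real x + of_nat (Suc n) * of_real om = of_real (x + real (Suc n) * om)" by simp
 show ?case using ge2 unfolding F_def dt.simps tricont.simps e B2_real \<beta>_def by simp
qed (simp_all add: F_def)

lemma poly_TM: "poly (char_poly (hmat n (TM om x))) \<zeta> = (- 1) ^ n * F om \<zeta> n (of_real x)"
 unfolding TM_tridiag poly_char_poly_tridiag F_tricont by (simp add: power2_eq_square)

definition spec :: "real => nat => real => real set" where
 "spec om n x = {E. F om (of_real E) n (of_real x) = 0}"

text \<open>The product over the real eigenvalues reduces every comparison of determinants at two
  energies to a comparison factor by factor.\<close>

lemma spectrum:
 obtains es :: "real list" where "length es = n" "set es = spec om n x"
  "!!\<zeta>. F om \<zeta> n (of_real x) = (\<Prod>e\<leftarrow>es. of_real e - \<zeta>)"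
  "char_poly (hmat n (TM om x)) = (\<Prod>e\<leftarrow>map complex_of_real es. [:- e, 1:])"
proof -
 obtain es :: "real list" where es: "length es = n"
  "char_poly (hmat n (TM om x)) = (\<Prod>e\<leftarrow>map complex_of_real es. [:- e, 1:])"
  by (rule hermitian_real_spectrum[where n = n and A = "TM om x", OF TM_herm], rule that)
 have F: "F om \<zeta> n (of_real x) = (\<Prod>e\<leftarrow>es. of_real e - \<zeta>)" for \<zeta>
 proof -
  have "F om \<zeta> n (of_real x) = (- 1) ^ n * poly (char_poly (hmat n (TM om x))) \<zeta>"
   unfolding poly_TM by (simp add: mult.assoc[symmetric] power_mult_distrib[symmetric])
  also have "... = (- 1) ^ length es * (\<Prod>e\<leftarrow>es. \<zeta> - of_real e)"
   unfolding es by (simp add: poly_prod_list o_def)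
  also have "... = (\<Prod>e\<leftarrow>es. of_real e - \<zeta>)"
  proof (induction es)
   case (Cons e es)
   have "(- 1) ^ length (e # es) * (\<Prod>e\<leftarrow>e # es. \<zeta> - of_real e) = (of_real e - \<zeta>) * ((- 1) ^ length es * (\<Prod>e\<leftarrow>es. \<zeta> - of_real e))"
    by (simp add: algebra_simps)
   then show ?case unfolding Cons by simp
  qed simp
  finally show ?thesis .
 qed
 have "set es = spec om n x"
  unfolding spec_def F by (auto simp: prod_list_zero_iff simp flip: of_real_diff)
 from that[OF es(1) this F es(2)] show ?thesis .
qed

lemma finite_spec: "finite (spec om n x)"
 by (metis List.finite_set spectrum)

lemma card_spec: "card (spec om n x) <= n"
 by (metis card_length spectrum)

text \<open>Leaving the real axis moves the energy away from every eigenvalue. This carries lower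
  bounds at real energies over to \<open>E + i \<eta>\<close> and bounds real determinants by
  \<open>exp U\<close>.\<close>

lemma F_real_le: "cmod (F om (of_real E) n (of_real x)) <= cmod (F om (Complex E \<eta>) n (of_real x))"
proof -
 obtain es :: "real list" where es: "!!\<zeta>. F om \<zeta> n (of_real x) = (\<Prod>e\<leftarrow>es. of_real e - \<zeta>)"
  by (rule spectrum) blast
 have "cmod (\<Prod>e\<leftarrow>es. of_real e - of_real E) <= cmod (\<Prod>e\<leftarrow>es. of_real e - Complex E \<eta>)"
 proof (induction es)
  case (Cons e es)
  have "cmod (of_real e - of_real E) <= cmod (of_real e - Complex E \<eta>)"
   using abs_Re_le_cmod[of "of_real e - Complex E \<eta>"] by (simp flip: of_real_diff)
  then show ?case using Cons by (auto simp: norm_mult intro!: mult_mono)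
 qed simp
 then show ?thesis unfolding es .
qed

text \<open>Every factor at \<open>E + i \<eta>\<close> is at least \<eta>, so moving to
  \<open>e\<close> changes it by a factor of at most \<open>1 + abs (e - E) / \<eta>\<close>; the
  \<open>n\<close> factors together give at most \<open>exp 1\<close>.\<close>

lemma F_compare_upper:
 assumes "0 < \<eta>" "abs (e - E) * real n <= \<eta>"
 shows "cmod (F om (of_real e) n (of_real x)) <= exp 1 * cmod (F om (Complex E \<eta>) n (of_real x))"
proof -
 obtain es :: "real list" where es: "length es = n" "!!\<zeta>. F om \<zeta> n (of_real x) = (\<Prod>e\<leftarrow>es. of_real e - \<zeta>)"
  by (rule spectrum) blast
 define \<delta> where "\<delta> = abs (e - E)"
 have "cmod (\<Prod>s\<leftarrow>es. of_real s - of_real e) <= (exp (\<delta> / \<eta>)) ^ length es * cmod (\<Prod>s\<leftarrow>es. of_real s - Complex E \<eta>)"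
 proof (induction es)
  case (Cons s es)
  let ?c = "cmod (of_real s - Complex E \<eta>)"
  have "abs (s - e) <= abs (s - E) + \<delta>" unfolding \<delta>_def by linarith
  also have "abs (s - E) <= ?c" using abs_Re_le_cmod[of "of_real s - Complex E \<eta>"] by simp
  also have "\<delta> <= \<delta> / \<eta> * ?c"
  proof -
   have "\<eta> <= ?c" using abs_Im_le_cmod[of "of_real s - Complex E \<eta>"] assms by simp
   then have "\<delta> / \<eta> * \<eta> <= \<delta> / \<eta> * ?c" using assms by (intro mult_left_mono) (auto simp: \<delta>_def)
   then show ?thesis using assms by simp
  qed
  also have "?c + \<delta> / \<eta> * ?c = (1 + \<delta> / \<eta>) * ?c" by (simp add: algebra_simps)
  also have "... <= exp (\<delta> / \<eta>) * ?c" using exp_ge_add_one_self by (intro mult_right_mono) auto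
  finally have "cmod (of_real s - of_real e) <= exp (\<delta> / \<eta>) * ?c" by (simp flip: of_real_diff)
  then have "cmod (of_real s - of_real e) * cmod (\<Prod>s\<leftarrow>es. of_real s - of_real e) <=
    (exp (\<delta> / \<eta>) * ?c) * ((exp (\<delta> / \<eta>)) ^ length es * cmod (\<Prod>s\<leftarrow>es. of_real s - Complex E \<eta>))"
   using Cons by (intro mult_mono) auto
  then show ?case by (simp add: norm_mult mult_ac)
 qed simp
 also have "(exp (\<delta> / \<eta>)) ^ length es <= exp 1"
 proof -
  have "(exp (\<delta> / \<eta>)) ^ length es = exp (real n * (\<delta> / \<eta>))" unfolding es(1) exp_of_nat_mult ..
  also have "... <= exp 1" using assms by (simp add: \<delta>_def field_simps)
  finally show ?thesis .
 qed
 finally show ?thesis unfolding es(2) by (simp add: mult_right_mono)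
qed

text \<open>Away from resonance the shift is invisible: a factor of size at least
  \<open>2 * n * \<eta>\<close> changes by at most \<open>1 + 1 / n\<close>. Together with
  \<open>F_compare_upper\<close> this lets bounds at complex energy govern eigenvectors at real
  energy.\<close>

lemma F_compare_lower:
 assumes "0 < \<eta>" "abs (e - E) <= \<eta>" and n: "n > 0"
  and far: "!!s. s : spec om n x ==> abs (s - E) >= 4 * real n * \<eta>"
 shows "cmod (F om (Complex E \<eta>) n (of_real x)) <= exp 1 * cmod (F om (of_real e) n (of_real x))"
proof -
 obtain es :: "real list" where es: "length es = n" "set es = spec om n x" "!!\<zeta>. F om \<zeta> n (of_real x) = (\<Prod>e\<leftarrow>es. of_real e - \<zeta>)"
  by (rule spectrum) blast
 have "cmod (\<Prod>s\<leftarrow>es. of_real s - Complex E \<eta>) <= (exp (1 / real n)) ^ length es * cmod (\<Prod>s\<leftarrow>es. of_real s - of_real e)"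
  using far unfolding es(2)[symmetric]
 proof (induction es)
  case (Cons s es)
  have n1: "real n >= 1" using n by simp
  have s: "abs (s - E) >= 4 * real n * \<eta>" using Cons.prems by simp
  have "4 * real n * \<eta> - \<eta> <= abs (s - e)" using s assms by linarith
  moreover have "\<eta> <= real n * \<eta>" using n1 assms by simp
  ultimately have ge: "2 * real n * \<eta> <= abs (s - e)" by linarith
  have "cmod (of_real s - Complex E \<eta>) <= abs (s - E) + \<eta>" using cmod_le[of "of_real s - Complex E \<eta>"] assms by simp
  also have "... <= abs (s - e) + 2 * \<eta>" using assms by linarith
  also have "2 * \<eta> <= 1 / real n * abs (s - e)" using ge n1 by (simp add: field_simps)
  also have "abs (s - e) + 1 / real n * abs (s - e) = (1 + 1 / real n) * abs (s - e)" by (simp add: algebra_simps)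
  also have "... <= exp (1 / real n) * abs (s - e)" using exp_ge_add_one_self by (intro mult_right_mono) auto
  finally have "cmod (of_real s - Complex E \<eta>) <= exp (1 / real n) * cmod (of_real s - of_real e)"
   by (simp flip: of_real_diff)
  moreover have "cmod (\<Prod>s\<leftarrow>es. of_real s - Complex E \<eta>) <= (exp (1 / real n)) ^ length es * cmod (\<Prod>s\<leftarrow>es. of_real s - of_real e)"
   using Cons by simp
  ultimately have "cmod (of_real s - Complex E \<eta>) * cmod (\<Prod>s\<leftarrow>es. of_real s - Complex E \<eta>) <=
   (exp (1 / real n) * cmod (of_real s - of_real e)) * ((exp (1 / real n)) ^ length es * cmod (\<Prod>s\<leftarrow>es. of_real s - of_real e))"
   by (intro mult_mono) auto
  then show ?case by (simp add: norm_mult mult_ac)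
 qed simp
 also have "(exp (1 / real n)) ^ length es = exp 1" unfolding es(1) exp_of_nat_mult[symmetric] using n by simp
 finally show ?thesis unfolding es(3) .
qed

lemma F_lower_dist:
 assumes "0 <= t" "!!s. s : spec om n x ==> abs (s - E) >= t"
 shows "t ^ n <= cmod (F om (of_real E) n (of_real x))"
proof -
 obtain es :: "real list" where es: "length es = n" "set es = spec om n x" "!!\<zeta>. F om \<zeta> n (of_real x) = (\<Prod>e\<leftarrow>es. of_real e - \<zeta>)"
  by (rule spectrum) blast
 have "t ^ length es <= cmod (\<Prod>e\<leftarrow>es. of_real e - of_real E)"
  using assms(2) unfolding es(2)[symmetric]
 proof (induction es)
  case (Cons s es)
  have "t <= cmod (of_real s - of_real E)" using Cons.prems[of s] by (simp flip: of_real_diff)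
  moreover have "t ^ length es <= cmod (\<Prod>e\<leftarrow>es. of_real e - of_real E)" using Cons by simp
  ultimately show ?case using assms(1) by (auto simp: norm_mult intro!: mult_mono)
 qed simp
 then show ?thesis unfolding es by simp
qed

lemma eigenvector:
 assumes "E : spec om n x"
 obtains v where "(\<Sum>k<n. (cmod (v k))^2) = 1" "!!i. i < n ==> (\<Sum>k<n. TM om x i k * v k) = of_real E * v i"
proof -
 have "poly (char_poly (hmat n (TM om x))) (of_real E) = 0" using assms unfolding poly_TM spec_def by simp
 then obtain v r where v: "(\<Sum>k<n. cnj (v k) * v k) = 1" "!!i. i < n ==> (\<Sum>k<n. TM om x i k * v k) = of_real E * v i"
  by (rule unit_eigenvector) blast
 have "complex_of_real (\<Sum>k<n. (cmod (v k))^2) = of_real 1"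
  unfolding of_real_sum complex_norm_square using v(1) by (simp add: mult.commute)
 then have "(\<Sum>k<n. (cmod (v k))^2) = 1" by (simp only: of_real_eq_iff)
 from that[OF this v(2)] show ?thesis by blast
qed

lemma real_Lipschitz:
 assumes f: "f holomorphic_on strip \<rho>" and bd: "!!z. z : strip \<rho> ==> cmod (f z) <= A"
 shows "cmod (f (of_real x) - f (of_real y)) <= 2 * A / \<rho> * abs (x - y)"
proof -
 have "cmod (f (of_real x) - f (of_real y)) <= 2 * A / \<rho> * cmod (complex_of_real x - of_real y)"
  by (rule strip_Lipschitz[OF f bd \<rho>]) (use \<rho> in \<open>auto simp: strip_def\<close>)
 then show ?thesis by (simp flip: of_real_diff)
qed

text \<open>An eigenvector at one phase and frequency is an approximate eigenvector at the other.
  Entries move at rate \<open>2 * A / \<rho>\<close>, and a tridiagonal perturbation has norm at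
  most three times its largest entry, which gives the \<open>6\<close>.\<close>

theorem spec_Lipschitz:
 assumes E: "E : spec om n x"
 shows "\<exists>E'\<in>spec om' n x'. abs (E - E') <= 6 * A / \<rho> * (abs (x - x') + real n * abs (om - om'))"
proof -
 obtain v where v: "(\<Sum>k<n. (cmod (v k))^2) = 1" "!!i. i < n ==> (\<Sum>k<n. TM om x i k * v k) = of_real E * v i"
  by (rule eigenvector[OF E], rule that)
 define \<delta> where "\<delta> = 2 * A / \<rho> * (abs (x - x') + real n * abs (om - om'))"
 have \<delta>: "\<delta> >= 0" unfolding \<delta>_def using A \<rho> by simp
 define D where "D i k = (if i < n & k < n then TM om' x' i k - TM om x i k else 0)" for i k
 have pt: "2 * A / \<rho> * abs ((x' + real i * om') - (x + real i * om)) <= \<delta>" if "i < n" for i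
 proof -
  have "abs ((x' + real i * om') - (x + real i * om)) = abs ((x' - x) + real i * (om' - om))" by (simp add: algebra_simps)
  also have "... <= abs (x' - x) + real i * abs (om' - om)"
   using abs_triangle_ineq[of "x' - x" "real i * (om' - om)"] by (simp add: abs_mult)
  also have "... <= abs (x - x') + real n * abs (om - om')"
   using that by (intro add_mono mult_mono) (auto simp: abs_minus_commute)
  finally show ?thesis unfolding \<delta>_def using A \<rho> by (intro mult_left_mono) auto
 qed
 have bpt: "abs (\<beta> om' x' i - \<beta> om x i) <= \<delta>" if "i < n" for i
  unfolding \<beta>_def
  by (rule order_trans[OF norm_triangle_ineq3 order_trans[OF real_Lipschitz[OF bhol bbd] pt[OF that]]])
 have D1: "cmod (D i k) <= \<delta>" for i k
 proof -
  have "cmod (TM om' x' i k - TM om x i k) <= \<delta>" if ik: "i < n" "k < n"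
  proof -
   consider "i = k" | "k = Suc i" | "i = Suc k" | "i ~= k" "k ~= Suc i" "i ~= Suc k" by blast
   then show ?thesis
   proof cases
    case 1
    then have "TM om' x' i k - TM om x i k = a (of_real (x' + real i * om')) - a (of_real (x + real i * om))"
     by (simp add: TM_def)
    then show ?thesis using order_trans[OF real_Lipschitz[OF ahol abd] pt[OF ik(1)]] by metis
   next
    case 2
    have "TM om' x' i k - TM om x i k = of_real (\<beta> om x k - \<beta> om' x' k)" using 2 by (simp add: TM_def)
    then have "cmod (TM om' x' i k - TM om x i k) = abs (\<beta> om x k - \<beta> om' x' k)" by (simp only: norm_of_real)
    then show ?thesis using bpt[OF ik(2)] by (simp add: abs_minus_commute)
   next
    case 3
    have "TM om' x' i k - TM om x i k = of_real (\<beta> om x i - \<beta> om' x' i)" using 3 by (simp add: TM_def)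
    then have "cmod (TM om' x' i k - TM om x i k) = abs (\<beta> om x i - \<beta> om' x' i)" by (simp only: norm_of_real)
    then show ?thesis using bpt[OF ik(1)] by (simp add: abs_minus_commute)
   next
    case 4 then show ?thesis using \<delta> by (simp add: TM_def)
   qed
  qed
  then show ?thesis unfolding D_def using \<delta> by simp
 qed
 obtain es :: "real list" where es: "set es = spec om' n x'"
  "char_poly (hmat n (TM om' x')) = (\<Prod>e\<leftarrow>map complex_of_real es. [:- e, 1:])"
  by (rule spectrum) blast
 have "\<exists>e\<in>set (map complex_of_real es). cmod (e - of_real E) <= 3 * \<delta>"
 proof (rule hermitian_spectrum_dist[OF TM_herm es(2)])
  show "(\<Sum>i<n. (cmod (v i))^2) > 0" using v by simp
  have "(\<Sum>i<n. (cmod ((\<Sum>k<n. TM om' x' i k * v k) - of_real E * v i))^2) = (\<Sum>i<n. (cmod (\<Sum>k<n. D i k * v k))^2)"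
  proof (rule sum.cong[OF refl])
   fix i assume i: "i : {..<n}"
   have "(\<Sum>k<n. TM om' x' i k * v k) - of_real E * v i = (\<Sum>k<n. TM om' x' i k * v k) - (\<Sum>k<n. TM om x i k * v k)"
    using v(2) i by simp
   also have "... = (\<Sum>k<n. D i k * v k)"
    unfolding sum_subtractf[symmetric] using i by (intro sum.cong refl) (simp add: D_def algebra_simps)
   finally show "(cmod ((\<Sum>k<n. TM om' x' i k * v k) - of_real E * v i))^2 = (cmod (\<Sum>k<n. D i k * v k))^2" by simp
  qed
  also have "... <= (3 * \<delta>)^2 * (\<Sum>k<n. (cmod (v k))^2)"
   by (rule tridiagonal_norm) (use D1 in \<open>auto simp: D_def TM_def\<close>)
  finally show "(\<Sum>i<n. (cmod ((\<Sum>k<n. TM om' x' i k * v k) - of_real E * v i))^2) <= (3 * \<delta>)^2 * (\<Sum>i<n. (cmod (v i))^2)" .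
 qed (use \<delta> in simp)
 then obtain e where e: "e : set es" "cmod (of_real e - complex_of_real E) <= 3 * \<delta>" by auto
 then have "abs (e - E) <= 3 * \<delta>" by (simp flip: of_real_diff)
 then show ?thesis using e(1) es(1) unfolding \<delta>_def
  by (intro bexI[of _ e]) (auto simp: abs_minus_commute algebra_simps)
qed

lemma orthonormal_eigenvectors:
 fixes es :: "real list"
 assumes "char_poly (hmat n (TM om x)) = (\<Prod>e\<leftarrow>map complex_of_real es. [:- e, 1:])"
  and jk: "j < n" "k < n" "j ~= k"
 obtains u v where "(\<Sum>i<n. cnj (u i) * u i) = 1" "(\<Sum>i<n. cnj (v i) * v i) = 1" "(\<Sum>i<n. cnj (u i) * v i) = 0"
  "!!i. i < n ==> (\<Sum>m<n. TM om x i m * u m) = of_real (es ! j) * u i"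
  "!!i. i < n ==> (\<Sum>m<n. TM om x i m * v m) = of_real (es ! k) * v i"
proof -
 have len: "length es = n"
  using degree_monic_char_poly[OF hmat_carrier, of n "TM om x"] unfolding assms(1) degree_linear_factors by simp
 obtain V where V: "!!i j. i < n ==> j < n ==> (\<Sum>k<n. cnj (V k i) * V k j) = (if i = j then 1 else 0)"
  "!!i j. i < n ==> j < n ==> (\<Sum>k<n. TM om x i k * V k j) = map complex_of_real es ! j * V i j"
  using hermitian_eigenbasis[OF TM_herm assms(1)] by blast
 show ?thesis
  by (rule that[of "%i. V i j" "%i. V i k"]) (use V jk len in auto)
qed

end

section \<open>The Lyapunov exponent\<close>

text \<open>Convergence is part of the claim, since \<open>lyapunov\<close> is defined through
  \<open>lim\<close>. The limit is the infimum, so every finite scale bounds it from above and no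
  rate of convergence is required.\<close>

lemma fekete:
 fixes \<alpha> :: "nat => real"
 assumes sub: "!!n m. \<alpha> (n + m) <= \<alpha> n + \<alpha> m" and low: "!!n. - C <= \<alpha> n" and C: "C >= 0" and d: "d > 0"
 shows "lim (%n. \<alpha> n / real n) <= \<alpha> d / real d"
proof -
 define L where "L = (INF n\<in>{1..}. \<alpha> n / real n)"
 have bdd: "bdd_below ((%n. \<alpha> n / real n) ` {1..})"
 proof (rule bdd_belowI2)
  fix n :: nat assume "n : {1..}"
  then have "- C / real n <= \<alpha> n / real n" by (intro divide_right_mono low) auto
  moreover have "- C <= - C / real n" using \<open>n \<in> {1..}\<close> C by (simp add: divide_le_eq mult_le_cancel_left1)
  ultimately show "- C <= \<alpha> n / real n" by linarith
 qed
 have le: "L <= \<alpha> n / real n" if "n > 0" for n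
  unfolding L_def by (rule cINF_lower[OF bdd]) (use that in auto)
 have "(%n. \<alpha> n / real n) \<longlonglongrightarrow> L"
 proof (rule LIMSEQ_I)
  fix r :: real assume r: "0 < r"
  have "\<exists>m\<in>{1..}. \<alpha> m / real m < L + r / 2"
  proof (rule ccontr)
   assume "\<not> ?thesis"
   then have "L + r / 2 <= L" unfolding L_def by (intro cINF_greatest) (auto simp: not_less)
   then show False using r by simp
  qed
  then obtain m where m: "m >= 1" "\<alpha> m / real m < L + r / 2" by auto
  define M where "M = Max ((%j. abs (\<alpha> j)) ` {..<m})"
  have M: "abs (\<alpha> j) <= M" if "j < m" for j unfolding M_def using that by (intro Max_ge) auto
  have mult: "\<alpha> (q * m + j) <= real q * \<alpha> m + \<alpha> j" for q j
  proof (induction q)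
   case (Suc q)
   have "\<alpha> (Suc q * m + j) = \<alpha> (m + (q * m + j))" by (simp add: algebra_simps)
   then show ?case using sub[of m "q * m + j"] Suc by (simp add: algebra_simps)
  qed simp
  obtain n0 :: nat where n0: "2 * (abs (\<alpha> m) + M) / r < real n0" using reals_Archimedean2 by blast
  show "\<exists>no. \<forall>n\<ge>no. norm (\<alpha> n / real n - L) < r"
  proof (intro exI allI impI)
   fix n assume n: "n >= max n0 1"
   then have n1: "real n > 0" by simp
   define q where "q = n div m"
   have nq: "n = q * m + n mod m" unfolding q_def by simp
   have nm: "n mod m < m" using m by simp
   have "\<alpha> n <= real q * \<alpha> m + M" using mult[of q "n mod m"] nq M[OF nm] by (metis abs_le_D1 add_left_mono order_trans)
   also have "real q * \<alpha> m = (real n - real (n mod m)) * (\<alpha> m / real m)"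
   proof -
    have "real n = real q * real m + real (n mod m)" using nq by (metis of_nat_add of_nat_mult)
    then show ?thesis using m by simp
   qed
   also have "... = real n * (\<alpha> m / real m) - real (n mod m) / real m * \<alpha> m" by (simp add: algebra_simps)
   also have "... <= real n * (\<alpha> m / real m) + abs (\<alpha> m)"
   proof -
    have "abs (real (n mod m) / real m * \<alpha> m) <= 1 * abs (\<alpha> m)"
     unfolding abs_mult using nm by (intro mult_right_mono) auto
    then show ?thesis by linarith
   qed
   finally have "\<alpha> n <= real n * (\<alpha> m / real m) + (abs (\<alpha> m) + M)" by simp
   moreover have "real n * (\<alpha> m / real m) < real n * (L + r / 2)" using m n1 by (intro mult_strict_left_mono) auto
   moreover have "abs (\<alpha> m) + M < real n * (r / 2)"
   proof -
    have "2 * (abs (\<alpha> m) + M) / r < real n" using n0 n by linarith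
    then show ?thesis using r by (simp add: pos_divide_less_eq)
   qed
   ultimately have "\<alpha> n < real n * (L + r / 2) + real n * (r / 2)" by linarith
   also have "... = (L + r) * real n" by (simp add: algebra_simps)
   finally have "\<alpha> n / real n < L + r" using n1 by (simp add: pos_divide_less_eq)
   moreover have "L <= \<alpha> n / real n" by (rule le) (use n in auto)
   ultimately show "norm (\<alpha> n / real n - L) < r" by simp
  qed
 qed
 then show ?thesis using limI le[OF d] by metis
qed

lemma onorm_2x2:
 fixes M :: "complex^2^2"
 shows "cmod (vec_nth (vec_nth M i) j) <= onorm ((*v) M)"
  "onorm ((*v) M) <= (\<Sum>i\<in>UNIV. \<Sum>j\<in>UNIV. cmod (vec_nth (vec_nth M i) j))"
proof -
 have bl: "bounded_linear ((*v) M)" by simp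
 have "cmod (vec_nth (vec_nth M i) j) = cmod (vec_nth (M *v axis j 1) i)"
  by (simp add: matrix_vector_mult_def axis_def if_distrib[of "%x. _ * x"] cong: if_cong)
 also have "... <= norm (M *v axis j 1)" by (rule Finite_Cartesian_Product.norm_nth_le)
 also have "... <= onorm ((*v) M) * norm (axis j (1::complex) :: complex^2)" by (rule onorm[OF bl])
 also have "norm (axis j (1::complex) :: complex^2) <= (\<Sum>i\<in>UNIV. norm (vec_nth (axis j (1::complex) :: complex^2) i))"
  unfolding norm_vec_def by (rule L2_set_le_sum) auto
 also have "... = 1" by (simp add: axis_def if_distrib[of cmod] cong: if_cong)
 finally show "cmod (vec_nth (vec_nth M i) j) <= onorm ((*v) M)" by (simp add: onorm_pos_le mult_left_mono)
 show "onorm ((*v) M) <= (\<Sum>i\<in>UNIV. \<Sum>j\<in>UNIV. cmod (vec_nth (vec_nth M i) j))"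
 proof (rule onorm_bound)
  fix x :: "complex^2"
  have "norm (M *v x) <= (\<Sum>i\<in>UNIV. norm (vec_nth (M *v x) i))"
   unfolding norm_vec_def by (rule L2_set_le_sum) auto
  also have "... <= (\<Sum>i\<in>UNIV. \<Sum>j\<in>UNIV. cmod (vec_nth (vec_nth M i) j) * norm x)"
  proof (rule sum_mono)
   fix i
   have "norm (vec_nth (M *v x) i) <= (\<Sum>j\<in>UNIV. cmod (vec_nth (vec_nth M i) j * vec_nth x j))"
    by (simp add: matrix_vector_mult_def norm_sum)
   also have "... <= (\<Sum>j\<in>UNIV. cmod (vec_nth (vec_nth M i) j) * norm x)"
    unfolding norm_mult by (intro sum_mono mult_left_mono Finite_Cartesian_Product.norm_nth_le) auto
   finally show "norm (vec_nth (M *v x) i) <= (\<Sum>j\<in>UNIV. cmod (vec_nth (vec_nth M i) j) * norm x)" .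
  qed
  finally show "norm (M *v x) <= (\<Sum>i\<in>UNIV. \<Sum>j\<in>UNIV. cmod (vec_nth (vec_nth M i) j)) * norm x"
   by (simp add: sum_distrib_right)
 qed (auto intro!: sum_nonneg)
qed

lemma continuous_onorm_2x2:
 assumes "!!i j. continuous_on S (%x. vec_nth (vec_nth (M x :: complex^2^2) i) j)"
 shows "continuous_on S (%x::real. onorm ((*v) (M x)))"
proof -
 have lip: "abs (onorm ((*v) X) - onorm ((*v) Y)) <= (\<Sum>i\<in>UNIV. \<Sum>j\<in>UNIV. cmod (vec_nth (vec_nth X i) j - vec_nth (vec_nth Y i) j))"
  for X Y :: "complex^2^2"
 proof -
  have tri: "onorm ((*v) X) <= onorm ((*v) Y) + onorm ((*v) (X - Y))" for X Y :: "complex^2^2"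
  proof -
   have "(*v) X = (%x. Y *v x + (X - Y) *v x)" by (auto simp: matrix_vector_mult_diff_rdistrib)
   then show ?thesis using onorm_triangle[of "(*v) Y" "(*v) (X - Y)"] by simp
  qed
  have e: "onorm ((*v) (Y - X)) = onorm ((*v) (X - Y))"
  proof -
   have "(*v) (Y - X) = (%x. - ((X - Y) *v x))" by (auto simp: matrix_vector_mult_diff_rdistrib)
   then show ?thesis using onorm_neg[of "(*v) (X - Y)"] by simp
  qed
  have "abs (onorm ((*v) X) - onorm ((*v) Y)) <= onorm ((*v) (X - Y))" using tri[of X Y] tri[of Y X] e by linarith
  also have "... <= (\<Sum>i\<in>UNIV. \<Sum>j\<in>UNIV. cmod (vec_nth (vec_nth (X - Y) i) j))" by (rule onorm_2x2)
  finally show ?thesis by simp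
 qed
 show ?thesis unfolding continuous_on_def
 proof
  fix x assume x: "x : S"
  have "((%y. \<Sum>i\<in>UNIV. \<Sum>j\<in>UNIV. cmod (vec_nth (vec_nth (M y) i) j - vec_nth (vec_nth (M x) i) j)) \<longlongrightarrow>
    (\<Sum>i\<in>UNIV. \<Sum>j\<in>UNIV. cmod (vec_nth (vec_nth (M x) i) j - vec_nth (vec_nth (M x) i) j))) (at x within S)"
   using assms x unfolding continuous_on_def
   by (intro tendsto_sum tendsto_norm tendsto_diff tendsto_const) auto
  then have "((%y. \<Sum>i\<in>UNIV. \<Sum>j\<in>UNIV. cmod (vec_nth (vec_nth (M y) i) j - vec_nth (vec_nth (M x) i) j)) \<longlongrightarrow> 0) (at x within S)"
   by simp
  then have "((%y. onorm ((*v) (M y)) - onorm ((*v) (M x))) \<longlongrightarrow> 0) (at x within S)"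
   by (rule Lim_null_comparison[rotated]) (use lip in \<open>auto intro!: always_eventually\<close>)
  then show "((%x. onorm ((*v) (M x))) \<longlongrightarrow> onorm ((*v) (M x))) (at x within S)"
   by (simp add: LIM_zero_cancel)
 qed
qed

text \<open>Provides genuine Lebesgue integrability, without which the integrals defining
  \<open>lyapunov\<close> and \<open>star_norm\<close> could not be identified with the gauge
  integrals used in the estimates.\<close>

lemma set_integrable_of_ae_continuous:
 fixes f l u :: "real => real"
 assumes Z: "finite Z" and cont: "continuous_on ({0..1} - Z) f"
  and lu: "set_integrable lborel {0..1} l" "set_integrable lborel {0..1} u"
  and bd: "!!x. x : {0..1} - Z ==> l x <= f x & f x <= u x"
 shows "set_integrable lborel {0..1} f"
proof -
 have Sb: "{0..1} - Z : sets borel" using Z by (intro sets.Diff) (auto intro: borel_closed finite_imp_closed)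
 have m1: "(%x. indicator ({0..1} - Z) x *\<^sub>R f x) : borel_measurable lborel"
  using borel_measurable_continuous_on_indicator[OF Sb cont] by simp
 have mf: "(%x. indicator {0..1} x *\<^sub>R f x) : borel_measurable lborel"
  by (rule measurable_discrete_difference[OF m1, of Z]) (use Z in \<open>auto simp: countable_finite indicator_def\<close>)
 have bound: "integrable lborel (%x. abs (indicator {0..1} x *\<^sub>R l x) + abs (indicator {0..1} x *\<^sub>R u x))"
  using lu unfolding set_integrable_def by (intro Bochner_Integration.integrable_add integrable_abs)
 show ?thesis unfolding set_integrable_def
 proof (rule Bochner_Integration.integrable_bound[OF bound mf])
  have "AE x in lborel. x \<notin> Z" using Z
   by (intro AE_I'[of Z]) (auto simp: null_sets_def emeasure_lborel_countable countable_finite intro: borel_closed finite_imp_closed)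
  then show "AE x in lborel. norm (indicator {0..1} x *\<^sub>R f x)
    <= norm (abs (indicator {0..1} x *\<^sub>R l x) + abs (indicator {0..1} x *\<^sub>R u x))"
  proof eventually_elim
   case (elim x)
   then show ?case using bd[of x] by (auto simp: indicator_def)
  qed
 qed
qed

lemma integral_le_off_finite:
 fixes f g :: "real => real"
 assumes "finite Z" "f integrable_on {0..1}" "g integrable_on {0..1}" "!!x. x : {0..1} - Z ==> f x <= g x"
 shows "integral {0..1} f <= integral {0..1} g"
proof -
 have "((%x. if x : Z then g x else f x) has_integral integral {0..1} f) {0..1}"
  by (rule has_integral_spike_finite[OF assms(1) _ integrable_integral[OF assms(2)]]) auto
 then show ?thesis by (rule has_integral_le[OF _ integrable_integral[OF assms(3)]]) (use assms(4) in auto)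
qed

section \<open>Transfer matrices and determinants\<close>

context jac
begin

lemma b_cont: "continuous_on S (%x. b (of_real (x + t)))"
 using \<rho> by (intro continuous_on_compose2[OF holomorphic_on_imp_continuous_on[OF bhol]] continuous_intros) (auto simp: strip_def)

lemma a_cont: "continuous_on S (%x. a (of_real (x + t)))"
 using \<rho> by (intro continuous_on_compose2[OF holomorphic_on_imp_continuous_on[OF ahol]] continuous_intros) (auto simp: strip_def)

lemma bl_set_integrable: "set_integrable lborel {0..1} (%x. bl (x + t))"
proof -
 have hk: "((%x. bl (x + t)) has_integral \<D>) {0..1}"
  unfolding \<D>_def by (rule per_has_integral_shift[OF bl_per integrable_integral[OF bl_integrable]])
 then have "(%x. A - bl (x + t)) integrable_on {0..1}" by (intro integrable_diff) auto
 then have "(%x. A - bl (x + t)) absolutely_integrable_on {0..1}"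
  by (rule nonnegative_absolutely_integrable_1) (use bl_le in \<open>simp del: of_real_add\<close>)
 moreover have "(%x. indicator {0..1} x *\<^sub>R (A - bl (x + t))) : borel_measurable lborel"
 proof -
  have "(%x. b (of_real (x + t))) : borel_measurable borel" by (rule borel_measurable_continuous_onI[OF b_cont])
  then show ?thesis by simp
 qed
 ultimately have 1: "set_integrable lborel {0..1} (%x. A - bl (x + t))"
  unfolding set_integrable_def using integrable_completion by blast
 have "set_integrable lborel {0..1} (%x::real. A)" by (simp add: set_integrable_def)
 from set_integral_diff(1)[OF this 1]
 have "set_integrable lborel {0..1} (%x. A - (A - bl (x + t)))" .
 then show ?thesis by simp
qed

lemma bl_shift_integral: "((%x. bl (x + t)) has_integral \<D>) {0..1}"
 unfolding \<D>_def by (rule per_has_integral_shift[OF bl_per integrable_integral[OF bl_integrable]])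

lemma b_zeros_shift_finite: "finite {x : {0..1}. b (of_real (x + t)) = 0}"
proof -
 have "{x : {0..1}. b (of_real (x + t)) = 0} \<subseteq> (%x. x - t) ` {x : {t..t + 1}. b (of_real x) = 0}"
  by (auto intro!: image_eqI[of _ _ "_ + t"])
 then show ?thesis using b_zeros_finite finite_surj by blast
qed

context
 fixes bt :: "complex => complex" and om E :: real
 assumes bt: "!!x::real. bt (of_real x) = cnj (b (of_real x))"
begin

definition MT :: "nat => real => complex^2^2" where
 "MT n x = transfer_matrix a b bt x om E n"

abbreviation "ent M i j \<equiv> vec_nth (vec_nth M i) j"

lemma ent_Suc: "ent (MT (Suc n) x) 1 j = ((a (of_real (x + real n * om)) - of_real E) * ent (MT n x) 1 j
   - bt (of_real (x + real n * om)) * ent (MT n x) 2 j) / b (of_real (x + real (Suc n) * om))"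
 "ent (MT (Suc n) x) 2 j = b (of_real (x + real (Suc n) * om)) / b (of_real (x + real (Suc n) * om)) * ent (MT n x) 1 j"
 by (simp_all add: MT_def transfer_factor_def Let_def matrix_matrix_mult_def sum_2 diff_divide_distrib add_divide_distrib algebra_simps)

lemma ent_0: "ent (MT 0 x) i j = (if i = j then 1 else 0)"
 by (simp add: MT_def Finite_Cartesian_Product.mat_def)

lemma btb: "bt (of_real x) * b (of_real x) = B2 b (of_real x)"
 unfolding bt B2_real complex_norm_square by simp

abbreviation "FE n x \<equiv> F om (of_real E) n (complex_of_real x)"

lemma FE_rec: "FE (Suc (Suc n)) x = (a (of_real (x + real (Suc n) * om)) - of_real E) * FE (Suc n) x
  - B2 b (of_real (x + real (Suc n) * om)) * FE n x"
 unfolding F_def by simp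

text \<open>After multiplication by the product of the \<open>b\<close> the entries are determinants
  of the chain with its last site, its first site, or both removed. The \<open>case\<close> is the
  chain of one site, where both cannot be removed and the entry is \<open>0\<close>.\<close>

lemma MT_entries:
 assumes nz: "!!j. j < Suc n ==> b (of_real (x + real (Suc j) * om)) ~= 0"
 defines "u \<equiv> %n. \<Prod>j<n. b (of_real (x + real (Suc j) * om))"
 shows "ent (MT (Suc n) x) 1 1 * u (Suc n) = FE (Suc n) x &
  ent (MT (Suc n) x) 2 1 * u (Suc n) = b (of_real (x + real (Suc n) * om)) * FE n x &
  ent (MT (Suc n) x) 1 2 * u (Suc n) = - bt (of_real x) * FE n (x + om) &
  ent (MT (Suc n) x) 2 2 * u (Suc n) = - bt (of_real x) * b (of_real (x + real (Suc n) * om)) *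
   (case n of 0 => 0 | Suc m => FE m (x + om))"
 using nz
proof (induction n)
 case 0
 have "b (of_real (x + om)) ~= 0" using 0[of 0] by simp
 then show ?case unfolding u_def by (simp add: ent_Suc ent_0 F_def)
next
 case (Suc n)
 let ?b = "%k. b (of_real (x + real k * om))" and ?a = "%k. a (of_real (x + real k * om)) - of_real E"
 have b2: "?b (Suc (Suc n)) ~= 0" using Suc.prems[of "Suc n"] by simp
 have IH: "ent (MT (Suc n) x) 1 1 * u (Suc n) = FE (Suc n) x"
  "ent (MT (Suc n) x) 2 1 * u (Suc n) = ?b (Suc n) * FE n x"
  "ent (MT (Suc n) x) 1 2 * u (Suc n) = - bt (of_real x) * FE n (x + om)"
  "ent (MT (Suc n) x) 2 2 * u (Suc n) = - bt (of_real x) * ?b (Suc n) * (case n of 0 => 0 | Suc m => FE m (x + om))"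
  using Suc.IH Suc.prems by auto
 have uS: "u (Suc (Suc n)) = u (Suc n) * ?b (Suc (Suc n))" unfolding u_def by simp
 have e1: "ent (MT (Suc (Suc n)) x) 1 j * u (Suc (Suc n)) =
   ?a (Suc n) * (ent (MT (Suc n) x) 1 j * u (Suc n)) - bt (of_real (x + real (Suc n) * om)) * (ent (MT (Suc n) x) 2 j * u (Suc n))" for j
  unfolding ent_Suc(1)[of "Suc n"] uS using b2 by (simp add: field_simps del: of_nat_Suc)
 have e2: "ent (MT (Suc (Suc n)) x) 2 j * u (Suc (Suc n)) = ?b (Suc (Suc n)) * (ent (MT (Suc n) x) 1 j * u (Suc n))" for j
  unfolding ent_Suc(2)[of "Suc n"] uS using b2 by (simp del: of_nat_Suc)
 have bb: "bt (of_real (x + real (Suc n) * om)) * (?b (Suc n) * X) = B2 b (of_real (x + real (Suc n) * om)) * X" for X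
  using btb[of "x + real (Suc n) * om"] by (simp only: mult.assoc[symmetric])
 have c1: "ent (MT (Suc (Suc n)) x) 1 1 * u (Suc (Suc n)) = FE (Suc (Suc n)) x"
  unfolding e1 IH bb FE_rec ..
 have c3: "ent (MT (Suc (Suc n)) x) 1 2 * u (Suc (Suc n)) = - bt (of_real x) * FE (Suc n) (x + om)"
 proof (cases n)
  case 0
  then show ?thesis unfolding e1 IH by (simp add: F_def)
 next
  case (Suc m)
  have s: "x + real (Suc n) * om = (x + om) + real (Suc m) * om" unfolding Suc by (simp add: algebra_simps)
  have h: "(case n of 0 => 0 | Suc m => FE m (x + om)) = FE m (x + om)" using Suc by simp
  have eq: "bt (of_real (x + real (Suc n) * om)) * (- bt (of_real x) * ?b (Suc n) * FE m (x + om)) =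
    - bt (of_real x) * (B2 b (of_real (x + real (Suc n) * om)) * FE m (x + om))"
   using bb[of "- bt (of_real x) * FE m (x + om)"] by (simp add: mult_ac)
  have "ent (MT (Suc (Suc n)) x) 1 2 * u (Suc (Suc n)) = - bt (of_real x) *
    (?a (Suc n) * FE n (x + om) - B2 b (of_real (x + real (Suc n) * om)) * FE m (x + om))"
   unfolding e1 IH(3,4) h eq by (simp add: algebra_simps del: of_nat_Suc of_real_add of_real_mult)
  then show ?thesis unfolding Suc s[unfolded Suc] FE_rec[of m "x + om"] .
 qed
 have c2: "ent (MT (Suc (Suc n)) x) 2 1 * u (Suc (Suc n)) = ?b (Suc (Suc n)) * FE (Suc n) x"
  unfolding e2 IH ..
 have c4: "ent (MT (Suc (Suc n)) x) 2 2 * u (Suc (Suc n)) = - bt (of_real x) * ?b (Suc (Suc n)) * FE n (x + om)"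
  unfolding e2 IH by (simp only: mult_ac mult_minus_left mult_minus_right)
 show ?case unfolding c1 c2 c3 c4 nat.case by simp
qed

definition nM :: "nat => real => real" where "nM n x = onorm ((*v) (MT n x))"

definition ZM :: "nat => real set" where
 "ZM n = (\<Union>j\<le>n. {x : {0..1}. b (of_real (x + real j * om)) = 0})"

lemma ZM_finite: "finite (ZM n)"
 unfolding ZM_def by (intro finite_UN_I b_zeros_shift_finite) auto

lemma ZM_nz: "x : {0..1} - ZM n ==> j <= n ==> b (of_real (x + real j * om)) ~= 0"
 by (auto simp: ZM_def)

lemma MT_shift: "MT (n + m) x = MT m (x + real n * om) ** MT n x"
proof (induction m)
 case (Suc m)
 have "transfer_factor a b bt x om E (n + m) = transfer_factor a b bt (x + real n * om) om E m"
  unfolding transfer_factor_def by (simp add: algebra_simps)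
 then show ?case using Suc by (simp add: MT_def matrix_mul_assoc)
qed (simp add: MT_def)

lemma MT_det:
 assumes "!!j. j <= n ==> b (of_real (x + real j * om)) ~= 0"
 shows "cmod (ent (MT n x) 1 1 * ent (MT n x) 2 2 - ent (MT n x) 1 2 * ent (MT n x) 2 1)
  = cmod (b (of_real x)) / cmod (b (of_real (x + real n * om)))"
 using assms
proof (induction n)
 case 0 then show ?case by (simp add: ent_0)
next
 case (Suc n)
 have b: "b (of_real (x + real (Suc n) * om)) ~= 0" "b (of_real (x + real n * om)) ~= 0"
  using Suc.prems[of "Suc n"] Suc.prems[of n] by auto
 have "ent (MT (Suc n) x) 1 1 * ent (MT (Suc n) x) 2 2 - ent (MT (Suc n) x) 1 2 * ent (MT (Suc n) x) 2 1 =
   (bt (of_real (x + real n * om)) / b (of_real (x + real (Suc n) * om))) *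
   (ent (MT n x) 1 1 * ent (MT n x) 2 2 - ent (MT n x) 1 2 * ent (MT n x) 2 1)"
  unfolding ent_Suc using b(1) by (simp add: field_simps del: of_nat_Suc of_real_add of_real_mult)
 moreover have "cmod (ent (MT n x) 1 1 * ent (MT n x) 2 2 - ent (MT n x) 1 2 * ent (MT n x) 2 1)
  = cmod (b (of_real x)) / cmod (b (of_real (x + real n * om)))"
  using Suc by simp
 ultimately have "cmod (ent (MT (Suc n) x) 1 1 * ent (MT (Suc n) x) 2 2 - ent (MT (Suc n) x) 1 2 * ent (MT (Suc n) x) 2 1) =
   cmod (b (of_real (x + real n * om))) / cmod (b (of_real (x + real (Suc n) * om))) *
   (cmod (b (of_real x)) / cmod (b (of_real (x + real n * om))))"
  by (simp only: norm_mult norm_divide bt complex_mod_cnj)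
 then show ?case using b by simp
qed

text \<open>A two by two matrix satisfies \<open>cmod det <= 2 * norm^2\<close>, and the
  determinants of the factors telescope to a quotient of two values of \<open>b\<close>. The
  resulting lower bound has mean \<open>- ln 2 / 2\<close>, which is the boundedness below that
  \<open>fekete\<close> asks for.\<close>

lemma nM_lower:
 assumes nz: "!!j. j <= n ==> b (of_real (x + real j * om)) ~= 0"
 shows "nM n x > 0" "(bl x - bl (x + real n * om)) / 2 - ln 2 / 2 <= ln (nM n x)"
proof -
 have b: "cmod (b (of_real x)) > 0" "cmod (b (of_real (x + real n * om))) > 0" using nz[of 0] nz[of n] by auto
 have e: "cmod (ent (MT n x) i j) <= nM n x" for i j unfolding nM_def by (rule onorm_2x2)
 have nn: "0 <= nM n x" using e[of 1 1] norm_ge_zero order_trans by blast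
 have "cmod (b (of_real x)) / cmod (b (of_real (x + real n * om))) <=
   cmod (ent (MT n x) 1 1) * cmod (ent (MT n x) 2 2) + cmod (ent (MT n x) 1 2) * cmod (ent (MT n x) 2 1)"
  using norm_triangle_ineq4[of "ent (MT n x) 1 1 * ent (MT n x) 2 2" "ent (MT n x) 1 2 * ent (MT n x) 2 1"] MT_det[OF nz]
  by (simp add: norm_mult)
 also have "... <= nM n x * nM n x + nM n x * nM n x"
  by (intro add_mono mult_mono e nn) auto
 finally have le: "cmod (b (of_real x)) / cmod (b (of_real (x + real n * om))) <= 2 * (nM n x)^2"
  by (simp add: power2_eq_square)
 moreover have "0 < cmod (b (of_real x)) / cmod (b (of_real (x + real n * om)))" using b by simp
 ultimately have "0 < 2 * (nM n x)^2" by linarith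
 then show pos: "nM n x > 0" using nn by (simp add: zero_less_power2)
 have "ln (cmod (b (of_real x)) / cmod (b (of_real (x + real n * om)))) <= ln (2 * (nM n x)^2)"
  using le b by (intro ln_mono) auto
 then have "bl x - bl (x + real n * om) <= ln 2 + 2 * ln (nM n x)"
  using b pos by (simp add: ln_div ln_mult ln_realpow)
 moreover have "(X - Y) / 2 - Z / 2 <= T" if "X - Y <= Z + 2 * T" for X Y Z T :: real using that by (simp add: field_simps)
 ultimately show "(bl x - bl (x + real n * om)) / 2 - ln 2 / 2 <= ln (nM n x)" by blast
qed

lemma nM_per: "nM n (x + 1) = nM n x"
proof -
 have p: "f (of_real (x + 1 + t)) = f (of_real (x + t))" if "!!z. z : strip \<rho> ==> f (z + 1) = f z" for f :: "complex => complex" and t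
 proof -
  have "of_real (x + 1 + t) = complex_of_real (x + t) + 1" by simp
  then show ?thesis using that[OF strip_real[OF \<rho>]] by (simp only:)
 qed
 have pa: "a (of_real (x + 1 + t)) = a (of_real (x + t))" and pb: "b (of_real (x + 1 + t)) = b (of_real (x + t))" for t
  using p[of a] p[of b] aper bper by blast+
 have "transfer_factor a b bt (x + 1) om E j = transfer_factor a b bt x om E j" for j
  unfolding transfer_factor_def bt by (simp only: pa pb)
 then have "MT n (x + 1) = MT n x" unfolding MT_def by (induction n) auto
 then show ?thesis by (simp add: nM_def)
qed

lemma nM_continuous: "continuous_on ({0..1} - ZM n) (%x. ln (nM n x))"
proof (intro continuous_intros)
 have ent_cont: "continuous_on ({0..1} - ZM n) (%x. ent (MT m x) i j)" if "m <= n" for m i j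
  using that
 proof (induction m arbitrary: i j)
  case (Suc m)
  have bc: "continuous_on S (%x. bt (of_real (x + t)))" for S t unfolding bt by (intro continuous_intros b_cont)
  have nz: "\<forall>x\<in>{0..1} - ZM n. b (of_real (x + real (Suc m) * om)) ~= 0" using ZM_nz Suc.prems by blast
  have "i = 1 \<or> i = 2" by (rule exhaust_2)
  then show ?case
  proof
   assume i: "i = 1"
   show ?thesis unfolding i ent_Suc using nz Suc
    by (intro continuous_on_divide continuous_on_diff continuous_on_mult a_cont b_cont bc continuous_on_const) auto
  next
   assume i: "i = 2"
   show ?thesis unfolding i ent_Suc using nz Suc
    by (intro continuous_on_divide continuous_on_mult b_cont) auto
  qed
 qed (simp add: ent_0)
 show "continuous_on ({0..1} - ZM n) (nM n)"
  unfolding nM_def[abs_def] by (rule continuous_onorm_2x2[OF ent_cont]) simp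
 show "\<forall>x\<in>{0..1} - ZM n. nM n x ~= 0"
 proof
  fix x assume "x : {0..1} - ZM n"
  then have "nM n x > 0" by (intro nM_lower ZM_nz)
  then show "nM n x ~= 0" by simp
 qed
qed

context
 fixes \<eta> :: real
 assumes \<eta>: "0 < \<eta>" "\<eta> <= 1" and E: "abs E <= A"
begin

lemma U_ge_1: "- \<Lambda> \<eta> <= U om E \<eta> 1 x"
proof -
 interpret herglotz_real "%z. a z - Complex E \<eta>" "B2 b" "of_real om" "of_real x" \<eta> "2 * A + 1" "A^2"
  by (rule herglotz_real_F[OF \<eta> E])
 have "\<eta> / 2 <= cmod (F om (Complex E \<eta>) 1 (of_real x))"
  using ratio_lower[of 0] unfolding F_def by simp
 then have "ln (\<eta> / 2) <= U om E \<eta> 1 x" unfolding U_def using \<eta> by (intro ln_mono) auto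
 moreover have "- \<Lambda> \<eta> <= ln (\<eta> / 2)"
 proof -
  have "\<Lambda> \<eta> = - ln (\<eta> / (12 * A^2))" unfolding \<Lambda>_def using \<eta> A by (simp add: ln_div)
  moreover have "ln (\<eta> / (12 * A^2)) <= ln (\<eta> / 2)"
   using \<eta> A2 A by (intro ln_mono divide_left_mono) auto
  ultimately show ?thesis by simp
 qed
 ultimately show ?thesis by linarith
qed

lemma U_drop_last: "U om E \<eta> n x <= U om E \<eta> (Suc n) x + 3 * \<Lambda> \<eta>"
 using U_split[OF \<eta> E, of om n 1 x] U_ge_1[of "x + real n * om"] by simp

lemma U_drop_first: "U om E \<eta> n (x + om) <= U om E \<eta> (Suc n) x + 3 * \<Lambda> \<eta>"
 using U_split[OF \<eta> E, of om 1 n x] U_ge_1[of x] by simp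

lemma FE_le: "cmod (FE n x) <= exp (U om E \<eta> n x)"
 unfolding U_def using F_real_le[of om E n x \<eta>] F_nz[OF \<eta> E] by simp

text \<open>Each entry is a determinant with at most two sites missing, and restoring a site costs
  \<open>3 * \<Lambda>\<close>. The remaining \<open>2 * \<Lambda>\<close> of the
  \<open>8 * \<Lambda>\<close> absorb the factor \<open>A^2\<close> and the number of
  entries.\<close>

lemma nM_upper:
 assumes n: "n > 0" and nz: "!!j. j <= n ==> b (of_real (x + real j * om)) ~= 0"
 shows "ln (nM n x) <= U om E \<eta> n x + 8 * \<Lambda> \<eta> - (\<Sum>j<n. bl (x + real (Suc j) * om))"
proof -
 obtain m where m: "n = Suc m" using n by (cases n) auto
 define u where "u = (\<Prod>j<Suc m. b (of_real (x + real (Suc j) * om)))"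
 have unz: "u ~= 0" unfolding u_def m using nz unfolding m by (simp del: of_real_add of_real_mult of_nat_Suc)
 have ents: "ent (MT n x) 1 1 * u = FE (Suc m) x &
  ent (MT n x) 2 1 * u = b (of_real (x + real (Suc m) * om)) * FE m x &
  ent (MT n x) 1 2 * u = - bt (of_real x) * FE m (x + om) &
  ent (MT n x) 2 2 * u = - bt (of_real x) * b (of_real (x + real (Suc m) * om)) *
   (case m of 0 => 0 | Suc m => FE m (x + om))"
  unfolding m u_def by (rule MT_entries, rule nz) (use m in simp)
 define T where "T = exp (U om E \<eta> n x + 6 * \<Lambda> \<eta>)"
 have L: "\<Lambda> \<eta> >= 1" by (rule \<Lambda>_ge[OF \<eta>])
 have bb: "cmod (b (of_real y)) <= A" for y using bbd \<rho> by simp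
 have f1: "cmod (FE (Suc m) x) <= T"
  unfolding T_def by (rule order_trans[OF FE_le]) (use L m in simp)
 have f2: "cmod (FE m x) <= T"
  unfolding T_def by (rule order_trans[OF FE_le]) (use U_drop_last[of m x] L m in simp)
 have f3: "cmod (FE m (x + om)) <= T"
  unfolding T_def by (rule order_trans[OF FE_le]) (use U_drop_first[of m x] L m in simp)
 have f4: "cmod (case m of 0 => 0 | Suc m => FE m (x + om)) <= T"
 proof (cases m)
  case 0 then show ?thesis by (simp add: T_def)
 next
  case (Suc k)
  have "cmod (FE k (x + om)) <= T"
   unfolding T_def by (rule order_trans[OF FE_le])
    (use U_drop_last[of k "x + om"] U_drop_first[of m x] Suc m in simp)
  then show ?thesis using Suc by simp
 qed
 have T0: "T > 0" by (simp add: T_def)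
 have all: "cmod (ent (MT n x) i j) * cmod u <= A^2 * T" for i j
 proof -
  have g: "X * Y <= A^2 * T" if "X <= A^2" "0 <= Y" "Y <= T" for X Y
   using that T0 by (intro mult_mono) auto
  have bt': "cmod (bt (of_real x)) <= A" using bb[of x] by (simp add: bt)
  have "cmod (ent (MT n x) 1 1 * u) <= A^2 * T" using ents g[of 1 "cmod (FE (Suc m) x)"] f1 A2 by simp
  moreover have "cmod (ent (MT n x) 2 1 * u) <= A^2 * T"
   using ents g[of "cmod (b (of_real (x + real (Suc m) * om)))" "cmod (FE m x)"] f2 A2 bb[of "x + real (Suc m) * om"] by (simp add: norm_mult)
  moreover have "cmod (ent (MT n x) 1 2 * u) <= A^2 * T"
   using ents g[of "cmod (bt (of_real x))" "cmod (FE m (x + om))"] f3 A2 bt' by (simp add: norm_mult)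
  moreover have "cmod (ent (MT n x) 2 2 * u) <= A^2 * T"
  proof -
   have "cmod (bt (of_real x)) * cmod (b (of_real (x + real (Suc m) * om))) <= A^2"
    unfolding power2_eq_square by (intro mult_mono bt' bb) (use A in auto)
   from g[OF this norm_ge_zero f4] show ?thesis using ents by (simp add: norm_mult)
  qed
  ultimately show ?thesis using exhaust_2[of i] exhaust_2[of j] by (auto simp: norm_mult)
 qed
 have "nM n x * cmod u <= (\<Sum>i\<in>UNIV. \<Sum>j\<in>UNIV. cmod (ent (MT n x) i j) * cmod u)"
  unfolding sum_distrib_right[symmetric] nM_def by (intro mult_right_mono onorm_2x2) auto
 also have "... <= 4 * (A^2 * T)"
  using all[of 1 1] all[of 1 2] all[of 2 1] all[of 2 2] by (simp add: sum_2)
 also have "... <= exp (2 * \<Lambda> \<eta>) * T"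
 proof -
  have "4 * A^2 <= 12 * A^2 / \<eta>" using \<eta> A by (simp add: field_simps)
  also have "... = exp (\<Lambda> \<eta>)" unfolding \<Lambda>_def using \<eta> A by simp
  also have "... <= exp (2 * \<Lambda> \<eta>)" using L by simp
  finally show ?thesis using T0 by (simp add: mult.assoc[symmetric])
 qed
 also have "... = exp (U om E \<eta> n x + 8 * \<Lambda> \<eta>)"
  unfolding T_def exp_add[symmetric] by (simp add: algebra_simps)
 finally have "nM n x * cmod u <= exp (U om E \<eta> n x + 8 * \<Lambda> \<eta>)" .
 moreover have pos: "nM n x > 0" by (rule nM_lower) (rule nz)
 ultimately have "ln (nM n x * cmod u) <= U om E \<eta> n x + 8 * \<Lambda> \<eta>"
  using unz by (subst ln_le_cancel_iff[of _ "exp (U om E \<eta> n x + 8 * \<Lambda> \<eta>)", unfolded ln_exp]) auto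
 moreover have "ln (cmod u) = (\<Sum>j<n. bl (x + real (Suc j) * om))"
 proof -
  have "b (of_real (x + real (Suc j) * om)) ~= 0" if "j < Suc m" for j by (rule nz) (use that m in simp)
  then show ?thesis unfolding u_def m prod_norm[symmetric]
   by (intro ln_prod) (simp_all del: of_real_add of_real_mult of_nat_Suc)
 qed
 ultimately show ?thesis using pos unz by (simp add: ln_mult)
qed

lemma nM_set_integrable: "set_integrable lborel {0..1} (%x. ln (nM n x))"
proof (cases "n = 0")
 case True
 have "MT 0 x = Finite_Cartesian_Product.mat 1" for x by (simp add: MT_def)
 then have "nM 0 x = nM 0 y" for x y by (simp add: nM_def)
 then have "(%x. ln (nM n x)) = (%x. ln (nM 0 0))" using True by (auto simp: fun_eq_iff) metis
 then show ?thesis by (simp add: set_integrable_def)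
next
 case False
 interpret C1_per "U om E \<eta> n" "U' om E \<eta> n" by (rule U_C1[OF \<eta> E])
 have Ui: "set_integrable lborel {0..1} (U om E \<eta> n)" by (rule borel_integrable_atLeastAtMost') (rule contU)
 have ci: "set_integrable lborel {0..1} (%x::real. c)" for c :: real by (simp add: set_integrable_def)
 show ?thesis
 proof (rule set_integrable_of_ae_continuous[OF ZM_finite nM_continuous])
  show "set_integrable lborel {0..1} (%x. (bl (x + 0) - bl (x + real n * om)) / 2 - ln 2 / 2)"
   by (intro set_integral_diff(1) set_integrable_divide ci bl_set_integrable)
  have "set_integrable lborel {0..1} (%x. \<Sum>j\<in>{..<n}. bl (x + real (Suc j) * om))"
   using bl_set_integrable unfolding set_integrable_def scaleR_sum_right by (intro Bochner_Integration.integrable_sum)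
  then show "set_integrable lborel {0..1} (%x. U om E \<eta> n x + 8 * \<Lambda> \<eta> - (\<Sum>j<n. bl (x + real (Suc j) * om)))"
   by (intro set_integral_diff(1) set_integral_add(1) ci Ui)
  fix x assume "x : {0..1} - ZM n"
  then have nz: "!!j. j <= n ==> b (of_real (x + real j * om)) ~= 0" by (rule ZM_nz)
  show "(bl (x + 0) - bl (x + real n * om)) / 2 - ln 2 / 2 <= ln (nM n x) &
   ln (nM n x) <= U om E \<eta> n x + 8 * \<Lambda> \<eta> - (\<Sum>j<n. bl (x + real (Suc j) * om))"
   using nM_lower(2)[OF nz] nM_upper[OF _ nz] False by simp
 qed
qed

text \<open>By subadditivity the Lyapunov exponent is at most the mean of
  \<open>ln (nM d x) / d\<close> for every \<open>d\<close>; integrating \<open>nM_upper\<close> and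
  using that all shifts of \<open>bl\<close> have mean \<open>\<D>\<close> turns this into a lower
  bound for the mean of \<open>U\<close> at each finite length.\<close>

theorem lyapunov_lower:
 assumes L: "lyapunov a b bt om E > \<gamma>" and d: "d > 0"
 shows "real d * (\<D> + \<gamma>) - 8 * \<Lambda> \<eta> <= integral {0..1} (U om E \<eta> d)"
proof -
 define \<alpha> where "\<alpha> n = integral {0..1} (%x. ln (nM n x))" for n
 note si = set_borel_integral_eq_integral[OF nM_set_integrable]
 have lyap: "lyapunov a b bt om E = lim (%n. \<alpha> n / real n)"
  unfolding lyapunov_def \<alpha>_def using si(2) by (simp add: nM_def MT_def)
 have nMp: "per (%x. ln (nM n x))" for n using nM_per by (simp add: per_def)
 have sub: "\<alpha> (n + m) <= \<alpha> n + \<alpha> m" for n m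
 proof -
  have sh: "((%x. ln (nM m (x + real n * om))) has_integral \<alpha> m) {0..1}"
   unfolding \<alpha>_def by (rule per_has_integral_shift[OF nMp integrable_integral[OF si(1)]])
  have "\<alpha> (n + m) <= integral {0..1} (%x. ln (nM n x) + ln (nM m (x + real n * om)))"
   unfolding \<alpha>_def
  proof (rule integral_le_off_finite[OF ZM_finite[of "n + m"] si(1)])
   show "(%x. ln (nM n x) + ln (nM m (x + real n * om))) integrable_on {0..1}"
    using sh by (intro integrable_add si(1)) blast
   fix x assume x: "x : {0..1} - ZM (n + m)"
   have p1: "nM n x > 0" by (rule nM_lower) (use ZM_nz[OF x] in auto)
   have p2: "nM m (x + real n * om) > 0"
   proof (rule nM_lower)
    fix j assume "j <= m"
    then have "b (of_real (x + real (n + j) * om)) ~= 0" by (intro ZM_nz[OF x]) auto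
    then show "b (of_real (x + real n * om + real j * om)) ~= 0" by (simp add: algebra_simps)
   qed
   have p3: "nM (n + m) x > 0" by (rule nM_lower) (use ZM_nz[OF x] in auto)
   have "nM (n + m) x <= nM m (x + real n * om) * nM n x"
   proof -
    have "(*v) (MT (n + m) x) = (*v) (MT m (x + real n * om)) \<circ> (*v) (MT n x)"
     unfolding MT_shift by (auto simp: matrix_vector_mul_assoc)
    then show ?thesis unfolding nM_def using onorm_compose[of "(*v) (MT m (x + real n * om))" "(*v) (MT n x)"] by simp
   qed
   then have "ln (nM (n + m) x) <= ln (nM m (x + real n * om) * nM n x)" using p3 by (intro ln_mono) auto
   then show "ln (nM (n + m) x) <= ln (nM n x) + ln (nM m (x + real n * om))" using p1 p2 by (simp add: ln_mult)
  qed
  also have "... = \<alpha> n + \<alpha> m"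
   using integral_add[OF si(1)[of n], of "%x. ln (nM m (x + real n * om))"] sh
   by (simp add: \<alpha>_def integral_unique has_integral_integrable)
  finally show ?thesis .
 qed
 have low: "- (ln 2 / 2) <= \<alpha> n" for n
 proof -
  have hi: "((%x. (bl (x + 0) - bl (x + real n * om)) / 2 - ln 2 / 2) has_integral (\<D> - \<D>) / 2 - ln 2 / 2 * 1) {0..1}"
   by (intro has_integral_diff has_integral_divide bl_shift_integral) (use has_integral_const_real[of "ln 2 / 2" 0 1] in simp)
  have "integral {0..1} (%x. (bl (x + 0) - bl (x + real n * om)) / 2 - ln 2 / 2) <= \<alpha> n"
   unfolding \<alpha>_def
  proof (rule integral_le_off_finite[OF ZM_finite[of n] _ si(1)])
   fix x assume "x : {0..1} - ZM n"
   then have "!!j. j <= n ==> b (of_real (x + real j * om)) ~= 0" by (rule ZM_nz)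
   from nM_lower(2)[OF this] show "(bl (x + 0) - bl (x + real n * om)) / 2 - ln 2 / 2 <= ln (nM n x)" by simp
  qed (use hi in blast)
  then show ?thesis using hi by (simp add: integral_unique)
 qed
 have "\<gamma> < \<alpha> d / real d" using L fekete[of \<alpha>, OF sub low _ d] unfolding lyap by simp
 then have 1: "real d * \<gamma> <= \<alpha> d" using d by (simp add: pos_less_divide_eq mult.commute)
 interpret C1_per "U om E \<eta> d" "U' om E \<eta> d" by (rule U_C1[OF \<eta> E])
 have hi: "((%x. U om E \<eta> d x + 8 * \<Lambda> \<eta> - (\<Sum>j<d. bl (x + real (Suc j) * om))) has_integral
   integral {0..1} (U om E \<eta> d) + 8 * \<Lambda> \<eta> - (\<Sum>j<d. \<D>)) {0..1}"
  by (intro has_integral_diff has_integral_add has_integral_sum bl_shift_integral integrable_integral[OF intU])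
   (use has_integral_const_real[of "8 * \<Lambda> \<eta>" 0 1] in simp_all)
 have "\<alpha> d <= integral {0..1} (%x. U om E \<eta> d x + 8 * \<Lambda> \<eta> - (\<Sum>j<d. bl (x + real (Suc j) * om)))"
  unfolding \<alpha>_def
 proof (rule integral_le_off_finite[OF ZM_finite[of d] si(1)])
  fix x assume "x : {0..1} - ZM d"
  then have "!!j. j <= d ==> b (of_real (x + real j * om)) ~= 0" by (rule ZM_nz)
  from nM_upper[OF d this] show "ln (nM d x) <= U om E \<eta> d x + 8 * \<Lambda> \<eta> - (\<Sum>j<d. bl (x + real (Suc j) * om))" .
 qed (use hi in blast)
 then have "\<alpha> d <= integral {0..1} (U om E \<eta> d) + 8 * \<Lambda> \<eta> - real d * \<D>"
  using hi by (simp add: integral_unique)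
 then show ?thesis using 1 by (simp add: algebra_simps)
qed

end

end

end

section \<open>Exponential decay of eigenvectors across a window far from resonance\<close>

text \<open>Poisson's formula cleared of the denominator \<open>f (s + k)\<close>, so no
  invertibility is assumed. The index of \<open>g\<close> is shifted by one: \<open>g 0\<close> and
  \<open>g (Suc (s + k))\<close> are the boundary values of a window whose own sites are
  \<open>1, ..., s + k\<close>.\<close>

lemma poisson:
 fixes \<alpha> \<beta> g :: "nat => 'a :: comm_ring_1"
 assumes rec: "!!j. j < s + k ==> \<beta> (Suc j) * g (Suc (Suc j)) = \<alpha> j * g (Suc j) - \<beta> j * g j"
 defines "f \<equiv> tricont \<alpha> (%j. (\<beta> (Suc j))^2)"
  and "h \<equiv> %k. case k of 0 => 0 | Suc m => tricont (%j. \<alpha> (Suc s + j)) (%j. (\<beta> (Suc (Suc s + j)))^2) m"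
 shows "f (s + k) * g (Suc s) = (\<Prod>j\<le>s. \<beta> j) * h k * g 0 + f s * (\<Prod>j=Suc s..s + k. \<beta> j) * g (Suc (s + k))"
 using rec
proof (induction k rule: induct_nat_012)
 case 0
 then show ?case by (simp add: h_def)
next
 case 1
 \<comment> \<open>Solution from the left boundary alone: the part of the window up to
   \<open>s\<close> is eliminated in terms of \<open>g 0\<close> and the next value. The outer
   induction then extends the window to the right.\<close>
 have "f s * \<beta> s * g s = (\<Prod>j\<le>s. \<beta> j) * g 0 + (case s of 0 => 0 | Suc r => (\<beta> s)^2 * f r) * g (Suc s)"
  if "s <= s'" "!!j. j < s' ==> \<beta> (Suc j) * g (Suc (Suc j)) = \<alpha> j * g (Suc j) - \<beta> j * g j" for s s'
  using that
 proof (induction s)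
  case (Suc s)
  have IH: "f s * \<beta> s * g s = (\<Prod>j\<le>s. \<beta> j) * g 0 + (case s of 0 => 0 | Suc r => (\<beta> s)^2 * f r) * g (Suc s)"
   using Suc by auto
  have r: "\<beta> (Suc s) * g (Suc (Suc s)) = \<alpha> s * g (Suc s) - \<beta> s * g s" using Suc.prems by auto
  have fs: "f (Suc s) = \<alpha> s * f s - (case s of 0 => 0 | Suc r => (\<beta> s)^2 * f r)"
   by (cases s) (simp_all add: f_def)
  have "f (Suc s) * \<beta> (Suc s) * g (Suc s) - (\<beta> (Suc s))^2 * f s * g (Suc (Suc s))
   = \<beta> (Suc s) * (f (Suc s) * g (Suc s) - f s * (\<alpha> s * g (Suc s) - \<beta> s * g s))"
   unfolding r[symmetric] by (simp add: power2_eq_square algebra_simps)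
  also have "... = \<beta> (Suc s) * ((\<Prod>j\<le>s. \<beta> j) * g 0)"
   using IH unfolding fs by (simp add: algebra_simps)
  finally show ?case by (simp add: algebra_simps)
 qed (simp add: f_def)
 from this[of s "Suc s"] 1 have
  IH: "f s * \<beta> s * g s = (\<Prod>j\<le>s. \<beta> j) * g 0 + (case s of 0 => 0 | Suc r => (\<beta> s)^2 * f r) * g (Suc s)" by simp
 have r: "\<beta> (Suc s) * g (Suc (Suc s)) = \<alpha> s * g (Suc s) - \<beta> s * g s" using 1 by auto
 have fs: "f (Suc s) = \<alpha> s * f s - (case s of 0 => 0 | Suc r => (\<beta> s)^2 * f r)"
  by (cases s) (simp_all add: f_def)
 have "f (Suc s) * g (Suc s) - f s * (\<beta> (Suc s) * g (Suc (Suc s))) = (\<Prod>j\<le>s. \<beta> j) * g 0"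
  using IH unfolding fs r by (simp add: algebra_simps)
 then show ?case by (simp add: h_def algebra_simps)
next
 case (ge2 k)
 have f2: "f (s + Suc (Suc k)) = \<alpha> (Suc (s + k)) * f (s + Suc k) - (\<beta> (Suc (s + k)))^2 * f (s + k)" by (simp add: f_def)
 have h2: "h (Suc (Suc k)) = \<alpha> (Suc (s + k)) * h (Suc k) - (\<beta> (Suc (s + k)))^2 * h k"
  by (cases k) (simp_all add: h_def)
 have r: "\<beta> (Suc (Suc (s + k))) * g (Suc (Suc (Suc (s + k)))) = \<alpha> (Suc (s + k)) * g (Suc (Suc (s + k))) - \<beta> (Suc (s + k)) * g (Suc (s + k))"
  using ge2.prems by auto
 define P where "P = (\<Prod>j=Suc s..s + k. \<beta> j)"
 have i1: "f (s + k) * g (Suc s) = (\<Prod>j\<le>s. \<beta> j) * h k * g 0 + f s * P * g (Suc (s + k))" using ge2 by (simp add: P_def)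
 have i2: "f (s + Suc k) * g (Suc s) = (\<Prod>j\<le>s. \<beta> j) * h (Suc k) * g 0 + f s * (P * \<beta> (Suc (s + k))) * g (Suc (Suc (s + k)))"
  using ge2 by (simp add: P_def)
 have "f (s + Suc (Suc k)) * g (Suc s) = \<alpha> (Suc (s + k)) * (f (s + Suc k) * g (Suc s)) - (\<beta> (Suc (s + k)))^2 * (f (s + k) * g (Suc s))"
  unfolding f2 by (simp add: algebra_simps)
 also have "... = (\<Prod>j\<le>s. \<beta> j) * h (Suc (Suc k)) * g 0 + f s * P * \<beta> (Suc (s + k)) *
   (\<alpha> (Suc (s + k)) * g (Suc (Suc (s + k))) - \<beta> (Suc (s + k)) * g (Suc (s + k)))"
  unfolding i1 i2 h2 by (simp add: power2_eq_square algebra_simps)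
 also have "... = (\<Prod>j\<le>s. \<beta> j) * h (Suc (Suc k)) * g 0 + f s * (P * \<beta> (Suc (s + k)) * \<beta> (Suc (Suc (s + k)))) * g (Suc (Suc (Suc (s + k))))"
  unfolding r[symmetric] by (simp add: algebra_simps)
 finally show ?case by (simp add: P_def)
qed

context jac
begin

lemma \<beta>_shift: "\<beta> om (x + real n * om) k = \<beta> om x (n + k)"
 by (simp add: \<beta>_def algebra_simps)

lemma prod_\<beta>: "(\<Prod>j=m..<m + k. \<beta> om x j) = (\<Prod>j<k. cmod (b (of_real ((x + real m * om) + real j * om))))"
proof -
 have "(\<Prod>j=m..<m + k. \<beta> om x j) = (\<Prod>j<k. \<beta> om x (m + j))"
  by (rule prod.reindex_bij_witness[of _ "%j. m + j" "%j. j - m"]) auto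
 then show ?thesis unfolding \<beta>_shift[symmetric] unfolding \<beta>_def .
qed

text \<open>In Poisson's formula the boundary at distance \<open>d\<close> carries a product of
  \<open>d\<close> values of \<open>b\<close> and the determinant of the other \<open>l - d\<close>
  sites, over the full determinant. By splitting, the full determinant contains the same
  complementary one, which cancels; what remains is the product of \<open>b\<close> against the
  determinant of \<open>d\<close> sites, that is a rate \<open>\<D> + \<gamma> / 4\<close> against
  \<open>\<D> + \<gamma>\<close>. This is the \<open>3/4\<close>.\<close>

lemma green_decay:
 fixes g :: "nat => complex"
 assumes \<eta>: "0 < \<eta>" "\<eta> <= 1" and E: "abs E <= A"
  and LD: "!!n y. n <= l ==> abs (U om E \<eta> n y - integral {0..1} (U om E \<eta> n)) <= C1"
  and lyap: "!!d. d > 0 ==> real d * (\<D> + \<gamma>) - 8 * \<Lambda> \<eta> <= integral {0..1} (U om E \<eta> d)"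
  and bprod: "!!y s. (\<Prod>k<s. cmod (b (of_real (y + real k * om)))) <= exp (real s * (\<D> + \<gamma> / 4) + C2)"
  and far: "!!s. s : spec om l y ==> 4 * real l * \<eta> <= abs (s - E)" and e: "abs (e - E) * real l <= \<eta>" and s: "s < l"
  and rec: "!!j. j < l ==> of_real (\<beta> om y (Suc j)) * g (Suc (Suc j)) =
   (a (of_real (y + real j * om)) - of_real e) * g (Suc j) - of_real (\<beta> om y j) * g j"
 shows "cmod (g (Suc s)) <= exp (2 + 10 * \<Lambda> \<eta> + C1 + C2 - 3/4 * \<gamma> * real (Suc s)) * cmod (g 0)
   + exp (2 + 10 * \<Lambda> \<eta> + C1 + C2 - 3/4 * \<gamma> * real (l - s)) * cmod (g (Suc l))"
proof -
 obtain m where m: "l = s + Suc m" using s less_iff_Suc_add by (metis add_Suc_right)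
 have l: "l > 0" using s by simp
 define y' where "y' = y + real (Suc s) * om"
 let ?f = "%n y. F om (of_real e) n (complex_of_real y)"
 define \<Gamma> where "\<Gamma> = 2 + 10 * \<Lambda> \<eta> + C1 + C2"
 have eE: "abs (e - E) <= \<eta>"
 proof -
  have "abs (e - E) * 1 <= abs (e - E) * real l" using l by (intro mult_left_mono) auto
  then show ?thesis using e by simp
 qed
 have eE': "abs (e - E) * real n <= \<eta>" if "n <= l" for n
 proof -
  have "abs (e - E) * real n <= abs (e - E) * real l" using that by (intro mult_left_mono) auto
  then show ?thesis using e by simp
 qed
 have expU: "cmod (F om (Complex E \<eta>) n (of_real z)) = exp (U om E \<eta> n z)" for n z
  unfolding U_def using F_nz[OF \<eta> E] by simp
 have up: "cmod (?f n z) <= exp (1 + U om E \<eta> n z)" if "n <= l" for n z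
  using F_compare_upper[OF \<eta>(1) eE'[OF that], of om z] unfolding expU by (simp add: exp_add)
 have low: "exp (U om E \<eta> l y) <= exp 1 * cmod (?f l y)"
  using F_compare_lower[OF \<eta>(1) eE l, of om y] far unfolding expU by simp
 have Ulow: "real d * (\<D> + \<gamma>) - 8 * \<Lambda> \<eta> - C1 <= U om E \<eta> d z" if "d <= l" for d z
 proof (cases "d = 0")
  case True
  have "C1 >= 0" using LD[of 0 0] by simp
  then show ?thesis using True \<Lambda>_ge[OF \<eta>] by simp
 next
  case False
  then show ?thesis using LD[OF that, of z] lyap[of d] by (simp add: abs_le_iff)
 qed
 \<comment> \<open>\<open>n\<close> and \<open>d\<close> are complementary, and the hypothesis on
   the splitting makes \<open>U n\<close> drop out: no upper bound on it is ever used.\<close>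
 have key: "X * cmod (?f n z) <= exp (\<Gamma> - 3/4 * \<gamma> * real d) * cmod (?f l y)"
  if "n <= l" "d <= l" and X: "X <= exp (real d * (\<D> + \<gamma> / 4) + C2)" "X >= 0"
   and sp: "U om E \<eta> n z + U om E \<eta> d z' - 2 * \<Lambda> \<eta> <= U om E \<eta> l y" for X n z d z'
 proof -
  have "X * cmod (?f n z) <= exp (real d * (\<D> + \<gamma> / 4) + C2) * exp (1 + U om E \<eta> n z)"
   using X up[OF that(1)] by (intro mult_mono) auto
  also have "... = exp (real d * (\<D> + \<gamma> / 4) + C2 + 1 + U om E \<eta> n z - U om E \<eta> l y) * exp (U om E \<eta> l y)"
   unfolding exp_add[symmetric] by simp
  also have "... <= exp (\<Gamma> - 3/4 * \<gamma> * real d - 1) * exp (U om E \<eta> l y)"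
  proof -
   have "real d * (\<D> + \<gamma> / 4) + C2 + 1 + U om E \<eta> n z - U om E \<eta> l y <= \<Gamma> - 3/4 * \<gamma> * real d - 1"
    using sp Ulow[OF that(2), of z'] unfolding \<Gamma>_def by (simp add: algebra_simps)
   then show ?thesis by simp
  qed
  also have "... <= exp (\<Gamma> - 3/4 * \<gamma> * real d - 1) * (exp 1 * cmod (?f l y))"
   using low by (intro mult_left_mono) auto
  also have "... = exp (\<Gamma> - 3/4 * \<gamma> * real d) * cmod (?f l y)"
   unfolding mult.assoc[symmetric] exp_add[symmetric] by simp
  finally show ?thesis .
 qed
 have sp1: "U om E \<eta> m y' + U om E \<eta> (Suc s) y - 2 * \<Lambda> \<eta> <= U om E \<eta> l y"
  using U_split[OF \<eta> E, of om "Suc s" m y] m unfolding y'_def by (simp add: abs_le_iff)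
 have sp2: "U om E \<eta> s y + U om E \<eta> (Suc m) (y + real s * om) - 2 * \<Lambda> \<eta> <= U om E \<eta> l y"
  using U_split[OF \<eta> E, of om s "Suc m" y] m by (simp add: abs_le_iff)
 define P1 where "P1 = (\<Prod>j\<le>s. \<beta> om y j)"
 define P2 where "P2 = (\<Prod>j=Suc s..l. \<beta> om y j)"
 have P1: "P1 <= exp (real (Suc s) * (\<D> + \<gamma> / 4) + C2)" "P1 >= 0"
  using bprod[of y "Suc s"] prod_\<beta>[of om y 0 "Suc s"]
  by (simp_all add: P1_def atLeast0LessThan lessThan_Suc_atMost prod_nonneg \<beta>_def del: of_real_add of_real_mult of_nat_Suc)
 have "P2 = (\<Prod>j=Suc s..<Suc s + Suc m. \<beta> om y j)" unfolding P2_def m by (intro prod.cong) auto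
 then have P2: "P2 <= exp (real (Suc m) * (\<D> + \<gamma> / 4) + C2)" "P2 >= 0"
  unfolding prod_\<beta> by (simp_all only: bprod prod_nonneg norm_ge_zero)
 have k1: "P1 * cmod (?f m y') <= exp (\<Gamma> - 3/4 * \<gamma> * real (Suc s)) * cmod (?f l y)"
  by (rule key[OF _ _ P1 sp1]) (use m in auto)
 have k2: "P2 * cmod (?f s y) <= exp (\<Gamma> - 3/4 * \<gamma> * real (Suc m)) * cmod (?f l y)"
  by (rule key[OF _ _ P2 sp2]) (use m in auto)
 have id: "?f l y * g (Suc s) = of_real P1 * ?f m y' * g 0 + ?f s y * of_real P2 * g (Suc l)"
 proof -
  have e1: "y' + real k * om = y + real (Suc s + k) * om" for k by (simp add: y'_def algebra_simps)
  have e2: "\<beta> om y' (Suc j) = \<beta> om y (Suc (Suc s + j))" for j unfolding y'_def \<beta>_shift by simp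
  from poisson[where \<alpha> = "%k. a (of_real (y + real k * om)) - of_real e" and \<beta> = "%k. complex_of_real (\<beta> om y k)"
    and s = s and k = "Suc m" and g = g] rec
  show ?thesis unfolding F_tricont P1_def P2_def of_real_prod of_real_power e1 e2 m by simp
 qed
 define f0 where "f0 = cmod (?f l y)"
 have f0: "f0 > 0"
 proof -
  have "exp 1 * f0 > 0" using low exp_gt_zero[of "U om E \<eta> l y"] unfolding f0_def by linarith
  then show ?thesis by (simp add: zero_less_mult_iff)
 qed
 have "f0 * cmod (g (Suc s)) <= P1 * cmod (?f m y') * cmod (g 0) + P2 * cmod (?f s y) * cmod (g (Suc l))"
 proof -
  have "f0 * cmod (g (Suc s)) = cmod (of_real P1 * ?f m y' * g 0 + ?f s y * of_real P2 * g (Suc l))"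
   unfolding f0_def norm_mult[symmetric] id ..
  also have "... <= cmod (of_real P1 * ?f m y' * g 0) + cmod (?f s y * of_real P2 * g (Suc l))" by (rule norm_triangle_ineq)
  finally show ?thesis using P1 P2 by (simp add: norm_mult mult_ac)
 qed
 also have "... <= exp (\<Gamma> - 3/4 * \<gamma> * real (Suc s)) * f0 * cmod (g 0) + exp (\<Gamma> - 3/4 * \<gamma> * real (Suc m)) * f0 * cmod (g (Suc l))"
  using k1 k2 unfolding f0_def by (intro add_mono mult_right_mono) auto
 also have "... = f0 * (exp (\<Gamma> - 3/4 * \<gamma> * real (Suc s)) * cmod (g 0) + exp (\<Gamma> - 3/4 * \<gamma> * real (Suc m)) * cmod (g (Suc l)))"
  by (simp add: algebra_simps)
 finally show ?thesis using f0 m unfolding \<Gamma>_def by (simp del: of_nat_Suc)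
qed

text \<open>First site of the window of length \<open>l\<close> around \<open>t\<close>. Truncated
  subtraction and \<open>min\<close> push it inside the chain near the two ends.\<close>

definition win :: "nat => nat => nat => nat" where "win l N t = min (t - l div 2) (N - l)"

text \<open>\<open>v\<close> is \<open>u\<close> moved one step and extended by zero at both ends,
  so that the first and last rows of the matrix become ordinary instances of the recurrence.\<close>

lemma eigen_rec:
 fixes u :: "nat => complex"
 assumes ev: "(\<Sum>m<N. TM om x i m * u m) = of_real e * u i" and that: "i < N"
 defines "v \<equiv> %i. if i = 0 \<or> i > N then 0 else u (i - 1)"
 shows "of_real (\<beta> om x (Suc i)) * v (Suc (Suc i)) =
   (a (of_real (x + real i * om)) - of_real e) * v (Suc i) - of_real (\<beta> om x i) * v i"
proof -
 have "(\<Sum>m<N. TM om x i m * u m) = (\<Sum>m<N. (if m = i then a (of_real (x + real i * om)) * u i else 0)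
   + (if m = Suc i then - of_real (\<beta> om x (Suc i)) * u (Suc i) else 0)
   + (if Suc m = i then - of_real (\<beta> om x i) * u (i - 1) else 0))"
  by (intro sum.cong refl) (auto simp: TM_def)
 also have "... = a (of_real (x + real i * om)) * u i
   + (if Suc i < N then - of_real (\<beta> om x (Suc i)) * u (Suc i) else 0)
   + (if 0 < i then - of_real (\<beta> om x i) * u (i - 1) else 0)"
 proof -
  have 1: "(\<Sum>m<N. if m = i then a (of_real (x + real i * om)) * u i else 0) = a (of_real (x + real i * om)) * u i"
   using that by (simp add: sum.delta)
  have 2: "(\<Sum>m<N. if m = Suc i then - of_real (\<beta> om x (Suc i)) * u (Suc i) else 0) =
    (if Suc i < N then - of_real (\<beta> om x (Suc i)) * u (Suc i) else 0)"
   by (simp add: sum.delta)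
  have 3: "(\<Sum>m<N. if Suc m = i then - of_real (\<beta> om x i) * u (i - 1) else 0) =
    (if 0 < i then - of_real (\<beta> om x i) * u (i - 1) else 0)"
  proof (cases i)
   case (Suc r)
   then show ?thesis using that by (simp add: sum.delta)
  qed simp
  show ?thesis unfolding sum.distrib 1 2 3 ..
 qed
 finally have "a (of_real (x + real i * om)) * u i
   + (if Suc i < N then - of_real (\<beta> om x (Suc i)) * u (Suc i) else 0)
   + (if 0 < i then - of_real (\<beta> om x i) * u (i - 1) else 0) = of_real e * u i" using ev by simp
 then show ?thesis using that unfolding v_def by (auto simp: algebra_simps simp del: of_real_add of_real_mult split: if_splits)
qed

text \<open>On each side, either the boundary of the window is at distance at least
  \<open>l div 2\<close> from \<open>t\<close>, or it is an end of the chain, where the extended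
  vector vanishes and contributes nothing.\<close>

lemma site_decay:
 fixes u :: "nat => complex"
 assumes \<eta>: "0 < \<eta>" "\<eta> <= 1" and E: "abs E <= A"
  and LD: "!!n y. n <= l ==> abs (U om E \<eta> n y - integral {0..1} (U om E \<eta> n)) <= C1"
  and lyap: "!!d. d > 0 ==> real d * (\<D> + \<gamma>) - 8 * \<Lambda> \<eta> <= integral {0..1} (U om E \<eta> d)"
  and bprod: "!!y s. (\<Prod>k<s. cmod (b (of_real (y + real k * om)))) <= exp (real s * (\<D> + \<gamma> / 4) + C2)"
  and \<gamma>: "\<gamma> > 0" and l: "0 < l" "l <= N" and t: "t < N"
  and far: "!!s. s : spec om l (x + real (win l N t) * om) ==> 4 * real l * \<eta> <= abs (s - E)" and e: "abs (e - E) * real l <= \<eta>"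
  and ev: "!!i. i < N ==> (\<Sum>m<N. TM om x i m * u m) = of_real e * u i"
  and bd: "!!i. i < N ==> cmod (u i) <= K"
 shows "cmod (u t) <= 2 * exp (2 + 10 * \<Lambda> \<eta> + C1 + C2 - 3/4 * \<gamma> * real (l div 2)) * K"
proof -
 define n where "n = win l N t"
 define y where "y = x + real n * om"
 define s where "s = t - n"
 have n: "n <= t" "n + l <= N" using l t unfolding n_def win_def by auto
 have s: "s < l" "t = n + s" using n t l unfolding s_def n_def win_def min_def by (auto split: if_splits)
 define v where "v i = (if i = 0 \<or> i > N then 0 else u (i - 1))" for i
 define g where "g j = v (n + j)" for j
 have tri: "of_real (\<beta> om x (Suc i)) * v (Suc (Suc i)) =
   (a (of_real (x + real i * om)) - of_real e) * v (Suc i) - of_real (\<beta> om x i) * v i" if "i < N" for i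
  unfolding v_def by (rule eigen_rec[OF ev[OF that] that])
 have rec: "of_real (\<beta> om y (Suc j)) * g (Suc (Suc j)) =
   (a (of_real (y + real j * om)) - of_real e) * g (Suc j) - of_real (\<beta> om y j) * g j" if "j < l" for j
 proof -
  have e: "y + real j * om = x + real (n + j) * om" by (simp add: y_def algebra_simps)
  show ?thesis using tri[of "n + j"] that n unfolding e unfolding y_def \<beta>_shift g_def by simp
 qed
 have "cmod (u t) = cmod (g (Suc s))" using t s unfolding g_def v_def by simp
 also have "... <= exp (2 + 10 * \<Lambda> \<eta> + C1 + C2 - 3/4 * \<gamma> * real (Suc s)) * cmod (g 0)
   + exp (2 + 10 * \<Lambda> \<eta> + C1 + C2 - 3/4 * \<gamma> * real (l - s)) * cmod (g (Suc l))"
  by (rule green_decay[OF \<eta> E LD lyap bprod _ e s(1) rec]) (use far in \<open>auto simp: y_def n_def\<close>)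
 also have "... <= exp (2 + 10 * \<Lambda> \<eta> + C1 + C2 - 3/4 * \<gamma> * real (l div 2)) * K +
   exp (2 + 10 * \<Lambda> \<eta> + C1 + C2 - 3/4 * \<gamma> * real (l div 2)) * K"
 proof -
  have K: "0 <= K" using bd[OF t] norm_ge_zero order_trans by blast
  have mono: "exp (X - 3/4 * \<gamma> * real p) <= exp (X - 3/4 * \<gamma> * real q)" if "q <= p" for X p q
   using that \<gamma> by simp
  have 1: "exp (X - 3/4 * \<gamma> * real (Suc s)) * cmod (g 0) <= exp (X - 3/4 * \<gamma> * real (l div 2)) * K" for X
  proof (cases "n = 0")
   case True
   then show ?thesis using K by (simp add: g_def v_def)
  next
   case False
   have q: "q <= Suc (t - min (t - q) (N - l))" if "min (t - q) (N - l) ~= 0" for q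
    using that unfolding min_def by (cases "t - q <= N - l") simp_all
   have "l div 2 <= Suc s" unfolding s_def n_def win_def
    by (rule q, fold win_def, fold n_def, rule False)
   moreover have "cmod (g 0) <= K" using False n t bd[of "n - 1"] by (simp add: g_def v_def)
   ultimately show ?thesis by (intro mult_mono mono exp_ge_zero norm_ge_zero)
  qed
  have 2: "exp (X - 3/4 * \<gamma> * real (l - s)) * cmod (g (Suc l)) <= exp (X - 3/4 * \<gamma> * real (l div 2)) * K" for X
  proof (cases "n + l = N")
   case True
   then show ?thesis using K by (simp add: g_def v_def)
  next
   case False
   have q: "q <= l - (t - min (t - q) (N - l))" if "2 * q <= l" "min (t - q) (N - l) + l ~= N" "min (t - q) (N - l) + l <= N" for q
    using that unfolding min_def by (cases "t - q <= N - l") simp_all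
   have "l div 2 <= l - s" unfolding s_def n_def win_def
    by (rule q, simp, fold win_def, fold n_def, rule False, rule n(2))
   moreover have "cmod (g (Suc l)) <= K" using False n bd[of "n + l"] by (simp add: g_def v_def)
   ultimately show ?thesis by (intro mult_mono mono exp_ge_zero norm_ge_zero)
  qed
  show ?thesis by (intro add_mono 1 2)
 qed
 finally show ?thesis by (simp add: mult_ac)
qed

end

section \<open>Elimination of double resonances\<close>

lemma grid_cell:
 fixes y :: real
 assumes "0 <= y" "y <= real k" "k > 0"
 obtains i where "i < k" "real i <= y" "y <= real i + 1"
proof (cases "nat \<lfloor>y\<rfloor> <= k - 1")
 case True
 show ?thesis
 proof (rule that[of "nat \<lfloor>y\<rfloor>"])
  show "nat \<lfloor>y\<rfloor> < k" using True assms(3) by simp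
  show "real (nat \<lfloor>y\<rfloor>) <= y" using assms(1) by simp
  show "y <= real (nat \<lfloor>y\<rfloor>) + 1" by linarith
 qed
next
 case False
 then have "real k <= real (nat \<lfloor>y\<rfloor>)" by simp
 also have "... <= y" using assms(1) by simp
 finally show ?thesis using assms(2,3) by (intro that[of "k - 1"]) (auto simp: of_nat_diff)
qed

text \<open>Number and common length of the covering intervals are tracked separately: refinement
  multiplies the number while the length shrinks much faster, and only the final product is a
  measure.\<close>

definition cov :: "real set => nat => real => bool" where
 "cov B m r \<longleftrightarrow> (\<exists>X. finite X & card X <= m & B \<subseteq> (\<Union>u\<in>X. {u..u + r}))"

lemma cov_empty [simp]: "cov {} m r"
 unfolding cov_def by (intro exI[of _ "{}"]) auto

lemma cov_mono: "cov B m r ==> B' \<subseteq> B ==> r <= r' ==> cov B' m r'"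
 unfolding cov_def by (elim exE conjE) (intro exI conjI, assumption, assumption, force)

lemma cov_refine:
 assumes "cov B m r" and "!!u. cov (B \<inter> {u..u + r}) m' r'"
 shows "cov B (m * m') r'"
proof -
 obtain X where X: "finite X" "card X <= m" "B \<subseteq> (\<Union>u\<in>X. {u..u + r})" using assms(1) unfolding cov_def by auto
 from assms(2) have "\<exists>Y. finite Y & card Y <= m' & B \<inter> {u..u + r} \<subseteq> (\<Union>v\<in>Y. {v..v + r'})" for u
  unfolding cov_def .
 then obtain Y where Y: "!!u. finite (Y u)" "!!u. card (Y u) <= m'" "!!u. B \<inter> {u..u + r} \<subseteq> (\<Union>v\<in>Y u. {v..v + r'})"
  by metis
 show ?thesis unfolding cov_def
 proof (intro exI[of _ "\<Union>u\<in>X. Y u"] conjI)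
  have "card (\<Union>u\<in>X. Y u) <= (\<Sum>u\<in>X. card (Y u))" by (rule card_UN_le[OF X(1)])
  also have "... <= card X * m'" using sum_bounded_above[of X "%u. card (Y u)" m'] Y(2) by simp
  finally show "card (\<Union>u\<in>X. Y u) <= m * m'" using X(2) by (meson mult_le_mono1 order_trans)
  show "B \<subseteq> (\<Union>u\<in>\<Union>u\<in>X. Y u. {u..u + r'})"
  proof
   fix z assume z: "z : B"
   then obtain u where u: "u : X" "z : {u..u + r}" using X(3) by blast
   then have "z : (\<Union>v\<in>Y u. {v..v + r'})" using z Y(3)[of u] by blast
   then show "z : (\<Union>u\<in>\<Union>u\<in>X. Y u. {u..u + r'})" using u by blast
  qed
 qed (use X Y in auto)
qed

text \<open>Passes to a fixed grid of frequencies, common to all energies, so that exceptional sets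
  of different energies can be counted against each other.\<close>

lemma cov_cells:
 assumes cov: "cov B m r" and g: "g > 0" and r: "r >= 0"
 shows "finite {i::nat. B \<inter> {real i * g..(real i + 1) * g} ~= {}}"
  "real (card {i::nat. B \<inter> {real i * g..(real i + 1) * g} ~= {}}) <= real m * (r / g + 2)"
proof -
 obtain X where X: "finite X" "card X <= m" "B \<subseteq> (\<Union>u\<in>X. {u..u + r})" using cov unfolding cov_def by auto
 define I where "I u = {i::int. u / g - 1 <= of_int i & of_int i <= (u + r) / g}" for u
 have I: "I u = {\<lceil>u / g - 1\<rceil>..\<lfloor>(u + r) / g\<rfloor>}" for u unfolding I_def by (simp only: set_eq_iff mem_Collect_eq atLeastAtMost_iff ceiling_le_iff le_floor_iff simp_thms)
 have cardI: "real (card (I u)) <= r / g + 2" for u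
 proof -
  have "of_int \<lfloor>(u + r) / g\<rfloor> - of_int \<lceil>u / g - 1\<rceil> <= (u + r) / g - (u / g - 1)" by linarith
  also have "... = r / g + 1" using g by (simp add: field_simps)
  finally have "real_of_int (\<lfloor>(u + r) / g\<rfloor> - \<lceil>u / g - 1\<rceil> + 1) <= r / g + 2" by simp
  moreover have "r / g >= 0" using g r by simp
  ultimately show ?thesis unfolding I by (auto simp: card_atLeastAtMost_int)
 qed
 have sub: "int ` {i::nat. B \<inter> {real i * g..(real i + 1) * g} ~= {}} \<subseteq> (\<Union>u\<in>X. I u)"
 proof
  fix j assume "j : int ` {i::nat. B \<inter> {real i * g..(real i + 1) * g} ~= {}}"
  then obtain i where j: "j = int i" "B \<inter> {real i * g..(real i + 1) * g} ~= {}" by blast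
  then obtain z where "z : B" "z : {real i * g..(real i + 1) * g}" by blast
  then have i: "j = int i" "z : B" "real i * g <= z" "z <= (real i + 1) * g" using j by auto
  then obtain u where u: "u : X" "u <= z" "z <= u + r" using X(3) by fastforce
  have "u <= (real i + 1) * g" "real i * g <= u + r" using u i by linarith+
  then have "j : I u" unfolding I_def i(1) using g by (simp add: field_simps)
  then show "j : (\<Union>u\<in>X. I u)" using u by blast
 qed
 have fin: "finite (\<Union>u\<in>X. I u)" using X unfolding I by auto
 show fin': "finite {i::nat. B \<inter> {real i * g..(real i + 1) * g} ~= {}}"
  using finite_subset[OF sub fin] by (rule finite_imageD) simp
 have "card {i::nat. B \<inter> {real i * g..(real i + 1) * g} ~= {}} = card (int ` {i::nat. B \<inter> {real i * g..(real i + 1) * g} ~= {}})"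
  by (rule card_image[symmetric]) simp
 also have "... <= card (\<Union>u\<in>X. I u)" by (rule card_mono[OF fin sub])
 also have "... <= (\<Sum>u\<in>X. card (I u))" by (rule card_UN_le[OF X(1)])
 finally have "real (card {i::nat. B \<inter> {real i * g..(real i + 1) * g} ~= {}}) <= (\<Sum>u\<in>X. real (card (I u)))"
  unfolding of_nat_sum[symmetric] of_nat_le_iff .
 also have "... <= real (card X) * (r / g + 2)" using sum_bounded_above[of X "%u. real (card (I u))"] cardI by simp
 also have "... <= real m * (r / g + 2)" using X(2) g r by (intro mult_right_mono) auto
 finally show "real (card {i::nat. B \<inter> {real i * g..(real i + 1) * g} ~= {}}) <= real m * (r / g + 2)" .
qed

text \<open>Between consecutive points of \<open>Z\<close> a connected interval is covered by the
  two disjoint open sets \<open>S\<close> and the interior of its complement, hence it lies entirely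
  in one of them.\<close>

lemma open_set_arcs:
 fixes S Z :: "real set"
 assumes S: "open S" and Z: "finite Z"
  and bdry: "!!y. y : {0..1} ==> y \<notin> S ==> y \<notin> Z ==> \<exists>d>0. ball y d \<inter> S = {}"
 obtains V where "finite V" "card V <= card Z + 1"
  "!!u v. (u, v) : V ==> u <= v & 0 <= u & v <= 1 & {u<..<v} \<subseteq> S" "S \<inter> {0..1} \<subseteq> (\<Union>(u, v)\<in>V. {u..v})"
proof -
 define Z' where "Z' = insert 0 (insert 1 (Z \<inter> {0..1}))"
 have fZ: "finite Z'" "0 : Z'" "1 : Z'" "Z' \<subseteq> {0..1}" using Z by (auto simp: Z'_def)
 define nx where "nx u = Min {z : Z'. u < z}" for u
 have nx: "nx u : Z'" "u < nx u" "!!z. z : Z' ==> u < z ==> nx u <= z" if "u < 1" for u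
 proof -
  have "finite {z : Z'. u < z}" "{z : Z'. u < z} ~= {}" using fZ that by auto
  from Min_in[OF this] Min_le[OF this(1)] show "nx u : Z'" "u < nx u" "!!z. z : Z' ==> u < z ==> nx u <= z"
   unfolding nx_def by auto
 qed
 define V where "V = (%u. (u, nx u)) ` {u : Z' - {1}. {u<..<nx u} \<subseteq> S}"
 have dich: "{u<..<nx u} \<subseteq> S" if u: "u : Z'" "u < 1" and y: "y : {u<..<nx u}" "y : S" for u y
 proof (rule ccontr)
  assume "\<not> {u<..<nx u} \<subseteq> S"
  then obtain z where z: "z : {u<..<nx u}" "z \<notin> S" by blast
  have np: "x : {0..1} & x \<notin> Z" if "x : {u<..<nx u}" for x
  proof -
   have x: "x : {0..1}" using that u fZ nx(1)[OF u(2)] by force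
   have "x \<notin> Z'" using nx(3)[OF u(2), of x] that by force
   then show ?thesis using x by (auto simp: Z'_def)
  qed
  have "connected {u<..<nx u}" by simp
  moreover define W where "W = {x. \<exists>d>0. ball x d \<inter> S = {}}"
  have "open W" unfolding open_contains_ball
  proof
   fix x assume "x : W"
   then obtain d where d: "d > 0" "ball x d \<inter> S = {}" by (auto simp: W_def)
   have "ball x d \<subseteq> W"
   proof
    fix w assume w: "w : ball x d"
    then obtain d' where "d' > 0" "ball w d' \<subseteq> ball x d" by (meson open_ball open_contains_ball)
    then show "w : W" using d unfolding W_def by blast
   qed
   then show "\<exists>e>0. ball x e \<subseteq> W" using d by blast
  qed
  moreover have "{u<..<nx u} \<subseteq> S \<union> W"
  proof
   fix x assume x: "x : {u<..<nx u}"
   show "x : S \<union> W" using np[OF x] bdry[of x] by (auto simp: W_def)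
  qed
  moreover have "S \<inter> W = {}" by (force simp: W_def)
  ultimately have "{u<..<nx u} \<inter> S = {} \<or> {u<..<nx u} \<inter> W = {}"
   using S connectedD[of "{u<..<nx u}" S W] by (metis inf_bot_left inf_commute)
  moreover have "z : W" using np[OF z(1)] bdry z unfolding W_def by blast
  ultimately show False using y z by blast
 qed
 show thesis
 proof (rule that[of V])
  show "finite V" using fZ by (simp add: V_def)
  have "card V <= card {u : Z' - {1}. {u<..<nx u} \<subseteq> S}" unfolding V_def using fZ by (intro card_image_le) auto
  also have "... <= card (insert 0 Z)" by (rule card_mono) (auto simp: Z Z'_def)
  also have "... <= card Z + 1" using card_insert_le_m1[of "card Z + 1" Z 0] by simp
  finally show "card V <= card Z + 1" .
  show "u <= v & 0 <= u & v <= 1 & {u<..<v} \<subseteq> S" if "(u, v) : V" for u v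
  proof -
   have u: "u : Z'" "u ~= 1" "v = nx u" "{u<..<v} \<subseteq> S" using that by (auto simp: V_def)
   then have "u < 1" using fZ by force
   from nx[OF this] u fZ show ?thesis by force
  qed
  show "S \<inter> {0..1} \<subseteq> (\<Union>(u, v)\<in>V. {u..v})"
  proof
   fix y assume y: "y : S \<inter> {0..1}"
   obtain d where d: "d > 0" "ball y d \<subseteq> S" using S y by (auto simp: open_contains_ball)
   define u where "u = (if y < 1 then Max {z : Z'. z <= y} else Max {z : Z'. z < 1})"
   have u: "u : Z'" "u < 1" "u <= y" "y <= nx u" "\<exists>x\<in>{u<..<nx u}. x : S"
   proof -
    show 1: "u : Z'" "u < 1" "u <= y" "y <= nx u"
    proof -
     have a: "finite {z : Z'. z <= y}" "{z : Z'. z <= y} ~= {}" using fZ y by auto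
     have b: "finite {z : Z'. z < 1}" "{z : Z'. z < 1} ~= {}" using fZ by auto
     show 2: "u : Z'" "u < 1" "u <= y" using Max_in[OF a] Max_in[OF b] y unfolding u_def by (auto split: if_splits)
     show "y <= nx u"
     proof (rule ccontr)
      assume "\<not> y <= nx u"
      then have n: "nx u < y" by simp
      have "nx u <= u" using Max_ge[OF a(1), of "nx u"] Max_ge[OF b(1), of "nx u"] n nx(1)[OF 2(2)] y unfolding u_def
       by (auto split: if_splits)
      then show False using nx(2)[OF 2(2)] by simp
     qed
    qed
    show "\<exists>x\<in>{u<..<nx u}. x : S"
    proof (cases "y < nx u")
     case True
     define x where "x = min (y + d / 2) ((y + nx u) / 2)"
     have "x : ball y d" "u < x" "x < nx u" using d True 1 by (auto simp: x_def dist_real_def min_def)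
     then show ?thesis using d by (intro bexI[of _ x]) auto
    next
     case False
     then have y1: "y = nx u" using 1 by simp
     define x where "x = max (y - d / 2) ((y + u) / 2)"
     have "x : ball y d" "u < x" "x < nx u" using d 1 y1 nx(2)[OF 1(2)] by (auto simp: x_def dist_real_def max_def field_simps)
     then show ?thesis using d by (intro bexI[of _ x]) auto
    qed
   qed
   then have "(u, nx u) : V" using dich[of u] unfolding V_def by blast
   then show "y : (\<Union>(u, v)\<in>V. {u..v})" using u by (intro UN_I[of "(u, nx u)"]) auto
  qed
 qed
qed

text \<open>Two returns to the same arcs pin down \<open>k * om\<close> modulo one.\<close>

lemma return_cover:
 fixes S :: "real set"
 assumes per: "!!y m. y : S ==> y + of_int m : S"
  and V: "finite V" "card V <= n" "!!u v. (u, v) : V ==> v - u <= \<sigma>" "S \<inter> {0..1} \<subseteq> (\<Union>(u, v)\<in>V. {u..v})"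
  and k: "k > 0" "real k * w <= 1"
 shows "cov {om : {q..q + w}. \<exists>y. y : S & y + real k * om : S} (3 * n^2) (2 * \<sigma> / real k)"
proof -
 \<comment> \<open>When \<open>om\<close> runs through an interval of length \<open>w\<close> with
   \<open>k * w <= 1\<close>, the integer part \<open>m\<close> of \<open>y0 + k * om\<close> takes
   at most three values; the other choices are a start arc and an end arc.\<close>
 define X where "X = (%(p, p', m). (fst p' - snd p + of_int m) / real k) ` (V \<times> V \<times> {\<lfloor>real k * q\<rfloor>..\<lfloor>real k * q\<rfloor> + 2})"
 show ?thesis unfolding cov_def
 proof (intro exI[of _ X] conjI)
  show "finite X" using V by (simp add: X_def)
  have "card X <= card (V \<times> V \<times> {\<lfloor>real k * q\<rfloor>..\<lfloor>real k * q\<rfloor> + 2})" unfolding X_def using V by (intro card_image_le) auto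
  also have "... = 3 * (card V)^2" by (simp add: card_cartesian_product power2_eq_square)
  also have "... <= 3 * n^2" using V by (simp add: power_mono)
  finally show "card X <= 3 * n^2" .
  show "{om : {q..q + w}. \<exists>y. y : S & y + real k * om : S} \<subseteq> (\<Union>u\<in>X. {u..u + 2 * \<sigma> / real k})"
  proof clarify
   fix om y assume om: "om : {q..q + w}" and y: "y : S" "y + real k * om : S"
   define y0 where "y0 = y + of_int (- \<lfloor>y\<rfloor>)"
   have y0: "y0 : S" "0 <= y0" "y0 < 1" using per[OF y(1)] unfolding y0_def by (blast, simp, linarith)
   define m where "m = \<lfloor>y0 + real k * om\<rfloor>"
   define y1 where "y1 = y0 + real k * om - of_int m"
   have "y1 = (y + real k * om) + of_int (- \<lfloor>y\<rfloor> - m)" by (simp add: y1_def y0_def)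
   then have y1: "y1 : S" "0 <= y1" "y1 < 1"
    using per[OF y(2)] apply metis unfolding y1_def m_def by linarith+
   obtain u v where uv: "(u, v) : V" "u <= y0" "y0 <= v" using V(4) y0 by fastforce
   obtain u' v' where uv': "(u', v') : V" "u' <= y1" "y1 <= v'" using V(4) y1 by fastforce
   have "real k * om >= real k * q" "real k * om <= real k * (q + w)" using om by (auto intro: mult_left_mono)
   then have kw: "real k * q <= real k * om" "real k * om <= real k * q + 1" using k by (simp_all add: algebra_simps)
   have m: "m : {\<lfloor>real k * q\<rfloor>..\<lfloor>real k * q\<rfloor> + 2}" using kw y0 unfolding m_def by (simp add: le_floor_iff floor_le_iff) linarith
   define x where "x = (u' - v + of_int m) / real k"
   have "x : X" unfolding X_def x_def using uv uv' m by (intro image_eqI[of _ _ "((u, v), (u', v'), m)"]) auto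
   moreover have "x <= om" "om <= x + 2 * \<sigma> / real k"
   proof -
    have kx: "real k * x = u' - v + of_int m" using k by (simp add: x_def)
    have e: "real k * om = y1 - y0 + of_int m" by (simp add: y1_def)
    have "real k * x <= real k * om" unfolding kx e using uv uv' by simp
    then show "x <= om" using k by simp
    have "real k * om <= real k * (x + 2 * \<sigma> / real k)"
     using uv uv' V(3)[OF uv(1)] V(3)[OF uv'(1)] k unfolding distrib_left kx e by simp
    then show "om <= x + 2 * \<sigma> / real k" using k by simp
   qed
   ultimately show "om : (\<Union>u\<in>X. {u..u + 2 * \<sigma> / real k})" by auto
  qed
 qed
qed

lemma strip_zero_count:
 assumes G: "G holomorphic_on strip \<rho>" and \<rho>: "\<rho> > 0"
  and M: "!!z. z : strip \<rho> ==> cmod (G z) <= M"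
  and m: "m > 0" "!!i. i < nc \<rho> ==> m <= cmod (G (of_real (ctr \<rho> i)))"
 shows "finite {x\<in>{0..1}. G (of_real x) = 0}" "real (card {x\<in>{0..1}. G (of_real x) = 0}) <= real (nc \<rho>) * log 2 (M / m)"
proof -
 have ex: "\<exists>zs :: complex list. real (length zs) <= log 2 (M / m) &
   (\<forall>x. abs (x - ctr \<rho> i) <= \<rho> / 8 --> G (of_real x) = 0 --> of_real x : set zs)" if i: "i < nc \<rho>" for i
 proof -
  interpret disc_bound G "of_real (ctr \<rho> i)" "\<rho> / 8" \<rho> M m
  proof
   show "G holomorphic_on ball (of_real (ctr \<rho> i)) \<rho>" by (rule holomorphic_on_subset[OF G ball_subset_strip])
   show "cmod (G z) <= M" if "z : ball (of_real (ctr \<rho> i)) \<rho>" for z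
    by (rule M) (use that ball_subset_strip in blast)
  qed (use m i \<rho> in auto)
  obtain zs g where g: "set zs \<subseteq> cball (of_real (ctr \<rho> i)) (2 * (\<rho> / 8))" "g holomorphic_on ball (of_real (ctr \<rho> i)) \<rho>"
   "!!z. z : ball (of_real (ctr \<rho> i)) \<rho> ==> G z = zfac zs z * g z"
   "!!z. z : cball (of_real (ctr \<rho> i)) (2 * (\<rho> / 8)) ==> g z ~= 0" by (rule factorization, rule that)
  have "2 ^ length zs <= M / m" by (rule zeros_bound[OF g(1,2,3)])
  then have "real (length zs) <= log 2 (M / m)"
   using M_pos m(1) by (subst le_log_iff) (auto simp: powr_realpow)
  moreover have "of_real x : set zs" if x: "abs (x - ctr \<rho> i) <= \<rho> / 8" "G (of_real x) = 0" for x
  proof -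
   have d: "dist (complex_of_real (ctr \<rho> i)) (of_real x) <= \<rho> / 8" using x by (simp add: dist_of_real dist_real_def abs_minus_commute)
   then have "g (of_real x) ~= 0" "G (of_real x) = zfac zs (of_real x) * g (of_real x)" using g(3,4)[of "of_real x"] \<rho> by auto
   then have "zfac zs (of_real x) = 0" using x by (metis mult_eq_0_iff)
   then show ?thesis using zfac_eq_0_iff by blast
  qed
  ultimately show ?thesis by blast
 qed
 then have "\<forall>i\<in>{..<nc \<rho>}. \<exists>zs :: complex list. real (length zs) <= log 2 (M / m) &
   (\<forall>x. abs (x - ctr \<rho> i) <= \<rho> / 8 --> G (of_real x) = 0 --> of_real x : set zs)" by auto
 from bchoice[OF this] obtain zs :: "nat => complex list" where zs: "!!i. i < nc \<rho> ==> real (length (zs i)) <= log 2 (M / m)"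
  "!!i x. i < nc \<rho> ==> abs (x - ctr \<rho> i) <= \<rho> / 8 ==> G (of_real x) = 0 ==> of_real x : set (zs i)" by auto
 have sub: "{x\<in>{0..1}. G (of_real x) = 0} \<subseteq> Re ` (\<Union>i<nc \<rho>. set (zs i))"
 proof
  fix x assume x: "x : {x\<in>{0..1}. G (complex_of_real x) = 0}"
  have nc: "4 / \<rho> <= real (nc \<rho>)" by (rule nc_ge[OF \<rho>])
  then have nc0: "nc \<rho> > 0" using \<rho> by (metis divide_pos_pos not_less of_nat_0_less_iff order_less_le_trans zero_less_numeral)
  have x4: "0 <= 4 * x / \<rho>" "4 * x / \<rho> <= 4 / \<rho>" using x \<rho> by (auto intro!: divide_right_mono)
  obtain i where i: "i < nc \<rho>" and le: "real i <= 4 * x / \<rho>" "4 * x / \<rho> <= real i + 1"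
   by (rule grid_cell[OF x4(1) order_trans[OF x4(2) nc] nc0])
  have "abs (x - ctr \<rho> i) <= \<rho> / 8" using le \<rho> unfolding ctr_def by (simp add: field_simps abs_le_iff)
  then have "of_real x : set (zs i)" using zs(2)[OF i] x by auto
  then show "x : Re ` (\<Union>i<nc \<rho>. set (zs i))" using i by (intro image_eqI[of _ _ "of_real x"]) auto
 qed
 show "finite {x\<in>{0..1}. G (of_real x) = 0}" by (rule finite_subset[OF sub]) auto
 have "card {x\<in>{0..1}. G (of_real x) = 0} <= card (Re ` (\<Union>i<nc \<rho>. set (zs i)))" by (rule card_mono[OF _ sub]) auto
 also have "... <= card (\<Union>i<nc \<rho>. set (zs i))" by (rule card_image_le) auto
 also have "... <= (\<Sum>i<nc \<rho>. card (set (zs i)))" by (rule card_UN_le) auto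
 finally have "real (card {x\<in>{0..1}. G (of_real x) = 0}) <= (\<Sum>i<nc \<rho>. real (card (set (zs i))))"
  unfolding of_nat_sum[symmetric] of_nat_le_iff .
 also have "... <= (\<Sum>i<nc \<rho>. log 2 (M / m))"
 proof (rule sum_mono)
  fix i assume "i : {..<nc \<rho>}"
  then show "real (card (set (zs i))) <= log 2 (M / m)" using zs(1)[of i] card_length[of "zs i"] by (simp add: order_trans[rotated])
 qed
 finally show "real (card {x\<in>{0..1}. G (of_real x) = 0}) <= real (nc \<rho>) * log 2 (M / m)" by simp
qed

section \<open>Sets of resonant phases\<close>

context jac
begin

definition res :: "real => nat => real => real => real set" where
 "res om l e E = {y. \<exists>s\<in>spec om l y. abs (s - E) < e}"

definition Lip :: real where "Lip = 6 * A / \<rho>"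

lemma Lip_pos: "Lip > 0"
 using A \<rho> by (simp add: Lip_def)

lemma spec_per: "spec om l (y + of_int m) = spec om l y"
proof -
 have "per (%y. F om (of_real E) l (of_real y))" for E
  unfolding per_def using F_per \<rho> by simp
 from per_int[OF this] show ?thesis unfolding spec_def by simp
qed

lemma res_per: "y : res om l e E ==> y + of_int m : res om l e E"
 by (simp add: res_def spec_per)

lemma res_mono: "e <= e' ==> res om l e E \<subseteq> res om l e' E"
 by (force simp: res_def)

lemma res_Lipschitz:
 assumes "y : res om l e E" "Lip * (abs (y - y') + real l * abs (om - om')) <= d"
 shows "y' : res om' l (e + d) E"
proof -
 obtain s where s: "s : spec om l y" "abs (s - E) < e" using assms(1) by (auto simp: res_def)
 from spec_Lipschitz[OF s(1), of om' y', folded Lip_def] obtain s' where "s' : spec om' l y'" "abs (s - s') <= d" using assms(2) by fastforce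
 then show ?thesis unfolding res_def using s(2) by (intro CollectI bexI[of _ s']) auto
qed

lemma open_res: "open (res om l e E)"
 unfolding open_contains_ball
proof
 fix y assume "y : res om l e E"
 then obtain s where s: "s : spec om l y" "abs (s - E) < e" by (auto simp: res_def)
 define d where "d = e - abs (s - E)"
 have d: "d > 0" using s by (simp add: d_def)
 have "ball y (d / (2 * Lip)) \<subseteq> res om l e E"
 proof
  fix y' assume "y' : ball y (d / (2 * Lip))"
  then have "abs (y - y') < d / (2 * Lip)" by (simp only: mem_ball dist_real_def)
  then have "abs (y - y') * (2 * Lip) < d" using Lip_pos by (subst (asm) pos_less_divide_eq) auto
  then have "Lip * (abs (y - y') + real l * abs (om - om)) <= d / 2" by (simp add: algebra_simps)
  moreover have "y : res om l (e - d / 2) E" unfolding res_def using s d by (intro CollectI bexI[of _ s]) (auto simp: d_def field_simps)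
  ultimately have "y' : res om l (e - d / 2 + d / 2) E" by (intro res_Lipschitz)
  then show "y' : res om l e E" by simp
 qed
 moreover have "d / (2 * Lip) > 0" using d Lip_pos by (intro divide_pos_pos) auto
 ultimately show "\<exists>r>0. ball y r \<subseteq> res om l e E" by blast
qed

text \<open>At a boundary point some eigenvalue lies exactly at \<open>E + e\<close> or
  \<open>E - e\<close>. The boundary therefore consists of zeros of two determinants, which
  \<open>boundary_count\<close> bounds.\<close>

lemma res_boundary:
 assumes "y \<notin> res om l e E" "E + e \<notin> spec om l y" "E - e \<notin> spec om l y"
 shows "\<exists>d>0. ball y d \<inter> res om l e E = {}"
proof -
 define D where "D = insert 1 ((%s. abs (s - E) - e) ` spec om l y)"
 have fD: "finite D" "D ~= {}" using finite_spec by (auto simp: D_def)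
 have "x > 0" if "x : D" for x
 proof (cases "x = 1")
  case False
  then obtain s where s: "s : spec om l y" "x = abs (s - E) - e" using \<open>x \<in> D\<close> by (auto simp: D_def)
  then have "abs (s - E) >= e" using assms(1) by (auto simp: res_def not_less)
  moreover have "abs (s - E) ~= e"
  proof
   assume "abs (s - E) = e"
   then have "s = E + e \<or> s = E - e" by linarith
   then show False using s assms by blast
  qed
  ultimately show ?thesis using s by simp
 qed simp
 moreover define d where "d = Min D"
 ultimately have d: "d > 0" using Min_in[OF fD] by blast
 have "y' \<notin> res om l e E" if "y' : ball y (d / Lip)" for y'
 proof
  assume "y' : res om l e E"
  moreover have "abs (y' - y) < d / Lip" using that by (simp only: mem_ball dist_real_def abs_minus_commute)
  then have "abs (y' - y) * Lip < d" using Lip_pos by (subst (asm) pos_less_divide_eq)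
  then have "Lip * (abs (y' - y) + real l * abs (om - om)) <= d" by (simp add: mult.commute)
  ultimately have "y : res om l (e + d) E" by (rule res_Lipschitz)
  then obtain s where s: "s : spec om l y" "abs (s - E) < e + d" by (auto simp: res_def)
  have "d <= abs (s - E) - e" unfolding d_def by (rule Min_le[OF fD(1)]) (use s in \<open>simp add: D_def\<close>)
  then show False using s by simp
 qed
 moreover have "d / Lip > 0" using d Lip_pos by (intro divide_pos_pos)
 ultimately show ?thesis by blast
qed

lemma boundary_count:
 assumes E: "abs E <= A + 1" and t: "0 < t" and far: "!!i s. i < nc \<rho> ==> s : spec om l (ctr \<rho> i) ==> t <= abs (s - E)"
 shows "finite {y\<in>{0..1}. E : spec om l y}"
  "real (card {y\<in>{0..1}. E : spec om l y}) <= real (nc \<rho>) * (real l * log 2 (4 * A^2 / t))"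
proof -
 have bd: "cmod (F om (of_real E) l z) <= (4 * A^2) ^ l" if "z : strip \<rho>" for z
  by (rule F_bd[OF that]) (use E in simp)
 have low: "t ^ l <= cmod (F om (of_real E) l (of_real (ctr \<rho> i)))" if "i < nc \<rho>" for i
  by (rule F_lower_dist) (use t far[OF that] in auto)
 note sz = strip_zero_count[OF F_hol \<rho> bd _ low]
 show "finite {y\<in>{0..1}. E : spec om l y}" unfolding spec_def mem_Collect_eq by (rule sz) (use t in simp_all)
 have "real (card {y\<in>{0..1}. E : spec om l y}) <= real (nc \<rho>) * log 2 ((4 * A^2) ^ l / t ^ l)"
  unfolding spec_def mem_Collect_eq by (rule sz) (use t in simp_all)
 also have "log 2 ((4 * A^2) ^ l / t ^ l) = real l * log 2 (4 * A^2 / t)"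
  unfolding power_divide[symmetric] using t A by (intro log_nat_power) auto
 finally show "real (card {y\<in>{0..1}. E : spec om l y}) <= real (nc \<rho>) * (real l * log 2 (4 * A^2 / t))" .
qed

lemma res_fmeasurable: "res om l e E \<inter> {0..1} : fmeasurable lborel"
proof (rule fmeasurableI2[of "{0..1}"])
 show "{0..1::real} : fmeasurable lborel" by (simp add: fmeasurable_def)
 show "res om l e E \<inter> {0..1} : sets lborel" using borel_open[OF open_res] by simp
qed auto

text \<open>The number of arcs is controlled by zeros, and no arc is longer than the measure of the
  whole set. The margin \<open>2 * t\<close> at the centres leaves \<open>t\<close> for the shifted
  energies \<open>E + e\<close> and \<open>E - e\<close>.\<close>

lemma res_arcs:
 assumes E: "abs E <= A" and e: "0 < e" "e <= t" "t <= 1"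
  and far: "!!i s. i < nc \<rho> ==> s : spec om l (ctr \<rho> i) ==> 2 * t <= abs (s - E)"
  and n: "2 * real (nc \<rho>) * real l * log 2 (4 * A^2 / t) + 1 <= real n"
 obtains V where "finite V" "card V <= n"
  "!!u v. (u, v) : V ==> v - u <= measure lborel (res om l e E \<inter> {0..1})"
  "res om l e E \<inter> {0..1} \<subseteq> (\<Union>(u, v)\<in>V. {u..v})"
proof -
 define Z1 where "Z1 = {y\<in>{0..1}. E + e : spec om l y}"
 define Z2 where "Z2 = {y\<in>{0..1}. E - e : spec om l y}"
 have f1: "t <= abs (s - (E + e))" "t <= abs (s - (E - e))" if "i < nc \<rho>" "s : spec om l (ctr \<rho> i)" for i s
  using far[OF that] e by linarith+
 have b: "abs (E + e) <= A + 1" "abs (E - e) <= A + 1" "0 < t" using E e by linarith+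
 have z1: "finite Z1" "real (card Z1) <= real (nc \<rho>) * (real l * log 2 (4 * A^2 / t))"
  unfolding Z1_def by (rule boundary_count[OF b(1,3)], erule f1(1), assumption)+
 have z2: "finite Z2" "real (card Z2) <= real (nc \<rho>) * (real l * log 2 (4 * A^2 / t))"
  unfolding Z2_def by (rule boundary_count[OF b(2,3)], erule f1(2), assumption)+
 have card: "card (Z1 \<union> Z2) + 1 <= n"
 proof -
  have "real (card (Z1 \<union> Z2)) <= real (card Z1) + real (card Z2)" using card_Un_le[of Z1 Z2] by (simp flip: of_nat_add)
  then have "real (card (Z1 \<union> Z2) + 1) <= real n" using z1(2) z2(2) n by (simp add: algebra_simps)
  then show ?thesis by linarith
 qed
 have fin: "finite (Z1 \<union> Z2)" using z1(1) z2(1) by simp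
 have bdry: "\<exists>d>0. ball y d \<inter> res om l e E = {}" if "y : {0..1}" "y \<notin> res om l e E" "y \<notin> Z1 \<union> Z2" for y
  by (rule res_boundary) (use that in \<open>auto simp: Z1_def Z2_def\<close>)
 obtain V where V: "finite V" "card V <= card (Z1 \<union> Z2) + 1"
  "!!u v. (u, v) : V ==> u <= v & 0 <= u & v <= 1 & {u<..<v} \<subseteq> res om l e E"
  "res om l e E \<inter> {0..1} \<subseteq> (\<Union>(u, v)\<in>V. {u..v})"
  by (rule open_set_arcs[OF open_res fin bdry], assumption+, rule that)
 show thesis
 proof (rule that[OF V(1) _ _ V(4)])
  show "card V <= n" using V(2) card by linarith
  fix u v assume "(u, v) : V"
  from V(3)[OF this] have uv: "u <= v" "{u<..<v} \<subseteq> res om l e E \<inter> {0..1}" by auto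
  have "v - u = measure lborel {u<..<v}" using uv by (simp add: measure_def)
  also have "... <= measure lborel (res om l e E \<inter> {0..1})"
   by (rule measure_mono_fmeasurable[OF uv(2) _ res_fmeasurable]) simp
  finally show "v - u <= measure lborel (res om l e E \<inter> {0..1})" .
 qed
qed

text \<open>\<open>L0\<close> is a crude constant valid at all energy widths from \<open>h\<close>
  to \<open>t\<close> and serves the iteration; \<open>T\<close> is a sharper one at the single
  width \<open>2 * h\<close>, used in the last refinement, where it enters the final
  measure.\<close>

definition good :: "nat => real => real => real => real => real => real => bool" where
 "good l h t L0 T om E \<longleftrightarrow>
   (\<forall>i<nc \<rho>. \<forall>n\<le>l. \<forall>s\<in>spec om n (ctr \<rho> i). 2 * t <= abs (s - E)) &
   (\<forall>e. h <= e --> e <= t --> measure lborel (res om l e E \<inter> {0..1}) <= L0 * e) &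
   measure lborel (res om l (2 * h) E \<inter> {0..1}) <= T * h"

definition dbl :: "nat => real => real => real => real => real => nat => real set" where
 "dbl l h t L0 T E k = {om\<in>{0..1}. good l h t L0 T om E & (\<exists>y. y : res om l h E & y + real k * om : res om l h E)}"

context
 fixes l n k :: nat and h t L0 T E :: real
 assumes E: "abs E <= A" and h: "0 < h" and t: "t <= 1" and k: "k > 0" and l: "l > 0"
  and n: "2 * real (nc \<rho>) * real l * log 2 (4 * A^2 / t) + 1 <= real n"
begin

abbreviation "bad \<equiv> dbl l h t L0 T E k"

text \<open>One bad frequency of the cell is frozen. By Lipschitz dependence the resonant phases of
  all others in the cell lie in its resonant set for a slightly larger width, so a double resonance
  at distance \<open>k\<close> becomes two returns to one fixed family of arcs.\<close>

lemma dbl_step: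
 assumes w: "0 < w" "real k * w <= 1" "h + Lip * real l * w <= t"
  and X: "!!om. good l h t L0 T om E ==> measure lborel (res om l (h + Lip * real l * w) E \<inter> {0..1}) <= X"
 shows "cov (bad \<inter> {q..q + w}) (3 * n^2) (2 * X / real k)"
proof (cases "bad \<inter> {q..q + w} = {}")
 case False
 then obtain om0 where o: "om0 : bad" "om0 : {q..q + w}" by blast
 then have g: "good l h t L0 T om0 E" by (simp add: dbl_def)
 define e where "e = h + Lip * real l * w"
 define \<sigma> where "\<sigma> = measure lborel (res om0 l e E \<inter> {0..1})"
 have \<sigma>: "\<sigma> <= X" unfolding \<sigma>_def e_def by (rule X[OF g])
 have e: "0 < e" "e <= t"
 proof -
  have "0 <= Lip * real l * w" using Lip_pos w by (intro mult_nonneg_nonneg) auto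
  then show "0 < e" "e <= t" using h w unfolding e_def by linarith+
 qed
 have far: "2 * t <= abs (s - E)" if "i < nc \<rho>" "s : spec om0 l (ctr \<rho> i)" for i s
  using g that unfolding good_def by blast
 obtain V where V: "finite V" "card V <= n" "!!u v. (u, v) : V ==> v - u <= \<sigma>"
  "res om0 l e E \<inter> {0..1} \<subseteq> (\<Union>(u, v)\<in>V. {u..v})"
  unfolding \<sigma>_def by (rule res_arcs[OF E e t _ n, of om0]) (use far in blast)+
 have "cov {om : {q..q + w}. \<exists>y. y : res om0 l e E & y + real k * om : res om0 l e E} (3 * n^2) (2 * \<sigma> / real k)"
  by (rule return_cover[OF res_per V k w(2)])
 then show ?thesis
 proof (rule cov_mono)
  show "2 * \<sigma> / real k <= 2 * X / real k" using \<sigma> by (intro divide_right_mono) auto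
  show "bad \<inter> {q..q + w} \<subseteq> {om : {q..q + w}. \<exists>y. y : res om0 l e E & y + real k * om : res om0 l e E}"
  proof clarify
   fix om assume w': "om : bad" "om : {q..q + w}"
   then obtain y where y: "y : res om l h E" "y + real k * om : res om l h E" by (auto simp: dbl_def)
   have "abs (om - om0) <= w" using w' o by auto
   then have "Lip * (real l * abs (om - om0)) <= Lip * (real l * w)" using Lip_pos by (intro mult_left_mono) auto
   then have le: "Lip * (abs (z - z) + real l * abs (om - om0)) <= Lip * real l * w" for z :: real by simp
   show "\<exists>y. y : res om0 l e E & y + real k * om : res om0 l e E"
    using res_Lipschitz[OF y(1) le] res_Lipschitz[OF y(2) le] unfolding e_def by blast
  qed
 qed
qed simp

text \<open>Each step multiplies the number of intervals by \<open>3 * n^2\<close> and their length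
  by \<open>4 * L0 * Lip * l / k\<close>, which is small for large \<open>k\<close>. It stops at
  length \<open>h / (Lip * l)\<close>, where the uncertainty in the frequency moves eigenvalues by
  \<open>h\<close> and further narrowing of the cell gains nothing.\<close>

lemma dbl_iter:
 assumes th: "4 * L0 * (Lip * real l) <= real k" "0 <= L0" and hk: "real k * h <= Lip * real l" and tk: "2 * (Lip * real l) <= t * real k"
 shows "cov bad (k * (3 * n^2) ^ i) (max (h / (Lip * real l)) ((4 * L0 * (Lip * real l) / real k) ^ i / real k))"
proof -
 define C where "C = Lip * real l"
 have C: "C > 0" unfolding C_def using Lip_pos l by (intro mult_pos_pos) auto
 define \<theta> where "\<theta> = 4 * L0 * C / real k"
 have \<theta>: "0 <= \<theta>" "\<theta> <= 1" using th C k by (auto simp: \<theta>_def C_def[symmetric])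
 define w where "w i = max (h / C) (\<theta> ^ i / real k)" for i
 have w0: "w i > 0" for i using h C by (simp add: w_def less_max_iff_disj)
 have hC: "h / C <= 1 / real k" using hk C k unfolding C_def[symmetric] by (simp add: field_simps)
 have w1: "w i <= 1 / real k" for i
  unfolding w_def using hC \<theta> k by (auto intro!: divide_right_mono power_le_one)
 have "cov bad (k * (3 * n^2) ^ i) (w i)"
 proof (induction i)
  case 0
  have "w 0 = 1 / real k" using hC by (simp add: w_def)
  have "cov bad k (1 / real k)" unfolding cov_def
  proof (intro exI conjI)
   show "card ((%i. real i / real k) ` {..<k}) <= k" using card_image_le[of "{..<k}"] by simp
   show "bad \<subseteq> (\<Union>u\<in>(%i. real i / real k) ` {..<k}. {u..u + 1 / real k})"
   proof
    fix om assume "om : bad"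
    then have w: "0 <= om" "om <= 1" by (auto simp: dbl_def)
    have "real k * om <= real k" using w by (simp add: mult_left_le)
    then obtain i where i: "i < k" "real i <= real k * om" "real k * om <= real i + 1"
     by (rule grid_cell[OF mult_nonneg_nonneg[OF of_nat_0_le_iff w(1)] _ k])
    then have "real i / real k <= om" "om <= real i / real k + 1 / real k" using k by (simp_all add: field_simps)
    then show "om : (\<Union>u\<in>(%i. real i / real k) ` {..<k}. {u..u + 1 / real k})" using i by auto
   qed
  qed auto
  then show ?case using \<open>w 0 = 1 / real k\<close> by simp
 next
  case (Suc i)
  define e where "e = h + C * w i"
  have hCw: "h <= C * w i"
  proof -
   have "C * (h / C) <= C * w i" unfolding w_def using C by (intro mult_left_mono) auto
   then show ?thesis using C by simp
  qed
  have e2: "e <= 2 * C * w i" using hCw by (simp add: e_def)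
  have et: "e <= t"
  proof -
   have "2 * C * w i <= 2 * C * (1 / real k)" using w1 C by (intro mult_left_mono) auto
   also have "... <= t" using tk k unfolding C_def[symmetric] by (simp add: field_simps)
   finally show ?thesis using e2 by linarith
  qed
  have he: "h <= e" unfolding e_def using C w0[of i] by simp
  have step: "cov (bad \<inter> {q..q + w i}) (3 * n^2) (2 * (L0 * e) / real k)" for q
  proof (rule dbl_step[OF w0])
   show "real k * w i <= 1" using w1[of i] k by (simp add: field_simps)
   show "h + Lip * real l * w i <= t" using et unfolding e_def C_def .
   show "measure lborel (res om l (h + Lip * real l * w i) E \<inter> {0..1}) <= L0 * e" if "good l h t L0 T om E" for om
    using that he et unfolding good_def e_def C_def by blast
  qed
  have "2 * (L0 * e) / real k <= 2 * (L0 * (2 * C * w i)) / real k"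
   using e2 th(2) by (intro divide_right_mono mult_left_mono) auto
  also have "... = \<theta> * w i" by (simp add: \<theta>_def)
  also have "... <= w (Suc i)"
  proof -
   have "\<theta> * (h / C) <= 1 * (h / C)" using \<theta> h C by (intro mult_right_mono) auto
   moreover have "\<theta> * (\<theta> ^ i / real k) = \<theta> ^ Suc i / real k" by simp
   ultimately show ?thesis unfolding w_def by (auto simp: max_def)
  qed
  finally have le: "2 * (L0 * e) / real k <= w (Suc i)" .
  have "cov bad (k * (3 * n^2) ^ i * (3 * n^2)) (w (Suc i))"
   by (rule cov_refine[OF Suc]) (rule cov_mono[OF step order_refl le])
  then show ?case by (simp add: mult_ac)
 qed
 then show ?thesis unfolding w_def \<theta>_def C_def .
qed

text \<open>At the terminal cell length the enlarged width is exactly \<open>2 * h\<close>, so one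
  more step may use \<open>T\<close> in place of \<open>L0\<close>.\<close>

lemma dbl_cover:
 assumes th: "4 * L0 * (Lip * real l) <= real k" "0 <= L0" and hk: "real k * h <= Lip * real l" and tk: "2 * (Lip * real l) <= t * real k"
  and j: "(4 * L0 * (Lip * real l) / real k) ^ j / real k <= h / (Lip * real l)" and ht: "2 * h <= t"
 shows "cov bad (k * (3 * n^2) ^ Suc j) (2 * T * h / real k)"
proof -
 define C where "C = Lip * real l"
 have C: "C > 0" unfolding C_def using Lip_pos l by (intro mult_pos_pos) auto
 have w: "h / C > 0" using h C by simp
 have 1: "cov bad (k * (3 * n^2) ^ j) (h / C)"
  using dbl_iter[OF th hk tk, of j] j unfolding C_def[symmetric] by (simp add: max_def split: if_splits)
 have e: "h + Lip * real l * (h / C) = 2 * h" unfolding C_def[symmetric] using C by simp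
 have 2: "cov (bad \<inter> {q..q + h / C}) (3 * n^2) (2 * (T * h) / real k)" for q
 proof (rule dbl_step[OF w])
  show "real k * (h / C) <= 1" using hk C unfolding C_def[symmetric] by simp
 qed (use ht in \<open>unfold e, auto simp: good_def\<close>)
 have "cov bad (k * (3 * n^2) ^ j * (3 * n^2)) (2 * (T * h) / real k)" by (rule cov_refine[OF 1 2])
 then show ?thesis by (simp add: mult_ac)
qed

end

end

section \<open>Averaging over energy cells\<close>

lemma near_count:
 fixes a s e h :: real and m :: nat
 assumes h: "h > 0" and e: "e >= 0"
 shows "real (card {J\<in>{..<m}. abs (s - (a + (real J + 1 / 2) * h)) < e}) <= 2 * e / h + 1"
proof -
 define u where "u = (s - a) / h - 1 / 2"
 have sub: "int ` {J\<in>{..<m}. abs (s - (a + (real J + 1 / 2) * h)) < e} \<subseteq> {\<lceil>u - e / h\<rceil>..\<lfloor>u + e / h\<rfloor>}"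
 proof clarify
  fix J assume J: "abs (s - (a + (real J + 1 / 2) * h)) < e"
  have "u - real J = (s - (a + (real J + 1 / 2) * h)) / h" using h by (simp add: u_def field_simps)
  then have "abs (u - real J) = abs (s - (a + (real J + 1 / 2) * h)) / h" using h by simp
  also have "... <= e / h" using J h by (intro divide_right_mono) auto
  finally have "u - e / h <= real_of_int (int J)" "real_of_int (int J) <= u + e / h" by (auto simp: abs_le_iff)
  then show "int J : {\<lceil>u - e / h\<rceil>..\<lfloor>u + e / h\<rfloor>}"
   by (simp only: atLeastAtMost_iff ceiling_le_iff le_floor_iff simp_thms)
 qed
 have "card {J\<in>{..<m}. abs (s - (a + (real J + 1 / 2) * h)) < e} = card (int ` {J\<in>{..<m}. abs (s - (a + (real J + 1 / 2) * h)) < e})"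
  by (rule card_image[symmetric]) simp
 also have "... <= card {\<lceil>u - e / h\<rceil>..\<lfloor>u + e / h\<rfloor>}" by (rule card_mono[OF _ sub]) simp
 finally have "real (card {J\<in>{..<m}. abs (s - (a + (real J + 1 / 2) * h)) < e}) <= real (card {\<lceil>u - e / h\<rceil>..\<lfloor>u + e / h\<rfloor>})" by simp
 moreover have "real_of_int (\<lfloor>u + e / h\<rfloor> - \<lceil>u - e / h\<rceil> + 1) <= 2 * e / h + 1"
 proof -
  have "of_int \<lfloor>u + e / h\<rfloor> - of_int \<lceil>u - e / h\<rceil> <= (u + e / h) - (u - e / h)" by linarith
  then show ?thesis by simp
 qed
 moreover have "0 <= 2 * e / h + 1" using h e by simp
 ultimately show ?thesis by (auto simp: card_atLeastAtMost_int split: if_splits)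
qed

lemma card_union_le:
 fixes c :: real
 assumes "finite I" "!!i. i : I ==> real (card (B i)) <= c"
 shows "real (card (\<Union>i\<in>I. B i)) <= real (card I) * c"
proof -
 have "real (card (\<Union>i\<in>I. B i)) <= (\<Sum>i\<in>I. real (card (B i)))"
  using card_UN_le[OF assms(1), of B] unfolding of_nat_sum[symmetric] of_nat_le_iff .
 also have "... <= real (card I) * c" using sum_bounded_above[of I "%i. real (card (B i))" c] assms(2) by simp
 finally show ?thesis .
qed

lemma markov_count:
 fixes f :: "'a => real"
 assumes "finite I" "!!i. i : I ==> 0 <= f i" "sum f I <= S" "c > 0"
 shows "real (card {i\<in>I. c < f i}) <= S / c"
proof -
 have "real (card {i\<in>I. c < f i}) * c = (\<Sum>i\<in>{i\<in>I. c < f i}. c)" by simp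
 also have "... <= (\<Sum>i\<in>{i\<in>I. c < f i}. f i)" by (rule sum_mono) auto
 also have "... <= sum f I" using assms by (intro sum_mono2) auto
 finally show ?thesis using assms by (simp add: pos_le_divide_eq)
qed

text \<open>Double counting interchanges the roles of the two variables: if every energy has few bad
  frequencies, then most frequencies have few bad energies. This is the order of quantifiers in
  which the exceptional sets are wanted.\<close>

lemma double_count_markov:
 assumes fin: "finite (I :: nat set)" "finite (J :: nat set)" and P: "!!j. j : J ==> real (card {i\<in>I. Q j i}) <= P"
  and c: "c > 0" and P0: "P >= 0"
 shows "real (card {i\<in>I. c * real (card J) < real (card {j\<in>J. Q j i})}) <= P / c"
proof (cases "J = {}")
 case True
 then show ?thesis using c P0 by simp
next
 case False
 then have J: "card J > 0" using fin by (simp add: card_gt_0_iff)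
 have "(\<Sum>i\<in>I. real (card {j\<in>J. Q j i})) = (\<Sum>i\<in>I. \<Sum>j\<in>J. if Q j i then 1 else 0)"
  using fin by (simp add: sum.If_cases Int_def)
 also have "... = (\<Sum>j\<in>J. \<Sum>i\<in>I. if Q j i then 1 else 0)" by (rule sum.swap)
 also have "... = (\<Sum>j\<in>J. real (card {i\<in>I. Q j i}))" using fin by (simp add: sum.If_cases Int_def)
 also have "... <= real (card J) * P" using sum_bounded_above[of J "%j. real (card {i\<in>I. Q j i})" P] P by simp
 finally have "real (card {i\<in>I. c * real (card J) < real (card {j\<in>J. Q j i})}) <= real (card J) * P / (c * real (card J))"
  by (rule markov_count[OF fin(1) of_nat_0_le_iff]) (use c J in simp)
 then show ?thesis using J by simp
qed

context jac
begin

definition ec :: "nat => nat => real" where "ec m J = - A + (real J + 1 / 2) * (2 * A / real m)"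

lemma ec_bound: "J < m ==> abs (ec m J) <= A"
proof -
 assume J: "J < m"
 have 1: "0 <= (real J + 1 / 2) * (2 * A / real m)" using A by (intro mult_nonneg_nonneg) auto
 have "(real J + 1 / 2) * (2 * A / real m) <= real m * (2 * A / real m)" using J A by (intro mult_right_mono) auto
 also have "... = 2 * A" using J by simp
 finally show ?thesis using 1 unfolding ec_def by (simp only: abs_le_iff) linarith
qed

lemma cell_exists:
 assumes E: "abs E <= A" and m: "m > 0"
 obtains J where "J < m" "abs (E - ec m J) <= (2 * A / real m) / 2"
  "E : {- A + real J * (2 * A / real m)..- A + (real J + 1) * (2 * A / real m)}"
proof -
 define h where "h = 2 * A / real m"
 have h: "h > 0" "real m * h = 2 * A" using A m by (auto simp: h_def)
 have EA: "0 <= (E + A) / h" "(E + A) / h <= real m" using E h by (auto simp: pos_divide_le_eq abs_le_iff)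
 obtain J where J: "J < m" and 1: "real J <= (E + A) / h" and 2: "(E + A) / h <= real J + 1"
  by (rule grid_cell[OF EA m])
 have 3: "real J * h <= E + A" "E + A <= (real J + 1) * h" using 1 2 h by (simp_all add: pos_le_divide_eq pos_divide_le_eq)
 show ?thesis
 proof (rule that[OF J])
  show "abs (E - ec m J) <= (2 * A / real m) / 2"
   unfolding ec_def h_def[symmetric] abs_le_iff using 3 by (simp add: algebra_simps)
  show "E : {- A + real J * (2 * A / real m)..- A + (real J + 1) * (2 * A / real m)}"
   unfolding h_def[symmetric] using 3 by simp
 qed
qed

text \<open>At each phase there are at most \<open>l\<close> eigenvalues, each close to at most
  \<open>2 * e / h + 1\<close> cell centres. Averaging over energies in this way plays the role of a
  Wegner estimate, with no regularity in the phase.\<close>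

lemma sum_res:
 assumes m: "m > 0" and e: "e >= 0"
 shows "(\<Sum>J<m. measure lborel (res om l e (ec m J) \<inter> {0..1})) <= real l * (2 * e / (2 * A / real m) + 1)"
proof -
 define h where "h = 2 * A / real m"
 have h: "h > 0" using A m by (auto simp: h_def)
 define S where "S J = res om l e (ec m J) \<inter> {0..1}" for J
 have S: "S J : fmeasurable lborel" for J unfolding S_def by (rule res_fmeasurable)
 have int: "integrable lborel (indicator (S J) :: real => real)" for J
  using S[of J] by (intro integrable_real_indicator) (auto simp: fmeasurable_def)
 have "(\<Sum>J<m. measure lborel (S J)) = (\<Sum>J<m. integral\<^sup>L lborel (indicator (S J)))" by simp
 also have "... = integral\<^sup>L lborel (%y. \<Sum>J<m. indicator (S J) y)"
  by (rule Bochner_Integration.integral_sum[symmetric]) (rule int)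
 also have "... <= integral\<^sup>L lborel (%y::real. real l * (2 * e / h + 1) * indicator {0..1} y)"
 proof (rule Bochner_Integration.integral_mono)
  show "integrable lborel (%y. \<Sum>J<m. indicator (S J) y :: real)" by (intro Bochner_Integration.integrable_sum int)
  show "integrable lborel (%y::real. real l * (2 * e / h + 1) * indicator {0..1} y)"
   by (intro integrable_mult_right integrable_real_indicator) auto
  fix y :: real
  show "(\<Sum>J<m. indicator (S J) y) <= real l * (2 * e / h + 1) * indicator {0..1} y"
  proof (cases "y : {0..1}")
   case False
   then have "(\<Sum>J<m. indicator (S J) y :: real) = 0" by (auto simp: S_def indicator_def)
   then show ?thesis using False by simp
  next
   case True
   have "(\<Sum>J<m. indicator (S J) y :: real) = real (card {J\<in>{..<m}. y : S J})"
    by (simp add: indicator_def sum.If_cases Int_def)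
   also have "card {J\<in>{..<m}. y : S J} <= card (\<Union>s\<in>spec om l y. {J\<in>{..<m}. abs (s - (- A + (real J + 1 / 2) * h)) < e})"
    by (rule card_mono) (auto simp: finite_spec S_def res_def ec_def h_def)
   then have "real (card {J\<in>{..<m}. y : S J}) <= real (card (\<Union>s\<in>spec om l y. {J\<in>{..<m}. abs (s - (- A + (real J + 1 / 2) * h)) < e}))" by simp
   also have "... <= real (card (spec om l y)) * (2 * e / h + 1)"
    by (rule card_union_le[OF finite_spec near_count[OF h e]])
   also have "... <= real l * (2 * e / h + 1)" using card_spec h e by (intro mult_right_mono) auto
   finally show ?thesis using True by simp
  qed
 qed
 also have "... = real l * (2 * e / h + 1)" by simp
 finally show ?thesis unfolding S_def h_def .
qed

text \<open>The three summands match the three clauses of \<open>good\<close>: a direct count of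
  eigenvalues at the centre phases, and Markov's inequality for \<open>sum_res\<close> at dyadic
  widths and at width \<open>2 * h\<close>.\<close>

lemma not_good_count:
 fixes m ns :: nat
 assumes m: "m > 0" and L0: "L0 > 0" and T: "T > 0" and t: "t >= 0" and ns: "t < 2 ^ ns * (2 * A / real m)"
 defines "h \<equiv> 2 * A / real m"
 shows "real (card {J\<in>{..<m}. \<not> good l h t L0 T om (ec m J)}) <=
  real (nc \<rho>) * (real (l + 1) * (real l * (4 * t / h + 1))) + real ns * (5 * real l / (L0 * h)) + 5 * real l / (T * h)"
proof -
 have h: "h > 0" using A m by (auto simp: h_def)
 let ?mu = "%e J. measure lborel (res om l e (ec m J) \<inter> {0..1})"
 define B1 where "B1 = (\<Union>i\<in>{..<nc \<rho>}. \<Union>n\<in>{..<l + 1}. \<Union>s\<in>spec om n (ctr \<rho> i). {J\<in>{..<m}. abs (s - (- A + (real J + 1 / 2) * h)) < 2 * t})"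
 \<comment> \<open>The measure at width \<open>2 ^ Suc i * h\<close> is tested against the bound for
   \<open>2 ^ i * h\<close>, so that every width between two dyadic ones is covered by
   monotonicity.\<close>
 define B2 where "B2 = (\<Union>i\<in>{..<ns}. {J\<in>{..<m}. L0 * (2 ^ i * h) < ?mu (2 ^ Suc i * h) J})"
 define B3 where "B3 = {J\<in>{..<m}. T * h < ?mu (2 * h) J}"
 have sum: "(\<Sum>J<m. ?mu (2 ^ Suc i * h) J) <= 5 * real l * 2 ^ i" for i
 proof -
  have "(\<Sum>J<m. ?mu (2 ^ Suc i * h) J) <= real l * (2 * (2 ^ Suc i * h) / h + 1)"
   unfolding h_def by (rule sum_res[OF m]) (use h A in \<open>simp add: h_def\<close>)
  also have "2 * (2 ^ Suc i * h) / h + 1 <= 5 * 2 ^ i"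
  proof -
   have "(1::real) <= 2 ^ i" by simp
   then show ?thesis using h by simp
  qed
  then have "real l * (2 * (2 ^ Suc i * h) / h + 1) <= real l * (5 * 2 ^ i)" by (intro mult_left_mono) auto
  finally show ?thesis by (simp add: mult_ac)
 qed
 have c1: "real (card B1) <= real (nc \<rho>) * (real (l + 1) * (real l * (4 * t / h + 1)))"
 proof -
  have "real (card B1) <= real (card {..<nc \<rho>}) * (real (card {..<l + 1}) * (real l * (4 * t / h + 1)))"
   unfolding B1_def
  proof (intro card_union_le finite_lessThan)
   fix i n assume n: "n : {..<l + 1}"
   have "real (card (\<Union>s\<in>spec om n (ctr \<rho> i). {J\<in>{..<m}. abs (s - (- A + (real J + 1 / 2) * h)) < 2 * t})) <=
     real (card (spec om n (ctr \<rho> i))) * (2 * (2 * t) / h + 1)"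
    by (rule card_union_le[OF finite_spec near_count[OF h]]) (use t in simp)
   also have "... <= real l * (4 * t / h + 1)" using card_spec[of om n "ctr \<rho> i"] n h t by (intro mult_mono) auto
   finally show "real (card (\<Union>s\<in>spec om n (ctr \<rho> i). {J\<in>{..<m}. abs (s - (- A + (real J + 1 / 2) * h)) < 2 * t}))
     <= real l * (4 * t / h + 1)" .
  qed
  then show ?thesis by simp
 qed
 have c2: "real (card B2) <= real ns * (5 * real l / (L0 * h))"
 proof -
  have "real (card B2) <= real (card {..<ns}) * (5 * real l / (L0 * h))"
   unfolding B2_def
  proof (intro card_union_le finite_lessThan)
   fix i
   have "real (card {J\<in>{..<m}. L0 * (2 ^ i * h) < ?mu (2 ^ Suc i * h) J}) <= 5 * real l * 2 ^ i / (L0 * (2 ^ i * h))"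
    by (rule markov_count[OF _ _ sum]) (use L0 h in auto)
   then show "real (card {J\<in>{..<m}. L0 * (2 ^ i * h) < ?mu (2 ^ Suc i * h) J}) <= 5 * real l / (L0 * h)" by simp
  qed
  then show ?thesis by simp
 qed
 have c3: "real (card B3) <= 5 * real l / (T * h)"
 proof -
  have "(\<Sum>J<m. ?mu (2 * h) J) <= 5 * real l" using sum[of 0] by simp
  then show ?thesis unfolding B3_def by (rule markov_count[rotated 2]) (use T h in auto)
 qed
 have "{J\<in>{..<m}. \<not> good l h t L0 T om (ec m J)} \<subseteq> B1 \<union> B2 \<union> B3"
 proof (rule subsetI, rule ccontr)
  fix J assume "J : {J\<in>{..<m}. \<not> good l h t L0 T om (ec m J)}" "J \<notin> B1 \<union> B2 \<union> B3"
  then have J: "J : {..<m}" "\<not> good l h t L0 T om (ec m J)" "J \<notin> B3" "J \<notin> B2" "J \<notin> B1" by auto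
  have g3: "?mu (2 * h) J <= T * h" using J by (auto simp: B3_def)
  have g2: "?mu e J <= L0 * e" if e: "h <= e" "e <= t" for e
  proof -
   define P where "P i \<longleftrightarrow> e < 2 ^ i * h" for i :: nat
   have "P ns" using ns e by (simp add: P_def h_def)
   define i where "i = (LEAST i. P i)"
   have Pi: "P i" "i <= ns" unfolding i_def using \<open>P ns\<close> by (rule LeastI, rule Least_le)
   have "\<not> P 0" using e by (simp add: P_def)
   then obtain i' where i': "i = Suc i'" using Pi(1) by (cases i) auto
   have "\<not> P i'" using not_less_Least[of i' P] i' unfolding i_def by simp
   then have le: "2 ^ i' * h <= e" by (simp add: P_def not_less)
   have "J \<notin> {J\<in>{..<m}. L0 * (2 ^ i' * h) < ?mu (2 ^ Suc i' * h) J}" using J Pi(2) i' by (auto simp: B2_def)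
   then have "?mu (2 ^ Suc i' * h) J <= L0 * (2 ^ i' * h)" using J by (auto simp: not_less)
   also have "... <= L0 * e" using le L0 by (intro mult_left_mono) auto
   finally have "?mu (2 ^ Suc i' * h) J <= L0 * e" .
   moreover have "?mu e J <= ?mu (2 ^ Suc i' * h) J"
   proof (rule measure_mono_fmeasurable[OF _ _ res_fmeasurable])
    show "res om l e (ec m J) \<inter> {0..1} \<subseteq> res om l (2 ^ Suc i' * h) (ec m J) \<inter> {0..1}"
     using res_mono[of e "2 ^ Suc i' * h"] Pi(1) unfolding P_def i' by fastforce
   qed (use res_fmeasurable[of om l e "ec m J"] in \<open>auto simp: fmeasurable_def\<close>)
   ultimately show ?thesis by linarith
  qed
  have "\<not> (\<forall>i<nc \<rho>. \<forall>n\<le>l. \<forall>s\<in>spec om n (ctr \<rho> i). 2 * t <= abs (s - ec m J))"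
   using J(2) g2 g3 unfolding good_def by blast
  then obtain i n s where i: "i < nc \<rho>" "n <= l" "s : spec om n (ctr \<rho> i)" "abs (s - ec m J) < 2 * t" by (auto simp: not_le)
  have "n : {..<l + 1}" using i by simp
  then have "J : B1" unfolding B1_def using i J(1) unfolding ec_def h_def[symmetric] by blast
  then show False using J by blast
 qed
 moreover have "finite (B1 \<union> B2 \<union> B3)" using finite_spec unfolding B1_def B2_def B3_def by auto
 ultimately have "card {J\<in>{..<m}. \<not> good l h t L0 T om (ec m J)} <= card (B1 \<union> B2 \<union> B3)" by (intro card_mono)
 also have "... <= card B1 + card B2 + card B3" using card_Un_le[of "B1 \<union> B2" B3] card_Un_le[of B1 B2] by linarith
 finally have "real (card {J\<in>{..<m}. \<not> good l h t L0 T om (ec m J)}) <= real (card B1) + real (card B2) + real (card B3)" by linarith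
 then show ?thesis using c1 c2 c3 by linarith
qed

text \<open>The width is \<open>h / 2\<close> because an arbitrary energy is within
  \<open>h / 2\<close> of the centre of its cell, where the elimination is carried out at width
  \<open>h\<close>.\<close>

definition norep :: "real => nat => real => nat => nat => real => bool" where
 "norep om l h K0 R E \<longleftrightarrow> (\<forall>k\<in>{K0..R}. \<forall>y. \<not> (y : res om l (h / 2) E & y + real k * om : res om l (h / 2) E))"

text \<open>Gives the lower bounds on determinants at the centre phases, for every length up to
  \<open>l\<close>, on which the variation estimate rests.\<close>

definition centred :: "real => nat => real => real => bool" where
 "centred om l t E \<longleftrightarrow> (\<forall>i<nc \<rho>. \<forall>n\<le>l. \<forall>s\<in>spec om n (ctr \<rho> i). t <= abs (s - E))"

text \<open>For each energy cell, \<open>P\<close> bounds the frequency cells that meet a double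
  resonance at some distance in \<open>[K0, R]\<close>. Frequency cells bad for more than a fraction
  \<theta> of the energies form \<open>I\<close>; for the others the bad energies join those that
  are not \<open>good\<close>. Hence \<open>I\<close> depends on no energy, and the energy cells
  only on the frequency.\<close>

theorem elimination:
 fixes l n m ns K0 R G :: nat and jj :: "nat => nat" and t L0 T g \<theta> :: real
 defines "h \<equiv> 2 * A / real m"
 defines "P \<equiv> \<Sum>k=K0..R. real (k * (3 * n^2) ^ Suc (jj k)) * (2 * T * h / real k / g + 2)"
 assumes m: "m > 0" and l: "l > 0" and t: "0 <= t" "t <= 1" and ns: "t < 2 ^ ns * h"
  and n: "2 * real (nc \<rho>) * real l * log 2 (4 * A^2 / t) + 1 <= real n"
  and L0: "L0 > 0" and T: "T > 0" and g: "g > 0" "real G * g >= 1" and ht: "2 * h <= t" and K0: "K0 > 0" and \<theta>: "\<theta> > 0"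
  and th: "4 * L0 * (Lip * real l) <= real K0" and hk: "real R * h <= Lip * real l" and tk: "2 * (Lip * real l) <= t * real K0"
  and jj: "!!k. K0 <= k ==> k <= R ==> (4 * L0 * (Lip * real l) / real k) ^ jj k / real k <= h / (Lip * real l)"
 obtains I where "finite I" "card I <= G" "real (card I) <= P / \<theta>"
  "!!om. om : {0..1} ==> om \<notin> (\<Union>i\<in>I. {real i * g..(real i + 1) * g}) ==>
   \<exists>\<J>\<subseteq>{..<m}. real (card \<J>) <= real (nc \<rho>) * (real (l + 1) * (real l * (4 * t / h + 1))) +
     real ns * (5 * real l / (L0 * h)) + 5 * real l / (T * h) + \<theta> * real m &
    (\<forall>E. abs E <= A --> E \<notin> (\<Union>J\<in>\<J>. {- A + real J * h..- A + (real J + 1) * h}) --> centred om l t E & norep om l h K0 R E)"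
proof -
 have h: "h > 0" using A m by (auto simp: h_def)
 define Q where "Q J i \<longleftrightarrow> (\<exists>k\<in>{K0..R}. dbl l h t L0 T (ec m J) k \<inter> {real i * g..(real i + 1) * g} ~= {})" for J i
 define I where "I = {i\<in>{..<G}. \<theta> * real (card {..<m}) < real (card {J\<in>{..<m}. Q J i})}"
 have P0: "P >= 0" unfolding P_def using T h g by (intro sum_nonneg mult_nonneg_nonneg add_nonneg_nonneg) auto
 have count: "real (card {i\<in>{..<G}. Q J i}) <= P" if J: "J < m" for J
 proof -
  let ?C = "%k. {i::nat. dbl l h t L0 T (ec m J) k \<inter> {real i * g..(real i + 1) * g} ~= {}}"
  have c: "finite (?C k)" "real (card (?C k)) <= real (k * (3 * n^2) ^ Suc (jj k)) * (2 * T * h / real k / g + 2)"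
   if k: "k : {K0..R}" for k
  proof -
   have k0: "k > 0" "real k >= real K0" using k K0 by auto
   have "cov (dbl l h t L0 T (ec m J) k) (k * (3 * n^2) ^ Suc (jj k)) (2 * T * h / real k)"
   proof (rule dbl_cover[OF ec_bound[OF J] h t(2) k0(1) l n _ _ _ _ _ ht])
    show "4 * L0 * (Lip * real l) <= real k" using th k0 by linarith
    show "0 <= L0" using L0 by simp
    have "real k * h <= real R * h" using k h by (intro mult_right_mono) auto
    then show "real k * h <= Lip * real l" using hk by linarith
    have "t * real K0 <= t * real k" using k0 t by (intro mult_left_mono) auto
    then show "2 * (Lip * real l) <= t * real k" using tk by linarith
    show "(4 * L0 * (Lip * real l) / real k) ^ jj k / real k <= h / (Lip * real l)" using jj k by simp
   qed
   from cov_cells[OF this g(1)] T h k0 show "finite (?C k)"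
    "real (card (?C k)) <= real (k * (3 * n^2) ^ Suc (jj k)) * (2 * T * h / real k / g + 2)" by auto
  qed
  have "card {i\<in>{..<G}. Q J i} <= card (\<Union>k\<in>{K0..R}. ?C k)"
   by (rule card_mono) (use c in \<open>auto simp: Q_def\<close>)
  also have "... <= (\<Sum>k=K0..R. card (?C k))" by (rule card_UN_le) simp
  finally have "real (card {i\<in>{..<G}. Q J i}) <= (\<Sum>k=K0..R. real (card (?C k)))"
   unfolding of_nat_sum[symmetric] of_nat_le_iff .
  also have "... <= P" unfolding P_def by (rule sum_mono) (rule c)
  finally show ?thesis .
 qed
 have I: "finite I" "card I <= G" using card_mono[of "{..<G}" I] by (auto simp: I_def)
 have cI: "real (card I) <= P / \<theta>" unfolding I_def by (rule double_count_markov[OF _ _ _ \<theta> P0]) (use count in auto)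
 show thesis
 proof (rule that[OF I cI])
  fix om :: real assume om: "om : {0..1}" "om \<notin> (\<Union>i\<in>I. {real i * g..(real i + 1) * g})"
  obtain i where i: "i < G" "om : {real i * g..(real i + 1) * g}"
  proof -
   have G0: "G > 0" using g by (cases G) auto
   have "0 <= om / g" "om / g <= real G" using om g by (auto simp: pos_divide_le_eq)
   from grid_cell[OF this G0] obtain i where "i < G" "real i <= om / g" "om / g <= real i + 1" .
   then show ?thesis using that[of i] g by (simp add: pos_le_divide_eq pos_divide_le_eq)
  qed
  then have "i \<notin> I" using om(2) by blast
  then have few: "real (card {J\<in>{..<m}. Q J i}) <= \<theta> * real m" using i by (auto simp: I_def not_less)
  define \<J> where "\<J> = {J\<in>{..<m}. \<not> good l h t L0 T om (ec m J)} \<union> {J\<in>{..<m}. Q J i}"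
  have "real (card \<J>) <= real (card {J\<in>{..<m}. \<not> good l h t L0 T om (ec m J)}) + real (card {J\<in>{..<m}. Q J i})"
   unfolding \<J>_def of_nat_add[symmetric] of_nat_le_iff by (rule card_Un_le)
  also have "... <= real (nc \<rho>) * (real (l + 1) * (real l * (4 * t / h + 1))) +
     real ns * (5 * real l / (L0 * h)) + 5 * real l / (T * h) + \<theta> * real m"
   using not_good_count[OF m L0 T t(1) ns[unfolded h_def], of l om] few unfolding h_def by linarith
  finally have cJ: "real (card \<J>) <= real (nc \<rho>) * (real (l + 1) * (real l * (4 * t / h + 1))) +
     real ns * (5 * real l / (L0 * h)) + 5 * real l / (T * h) + \<theta> * real m" .
  show "\<exists>\<J>\<subseteq>{..<m}. real (card \<J>) <= real (nc \<rho>) * (real (l + 1) * (real l * (4 * t / h + 1))) +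
     real ns * (5 * real l / (L0 * h)) + 5 * real l / (T * h) + \<theta> * real m &
    (\<forall>E. abs E <= A --> E \<notin> (\<Union>J\<in>\<J>. {- A + real J * h..- A + (real J + 1) * h}) --> centred om l t E & norep om l h K0 R E)"
  proof (unfold centred_def norep_def, intro exI[of _ \<J>] conjI allI impI ballI cJ)
   show "\<J> \<subseteq> {..<m}" by (auto simp: \<J>_def)
   fix E assume E: "abs E <= A" "E \<notin> (\<Union>J\<in>\<J>. {- A + real J * h..- A + (real J + 1) * h})"
   obtain J where J: "J < m" "abs (E - ec m J) <= h / 2" "E : {- A + real J * h..- A + (real J + 1) * h}"
    unfolding h_def by (rule cell_exists[OF E(1) m])
   then have "J \<notin> \<J>" using E(2) by blast
   then have gd: "good l h t L0 T om (ec m J)" and nQ: "\<not> Q J i" using J by (auto simp: \<J>_def)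
   show "t <= abs (s - E)" if "i < nc \<rho>" "n <= l" "s : spec om n (ctr \<rho> i)" for i n s
   proof -
    have "2 * t <= abs (s - ec m J)" using gd that unfolding good_def by blast
    then show ?thesis using J(2) ht t(1) h by linarith
   qed
   show "\<not> (y : res om l (h / 2) E & y + real k * om : res om l (h / 2) E)" if k: "k : {K0..R}" for k y
   proof
    assume y: "y : res om l (h / 2) E & y + real k * om : res om l (h / 2) E"
    have sub: "res om l (h / 2) E \<subseteq> res om l h (ec m J)"
    proof
     fix z assume "z : res om l (h / 2) E"
     then obtain s where s: "s : spec om l z" "abs (s - E) < h / 2" by (auto simp: res_def)
     then have "abs (s - ec m J) < h" using J(2) by linarith
     then show "z : res om l h (ec m J)" using s by (auto simp: res_def)
    qed
    then have "om : dbl l h t L0 T (ec m J) k" using om(1) gd y unfolding dbl_def by blast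
    then show False using nQ i(2) k unfolding Q_def by blast
   qed
  qed
 qed
qed

end

section \<open>Two nearly degenerate eigenvectors cannot share a small cluster\<close>

lemma combination_sum:
 fixes u v :: "nat => complex"
 assumes "(\<Sum>i<N. cnj (u i) * u i) = 1" "(\<Sum>i<N. cnj (v i) * v i) = 1" "(\<Sum>i<N. cnj (u i) * v i) = 0"
 shows "(\<Sum>i<N. (cmod (c * u i - d * v i))^2) = (cmod c)^2 + (cmod d)^2"
proof -
 have vu: "(\<Sum>i<N. cnj (v i) * u i) = 0"
 proof -
  have "cnj (\<Sum>i<N. cnj (u i) * v i) = (\<Sum>i<N. cnj (v i) * u i)" by (simp add: mult.commute)
  then show ?thesis using assms(3) by simp
 qed
 have "complex_of_real (\<Sum>i<N. (cmod (c * u i - d * v i))^2) = (\<Sum>i<N. cnj (c * u i - d * v i) * (c * u i - d * v i))"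
  unfolding of_real_sum complex_norm_square by (simp add: mult.commute)
 also have "... = cnj c * c * (\<Sum>i<N. cnj (u i) * u i) + cnj d * d * (\<Sum>i<N. cnj (v i) * v i)
   - cnj c * d * (\<Sum>i<N. cnj (u i) * v i) - cnj d * c * (\<Sum>i<N. cnj (v i) * u i)"
  unfolding sum_distrib_left sum.distrib[symmetric] sum_subtractf[symmetric]
  by (intro sum.cong refl) (simp add: algebra_simps)
 also have "... = complex_of_real ((cmod c)^2 + (cmod d)^2)"
  unfolding assms vu of_real_add complex_norm_square by (simp add: mult.commute)
 finally show ?thesis by (simp only: of_real_eq_iff)
qed

lemma norm_combination_le:
 fixes c d x y :: complex
 shows "(cmod (c * x - d * y))^2 <= ((cmod c)^2 + (cmod d)^2) * ((cmod x)^2 + (cmod y)^2)"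
proof -
 have "cmod (c * x - d * y) <= cmod c * cmod x + cmod d * cmod y"
  using norm_triangle_ineq4[of "c * x" "d * y"] by (simp add: norm_mult)
 then have "(cmod (c * x - d * y))^2 <= (cmod c * cmod x + cmod d * cmod y)^2" by (intro power_mono) auto
 also have "... <= ((cmod c)^2 + (cmod d)^2) * ((cmod x)^2 + (cmod y)^2)"
  using zero_le_power2[of "cmod c * cmod y - cmod d * cmod x"] by (simp add: power2_eq_square algebra_simps)
 finally show ?thesis .
qed

text \<open>The Wronskian of the two eigenvectors is of size \<open>\<delta>\<close>. Hence the combination vanishing at the
 site \<open>m\<close> is of size \<open>\<delta>\<close> next to \<open>m\<close>, and the recurrence keeps it small along the cluster.\<close>

lemma cluster_contradiction:
 fixes u v :: "nat => complex" and \<alpha> :: "nat => complex" and \<beta> :: "nat => real" and e e' A \<delta> bs :: real and N s0 K :: nat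
 defines "ext \<equiv> %(u :: nat => complex) i. if i = 0 \<or> i > N then 0 else u (i - 1)"
  and "S \<equiv> {i\<in>{..<N}. abs (int i - int s0) < int K}"
 assumes ru: "!!i. i < N ==> of_real (\<beta> (Suc i)) * ext u (Suc (Suc i)) = (\<alpha> i - of_real e) * ext u (Suc i) - of_real (\<beta> i) * ext u i"
  and rv: "!!i. i < N ==> of_real (\<beta> (Suc i)) * ext v (Suc (Suc i)) = (\<alpha> i - of_real e') * ext v (Suc i) - of_real (\<beta> i) * ext v i"
  and on: "(\<Sum>i<N. cnj (u i) * u i) = 1" "(\<Sum>i<N. cnj (v i) * v i) = 1" "(\<Sum>i<N. cnj (u i) * v i) = 0"
  and bd: "!!i. cmod (\<alpha> i) <= A" "abs e <= A" "!!i. 0 <= \<beta> i" "!!i. \<beta> i <= A" "A >= 1"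
  and \<delta>: "abs (e' - e) <= \<delta>" and bs: "0 < bs" "bs <= A" "!!i. i : S ==> bs <= \<beta> i"
  and out: "(\<Sum>i\<in>{..<N} - S. (cmod (u i))^2 + (cmod (v i))^2) <= 1 / 2"
 shows "1 <= 8 * (real K)^2 * \<delta>^2 * (4 * A / bs) ^ (4 * K)"
proof -
 define \<rho> where "\<rho> i = (cmod (u i))^2 + (cmod (v i))^2" for i
 have \<rho>0: "\<rho> i >= 0" for i by (simp add: \<rho>_def)
 have norm1: "(\<Sum>i<N. (cmod (w i))^2) = 1" if "(\<Sum>i<N. cnj (w i) * w i) = 1" for w :: "nat => complex"
 proof -
  have "complex_of_real (\<Sum>i<N. (cmod (w i))^2) = 1"
   unfolding of_real_sum complex_norm_square using that by (simp add: mult.commute)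
  then show ?thesis by (simp only: of_real_eq_1_iff)
 qed
 have \<delta>0: "\<delta> >= 0" using \<delta> by linarith
 have tot: "(\<Sum>i<N. \<rho> i) = 2" unfolding \<rho>_def sum.distrib using norm1 on by simp
 have Sf: "finite S" "S \<subseteq> {..<N}" by (auto simp: S_def)
 have split: "(\<Sum>i<N. f i) = (\<Sum>i\<in>S. f i) + (\<Sum>i\<in>{..<N} - S. f i)" for f :: "nat => real"
  using sum.subset_diff[OF Sf(2), of f] by simp
 have inS: "(\<Sum>i\<in>S. \<rho> i) >= 3 / 2" using split[of \<rho>] tot out unfolding \<rho>_def by linarith
 then have Sne: "S ~= {}" by auto
 \<comment> \<open>The site of largest joint mass in the cluster. The inside mass is at least
   \<open>3 / 2\<close> on at most \<open>2 * K\<close> sites, so this site carries at least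
   \<open>1 / (2 * K)\<close>.\<close>
 define m where "m = (ARG_MAX \<rho> i. i : S)"
 have m: "m : S" "!!i. i : S ==> \<rho> i <= \<rho> m"
 proof -
  obtain i0 where i0: "i0 : S" "!!i. i : S ==> \<rho> i <= \<rho> i0"
   using finite_has_maximal[of "\<rho> ` S"] Sf Sne by (metis (no_types, lifting) finite_imageI imageE image_eqI image_is_empty linorder_le_cases order_antisym)
  have "is_arg_max \<rho> (%i. i : S) i0" unfolding is_arg_max_def using i0 by (auto simp: not_less)
  then have "is_arg_max \<rho> (%i. i : S) m" unfolding m_def arg_max_def by (rule someI)
  then show "m : S" "!!i. i : S ==> \<rho> i <= \<rho> m" unfolding is_arg_max_def by (auto simp: not_less)
 qed
 have cardS: "card S <= 2 * K"
 proof -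
  have "int ` S \<subseteq> {int s0 - int K<..<int s0 + int K}" by (auto simp: S_def)
  then have "card (int ` S) <= card {int s0 - int K<..<int s0 + int K}" by (intro card_mono) auto
  moreover have "card (int ` S) = card S" by (rule card_image) simp
  ultimately show ?thesis by simp
 qed
 have K: "K > 0" using m(1) by (auto simp: S_def)
 have rm: "1 <= 2 * real K * \<rho> m"
 proof -
  have "3 / 2 <= (\<Sum>i\<in>S. \<rho> m)" by (rule order_trans[OF inS]) (rule sum_mono[OF m(2)])
  also have "... = real (card S) * \<rho> m" by simp
  also have "... <= real (2 * K) * \<rho> m" using cardS \<rho>0 by (intro mult_right_mono) auto
  finally show ?thesis by simp
 qed
 \<comment> \<open>The Wronskian without conjugation. It vanishes at the left end and grows by
   \<open>(e' - e) * u k * v k\<close> at each site; since the total mass is \<open>2\<close>, the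
   sum of the products is at most \<open>1\<close> in modulus.\<close>
 define W where "W i = of_real (\<beta> i) * (ext u (Suc i) * ext v i - ext u i * ext v (Suc i))" for i
 have Wb: "cmod (W i) <= \<delta>" if "i <= N" for i
 proof -
  have Wf: "W i = (\<Sum>k<i. of_real (e' - e) * (u k * v k))" if "i <= N" for i
   using that
  proof (induction i)
   case (Suc i)
   have "W (Suc i) = (of_real (\<beta> (Suc i)) * ext u (Suc (Suc i))) * ext v (Suc i) - ext u (Suc i) * (of_real (\<beta> (Suc i)) * ext v (Suc (Suc i)))"
    by (simp add: W_def algebra_simps)
   also have "... = W i + of_real (e' - e) * (ext u (Suc i) * ext v (Suc i))"
   proof -
    have "i < N" using Suc.prems by simp
    show ?thesis unfolding ru[OF \<open>i < N\<close>] rv[OF \<open>i < N\<close>] by (simp add: W_def algebra_simps)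
   qed
   also have "ext u (Suc i) * ext v (Suc i) = u i * v i" using Suc.prems by (simp add: ext_def)
   finally show ?case using Suc by simp
  qed (simp add: W_def ext_def)
  have "cmod (W i) <= (\<Sum>k<i. cmod (of_real (e' - e) * (u k * v k)))" unfolding Wf[OF that] by (rule norm_sum)
  also have "... <= (\<Sum>k<i. \<delta> * (\<rho> k / 2))"
  proof (rule sum_mono)
   fix k
   have "cmod (u k) * cmod (v k) <= \<rho> k / 2"
    using zero_le_power2[of "cmod (u k) - cmod (v k)"] by (simp add: \<rho>_def power2_eq_square algebra_simps)
   then have "abs (e' - e) * (cmod (u k) * cmod (v k)) <= \<delta> * (\<rho> k / 2)" using \<delta> \<delta>0 by (intro mult_mono) auto
   then show "cmod (of_real (e' - e) * (u k * v k)) <= \<delta> * (\<rho> k / 2)" by (simp only: norm_mult norm_of_real)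
  qed
  also have "... <= (\<Sum>k<N. \<delta> * (\<rho> k / 2))" using that \<rho>0 \<delta>0 by (intro sum_mono2) auto
  also have "... = \<delta>" unfolding sum_distrib_left[symmetric] sum_divide_distrib[symmetric] tot by simp
  finally show ?thesis .
 qed
 \<comment> \<open>The combination vanishing at \<open>m\<close>. Its neighbouring values are
   Wronskians divided by \<open>\<beta>\<close>, hence small; yet by orthonormality its total mass
   is that of the site \<open>m\<close>, which cannot be small.\<close>
 define \<phi> where "\<phi> i = v m * u i - u m * v i" for i
 define \<psi> where "\<psi> i = v m * ext u i - u m * ext v i" for i
 have \<psi>: "\<psi> (Suc i) = \<phi> i" if "i < N" for i using that by (simp add: \<psi>_def \<phi>_def ext_def)
 have um: "cmod (u i) <= 1" "cmod (v i) <= 1" if "i < N" for i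
 proof -
  have "(cmod (w i))^2 <= 1" if "(\<Sum>i<N. cnj (w i) * w i) = 1" for w :: "nat => complex"
   using member_le_sum[of i "{..<N}" "%i. (cmod (w i))^2"] \<open>i < N\<close> norm1[OF that] by simp
  from this[OF on(1)] this[OF on(2)] show "cmod (u i) <= 1" "cmod (v i) <= 1"
   by (simp_all add: power2_le_iff_abs_le abs_square_le_1)
 qed
 have mN: "m < N" using m(1) by (simp add: S_def)
 \<comment> \<open>Growth per site: \<open>2 * A\<close> from the diagonal, \<open>A\<close> from
   the site before and \<open>A\<close> to absorb the error from \<open>e' - e\<close>, all divided
   by the smallest off-diagonal entry.\<close>
 define B where "B = 4 * A / bs"
 have B: "B >= 1" "bs * B = 4 * A" using bs bd(5) by (simp_all add: B_def)
 have err: "of_real (\<beta> (Suc i)) * \<psi> (Suc (Suc i)) = (\<alpha> i - of_real e) * \<psi> (Suc i) - of_real (\<beta> i) * \<psi> i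
   + of_real (e' - e) * (u m * ext v (Suc i))" if "i < N" for i
 proof -
  have "of_real (\<beta> (Suc i)) * \<psi> (Suc (Suc i)) = v m * (of_real (\<beta> (Suc i)) * ext u (Suc (Suc i))) - u m * (of_real (\<beta> (Suc i)) * ext v (Suc (Suc i)))"
   by (simp add: \<psi>_def algebra_simps)
  also have "... = (\<alpha> i - of_real e) * \<psi> (Suc i) - of_real (\<beta> i) * \<psi> i + of_real (e' - e) * (u m * ext v (Suc i))"
   unfolding ru[OF that] rv[OF that] \<psi>_def by (simp add: algebra_simps)
  finally show ?thesis .
 qed
 have errb: "cmod (of_real (e' - e) * (u m * ext v (Suc i))) <= \<delta>" if "i < N" for i
 proof -
  have "cmod (u m) * cmod (v i) <= 1 * 1" using um[OF mN] um[OF that] by (intro mult_mono) auto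
  then have "abs (e' - e) * (cmod (u m) * cmod (v i)) <= \<delta> * 1" using \<delta> \<delta>0 by (intro mult_mono) auto
  then have "cmod (of_real (e' - e) * (u m * v i)) <= \<delta>" by (simp only: norm_mult norm_of_real mult_1_right)
  then show ?thesis using that by (simp add: ext_def)
 qed
 have nxt: "bs * cmod X <= 2 * A * cmod Y + A * cmod Z + \<delta>"
  if "of_real b1 * X = (\<alpha> i - of_real e) * Y - of_real b2 * Z + W \<or> of_real b1 * X = (\<alpha> i - of_real e) * Y - of_real b2 * Z - W"
   "cmod W <= \<delta>" "bs <= b1" "0 <= b2" "b2 <= A" for b1 b2 :: real and X Y Z W i
 proof -
  have ab: "cmod (\<alpha> i - of_real e) <= 2 * A" using norm_triangle_ineq4[of "\<alpha> i" "of_real e"] bd(1)[of i] bd(2) by simp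
  have tri: "cmod Q <= cmod P1 + cmod P2 + cmod W" if "Q = P1 - P2 + W \<or> Q = P1 - P2 - W" for P1 P2 Q :: complex
  proof -
   have "cmod Q <= cmod (P1 - P2) + cmod W" using that norm_triangle_ineq norm_triangle_ineq4 by metis
   then show ?thesis using norm_triangle_ineq4[of P1 P2] by linarith
  qed
  have "bs * cmod X <= b1 * cmod X" using that by (intro mult_right_mono) auto
  also have "... = cmod (of_real b1 * X)" using that bs by (simp add: norm_mult)
  also have "... <= cmod ((\<alpha> i - of_real e) * Y) + cmod (of_real b2 * Z) + cmod W"
   by (rule tri[OF that(1)])
  also have "... <= 2 * A * cmod Y + A * cmod Z + \<delta>"
   unfolding norm_mult using ab that by (intro add_mono mult_right_mono) auto
  finally show ?thesis .
 qed
 have growth: "cmod X <= \<delta> * B ^ Suc k" if "bs * cmod X <= 2 * A * y + A * z + \<delta>" "y <= \<delta> * B ^ k" "z <= \<delta> * B ^ k" for X y z k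
 proof -
  have "A * y <= A * (\<delta> * B ^ k)" "A * z <= A * (\<delta> * B ^ k)" using that bd(5) by (auto intro!: mult_left_mono)
  moreover have "1 * \<delta> <= A * (\<delta> * B ^ k)"
  proof -
   have "1 * \<delta> <= B ^ k * \<delta>" using B(1) \<delta>0 by (intro mult_right_mono) auto
   also have "... = 1 * (\<delta> * B ^ k)" by simp
   also have "... <= A * (\<delta> * B ^ k)" using bd(5) B(1) \<delta>0 by (intro mult_right_mono) auto
   finally show ?thesis .
  qed
  ultimately have "bs * cmod X <= 4 * A * (\<delta> * B ^ k)" using that(1) by simp
  also have "... = bs * (\<delta> * B ^ Suc k)" unfolding B(2)[symmetric] by simp
  finally show ?thesis using bs by simp
 qed
 have \<phi>m: "\<phi> m = 0" by (simp add: \<phi>_def)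
 have Bmono: "\<delta> * B ^ k <= \<delta> * B ^ Suc k" for k using B(1) \<delta>0 by (intro mult_left_mono power_increasing) auto
 have right: "m + k : S ==> cmod (\<phi> (m + k)) <= \<delta> * B ^ k" for k
 proof (induction k rule: induct_nat_012)
  case 0
  then show ?case using \<phi>m \<delta>0 by simp
 next
  case 1
  then have N: "Suc m < N" "bs <= \<beta> (Suc m)" using bs(3) by (auto simp: S_def)
  have "W (Suc m) = of_real (\<beta> (Suc m)) * \<phi> (Suc m)" using N by (simp add: W_def \<phi>_def ext_def algebra_simps)
  then have "cmod (of_real (\<beta> (Suc m)) * \<phi> (Suc m)) <= \<delta>" using Wb[of "Suc m"] N by simp
  then have "\<beta> (Suc m) * cmod (\<phi> (Suc m)) <= \<delta>" using bd(3) by (simp add: norm_mult)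
  moreover have "bs * cmod (\<phi> (Suc m)) <= \<beta> (Suc m) * cmod (\<phi> (Suc m))" using N by (intro mult_right_mono) auto
  ultimately have "bs * cmod (\<phi> (Suc m)) <= 2 * A * 0 + A * 0 + \<delta>" by simp
  then show ?case using growth[of "\<phi> (Suc m)" 0 0 0] \<delta>0 by simp
 next
  case (ge2 k)
  have N: "m + Suc (Suc k) < N" "bs <= \<beta> (m + Suc (Suc k))" using ge2.prems bs(3) by (auto simp: S_def)
  have S: "m + k : S" "m + Suc k : S" using ge2.prems m(1) by (auto simp: S_def)
  have "cmod (\<phi> (m + k)) <= \<delta> * B ^ Suc k" using ge2.IH(1)[OF S(1)] Bmono[of k] by linarith
  moreover have "bs * cmod (\<phi> (m + Suc (Suc k))) <= 2 * A * cmod (\<phi> (m + Suc k)) + A * cmod (\<phi> (m + k)) + \<delta>"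
  proof (rule nxt[of "\<beta> (m + Suc (Suc k))" _ "m + Suc k" _ "\<beta> (m + Suc k)"])
   show "of_real (\<beta> (m + Suc (Suc k))) * \<phi> (m + Suc (Suc k)) = (\<alpha> (m + Suc k) - of_real e) * \<phi> (m + Suc k) - of_real (\<beta> (m + Suc k)) * \<phi> (m + k)
     + of_real (e' - e) * (u m * ext v (Suc (m + Suc k))) \<or> of_real (\<beta> (m + Suc (Suc k))) * \<phi> (m + Suc (Suc k)) = (\<alpha> (m + Suc k) - of_real e) * \<phi> (m + Suc k) - of_real (\<beta> (m + Suc k)) * \<phi> (m + k)
     - of_real (e' - e) * (u m * ext v (Suc (m + Suc k)))"
    using err[of "m + Suc k"] N(1) \<psi>[of "m + Suc (Suc k)"] \<psi>[of "m + Suc k"] \<psi>[of "m + k"] by simp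
  qed (use errb[of "m + Suc k"] N bd in auto)
  ultimately show ?case using growth ge2.IH(2)[OF S(2)] by blast
 qed
 have left: "k <= m ==> m - k : S ==> cmod (\<phi> (m - k)) <= \<delta> * B ^ k" for k
 proof (induction k rule: induct_nat_012)
  case 0
  then show ?case using \<phi>m \<delta>0 by simp
 next
  case 1
  then have N: "m > 0" "bs <= \<beta> m" using bs(3)[OF m(1)] by auto
  have "W m = - of_real (\<beta> m) * \<phi> (m - 1)" using N mN by (simp add: W_def \<phi>_def ext_def algebra_simps)
  then have "cmod (of_real (\<beta> m) * \<phi> (m - 1)) <= \<delta>" using Wb[of m] mN by (simp add: norm_mult)
  then have "\<beta> m * cmod (\<phi> (m - 1)) <= \<delta>" using bd(3) by (simp add: norm_mult)
  moreover have "bs * cmod (\<phi> (m - 1)) <= \<beta> m * cmod (\<phi> (m - 1))" using N by (intro mult_right_mono) auto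
  ultimately have "bs * cmod (\<phi> (m - 1)) <= 2 * A * 0 + A * 0 + \<delta>" by simp
  then show ?case using growth[of "\<phi> (m - 1)" 0 0 0] \<delta>0 by simp
 next
  case (ge2 k)
  define j where "j = m - Suc (Suc k)"
  have mj: "m = j + Suc (Suc k)" using ge2.prems by (simp add: j_def)
  have S: "Suc (Suc j) : S" "Suc j : S" using ge2.prems m(1) mj unfolding S_def by auto
  have i: "m - k = Suc (Suc j)" "m - Suc k = Suc j" using mj by auto
  have N: "Suc (Suc j) < N" "bs <= \<beta> (Suc j)" using S bs(3) by (auto simp: S_def)
  have ih: "cmod (\<phi> (Suc (Suc j))) <= \<delta> * B ^ k" "cmod (\<phi> (Suc j)) <= \<delta> * B ^ Suc k"
   using ge2.IH S unfolding i using mj by auto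
  have "cmod (\<phi> (Suc (Suc j))) <= \<delta> * B ^ Suc k" using ih(1) Bmono[of k] by linarith
  moreover have "bs * cmod (\<phi> j) <= 2 * A * cmod (\<phi> (Suc j)) + A * cmod (\<phi> (Suc (Suc j))) + \<delta>"
  proof (rule nxt[of "\<beta> (Suc j)" _ "Suc j" _ "\<beta> (Suc (Suc j))"])
   show "of_real (\<beta> (Suc j)) * \<phi> j = (\<alpha> (Suc j) - of_real e) * \<phi> (Suc j) - of_real (\<beta> (Suc (Suc j))) * \<phi> (Suc (Suc j))
     + of_real (e' - e) * (u m * ext v (Suc (Suc j))) \<or> of_real (\<beta> (Suc j)) * \<phi> j = (\<alpha> (Suc j) - of_real e) * \<phi> (Suc j) - of_real (\<beta> (Suc (Suc j))) * \<phi> (Suc (Suc j))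
     - of_real (e' - e) * (u m * ext v (Suc (Suc j)))"
    using err[of "Suc j"] N(1) \<psi>[of j] \<psi>[of "Suc j"] \<psi>[of "Suc (Suc j)"] by (simp add: algebra_simps)
  qed (use errb[of "Suc j"] N bd in auto)
  ultimately have "cmod (\<phi> j) <= \<delta> * B ^ Suc (Suc k)" using growth ih(2) by blast
  then show ?case by (simp add: j_def)
 qed
 have small: "(cmod (\<phi> i))^2 <= \<delta>^2 * B ^ (4 * K)" if i: "i : S" for i
 proof -
  have "cmod (\<phi> i) <= \<delta> * B ^ (2 * K)"
  proof -
   have le: "\<delta> * B ^ k <= \<delta> * B ^ (2 * K)" if "k <= 2 * K" for k
    using B(1) \<delta>0 that by (intro mult_left_mono power_increasing) auto
   show ?thesis
   proof (cases "m <= i")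
    case True
    then have "i - m <= 2 * K" using i m(1) by (auto simp: S_def)
    then show ?thesis using right[of "i - m"] True i le[of "i - m"] by simp
   next
    case False
    then have "m - i <= 2 * K" using i m(1) by (auto simp: S_def)
    then show ?thesis using left[of "m - i"] False i le[of "m - i"] by simp
   qed
  qed
  then have "(cmod (\<phi> i))^2 <= (\<delta> * B ^ (2 * K))^2" by (intro power_mono) auto
  then show ?thesis by (simp add: power_mult_distrib power_mult[symmetric] mult.commute)
 qed
 \<comment> \<open>Outside the cluster Cauchy-Schwarz allows at most half of
   \<open>\<rho> m\<close>, so the other half must come from the cluster, where the combination has
   been shown to be tiny.\<close>
 have "\<rho> m = (\<Sum>i<N. (cmod (\<phi> i))^2)" unfolding \<phi>_def combination_sum[OF on] by (simp add: \<rho>_def)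
 also have "... = (\<Sum>i\<in>S. (cmod (\<phi> i))^2) + (\<Sum>i\<in>{..<N} - S. (cmod (\<phi> i))^2)" by (rule split)
 also have "... <= 2 * real K * (\<delta>^2 * B ^ (4 * K)) + \<rho> m * (1 / 2)"
 proof (rule add_mono)
  have "(\<Sum>i\<in>S. (cmod (\<phi> i))^2) <= real (card S) * (\<delta>^2 * B ^ (4 * K))"
   using sum_bounded_above[of S "%i. (cmod (\<phi> i))^2", OF small] by simp
  also have "... <= real (2 * K) * (\<delta>^2 * B ^ (4 * K))" using cardS B by (intro mult_right_mono) auto
  finally show "(\<Sum>i\<in>S. (cmod (\<phi> i))^2) <= 2 * real K * (\<delta>^2 * B ^ (4 * K))" by simp
  have "(\<Sum>i\<in>{..<N} - S. (cmod (\<phi> i))^2) <= (\<Sum>i\<in>{..<N} - S. \<rho> m * \<rho> i)"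
  proof (rule sum_mono)
   fix i show "(cmod (\<phi> i))^2 <= \<rho> m * \<rho> i"
    using norm_combination_le[of "v m" "u i" "u m" "v i"] by (simp add: \<phi>_def \<rho>_def add.commute)
  qed
  also have "... = \<rho> m * (\<Sum>i\<in>{..<N} - S. \<rho> i)" by (rule sum_distrib_left[symmetric])
  also have "... <= \<rho> m * (1 / 2)" using out \<rho>0 unfolding \<rho>_def by (intro mult_left_mono) auto
  finally show "(\<Sum>i\<in>{..<N} - S. (cmod (\<phi> i))^2) <= \<rho> m * (1 / 2)" .
 qed
 finally have "\<rho> m <= 4 * real K * (\<delta>^2 * B ^ (4 * K))" by simp
 then have "2 * real K * \<rho> m <= 2 * real K * (4 * real K * (\<delta>^2 * B ^ (4 * K)))" by (intro mult_left_mono) auto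
 then have "1 <= 2 * real K * (4 * real K * (\<delta>^2 * B ^ (4 * K)))" using rm by linarith
 also have "... = 8 * (real K)^2 * \<delta>^2 * (4 * A / bs) ^ (4 * K)" by (simp add: B_def power2_eq_square)
 finally show ?thesis .
qed

section \<open>The choice of parameters at one scale\<close>

text \<open>At the scale \<open>R\<close>: windows have length \<open>ls R\<close>, sets of resonant phases have at most \<open>ns R\<close> arcs, the
energies in \<open>[- A, A]\<close> are cut into \<open>ms A R\<close> cells of width \<open>hs A R\<close>, the frequencies into \<open>gs R\<close> cells.\<close>

definition ls :: "nat => nat" where "ls R = nat \<lceil>ln (real R) powr 1.1\<rceil>"
definition ns :: "nat => nat" where "ns R = nat \<lceil>real (ls R) powr 1.01\<rceil>"
definition ms :: "real => nat => nat" where "ms A R = nat \<lceil>2 * A * real R * ln (real R) powr 5.9\<rceil>"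
definition gs :: "nat => nat" where "gs R = nat \<lceil>real R ^ 2 * ln (real R) powr 15\<rceil>"
definition hs :: "real => nat => real" where "hs A R = 2 * A / real (ms A R)"

lemma real_nat_ceiling: "0 <= x ==> real (nat \<lceil>x\<rceil>) = of_int \<lceil>x\<rceil>"
 by simp

lemma real_ls: "real (ls R) = of_int \<lceil>ln (real R) powr 1.1\<rceil>"
 unfolding ls_def by (rule real_nat_ceiling) simp

lemma real_ns: "real (ns R) = of_int \<lceil>real (ls R) powr 1.01\<rceil>"
 unfolding ns_def by (rule real_nat_ceiling) simp

lemma real_ms: "A >= 0 ==> real (ms A R) = of_int \<lceil>2 * A * real R * ln (real R) powr 5.9\<rceil>"
 unfolding ms_def by (rule real_nat_ceiling) simp

lemma real_gs: "real (gs R) = of_int \<lceil>real R ^ 2 * ln (real R) powr 15\<rceil>"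
 unfolding gs_def by (rule real_nat_ceiling) simp

text \<open>The binding condition contains \<open>9 * ns ^ 4\<close>. In powers of
  \<open>ln R\<close> its main term is \<open>0.12 + 4.444 + 1.1 + 0.1 - 5.9 < - 0.1\<close>, where
  \<open>4.444 = 4 * 1.01 * 1.1\<close> comes from the arcs. It is what pushes the exponent
  \<open>5.9\<close> of \<open>ms\<close> so close to the permitted \<open>6\<close>; the
  \<open>15\<close> of \<open>gs\<close> is ample.\<close>

locale elim_num =
 fixes A L C :: real and R :: nat
 assumes num: "3 <= ln (real R)" "3 <= real (ls R)" "1 <= real (ms A R)" "1 <= real (gs R)"
  "2 * C * real (ls R) * log 2 (4 * A^2 * real (ls R) ^ 5) + 1 <= real (ns R)"
  "2 * hs A R <= 1 / real (ls R) ^ 5"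
  "real R * hs A R <= L * real (ls R)"
  "4 * real (ls R) ^ 3 * (L * real (ls R)) * (L * real (ls R)) <= hs A R * real R powr 1.2"
  "L * real (ls R) <= hs A R * real R ^ 2"
  "4 * real (ls R) ^ 3 * (L * real (ls R)) <= real (ls R) ^ 10"
  "2 * (L * real (ls R)) <= real (ls R) ^ 95"
  "(ln (real R) / (40 * ln (real (ls R))) + 2) * ln (3 * real (ns R) ^ 2) <= ln (real R) / 10"
  "ln (real R) powr 0.12 * (real R * (9 * real (ns R) ^ 4) * (2 * (real (ls R) * ln (real R) powr 0.1) * hs A R + 2 * real R / real (gs R))
   + real R powr 0.7 * (2 * (real (ls R) * ln (real R) powr 0.1) * hs A R + 2 * real R / real (gs R))) <= ln (real R) powr (- 0.1)"
  "C * ((real (ls R) + 1) * (real (ls R) * (4 * (1 / real (ls R) ^ 5) + hs A R))) + (log 2 (real (ms A R)) + 2) * (5 * real (ls R) / real (ls R) ^ 3)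
   + 5 * real (ls R) / (real (ls R) * ln (real R) powr 0.1) + ln (real R) powr (- 0.12) * (2 * A) <= ln (real R) powr (- 0.05)"
  "real (ms A R) <= real R * ln (real R) powr 5.95"
  "real (gs R) <= 2 * real R ^ 2 * ln (real R) powr 15"

lemma elim_num_eventually:
 assumes "A >= 1" "C > 0" "L > 0"
 shows "eventually (elim_num A L C) sequentially"
proof -
 have A: "A >= 0" using assms by simp
 show ?thesis unfolding elim_num_def hs_def real_ms[OF A] real_gs real_ns real_ls
  by (intro eventually_conj) (use assms in real_asymp)+
qed

lemma mes_compl_le_UN:
 assumes "finite I" "real (card I) <= C" "real (card I) * r <= u"
  and "!!i. i : I ==> J i = {lo i..lo i + r}" and r: "r >= 0"
 shows "mes_compl_le (\<Union>i\<in>I. J i) u C"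
 unfolding mes_compl_le_def
proof (intro exI[of _ "J ` I"] conjI ballI)
 show "finite (J ` I)" using assms by simp
 have "real (card (J ` I)) <= real (card I)" using card_image_le[OF assms(1), of J] by simp
 then show "real (card (J ` I)) <= C" using assms(2) by linarith
 show "is_interval X" if "X : J ` I" for X using that assms(4) by (auto simp: is_interval_cc)
 have "emeasure lborel (\<Union>i\<in>I. J i) <= (\<Sum>i\<in>I. emeasure lborel (J i))"
  by (rule emeasure_subadditive_finite[OF assms(1)]) (use assms(4) in auto)
 also have "... = (\<Sum>i\<in>I. ennreal r)" by (intro sum.cong refl) (simp add: assms(4) r)
 also have "... = ennreal (real (card I) * r)" by (simp add: ennreal_mult r ennreal_of_nat_eq_real_of_nat)
 also have "... <= ennreal u" by (rule ennreal_leI[OF assms(3)])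
 finally show "emeasure lborel (\<Union> (J ` I)) <= ennreal u" by simp
qed auto

lemma mes_compl_le_Un:
 assumes "mes_compl_le S u C" "mes_compl_le S' u' C'" "u >= 0" "u' >= 0"
 shows "mes_compl_le (S \<union> S') (u + u') (C + C')"
proof -
 obtain I where I: "finite I" "real (card I) <= C" "\<forall>J\<in>I. is_interval J" "S \<subseteq> \<Union>I" "emeasure lborel (\<Union>I) <= ennreal u"
  using assms(1) unfolding mes_compl_le_def by auto
 obtain I' where I': "finite I'" "real (card I') <= C'" "\<forall>J\<in>I'. is_interval J" "S' \<subseteq> \<Union>I'" "emeasure lborel (\<Union>I') <= ennreal u'"
  using assms(2) unfolding mes_compl_le_def by auto
 have m: "\<Union>K\<in>sets lborel" if "finite K" "\<forall>J\<in>K. is_interval J" for K :: "real set set"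
  using that by (intro sets.finite_Union) (auto simp: real_interval_borel_measurable)
 show ?thesis unfolding mes_compl_le_def
 proof (intro exI[of _ "I \<union> I'"] conjI)
  have "real (card (I \<union> I')) <= real (card I) + real (card I')" using card_Un_le[of I I'] by linarith
  then show "real (card (I \<union> I')) <= C + C'" using I I' by linarith
  have "emeasure lborel (\<Union>(I \<union> I')) <= emeasure lborel (\<Union>I) + emeasure lborel (\<Union>I')"
   unfolding Union_Un_distrib by (rule emeasure_subadditive) (use I I' m in auto)
  also have "... <= ennreal u + ennreal u'" using I I' by (intro add_mono)
  also have "... = ennreal (u + u')" using assms by simp
  finally show "emeasure lborel (\<Union>(I \<union> I')) <= ennreal (u + u')" .
 qed (use I I' in auto)
qed

lemma mes_compl_le_mono:
 assumes "mes_compl_le S u C" "u <= u'" "C <= C'"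
 shows "mes_compl_le S u' C'"
 using assms unfolding mes_compl_le_def by (meson ennreal_leI order_trans)

context jac
begin

text \<open>Choices: \<open>L0 = l ^ 3\<close> makes the Markov loss summable over the dyadic
  widths, \<open>t = l ^ (- 5)\<close> beats the roughly \<open>l^2\<close> eigenvalues at each
  centre, and the least distance \<open>l ^ 100\<close> makes each refinement shrink by
  \<open>l ^ 90\<close>, so that few refinements are needed.\<close>

theorem scale_elimination:
 assumes num: "elim_num A Lip (real (nc \<rho>)) R"
 obtains \<Omega> where "mes_compl_le \<Omega> (ln (real R) powr (- 0.1)) (2 * real R ^ 2 * ln (real R) powr 15)"
  "!!om. om : {0..1} - \<Omega> ==> \<exists>\<E>. mes_compl_le \<E> (ln (real R) powr (- 0.05)) (real R * ln (real R) powr 5.95) &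
    (\<forall>E. abs E <= A --> E \<notin> \<E> --> norep om (ls R) (hs A R) (ls R ^ 100) R E & centred om (ls R) (1 / real (ls R) ^ 5) E)"
proof -
 define r where "r = ln (real R)"
 define l where "l = ls R"
 define n where "n = ns R"
 define m where "m = ms A R"
 define h where "h = hs A R"
 define G where "G = gs R"
 \<comment> \<open>Average constant \<open>l\<close> times a small power of \<open>ln R\<close>, so
   the energies violating it have measure of order \<open>r powr (- 0.1)\<close>.\<close>
 define T where "T = real l * r powr 0.1"
 define t where "t = 1 / real l ^ 5"
 define g where "g = 1 / real G"
 define q where "q = nat \<lceil>log 2 (real m)\<rceil> + 1"
 define j0 where "j0 = nat \<lceil>r / (40 * ln (real l))\<rceil>"
 \<comment> \<open>For distances beyond \<open>R powr 0.6\<close> a single refinement suffices,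
   which is essential because almost all \<open>k\<close> are of this kind and each costs a power of
   \<open>n\<close>. The fewer than \<open>R powr 0.6\<close> shorter distances may use
   many.\<close>
 define jj where "jj k = (if real R powr 0.6 <= real k then 1 else j0)" for k :: nat
 define P where "P = (\<Sum>k=l^100..R. real (k * (3 * n^2) ^ Suc (jj k)) * (2 * T * h / real k / g + 2))"
 note N = elim_num.num[OF num, folded r_def l_def n_def m_def h_def G_def, folded T_def t_def]
 have m0: "m > 0" and l0: "l > 0" and G0: "G > 0" using N by linarith+
 have hm: "h = 2 * A / real m" by (simp add: h_def m_def hs_def)
 have h0: "h > 0" using A m0 by (simp add: hm)
 have R0: "real R > 0"
 proof (rule ccontr)
  assume "\<not> real R > 0"
  then have "r = 0" by (simp add: r_def)
  then show False using N by simp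
 qed
 have Rr: "real R = exp r" using R0 by (simp add: r_def)
 have T0: "T > 0" unfolding T_def using N l0 by simp
 have t0: "0 < t" "t <= 1" using l0 by (simp_all add: t_def)
 have g0: "g > 0" "real G * g = 1" using G0 by (simp_all add: g_def)
 have lnl: "ln (real l) >= 1"
 proof -
  have "exp 1 <= real l" using exp_le N by linarith
  then show ?thesis using l0 by (simp add: ln_ge_iff)
 qed
 define C where "C = Lip * real l"
 have C0: "C > 0" unfolding C_def using Lip_pos l0 by simp
 have j0: "r / (40 * ln (real l)) <= real j0" "real j0 <= r / (40 * ln (real l)) + 1"
 proof -
  have "0 <= r / (40 * ln (real l))" using N lnl by simp
  then show "r / (40 * ln (real l)) <= real j0" "real j0 <= r / (40 * ln (real l)) + 1" unfolding j0_def by linarith+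
 qed
 have n1: "real n >= 1"
 proof -
  have "log 2 (4 * A^2 * real l ^ 5) >= 0"
  proof -
   have "1 * 1 <= (4 * A^2) * real l ^ 5" using A2 N by (intro mult_mono) auto
   then show ?thesis by simp
  qed
  then have "0 <= 2 * real (nc \<rho>) * real l * log 2 (4 * A^2 * real l ^ 5)" by simp
  then show ?thesis using N(5) by linarith
 qed
 \<comment> \<open>\<open>ln (3 * n^2)\<close> is about \<open>2.02 * ln l\<close>, so with
   \<open>j0\<close> about \<open>r / (40 * ln l)\<close> the number of intervals grows to roughly
   \<open>exp (r / 20)\<close>, below \<open>R powr 0.1\<close>.\<close>
 have npow: "(3 * real n ^ 2) ^ Suc j0 <= real R powr 0.1"
 proof -
  have pos: "3 * real n ^ 2 >= 1" using one_le_power[OF n1, of 2] by linarith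
  then have lnn: "ln (3 * real n ^ 2) >= 0" by simp
  have "(3 * real n ^ 2) ^ Suc j0 = exp (real (Suc j0) * ln (3 * real n ^ 2))"
  proof -
   have "exp (ln (3 * real n ^ 2)) = 3 * real n ^ 2" using pos by (intro exp_ln) linarith
   then show ?thesis unfolding exp_of_nat_mult by simp
  qed
  also have "... <= exp (r / 10)"
  proof -
   have "real (Suc j0) * ln (3 * real n ^ 2) <= (r / (40 * ln (real l)) + 2) * ln (3 * real n ^ 2)"
    using j0 lnn by (intro mult_right_mono) auto
   then show ?thesis using N(12) by simp
  qed
  also have "... = real R powr 0.1" using R0 by (simp add: powr_def r_def)
  finally show ?thesis .
 qed
 have K0pos: "l ^ 100 > 0" using l0 by simp
 \<comment> \<open>The refinements reach the terminal length: for large \<open>k\<close> since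
   \<open>k^2\<close> exceeds \<open>R powr 1.2\<close>, for small \<open>k\<close> since
   \<open>l ^ (- 90 * j0)\<close> is at most \<open>exp (- 9/4 * r)\<close>, below
   \<open>R ^ (- 2)\<close>.\<close>
 have ratio: "(4 * real l ^ 3 * C / real k) ^ jj k / real k <= h / C" if k: "l ^ 100 <= k" "k <= R" for k
 proof -
  have k0: "real k > 0" using less_le_trans[OF K0pos k(1)] by simp
  show ?thesis
  proof (cases "real R powr 0.6 <= real k")
   case True
   have "4 * real l ^ 3 * C * C <= h * real R powr 1.2" using N(8) by (simp add: C_def)
   also have "real R powr 1.2 = real R powr 0.6 * real R powr 0.6" by (simp add: powr_add[symmetric])
   also have "h * (real R powr 0.6 * real R powr 0.6) <= h * (real k * real k)"
    using True h0 by (intro mult_left_mono mult_mono) auto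
   finally have "4 * real l ^ 3 * C * C <= h * (real k * real k)" .
   then have "4 * real l ^ 3 * C / real k / real k <= h / C" using k0 C0 by (simp add: field_simps)
   then show ?thesis using True by (simp add: jj_def)
  next
   case False
   have "real l ^ 100 <= real k" using k(1) by (metis of_nat_le_iff of_nat_power)
   then have "4 * real l ^ 3 * C / real k <= real l ^ 10 / real l ^ 100"
    using N(10) l0 unfolding C_def by (intro frac_le) auto
   also have "... = (1 / real l) ^ 90" using l0 by (simp add: power_divide field_simps flip: power_add)
   finally have "(4 * real l ^ 3 * C / real k) ^ j0 <= ((1 / real l) ^ 90) ^ j0"
    using C0 by (intro power_mono) auto
   also have "... = exp (- (real (90 * j0) * ln (real l)))"
    unfolding power_mult[symmetric] exp_minus exp_of_nat_mult using l0 by (simp add: power_divide divide_inverse power_inverse)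
   also have "... <= exp (- 2 * r)"
   proof -
    have "r / (40 * ln (real l)) * (90 * ln (real l)) <= real j0 * (90 * ln (real l))"
     using j0 lnl by (intro mult_right_mono) auto
    then have "r * (9 / 4) <= real (90 * j0) * ln (real l)" using lnl by (simp add: mult_ac)
    then show ?thesis using N(1) by simp
   qed
   also have "... = 1 / real R ^ 2" unfolding Rr exp_of_nat_mult[symmetric] by (simp add: exp_minus divide_inverse)
   also have "... <= h / C" using N(9) C0 R0 by (simp add: C_def field_simps)
   finally have "(4 * real l ^ 3 * C / real k) ^ j0 <= h / C" .
   moreover have "(4 * real l ^ 3 * C / real k) ^ j0 / real k <= (4 * real l ^ 3 * C / real k) ^ j0 / 1"
   proof (rule divide_left_mono)
    show "1 <= real k" using k0 by simp
   qed (use k0 C0 in simp_all)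
   ultimately show ?thesis using False by (simp add: jj_def)
  qed
 qed
 have Pb: "P * g <= real R * (9 * real n ^ 4) * (2 * T * h + 2 * real R / real G) + real R powr 0.7 * (2 * T * h + 2 * real R / real G)"
 proof -
  define X where "X = 2 * T * h + 2 * real R / real G"
  have X0: "X >= 0" unfolding X_def using T0 h0 by simp
  have summand: "real (k * (3 * n^2) ^ Suc (jj k)) * (2 * T * h / real k / g + 2) * g <=
    9 * real n ^ 4 * X + (if real k <= real R powr 0.6 then real R powr 0.1 * X else 0)"
   if k: "k : {l^100..R}" for k
  proof -
   have k0: "real k > 0" using less_le_trans[OF K0pos, of k] k by simp
   have "real (k * (3 * n^2) ^ Suc (jj k)) * (2 * T * h / real k / g + 2) * g = (3 * real n ^ 2) ^ Suc (jj k) * (2 * T * h + 2 * real k * g)"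
    using k0 g0 by (simp add: field_simps)
   also have "... <= (3 * real n ^ 2) ^ Suc (jj k) * X"
   proof -
    have "real k * g <= real R * g" using k g0 by (intro mult_right_mono) auto
    then have "2 * T * h + 2 * real k * g <= X" unfolding X_def g_def by simp
    then show ?thesis by (intro mult_left_mono) auto
   qed
   also have "... <= 9 * real n ^ 4 * X + (if real k <= real R powr 0.6 then real R powr 0.1 * X else 0)"
   proof (cases "real R powr 0.6 <= real k")
    case True
    then have eq: "(3 * real n ^ 2) ^ Suc (jj k) = 9 * real n ^ 4" by (simp add: jj_def power2_eq_square power4_eq_xxxx)
    show ?thesis unfolding eq using X0 by simp
   next
    case False
    then have "(3 * real n ^ 2) ^ Suc (jj k) * X <= real R powr 0.1 * X"
     unfolding jj_def using npow X0 by (intro mult_right_mono) auto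
    then show ?thesis using False X0 by (simp add: add_increasing)
   qed
   finally show ?thesis .
  qed
  have "P * g <= (\<Sum>k=l^100..R. 9 * real n ^ 4 * X + (if real k <= real R powr 0.6 then real R powr 0.1 * X else 0))"
   unfolding P_def sum_distrib_right by (rule sum_mono[OF summand])
  also have "... = real (card {l^100..R}) * (9 * real n ^ 4 * X) + (\<Sum>k=l^100..R. if real k <= real R powr 0.6 then real R powr 0.1 * X else 0)"
   by (simp add: sum.distrib)
  also have "... <= real R * (9 * real n ^ 4 * X) + real R powr 0.6 * (real R powr 0.1 * X)"
  proof (rule add_mono)
   have "card {l^100..R} <= R" unfolding card_atLeastAtMost using K0pos by linarith
   then show "real (card {l^100..R}) * (9 * real n ^ 4 * X) <= real R * (9 * real n ^ 4 * X)" using X0 by (intro mult_right_mono) auto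
   have "(\<Sum>k=l^100..R. if real k <= real R powr 0.6 then real R powr 0.1 * X else 0) =
     real (card {k\<in>{l^100..R}. real k <= real R powr 0.6}) * (real R powr 0.1 * X)"
    by (simp add: sum.If_cases Int_def)
   also have "... <= real R powr 0.6 * (real R powr 0.1 * X)"
   proof (intro mult_right_mono)
    have "{k\<in>{l^100..R}. real k <= real R powr 0.6} \<subseteq> {1..nat \<lfloor>real R powr 0.6\<rfloor>}"
    proof (rule subsetI)
     fix k assume k: "k : {k\<in>{l^100..R}. real k <= real R powr 0.6}"
     then have "0 < k" using less_le_trans[OF K0pos, of k] by simp
     moreover have "k <= nat \<lfloor>real R powr 0.6\<rfloor>" using k by (simp add: le_nat_floor)
     ultimately show "k : {1..nat \<lfloor>real R powr 0.6\<rfloor>}" by simp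
    qed
    from card_mono[OF _ this] have "card {k\<in>{l^100..R}. real k <= real R powr 0.6} <= nat \<lfloor>real R powr 0.6\<rfloor>" by simp
    then have "real (card {k\<in>{l^100..R}. real k <= real R powr 0.6}) <= real (nat \<lfloor>real R powr 0.6\<rfloor>)" by (rule of_nat_mono)
    also have "... <= real R powr 0.6" by simp
    finally show "real (card {k\<in>{l^100..R}. real k <= real R powr 0.6}) <= real R powr 0.6" .
   qed (use X0 in auto)
   finally show "(\<Sum>k=l^100..R. if real k <= real R powr 0.6 then real R powr 0.1 * X else 0) <= real R powr 0.6 * (real R powr 0.1 * X)" .
  qed
  also have "real R powr 0.6 * (real R powr 0.1 * X) = real R powr 0.7 * X" by (simp add: powr_add[symmetric] mult.assoc[symmetric])
  finally show ?thesis unfolding X_def by (simp add: mult.assoc)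
 qed
 have tq: "t < 2 ^ q * (2 * A / real m)" "real q <= log 2 (real m) + 2"
 proof -
  have lm: "log 2 (real m) >= 0" using N(3) by simp
  then show "real q <= log 2 (real m) + 2" unfolding q_def by linarith
  have "log 2 (real m) <= real q" unfolding q_def using lm by linarith
  then have "real m <= 2 powr real q" using m0 by (simp add: log_le_iff)
  then have "real m <= 2 ^ q" by (simp add: powr_realpow)
  then have "real m * (2 * A / real m) <= 2 ^ q * (2 * A / real m)" using A by (intro mult_right_mono) auto
  then have "2 * A <= 2 ^ q * (2 * A / real m)" using m0 by simp
  then show "t < 2 ^ q * (2 * A / real m)" using t0 A by linarith
 qed
 have \<theta>: "r powr (- 0.12) > 0" using N by simp
 obtain I where I: "finite I" "card I <= G" "real (card I) <= P / r powr (- 0.12)"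
  "!!om. om : {0..1} ==> om \<notin> (\<Union>i\<in>I. {real i * g..(real i + 1) * g}) ==>
   \<exists>\<J>\<subseteq>{..<m}. real (card \<J>) <= real (nc \<rho>) * (real (l + 1) * (real l * (4 * t / h + 1))) +
     real q * (5 * real l / (real l ^ 3 * h)) + 5 * real l / (T * h) + r powr (- 0.12) * real m &
    (\<forall>E. abs E <= A --> E \<notin> (\<Union>J\<in>\<J>. {- A + real J * h..- A + (real J + 1) * h}) --> centred om l t E & norep om l h (l^100) R E)"
 proof (rule elimination[where m = m and l = l and t = t and ns = q and n = n and ?L0.0 = "real l ^ 3" and T = T
   and g = g and G = G and ?K0.0 = "l ^ 100" and \<theta> = "r powr (- 0.12)" and R = R and jj = jj, folded hm, folded P_def])
  show "t < 2 ^ q * h" using tq unfolding hm by simp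
  show "2 * real (nc \<rho>) * real l * log 2 (4 * A^2 / t) + 1 <= real n" using N(5) by (simp add: t_def)
  show "1 <= real G * g" using g0 by simp
  show "2 * h <= t" by (rule N(6))
  have "real l ^ 10 <= real l ^ 100" using N by (intro power_increasing) auto
  then show "4 * real l ^ 3 * (Lip * real l) <= real (l ^ 100)" using N(10) by simp
  show "real R * h <= Lip * real l" by (rule N)
  have "t * real (l ^ 100) = real l ^ 95" unfolding t_def using l0 by (simp add: field_simps flip: power_add)
  then show "2 * (Lip * real l) <= t * real (l ^ 100)" using N(11) by simp
  show "(4 * real l ^ 3 * (Lip * real l) / real k) ^ jj k / real k <= h / (Lip * real l)" if "l ^ 100 <= k" "k <= R" for k
   using ratio[OF that] unfolding C_def .
 qed (use m0 l0 t0 T0 g0 \<theta> K0pos in auto)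
 show thesis
 proof (rule that[of "\<Union>i\<in>I. {real i * g..(real i + 1) * g}"])
  show "mes_compl_le (\<Union>i\<in>I. {real i * g..(real i + 1) * g}) (ln (real R) powr (- 0.1)) (2 * real R ^ 2 * ln (real R) powr 15)"
  proof (rule mes_compl_le_UN[where r = g and lo = "%i. real i * g"])
   show "real (card I) <= 2 * real R ^ 2 * ln (real R) powr 15" using I(2) N(16) unfolding r_def by linarith
   have "real (card I) * g <= P / r powr (- 0.12) * g" using I(3) g0 by (intro mult_right_mono) auto
   also have "... = r powr 0.12 * (P * g)" using N(1) by (simp add: powr_minus_divide)
   also have "... <= r powr 0.12 * (real R * (9 * real n ^ 4) * (2 * T * h + 2 * real R / real G) + real R powr 0.7 * (2 * T * h + 2 * real R / real G))"
    by (rule mult_left_mono[OF Pb]) simp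
   also have "... <= r powr (- 0.1)" by (rule N)
   finally show "real (card I) * g <= ln (real R) powr (- 0.1)" unfolding r_def .
  qed (use I g0 in \<open>auto simp: algebra_simps\<close>)
  fix om assume "om : {0..1} - (\<Union>i\<in>I. {real i * g..(real i + 1) * g})"
  then have w: "om : {0..1}" "om \<notin> (\<Union>i\<in>I. {real i * g..(real i + 1) * g})" by auto
  obtain \<J> where J: "\<J> \<subseteq> {..<m}" "real (card \<J>) <= real (nc \<rho>) * (real (l + 1) * (real l * (4 * t / h + 1))) +
     real q * (5 * real l / (real l ^ 3 * h)) + 5 * real l / (T * h) + r powr (- 0.12) * real m"
    "!!E. abs E <= A ==> E \<notin> (\<Union>J\<in>\<J>. {- A + real J * h..- A + (real J + 1) * h}) ==> centred om l t E & norep om l h (l^100) R E"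
   using I(4)[OF w] by blast
  have fJ: "finite \<J>" "card \<J> <= m" using J(1) finite_subset card_mono[of "{..<m}" \<J>] by auto
  show "\<exists>\<E>. mes_compl_le \<E> (ln (real R) powr (- 0.05)) (real R * ln (real R) powr 5.95) &
    (\<forall>E. abs E <= A --> E \<notin> \<E> --> norep om (ls R) (hs A R) (ls R ^ 100) R E & centred om (ls R) (1 / real (ls R) ^ 5) E)"
  proof (intro exI[of _ "\<Union>J\<in>\<J>. {- A + real J * h..- A + (real J + 1) * h}"] conjI allI impI)
   show "mes_compl_le (\<Union>J\<in>\<J>. {- A + real J * h..- A + (real J + 1) * h}) (ln (real R) powr (- 0.05)) (real R * ln (real R) powr 5.95)"
   proof (rule mes_compl_le_UN[where r = h and lo = "%J. - A + real J * h"])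
    show "real (card \<J>) <= real R * ln (real R) powr 5.95" using fJ(2) N(15) unfolding r_def by linarith
    have mh: "real m * h = 2 * A" using m0 by (simp add: hm)
    have "real (card \<J>) * h <= (real (nc \<rho>) * (real (l + 1) * (real l * (4 * t / h + 1))) +
     real q * (5 * real l / (real l ^ 3 * h)) + 5 * real l / (T * h) + r powr (- 0.12) * real m) * h"
     using J(2) h0 by (intro mult_right_mono) auto
    also have "... = real (nc \<rho>) * ((real l + 1) * (real l * (4 * t + h))) + real q * (5 * real l / real l ^ 3)
      + 5 * real l / T + r powr (- 0.12) * (2 * A)"
    proof -
     have 1: "real (nc \<rho>) * (real (l + 1) * (real l * (4 * t / h + 1))) * h = real (nc \<rho>) * ((real l + 1) * (real l * (4 * t + h)))"
     proof -
      have "(4 * t / h + 1) * h = 4 * t + h" using h0 by (simp add: field_simps)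
      then show ?thesis by (metis (no_types, lifting) mult.assoc of_nat_1 of_nat_add)
     qed
     have 2: "real q * (5 * real l / (real l ^ 3 * h)) * h = real q * (5 * real l / real l ^ 3)" using h0 by simp
     have 3: "5 * real l / (T * h) * h = 5 * real l / T" using h0 by simp
     have 4: "r powr (- 0.12) * real m * h = r powr (- 0.12) * (2 * A)" unfolding mult.assoc mh ..
     show ?thesis unfolding distrib_right 1 2 3 4 ..
    qed
    also have "... <= real (nc \<rho>) * ((real l + 1) * (real l * (4 * t + h))) + (log 2 (real m) + 2) * (5 * real l / real l ^ 3)
      + 5 * real l / T + r powr (- 0.12) * (2 * A)"
     using tq(2) by (intro add_mono mult_right_mono order_refl) auto
    also have "... <= r powr (- 0.05)" by (rule N)
    finally show "real (card \<J>) * h <= ln (real R) powr (- 0.05)" unfolding r_def .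
   qed (use fJ h0 in \<open>auto simp: algebra_simps\<close>)
   fix E assume E: "abs E <= A" "E \<notin> (\<Union>J\<in>\<J>. {- A + real J * h..- A + (real J + 1) * h})"
   from J(3)[OF this] show "norep om (ls R) (hs A R) (ls R ^ 100) R E" "centred om (ls R) (1 / real (ls R) ^ 5) E"
    unfolding l_def[symmetric] h_def[symmetric] t_def[symmetric] by blast+
  qed
 qed
qed

end

text \<open>Base of twenty scales: \<open>xs ^ 20 >= ls\<close>. The oscillation bound is then about
  \<open>(ln R) powr 1.055\<close> up to powers of \<open>ln (ln R)\<close>, one unit from
  \<open>\<Lambda>\<close> and \<open>0.055 = 1.1 * 0.05\<close> from \<open>xs\<close>, against a
  gain of order \<open>(ln R) powr 1.1\<close>. The \<open>+ 1\<close> ensures a base of at least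
  \<open>2\<close>.\<close>

definition xs :: "nat => nat" where "xs R = nat \<lceil>real (ls R) powr 0.05\<rceil> + 1"

text \<open>Chosen so that \<open>4 * l * \<eta> = h / 2\<close>: the distance demanded by
  \<open>F_compare_lower\<close> is exactly the width of the resonances excluded in
  \<open>norep\<close>.\<close>

definition \<eta>s :: "real => nat => real" where "\<eta>s A R = hs A R / (8 * real (ls R))"

definition decay_num :: "real => real => real => real => real => real => nat => bool" where
 "decay_num A C c \<alpha> \<gamma> C2 R \<longleftrightarrow>
   3 <= real (ls R) & 0 < hs A R & \<eta>s A R <= 1 &
   3 + 10 * ln (12 * A^2 / \<eta>s A R) +
    4 ^ 20 * (8 * ln (12 * A^2 / \<eta>s A R) + 4 * real (xs R) * ((4 * ln (real (xs R) ^ 20) powr \<alpha> + 4) / c + 1) *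
     (30 * C * ln (6 * A^2 / (1 / real (ls R) ^ 5)) * ln (12 * A^2 / \<eta>s A R))) + C2
    - 3 / 4 * \<gamma> * (real (ls R) / 2 - 1) <= - (\<gamma> * real (ls R) / 8)"

lemma real_xs: "real (xs R) = of_int \<lceil>real (ls R) powr 0.05\<rceil> + 1"
 unfolding xs_def of_nat_add by (subst real_nat_ceiling) simp_all

lemma decay_num_eventually:
 assumes "A >= 1" "C > 0" "c > 0" "\<alpha> > 1" "\<gamma> > 0"
 shows "eventually (decay_num A C c \<alpha> \<gamma> C2) sequentially"
proof -
 have A: "A >= 0" using assms by simp
 show ?thesis unfolding decay_num_def \<eta>s_def hs_def real_ms[OF A] real_xs real_ls
  by (intro eventually_conj) (use assms in real_asymp)+
qed

context jac
begin

text \<open>\<open>K\<close> is left free: with the maximum of \<open>u\<close> it shows that the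
  window at the maximal site is resonant, with \<open>1\<close> it bounds a normalised eigenvector
  elsewhere. \<open>e\<close> may differ from \<open>E\<close> so that both eigenvectors of a close
  pair are covered.\<close>

definition decays :: "real => real => nat => real => real => bool" where
 "decays om E l h D \<longleftrightarrow> (\<forall>N x e u t K. l <= N --> t < N --> abs (e - E) * real l <= h / (8 * real l) -->
   (\<forall>i<N. (\<Sum>m<N. TM om x i m * u m) = of_real e * u i) --> (\<forall>i<N. cmod (u i) <= K) -->
   x + real (win l N t) * om \<notin> res om l (h / 2) E --> cmod (u t) <= D * K)"

text \<open>\<open>centred\<close> yields the lower bounds that feed \<open>large_deviation\<close>;
  \<open>lyapunov_lower\<close> and \<open>b_prod_bound\<close> supply the two competing rates, and
  \<open>decay_num\<close> states that all additive errors are absorbed when passing from rate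
  \<open>3/4 * \<gamma>\<close> over half a window to \<open>\<gamma> / 8\<close> over a full
  one.\<close>

theorem scale_decay:
 assumes num: "decay_num A (real (nc \<rho>)) c \<alpha> \<gamma> (2 * A * real Q) R"
  and w: "om : diophantine c \<alpha>" and c: "0 < c" "c < 1" and \<alpha>: "\<alpha> > 1" and \<gamma>: "\<gamma> > 0"
  and E: "abs E <= A" and bt: "!!x::real. bt (of_real x) = cnj (b (of_real x))"
  and L: "lyapunov a b bt om E > \<gamma>" and cen: "centred om (ls R) (1 / real (ls R) ^ 5) E"
  and \<tau>: "0 < \<tau>" "\<tau> <= 1" and Q: "2 <= Q" "eb \<rho> A \<tau> + 2 * VW \<rho> A \<tau> * Dn c \<alpha> (real Q) / real Q <= \<gamma> / 4"
 shows "decays om E (ls R) (hs A R) (exp (- (\<gamma> * real (ls R) / 8)))"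
 unfolding decays_def
proof (intro allI impI)
 define l where "l = ls R"
 define h where "h = hs A R"
 define \<eta> where "\<eta> = h / (8 * real l)"
 define t where "t = 1 / real l ^ 5"
 define C1 where "C1 = OSC 20 (xs R) c \<alpha> t \<eta>"
 define C2 where "C2 = 2 * A * real Q"
 have \<eta>s: "\<eta>s A R = \<eta>" by (simp add: \<eta>s_def \<eta>_def h_def l_def)
 have n: "3 <= real l" "0 < h" "\<eta> <= 1"
   "3 + 10 * \<Lambda> \<eta> + C1 + C2 - 3 / 4 * \<gamma> * (real l / 2 - 1) <= - (\<gamma> * real l / 8)"
  using num unfolding decay_num_def C1_def OSC_def \<Lambda>_def V1_def Dn_def C2_def \<eta>s t_def l_def h_def by auto
 have l0: "l > 0" using n by (cases l) auto
 have \<eta>: "0 < \<eta>" "\<eta> <= 1" using n l0 by (auto simp: \<eta>_def)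
 have t: "0 < t" "t <= 1" using l0 by (simp_all add: t_def)
 have lx: "l <= xs R ^ 20" "2 <= xs R"
 proof -
  have "real l = (real l powr 0.05) ^ 20" using l0 by (simp add: powr_powr flip: powr_realpow)
  also have "... <= real (xs R) ^ 20" unfolding real_xs l_def by (intro power_mono) (auto intro: order_trans[OF le_of_int_ceiling])
  finally show "l <= xs R ^ 20" unfolding of_nat_power[symmetric] of_nat_le_iff .
  have "real l powr 0.05 > 0" using l0 by simp
  then have "\<lceil>real l powr 0.05\<rceil> >= 1" by (simp add: le_ceiling_iff)
  then show "2 <= xs R" unfolding xs_def l_def by linarith
 qed
 have low: "t ^ n <= cmod (F om (Complex E \<eta>) n (of_real (ctr \<rho> i)))" if "i < nc \<rho>" "n <= l" for i n
 proof -
  have "t ^ n <= cmod (F om (of_real E) n (of_real (ctr \<rho> i)))"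
   by (rule F_lower_dist) (use cen that t in \<open>auto simp: centred_def t_def l_def\<close>)
  also have "... <= cmod (F om (Complex E \<eta>) n (of_real (ctr \<rho> i)))" by (rule F_real_le)
  finally show ?thesis .
 qed
 have LD: "abs (U om E \<eta> n y - integral {0..1} (U om E \<eta> n)) <= C1" if "n <= l" for n y
  unfolding C1_def by (rule large_deviation[OF \<eta> E t w c \<alpha> low lx(2) _ lx(1) that]) auto
 have lyap: "real d * (\<D> + \<gamma>) - 8 * \<Lambda> \<eta> <= integral {0..1} (U om E \<eta> d)" if "d > 0" for d
  by (rule lyapunov_lower[OF bt \<eta> E L that])
 have bprod: "(\<Prod>k<s. cmod (b (of_real (y + real k * om)))) <= exp (real s * (\<D> + \<gamma> / 4) + C2)" for y s
 proof -
  have "(\<Prod>k<s. cmod (b (of_real (y + real k * om)))) <=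
   exp (real s * (\<D> + (eb \<rho> A \<tau> + 2 * VW \<rho> A \<tau> * Dn c \<alpha> (real Q) / real Q)) + 2 * A * real Q)"
   by (rule b_prod_bound[OF \<tau> w c \<alpha> Q(1)])
  also have "... <= exp (real s * (\<D> + \<gamma> / 4) + C2)"
  proof -
   have "real s * (\<D> + (eb \<rho> A \<tau> + 2 * VW \<rho> A \<tau> * Dn c \<alpha> (real Q) / real Q)) <= real s * (\<D> + \<gamma> / 4)"
    using Q(2) by (intro mult_left_mono) auto
   then show ?thesis by (simp add: C2_def)
  qed
  finally show ?thesis .
 qed
 fix N x e and u :: "nat => complex" and s :: nat and K :: real
 assume N: "ls R <= N" and s: "s < N" and e: "abs (e - E) * real (ls R) <= hs A R / (8 * real (ls R))"
  and ev: "\<forall>i<N. (\<Sum>m<N. TM om x i m * u m) = of_real e * u i" and bd: "\<forall>i<N. cmod (u i) <= K"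
  and nres: "x + real (win (ls R) N s) * om \<notin> res om (ls R) (hs A R / 2) E"
 have far: "4 * real l * \<eta> <= abs (z - E)" if "z : spec om l (x + real (win l N s) * om)" for z
 proof -
  have "h / 2 <= abs (z - E)" using nres that unfolding res_def l_def[symmetric] h_def[symmetric] by force
  then show ?thesis using l0 by (simp add: \<eta>_def)
 qed
 have "cmod (u s) <= 2 * exp (2 + 10 * \<Lambda> \<eta> + C1 + C2 - 3/4 * \<gamma> * real (l div 2)) * K"
  by (rule site_decay[OF \<eta> E LD lyap bprod \<gamma> l0 _ s far]) (use N e ev bd in \<open>auto simp: l_def \<eta>_def h_def\<close>)
 also have "... <= exp (- (\<gamma> * real l / 8)) * K"
 proof (rule mult_right_mono)
  have "(2::real) <= exp 1" using exp_ge_add_one_self[of 1] by simp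
  then have "2 * exp (2 + 10 * \<Lambda> \<eta> + C1 + C2 - 3/4 * \<gamma> * real (l div 2)) <= exp 1 * exp (2 + 10 * \<Lambda> \<eta> + C1 + C2 - 3/4 * \<gamma> * real (l div 2))"
   by (intro mult_right_mono) auto
  also have "... = exp (3 + 10 * \<Lambda> \<eta> + C1 + C2 - 3/4 * \<gamma> * real (l div 2))" unfolding exp_add[symmetric] by (simp add: algebra_simps)
  also have "... <= exp (- (\<gamma> * real l / 8))"
  proof -
   have "real l / 2 - 1 <= real (l div 2)" by linarith
   then have "3/4 * \<gamma> * (real l / 2 - 1) <= 3/4 * \<gamma> * real (l div 2)" using \<gamma> by (intro mult_left_mono) auto
   then show ?thesis using n(4) by simp
  qed
  finally show "2 * exp (2 + 10 * \<Lambda> \<eta> + C1 + C2 - 3/4 * \<gamma> * real (l div 2)) <= exp (- (\<gamma> * real l / 8))" .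
  show "0 <= K" using bd s norm_ge_zero order_trans by blast
 qed
 finally show "cmod (u s) <= exp (- (\<gamma> * real (ls R) / 8)) * K" unfolding l_def .
qed

end

section \<open>Concentration of two eigenvectors on one cluster\<close>

lemma unit_vector_bound:
 fixes u :: "nat => complex"
 assumes "(\<Sum>i<N. cnj (u i) * u i) = 1"
 shows "(\<Sum>i<N. (cmod (u i))^2) = 1" "i < N ==> cmod (u i) <= 1"
proof -
 have "complex_of_real (\<Sum>i<N. (cmod (u i))^2) = 1"
  unfolding of_real_sum complex_norm_square using assms by (simp add: mult.commute)
 then show 1: "(\<Sum>i<N. (cmod (u i))^2) = 1" by (simp only: of_real_eq_1_iff)
 assume "i < N"
 then have "(cmod (u i))^2 <= 1" using member_le_sum[of i "{..<N}" "%i. (cmod (u i))^2"] 1 by simp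
 then show "cmod (u i) <= 1" by (simp add: abs_square_le_1)
qed

context jac
begin

lemma win_bounds:
 assumes "0 < l" "l <= N" "t < N"
 shows "win l N t <= t" "t < win l N t + l" "win l N t <= N"
proof -
 have "l div 2 < l" using assms by simp
 then have "min (t - q) (N - l) <= t & t < min (t - q) (N - l) + l & min (t - q) (N - l) <= N" if "q = l div 2" for q
  using assms that unfolding min_def by (cases "t - q <= N - l") auto
 then show "win l N t <= t" "t < win l N t + l" "win l N t <= N" unfolding win_def by blast+
qed

lemma norep_far:
 assumes "norep om l h K0 R E" "x + real i * om : res om l (h / 2) E" "x + real j * om : res om l (h / 2) E"
 shows "abs (int i - int j) < int K0 \<or> int R < abs (int i - int j)"
proof (rule ccontr)
 assume n: "\<not> ?thesis"
 have key: False if "i <= j" "\<not> (abs (int i - int j) < int K0 \<or> int R < abs (int i - int j))"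
  "x + real i * om : res om l (h / 2) E" "x + real j * om : res om l (h / 2) E" for i j
 proof -
  have k: "j - i : {K0..R}" using that(1,2) by auto
  have e: "x + real j * om = (x + real i * om) + real (j - i) * om" using that(1) by (simp add: of_nat_diff algebra_simps)
  show False using assms(1) k that(3,4) unfolding norep_def e by blast
 qed
 show False
 proof (cases "i <= j")
  case True
  show ?thesis by (rule key[OF True n assms(2,3)])
 next
  case False
  have n': "\<not> (abs (int j - int i) < int K0 \<or> int R < abs (int j - int i))"
   using n unfolding abs_minus_commute[of "int j" "int i"] .
  show ?thesis by (rule key[OF _ n' assms(3,2)]) (use False in simp)
 qed
qed

text \<open>The maximal site \<open>s0\<close> of one eigenvector is resonant at both scales, so no
  other resonance exists at distances from \<open>K1\<close> to \<open>N\<close> at the long scale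
  or from \<open>K2\<close> to \<open>R\<close> at the short one. Beyond \<open>Z\<close> the long
  windows force decay, between \<open>K\<close> and \<open>Z\<close> the short ones do. The argument
  uses only closeness to \<open>E\<close>, hence both eigenvectors live near the same
  \<open>s0\<close>.\<close>

theorem no_close_pair:
 fixes N R l1 l2 K1 K2 :: nat and h1 h2 D1 D2 bs \<delta> E om x :: real
 defines "K \<equiv> K2 + l2" and "Z \<equiv> K1 + l1"
 assumes E: "abs E <= A" and l: "0 < l1" "l1 <= N" "0 < l2" "l2 <= N"
  and dec: "decays om E l1 h1 D1" "decays om E l2 h2 D2" and D: "0 <= D1" "D1 < 1" "0 <= D2" "D2 < 1"
  and rep: "norep om l1 h1 K1 N E" "norep om l2 h2 K2 R E" and ZR: "Z + l2 <= R"
  and mass: "4 * real Z * D2^2 + 2 * real N * D1^2 <= 1 / 2" and bs: "0 < bs" "bs <= A"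
  and large: "!!y d. y : res om l2 (h2 / 2) E ==> abs d <= int (K + l2) ==> bs <= cmod (b (of_real (y + of_int d * om)))"
  and es: "char_poly (hmat N (TM om x)) = (\<Prod>e\<leftarrow>map complex_of_real es. [:- e, 1:])"
  and jk: "j < N" "k < N" "j ~= k" and Ej: "es ! j = E" and \<delta>: "abs (es ! k - E) <= \<delta>"
  and \<delta>h: "\<delta> * real l1 <= h1 / (8 * real l1)" "\<delta> * real l2 <= h2 / (8 * real l2)" and h: "0 <= h1" "0 <= h2"
 shows "1 <= 8 * (real K)^2 * \<delta>^2 * (4 * A / bs) ^ (4 * K)"
proof -
 define e' where "e' = es ! k"
 obtain u v where on: "(\<Sum>i<N. cnj (u i) * u i) = 1" "(\<Sum>i<N. cnj (v i) * v i) = 1" "(\<Sum>i<N. cnj (u i) * v i) = 0"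
  and ev: "!!i. i < N ==> (\<Sum>m<N. TM om x i m * u m) = of_real E * u i"
   "!!i. i < N ==> (\<Sum>m<N. TM om x i m * v m) = of_real e' * v i"
  by (rule orthonormal_eigenvectors[OF es jk, unfolded Ej, folded e'_def], rule that)
 have eE: "abs (e - E) * real l1 <= h1 / (8 * real l1)" "abs (e - E) * real l2 <= h2 / (8 * real l2)" if "e = E \<or> e = e'" for e
 proof -
  have "abs (e - E) * real l1 <= h1 / (8 * real l1) & abs (e - E) * real l2 <= h2 / (8 * real l2)"
   using that
  proof
   assume "e = E"
   then show ?thesis using h by simp
  next
   assume "e = e'"
   then have "abs (e - E) * real l1 <= \<delta> * real l1" "abs (e - E) * real l2 <= \<delta> * real l2"
    using \<delta> unfolding e'_def by (auto intro!: mult_right_mono)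
   then show ?thesis using \<delta>h by linarith
  qed
  then show "abs (e - E) * real l1 <= h1 / (8 * real l1)" "abs (e - E) * real l2 <= h2 / (8 * real l2)" by auto
 qed
 obtain s0 where s0: "s0 < N" "!!i. i < N ==> cmod (u i) <= cmod (u s0)"
 proof -
  define M where "M = Max ((%i. cmod (u i)) ` {..<N})"
  have ne: "finite ((%i. cmod (u i)) ` {..<N})" "(%i. cmod (u i)) ` {..<N} ~= {}" using jk by auto
  obtain s0 where "s0 < N" "M = cmod (u s0)" using Max_in[OF ne] unfolding M_def by auto
  moreover have "cmod (u i) <= M" if "i < N" for i unfolding M_def by (rule Max_ge[OF ne(1)]) (use that in auto)
  ultimately show ?thesis using that by metis
 qed
 have pos: "cmod (u s0) > 0"
 proof (rule ccontr)
  assume "\<not> cmod (u s0) > 0"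
  then have "u i = 0" if "i < N" for i using s0(2)[OF that] by simp
  then have "(\<Sum>i<N. cnj (u i) * u i) = 0" by simp
  then show False using on(1) by simp
 qed
 \<comment> \<open>A nonresonant window would bound the maximal entry by \<open>D1 < 1\<close> times
   itself.\<close>
 have res1: "x + real (win l1 N s0) * om : res om l1 (h1 / 2) E"
 proof (rule ccontr)
  assume "x + real (win l1 N s0) * om \<notin> res om l1 (h1 / 2) E"
  then have "cmod (u s0) <= D1 * cmod (u s0)"
   using dec(1)[unfolded decays_def, rule_format, of N s0 E x u "cmod (u s0)"] l s0 ev(1) eE(1)[of E] by auto
  moreover have "D1 * cmod (u s0) < 1 * cmod (u s0)" using D pos by (intro mult_strict_right_mono)
  ultimately show False by simp
 qed
 have res2: "x + real (win l2 N s0) * om : res om l2 (h2 / 2) E"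
 proof (rule ccontr)
  assume "x + real (win l2 N s0) * om \<notin> res om l2 (h2 / 2) E"
  then have "cmod (u s0) <= D2 * cmod (u s0)"
   using dec(2)[unfolded decays_def, rule_format, of N s0 E x u "cmod (u s0)"] l s0 ev(1) eE(2)[of E] by auto
  moreover have "D2 * cmod (u s0) < 1 * cmod (u s0)" using D pos by (intro mult_strict_right_mono)
  ultimately show False by simp
 qed
 note w1 = win_bounds[OF l(1,2)] and w2 = win_bounds[OF l(3,4)]
 \<comment> \<open>A window starts less than its length away from its site. The extra
   \<open>l1\<close> in \<open>Z\<close> and \<open>l2\<close> in \<open>K\<close> convert distances
   between sites into distances between starting phases, which is what \<open>norep\<close> speaks
   about.\<close>
 have tail: "cmod (w t) <= (if (abs (int t - int s0)) < int Z then D2 else D1)"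
  if t: "t < N" "int K <= abs (int t - int s0)" and w: "!!i. i < N ==> (\<Sum>m<N. TM om x i m * w m) = of_real e * w i"
   and e: "e = E \<or> e = e'" and w1: "!!i. i < N ==> cmod (w i) <= 1" for w :: "nat => complex" and e t
 proof (cases "abs (int t - int s0) < int Z")
  case True
  have "x + real (win l2 N t) * om \<notin> res om l2 (h2 / 2) E"
  proof
   assume "x + real (win l2 N t) * om : res om l2 (h2 / 2) E"
   from norep_far[OF rep(2) this res2] show False
    using w2[OF t(1)] w2[OF s0(1)] True t(2) ZR unfolding K_def by linarith
  qed
  then have "cmod (w t) <= D2 * 1"
   using dec(2)[unfolded decays_def, rule_format, of N t e x w 1] l t w w1 eE(2)[OF e] by auto
  then show ?thesis using True by simp
 next
  case False
  have "x + real (win l1 N t) * om \<notin> res om l1 (h1 / 2) E"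
  proof
   assume "x + real (win l1 N t) * om : res om l1 (h1 / 2) E"
   from norep_far[OF rep(1) this res1] show False
    using \<open>\<And>t. t < N \<Longrightarrow> t < win l1 N t + l1\<close>[OF t(1)] \<open>\<And>t. t < N \<Longrightarrow> win l1 N t \<le> t\<close>[OF t(1)] \<open>\<And>t. t < N \<Longrightarrow> win l1 N t \<le> N\<close>[OF t(1)]
     \<open>\<And>t. t < N \<Longrightarrow> t < win l1 N t + l1\<close>[OF s0(1)] \<open>\<And>t. t < N \<Longrightarrow> win l1 N t \<le> t\<close>[OF s0(1)] \<open>\<And>t. t < N \<Longrightarrow> win l1 N t \<le> N\<close>[OF s0(1)]
     False unfolding Z_def by linarith
  qed
  then have "cmod (w t) <= D1 * 1"
   using dec(1)[unfolded decays_def, rule_format, of N t e x w 1] l t w w1 eE(1)[OF e] by auto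
  then show ?thesis using False by simp
 qed
 define S where "S = {i\<in>{..<N}. abs (int i - int s0) < int K}"
 have out: "(\<Sum>i\<in>{..<N} - S. (cmod (u i))^2 + (cmod (v i))^2) <= 1 / 2"
 proof -
  have "(\<Sum>i\<in>{..<N} - S. (cmod (u i))^2 + (cmod (v i))^2) <=
    (\<Sum>i\<in>{..<N} - S. (if (abs (int i - int s0)) < int Z then 2 * D2^2 else 0) + 2 * D1^2)"
  proof (rule sum_mono)
   have two: "X + Y <= (if p then 2 * D2^2 else 0) + 2 * D1^2"
    if "X <= (if p then D2 else D1)^2" "Y <= (if p then D2 else D1)^2" for X Y :: real and p
   proof (cases p)
    case True
    then have "X + Y <= 2 * D2^2 + 0" using that by simp
    also have "... <= 2 * D2^2 + 2 * D1^2" by (intro add_mono) auto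
    finally show ?thesis using True by simp
   next
    case False
    then show ?thesis using that by simp
   qed
   fix i assume "i : {..<N} - S"
   then have i: "i < N" "int K <= abs (int i - int s0)" by (auto simp: S_def)
   have "(cmod (u i))^2 <= (if (abs (int i - int s0)) < int Z then D2 else D1)^2"
    "(cmod (v i))^2 <= (if (abs (int i - int s0)) < int Z then D2 else D1)^2"
    using tail[OF i ev(1) disjI1[OF refl] unit_vector_bound(2)[OF on(1)]]
     tail[OF i ev(2) disjI2[OF refl] unit_vector_bound(2)[OF on(2)]] by (simp_all only: power_mono norm_ge_zero)
   then show "(cmod (u i))^2 + (cmod (v i))^2 <= (if (abs (int i - int s0)) < int Z then 2 * D2^2 else 0) + 2 * D1^2"
    by (rule two)
  qed
  also have "... <= (\<Sum>i<N. (if (abs (int i - int s0)) < int Z then 2 * D2^2 else 0) + 2 * D1^2)"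
   by (rule sum_mono2) (auto intro!: add_nonneg_nonneg)
  also have "... = real (card {i\<in>{..<N}. abs (int i - int s0) < int Z}) * (2 * D2^2) + real N * (2 * D1^2)"
   by (simp add: sum.distrib sum.If_cases Int_def)
  also have "... <= real (2 * Z) * (2 * D2^2) + real N * (2 * D1^2)"
  proof -
   have "int ` {i\<in>{..<N}. abs (int i - int s0) < int Z} \<subseteq> {int s0 - int Z<..<int s0 + int Z}" by auto
   then have "card (int ` {i\<in>{..<N}. abs (int i - int s0) < int Z}) <= card {int s0 - int Z<..<int s0 + int Z}" by (intro card_mono) auto
   moreover have "card (int ` {i\<in>{..<N}. abs (int i - int s0) < int Z}) = card {i\<in>{..<N}. abs (int i - int s0) < int Z}" by (rule card_image) simp
   ultimately have "card {i\<in>{..<N}. abs (int i - int s0) < int Z} <= 2 * Z" by simp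
   then have "real (card {i\<in>{..<N}. abs (int i - int s0) < int Z}) <= real (2 * Z)" by (rule of_nat_mono)
   then show ?thesis by (intro add_mono mult_right_mono order_refl) auto
  qed
  also have "... <= 1 / 2" using mass by simp
  finally show ?thesis .
 qed
 have bS: "bs <= \<beta> om x i" if "i : S" for i
 proof -
  define d where "d = int i - int (win l2 N s0)"
  have "abs d <= int (K + l2)" using that w2[OF s0(1)] by (auto simp: S_def d_def)
  from large[OF res2 this] have "bs <= cmod (b (of_real (x + real (win l2 N s0) * om + of_int d * om)))" .
  moreover have "x + real (win l2 N s0) * om + of_int d * om = x + real i * om" by (simp add: d_def algebra_simps)
  ultimately show ?thesis unfolding \<beta>_def by simp
 qed
 show ?thesis
 proof (rule cluster_contradiction[where u = u and v = v and N = N and \<alpha> = "%i. a (of_real (x + real i * om))" and \<beta> = "\<beta> om x"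
    and e = E and e' = e' and ?s0.0 = s0 and K = K, folded S_def, OF _ _ on])
  show "of_real (\<beta> om x (Suc i)) * (if Suc (Suc i) = 0 \<or> Suc (Suc i) > N then 0 else u (Suc (Suc i) - 1)) =
    (a (of_real (x + real i * om)) - of_real E) * (if Suc i = 0 \<or> Suc i > N then 0 else u (Suc i - 1)) - of_real (\<beta> om x i) * (if i = 0 \<or> i > N then 0 else u (i - 1))"
   if "i < N" for i by (rule eigen_rec[OF ev(1)[OF that] that])
  show "of_real (\<beta> om x (Suc i)) * (if Suc (Suc i) = 0 \<or> Suc (Suc i) > N then 0 else v (Suc (Suc i) - 1)) =
    (a (of_real (x + real i * om)) - of_real e') * (if Suc i = 0 \<or> Suc i > N then 0 else v (Suc i - 1)) - of_real (\<beta> om x i) * (if i = 0 \<or> i > N then 0 else v (i - 1))"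
   if "i < N" for i by (rule eigen_rec[OF ev(2)[OF that] that])
  show "cmod (a (of_real (x + real i * om))) <= A" for i by (rule abd) (rule strip_real[OF \<rho>])
  show "\<beta> om x i <= A" for i unfolding \<beta>_def by (rule bbd) (rule strip_real[OF \<rho>])
  show "0 <= \<beta> om x i" for i by (simp add: \<beta>_def)
  show "abs (e' - E) <= \<delta>" using \<delta> by (simp add: e'_def)
 qed (use E A bs bS out in auto)
qed

end

section \<open>Combining two scales\<close>

text \<open>The cluster has about \<open>ls (Rs N) ^ 100\<close> sites, a power
  \<open>100 * 1.1 * 0.005 = 0.55\<close> of \<open>ln N\<close>, and each costs about
  \<open>ln R\<close>, a further \<open>0.005\<close>. The total stays below \<open>ln N\<close>,
  while \<open>Rs N\<close> still exceeds the \<open>(ln N) powr 110\<close> of the longer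
  scale.\<close>

definition Rs :: "nat => nat" where "Rs N = nat \<lceil>exp (ln (real N) powr 0.005)\<rceil>"

lemma real_Rs: "real (Rs N) = of_int \<lceil>exp (ln (real N) powr 0.005)\<rceil>"
 unfolding Rs_def by (rule real_nat_ceiling) simp

lemma Rs_at_top: "filterlim Rs at_top sequentially"
 unfolding filterlim_at_top
proof
 fix Z :: nat
 have "eventually (%N. real Z <= real (Rs N)) sequentially" unfolding real_Rs by real_asymp
 then show "eventually (%N. Z <= Rs N) sequentially" by simp
qed

text \<open>The condition with \<open>ln 8\<close> is the logarithm of the inequality that
  \<open>cluster_contradiction\<close> refutes. The last four compare exceptional sets: those at
  scale \<open>Rs N\<close> have measure a tiny power of \<open>ln N\<close>, still below the
  iterated-logarithm bounds allowed.\<close>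

locale pair_num =
 fixes A L Z q X \<gamma> :: real and N :: nat
 assumes num: "3 <= ln (real N)"
  "1 <= real (ls N)"
  "1 <= real (ls (Rs N))"
  "real (ls N) <= real N"
  "real (ls (Rs N)) <= real N"
  "0 < hs A N"
  "0 < hs A (Rs N)"
  "real (ls N) ^ 100 + real (ls N) + real (ls (Rs N)) <= real (Rs N)"
  "4 * (real (ls N) ^ 100 + real (ls N)) * exp (- (\<gamma> * real (ls (Rs N)) / 8))^2 + 2 * real N * exp (- (\<gamma> * real (ls N) / 8))^2 <= 1 / 2"
  "1 / (real N * ln (real N) powr 15) * real (ls N) <= hs A N / (8 * real (ls N))"
  "1 / (real N * ln (real N) powr 15) * real (ls (Rs N)) <= hs A (Rs N) / (8 * real (ls (Rs N)))"
  "q * hs A (Rs N) <= 1"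
  "hs A (Rs N) <= 1"
  "ln 8 + 2 * ln (real (ls (Rs N)) ^ 100 + real (ls (Rs N)))
   + 4 * (real (ls (Rs N)) ^ 100 + real (ls (Rs N))) * (ln (4 * A / q) - Z * ln (hs A (Rs N))) < 2 * ln (real N)"
  "ln (real N) powr (- 0.1) + ln (real (Rs N)) powr (- 0.1) <= exp (- ((ln (ln (ln (real N))))^2 / 20))"
  "2 * real N ^ 2 * ln (real N) powr 15 + 2 * real (Rs N) ^ 2 * ln (real (Rs N)) powr 15 <= 4 * (real N ^ 2 * ln (real N) powr 15)"
  "ln (real N) powr (- 0.05) + ln (real (Rs N)) powr (- 0.05) +
   X * (2 * (real (ls (Rs N)) ^ 100 + 2 * real (ls (Rs N))) + 1) * real (ls (Rs N)) * (2 * ((1 / 2 + L) * hs A (Rs N))) <= ln (ln (real N)) powr (- 1 / 10)"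
  "real N * ln (real N) powr 5.95 + real (Rs N) * ln (real (Rs N)) powr 5.95 +
   X * (2 * (real (ls (Rs N)) ^ 100 + 2 * real (ls (Rs N))) + 1) * real (ls (Rs N)) <= real N * ln (real N) ^ 6"

lemma pair_num_eventually:
 assumes "A >= 1" "L > 0" "Z > 0" "q > 0" "X > 0" "\<gamma> > 0"
 shows "eventually (pair_num A L Z q X \<gamma>) sequentially"
proof -
 have A: "A >= 0" using assms by simp
 show ?thesis unfolding pair_num_def hs_def real_ms[OF A] real_ls real_Rs
  by (intro eventually_conj) (use assms in real_asymp)+
qed

context jac
begin

text \<open>Besides the exceptional energies of both scales, a third set is removed: energies within
  \<open>r3\<close> of the spectrum of a short window that starts near a point where
  \<open>b\<close> is small, or at a bounded number of steps from it. For the rest, a resonant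
  cluster avoids near-zeros of \<open>b\<close>.\<close>

theorem two_scales:
 fixes N :: nat and c \<alpha> \<gamma> \<tau> :: real and Q :: nat
 assumes num: "elim_num A Lip (real (nc \<rho>)) N" "elim_num A Lip (real (nc \<rho>)) (Rs N)"
   "decay_num A (real (nc \<rho>)) c \<alpha> \<gamma> (2 * A * real Q) N" "decay_num A (real (nc \<rho>)) c \<alpha> \<gamma> (2 * A * real Q) (Rs N)"
   "pair_num A Lip (real (zb \<rho> A)) (cb \<rho> A) (real (nb \<rho> * zb \<rho> A)) \<gamma> N"
  and c: "0 < c" "c < 1" and \<alpha>: "\<alpha> > 1" and \<gamma>: "\<gamma> > 0"
  and bt: "!!x::real. bt (of_real x) = cnj (b (of_real x))"
  and \<tau>: "0 < \<tau>" "\<tau> <= 1" and Q: "2 <= Q" "eb \<rho> A \<tau> + 2 * VW \<rho> A \<tau> * Dn c \<alpha> (real Q) / real Q <= \<gamma> / 4"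
 obtains \<Omega> where "mes_compl_le \<Omega> (exp (- ((ln (ln (ln (real N))))^2 / 20))) (4 * (real N ^ 2 * ln (real N) powr 15))"
  "!!om. om : diophantine c \<alpha> - \<Omega> ==> \<exists>\<E>. mes_compl_le \<E> (ln (ln (real N)) powr (- 1 / 10)) (real N * ln (real N) ^ 6) &
    (\<forall>E x es j k. abs E <= A --> E \<notin> \<E> --> lyapunov a b bt om E > \<gamma> -->
     char_poly (hmat N (TM om x)) = (\<Prod>e\<leftarrow>map complex_of_real es. [:- e, 1:]) --> j < N --> k < N --> j ~= k --> es ! j = E -->
     1 / (real N * ln (real N) powr 15) < abs (es ! k - E))"
proof -
 define R where "R = Rs N"
 define l1 where "l1 = ls N"
 define l2 where "l2 = ls R"
 define h1 where "h1 = hs A N"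
 define h2 where "h2 = hs A R"
 define Kr where "Kr = real l2 ^ 100 + real l2"
 define X0 where "X0 = real (nb \<rho> * zb \<rho> A)"
 define \<delta> where "\<delta> = 1 / (real N * ln (real N) powr 15)"
 define r3 where "r3 = (1 / 2 + Lip) * h2"
 note P = pair_num.num[OF num(5), folded R_def, folded l1_def l2_def h1_def h2_def X0_def \<delta>_def, folded Kr_def r3_def]
 obtain O1 where O1: "mes_compl_le O1 (ln (real N) powr (- 0.1)) (2 * real N ^ 2 * ln (real N) powr 15)"
  "!!om. om : {0..1} - O1 ==> \<exists>\<E>. mes_compl_le \<E> (ln (real N) powr (- 0.05)) (real N * ln (real N) powr 5.95) &
    (\<forall>E. abs E <= A --> E \<notin> \<E> --> norep om l1 h1 (l1 ^ 100) N E & centred om l1 (1 / real l1 ^ 5) E)"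
  by (rule scale_elimination[OF num(1), folded l1_def h1_def], rule that)
 obtain O2 where O2: "mes_compl_le O2 (ln (real R) powr (- 0.1)) (2 * real R ^ 2 * ln (real R) powr 15)"
  "!!om. om : {0..1} - O2 ==> \<exists>\<E>. mes_compl_le \<E> (ln (real R) powr (- 0.05)) (real R * ln (real R) powr 5.95) &
    (\<forall>E. abs E <= A --> E \<notin> \<E> --> norep om l2 h2 (l2 ^ 100) R E & centred om l2 (1 / real l2 ^ 5) E)"
  by (rule scale_elimination[OF num(2)[folded R_def], folded l2_def h2_def], rule that)
 obtain X where X: "finite X" "card X <= nb \<rho> * zb \<rho> A"
  "!!x \<tau>. 0 < \<tau> ==> \<tau> <= 1 ==> cmod (b (of_real x)) < cb \<rho> A * \<tau> ^ zb \<rho> A ==>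
    \<exists>\<xi>\<in>X. \<exists>k::int. abs (x - \<xi> - of_int k) < \<tau>"
  by (rule small_b, rule that)
 define M where "M = l2 ^ 100 + l2 + l2"
 show thesis
 proof (rule that[of "O1 \<union> O2"])
  show "mes_compl_le (O1 \<union> O2) (exp (- ((ln (ln (ln (real N))))^2 / 20))) (4 * (real N ^ 2 * ln (real N) powr 15))"
   by (rule mes_compl_le_mono[OF mes_compl_le_Un[OF O1(1) O2(1)] P(15,16)]) simp_all
  fix om assume w: "om : diophantine c \<alpha> - (O1 \<union> O2)"
  then have w1: "om : diophantine c \<alpha>" "om : {0..1} - O1" "om : {0..1} - O2" by (auto simp: diophantine_def)
  obtain E1 where E1: "mes_compl_le E1 (ln (real N) powr (- 0.05)) (real N * ln (real N) powr 5.95)"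
    "!!E. abs E <= A ==> E \<notin> E1 ==> norep om l1 h1 (l1 ^ 100) N E & centred om l1 (1 / real l1 ^ 5) E" using O1(2)[OF w1(2)] by blast
  obtain E2 where E2: "mes_compl_le E2 (ln (real R) powr (- 0.05)) (real R * ln (real R) powr 5.95)"
    "!!E. abs E <= A ==> E \<notin> E2 ==> norep om l2 h2 (l2 ^ 100) R E & centred om l2 (1 / real l2 ^ 5) E" using O2(2)[OF w1(3)] by blast
  \<comment> \<open>Candidate windows start at a centre from \<open>small_b\<close> moved by up to
    \<open>M\<close> steps, \<open>M\<close> being the cluster radius plus one window.
    \<open>r3\<close> is the resonance width \<open>h2 / 2\<close> plus the eigenvalue shift
    \<open>Lip * h2\<close> from replacing the true phase by the centre.\<close>
  define I where "I = (SIGMA p:X \<times> {- int M..int M}. spec om l2 (fst p + of_int (snd p) * om))"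
  define E3 where "E3 = (\<Union>q\<in>I. {snd q - r3..snd q + r3})"
  have r3: "r3 >= 0" unfolding r3_def using Lip_pos P(7) by simp
  have E3: "mes_compl_le E3 (X0 * (2 * (real l2 ^ 100 + 2 * real l2) + 1) * real l2 * (2 * r3)) (X0 * (2 * (real l2 ^ 100 + 2 * real l2) + 1) * real l2)"
  proof -
   have fI: "finite I" unfolding I_def using X(1) finite_spec by auto
   have "card I = (\<Sum>p\<in>X \<times> {- int M..int M}. card (spec om l2 (fst p + of_int (snd p) * om)))"
    unfolding I_def by (rule card_SigmaI) (use X(1) finite_spec in auto)
   also have "... <= card (X \<times> {- int M..int M}) * l2"
    using sum_bounded_above[of "X \<times> {- int M..int M}" "%p. card (spec om l2 (fst p + of_int (snd p) * om))" l2] card_spec by simp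
   also have "card (X \<times> {- int M..int M}) = card X * (2 * M + 1)"
   proof -
    have "card {- int M..int M} = 2 * M + 1" unfolding card_atLeastAtMost_int by linarith
    then show ?thesis by (simp only: card_cartesian_product)
   qed
   also have "card X * (2 * M + 1) * l2 <= (nb \<rho> * zb \<rho> A) * (2 * M + 1) * l2" using X(2) by (intro mult_le_mono1)
   finally have "real (card I) <= real ((nb \<rho> * zb \<rho> A) * (2 * M + 1) * l2)" by (rule of_nat_mono)
   also have "... = X0 * (2 * (real l2 ^ 100 + 2 * real l2) + 1) * real l2" by (simp add: X0_def M_def algebra_simps)
   finally have c: "real (card I) <= X0 * (2 * (real l2 ^ 100 + 2 * real l2) + 1) * real l2" .
   show ?thesis unfolding E3_def
    by (rule mes_compl_le_UN[OF fI c mult_right_mono[OF c], where lo = "%q. snd q - r3"]) (use r3 in auto)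
  qed
  show "\<exists>\<E>. mes_compl_le \<E> (ln (ln (real N)) powr (- 1 / 10)) (real N * ln (real N) ^ 6) &
    (\<forall>E x es j k. abs E <= A --> E \<notin> \<E> --> lyapunov a b bt om E > \<gamma> -->
     char_poly (hmat N (TM om x)) = (\<Prod>e\<leftarrow>map complex_of_real es. [:- e, 1:]) --> j < N --> k < N --> j ~= k --> es ! j = E -->
     1 / (real N * ln (real N) powr 15) < abs (es ! k - E))"
  proof (intro exI[of _ "E1 \<union> E2 \<union> E3"] conjI allI impI)
   have "0 <= X0 * (2 * (real l2 ^ 100 + 2 * real l2) + 1) * real l2 * (2 * r3)"
    unfolding X0_def using r3 by (intro mult_nonneg_nonneg add_nonneg_nonneg) auto
   then show "mes_compl_le (E1 \<union> E2 \<union> E3) (ln (ln (real N)) powr (- 1 / 10)) (real N * ln (real N) ^ 6)"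
    by (intro mes_compl_le_mono[OF mes_compl_le_Un[OF mes_compl_le_Un[OF E1(1) E2(1)] E3] P(17,18)]) simp_all
   fix E x es j k
   assume E: "abs E <= A" "E \<notin> E1 \<union> E2 \<union> E3" and L: "lyapunov a b bt om E > \<gamma>"
    and es: "char_poly (hmat N (TM om x)) = (\<Prod>e\<leftarrow>map complex_of_real es. [:- e, 1:])"
    and jk: "j < N" "k < N" "j ~= k" and Ej: "es ! j = E"
   have n1: "norep om l1 h1 (l1 ^ 100) N E" "centred om l1 (1 / real l1 ^ 5) E" using E1(2)[OF E(1)] E(2) by auto
   have n2: "norep om l2 h2 (l2 ^ 100) R E" "centred om l2 (1 / real l2 ^ 5) E" using E2(2)[OF E(1)] E(2) by auto
   have d1: "decays om E l1 h1 (exp (- (\<gamma> * real l1 / 8)))"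
    unfolding l1_def h1_def
    by (rule scale_decay[OF num(3) w1(1) c \<alpha> \<gamma> E(1) bt L n1(2)[unfolded l1_def] \<tau> Q])
   have d2: "decays om E l2 h2 (exp (- (\<gamma> * real l2 / 8)))"
    unfolding l2_def h2_def
    by (rule scale_decay[OF num(4)[folded R_def] w1(1) c \<alpha> \<gamma> E(1) bt L n2(2)[unfolded l2_def] \<tau> Q])
   \<comment> \<open>\<open>small_b\<close> at \<tau> equal to \<open>h2\<close>. The lower bound is
     only polynomially small in \<open>h2\<close>, so a step of the recurrence loses a factor whose
     logarithm is of order \<open>ln R\<close>.\<close>
   define bs where "bs = cb \<rho> A * h2 ^ zb \<rho> A"
   have bs0: "bs > 0" unfolding bs_def using cb_pos P(7) by simp
   have "h2 ^ zb \<rho> A <= h2 ^ 1" using P(7,13) zb_pos by (intro power_decreasing) auto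
   then have "bs <= cb \<rho> A * h2" unfolding bs_def using cb_pos by simp
   then have bsA: "bs <= A" using P(12) A by linarith
   have large: "bs <= cmod (b (of_real (y + of_int d * om)))"
    if y: "y : res om l2 (h2 / 2) E" and d: "abs d <= int (l2 ^ 100 + l2 + l2)" for y d
   proof (rule ccontr)
    assume "\<not> ?thesis"
    then have "cmod (b (of_real (y + of_int d * om))) < cb \<rho> A * h2 ^ zb \<rho> A" by (simp add: bs_def)
    from X(3)[OF P(7,13) this] obtain \<xi> i where \<xi>: "\<xi> : X" "abs (y + of_int d * om - \<xi> - of_int i) < h2" by blast
    define z where "z = (\<xi> + of_int (- d) * om) + of_int i"
    have "Lip * (abs (y - z) + real l2 * abs (om - om)) <= Lip * h2"
     using \<xi>(2) Lip_pos by (intro mult_left_mono) (auto simp: z_def algebra_simps)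
    from res_Lipschitz[OF y this] have "z : res om l2 (h2 / 2 + Lip * h2) E" .
    then obtain s where s: "s : spec om l2 z" "abs (s - E) < h2 / 2 + Lip * h2" by (auto simp: res_def)
    have s': "s : spec om l2 (\<xi> + of_int (- d) * om)" using s(1) unfolding z_def spec_per .
    have "((\<xi>, - d), s) : I" unfolding I_def using \<xi>(1) d s' by (auto simp: M_def)
    moreover have "E : {s - r3..s + r3}" using s(2) unfolding r3_def by (auto simp: algebra_simps)
    ultimately have "E : E3" unfolding E3_def by (intro UN_I[of "((\<xi>, - d), s)"]) auto
    then show False using E(2) by blast
   qed
   show "1 / (real N * ln (real N) powr 15) < abs (es ! k - E)"
   proof (rule ccontr)
    assume "\<not> ?thesis"
    then have \<delta>: "abs (es ! k - E) <= \<delta>" by (simp add: \<delta>_def)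
    have l: "0 < l1" "l1 <= N" "0 < l2" "l2 <= N" using P(2-5) by linarith+
    have "1 <= 8 * (real (l2 ^ 100 + l2))^2 * \<delta>^2 * (4 * A / bs) ^ (4 * (l2 ^ 100 + l2))"
    proof (rule no_close_pair[OF E(1) l d1 d2 _ _ _ _ n1(1) n2(1) _ _ bs0 bsA large es jk Ej \<delta> P(10,11)])
     have "real (l1 ^ 100 + l1 + l2) <= real R" using P(8) by simp
     then show "l1 ^ 100 + l1 + l2 <= R" unfolding of_nat_le_iff .
     show "4 * real (l1 ^ 100 + l1) * (exp (- (\<gamma> * real l2 / 8)))^2 + 2 * real N * (exp (- (\<gamma> * real l1 / 8)))^2 <= 1 / 2"
      using P(9) by simp
    qed (use \<gamma> P(2,3,6,7) in auto)
    moreover have "8 * (real (l2 ^ 100 + l2))^2 * \<delta>^2 * (4 * A / bs) ^ (4 * (l2 ^ 100 + l2)) < 1"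
    proof -
     have N0: "real N > 0" using jk by simp
     have Kr0: "Kr > 0" unfolding Kr_def using P(3) by (simp add: add_pos_pos)
     have KrK: "real (l2 ^ 100 + l2) = Kr" by (simp add: Kr_def)
     have lN: "ln (real N) powr 15 > 0" using P(1) by (subst powr_gt_zero) linarith
     then have \<delta>0: "\<delta> > 0" unfolding \<delta>_def using N0 by (intro divide_pos_pos mult_pos_pos) auto
     have lnb: "ln (4 * A / bs) = ln (4 * A / cb \<rho> A) - real (zb \<rho> A) * ln h2"
     proof -
      have "4 * A / bs = (4 * A / cb \<rho> A) / h2 ^ zb \<rho> A" by (simp add: bs_def)
      also have "ln ... = ln (4 * A / cb \<rho> A) - ln (h2 ^ zb \<rho> A)" using A cb_pos P(7) by (subst ln_div) auto
      also have "ln (h2 ^ zb \<rho> A) = real (zb \<rho> A) * ln h2" using P(7) by (simp add: ln_realpow)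
      finally show ?thesis .
     qed
     have ln\<delta>: "ln \<delta> <= - ln (real N)"
     proof -
      have "1 powr 15 <= ln (real N) powr 15" using P(1) by (intro powr_mono2) auto
      then have "real N * 1 <= real N * ln (real N) powr 15" using N0 by (intro mult_left_mono) auto
      then have "\<delta> <= 1 / real N" unfolding \<delta>_def using N0 lN by (intro divide_left_mono mult_pos_pos) simp_all
      then have "ln \<delta> <= ln (1 / real N)" using \<delta>0 by (intro ln_mono) auto
      then show ?thesis using N0 by (simp add: ln_div)
     qed
     have B0: "4 * A / bs > 0" using A bs0 by simp
     have "ln (8 * Kr^2 * \<delta>^2 * (4 * A / bs) ^ (4 * (l2 ^ 100 + l2))) =
       ln 8 + 2 * ln Kr + 2 * ln \<delta> + real (4 * (l2 ^ 100 + l2)) * ln (4 * A / bs)"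
     proof -
      have "ln (8 * K^2 * d^2 * B ^ m) = ln 8 + 2 * ln K + 2 * ln d + real m * ln B"
       if "K > 0" "d > 0" "B > 0" for K d B :: real and m :: nat
       using that by (simp add: ln_mult ln_realpow)
      then show ?thesis using Kr0 \<delta>0 B0 by blast
     qed
     also have "real (4 * (l2 ^ 100 + l2)) = 4 * Kr" by (simp add: Kr_def)
     also have "ln 8 + 2 * ln Kr + 2 * ln \<delta> + 4 * Kr * ln (4 * A / bs) < 0"
      using P(14) ln\<delta> unfolding lnb by linarith
     finally show ?thesis unfolding KrK using Kr0 \<delta>0 B0 by (subst (asm) ln_less_zero_iff) (auto intro!: mult_pos_pos)
    qed
    ultimately show False by linarith
   qed
  qed
 qed
qed

end

section \<open>The standing hypotheses on the coefficients\<close>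

lemma closure_strip:
 assumes "\<rho> > 0" "abs (Im z) <= \<rho>"
 shows "z : closure (strip \<rho>)"
 unfolding closure_sequential
proof (intro exI conjI allI)
 let ?s = "%n::nat. 1 - 1 / real (Suc (Suc n))"
 show "Complex (Re z) (?s n * Im z) : strip \<rho>" for n
 proof -
  have s: "0 < ?s n" "?s n < 1" by (auto simp: field_simps)
  have "abs (?s n * Im z) <= ?s n * \<rho>" unfolding abs_mult using s assms by (intro mult_mono) auto
  also have "... < 1 * \<rho>" using s assms by (intro mult_strict_right_mono) auto
  finally show ?thesis by (simp add: strip_def)
 qed
 have "(%n. ?s n) \<longlonglongrightarrow> 1" by real_asymp
 then have "(%n. Complex (Re z) (?s n * Im z)) \<longlonglongrightarrow> Complex (Re z) (1 * Im z)"
  by (intro tendsto_Complex tendsto_mult tendsto_const)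
 then show "(%n. Complex (Re z) (?s n * Im z)) \<longlonglongrightarrow> z" by simp
qed

text \<open>By continuity the set where the modulus exceeds the essential supremum is open; being
  null it is empty. The bound \<open>M\<close> keeps the essential supremum finite, so that
  \<open>real_of_ereal\<close> does not return its default.\<close>

lemma Linf_norm_bound:
 assumes f: "continuous_on (strip \<rho>) f" and M: "!!z. z : strip \<rho> ==> cmod (f z) <= M" and z: "z : strip \<rho>"
 shows "cmod (f z) <= Linf_norm \<rho> f"
proof -
 define Ms where "Ms = restrict_space lborel (strip \<rho>)"
 define g where "g z = ereal (cmod (f z))" for z
 define e where "e = esssup Ms g"
 have g: "g : borel_measurable Ms"
 proof -
  have "(%z. cmod (f z)) : borel_measurable (restrict_space borel (strip \<rho>))"
   by (intro borel_measurable_continuous_on_restrict continuous_on_norm f)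
  then have "(%z. cmod (f z)) : borel_measurable Ms"
   unfolding Ms_def by (subst measurable_cong_sets[OF sets_restrict_space_cong[OF sets_lborel] refl])
  then show ?thesis unfolding g_def by (rule borel_measurable_ereal)
 qed
 have in_sets: "strip \<rho> \<inter> space lborel : sets lborel" using open_strip[of \<rho>] by simp
 have "AE z in Ms. g z <= ereal M"
  unfolding Ms_def AE_restrict_space_iff[OF in_sets] using M by (intro AE_I2) (simp add: g_def)
 then have eM: "e <= ereal M" unfolding e_def by (rule esssup_I[OF g])
 have ae: "AE z in lborel. z : strip \<rho> --> g z <= e"
  unfolding AE_restrict_space_iff[OF in_sets, symmetric] Ms_def[symmetric] e_def by (rule esssup_AE)
 define V where "V = strip \<rho> \<inter> g -` {e<..}"
 have V: "open V" unfolding V_def g_def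
  by (intro continuous_open_preimage[OF _ open_strip] continuous_on_ereal continuous_on_norm f) auto
 have "V = {}"
 proof (rule ccontr)
  assume "V ~= {}"
  then have "\<not> negligible V" using V open_not_negligible by blast
  moreover have "AE z in lborel. z \<notin> V" using ae by eventually_elim (auto simp: V_def)
  then have "V : null_sets lborel" using V by (subst (asm) AE_iff_null_sets[symmetric]) auto
  then have "negligible V" unfolding negligible_iff_null_sets by (rule null_sets_completionI)
  ultimately show False by blast
 qed
 then have le: "ereal (cmod (f z)) <= e" using z by (auto simp: V_def g_def not_less)
 then obtain c where "e = ereal c" using eM by (cases e) auto
 then show ?thesis using le unfolding Linf_norm_def e_def Ms_def g_def by simp
qed

text \<open>Finite order of vanishing at every point of the closed strip, boundary included:
  \<open>b\<close> is holomorphic on an open connected set containing \<open>S\<close> and not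
  identically zero there.\<close>

lemma analytic_local_lower_bound:
 assumes b: "b analytic_on S" and S: "connected S" and p: "p : S" and q: "q : S" "b q ~= 0"
 shows "\<exists>r m. \<exists>k::nat. r > 0 & m > 0 & (\<forall>z\<in>ball p r. m * cmod (z - p) ^ k <= cmod (b z))"
proof -
 obtain T where T: "open T" "S \<subseteq> T" "b holomorphic_on T" using b unfolding analytic_on_holomorphic by blast
 define C where "C = connected_component_set T p"
 have C: "open C" "connected C" "S \<subseteq> C" "C \<subseteq> T"
  unfolding C_def using open_connected_component[OF T(1)] connected_component_maximal[OF p S T(2)]
  by (auto simp: connected_component_subset)
 have hol: "b holomorphic_on C" by (rule holomorphic_on_subset[OF T(3) C(4)])
 have lower: "\<exists>r m. \<exists>k::nat. r > 0 & m > 0 & (\<forall>z\<in>ball p r. m * cmod (z - p) ^ k <= cmod (b z))"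
  if g: "continuous_on (ball p r) g" "!!z. z : ball p r ==> b z = (z - p) ^ k * g z" "!!z. z : ball p r ==> g z ~= 0"
   and r: "r > 0" for r k and g :: "complex => complex"
 proof -
  have sub: "cball p (r / 2) \<subseteq> ball p r" using r by auto
  have "continuous_on (cball p (r / 2)) (%z. cmod (g z))" by (intro continuous_on_norm continuous_on_subset[OF g(1) sub])
  from continuous_attains_inf[OF compact_cball _ this] r
  obtain w where w: "w : cball p (r / 2)" "!!z. z : cball p (r / 2) ==> cmod (g w) <= cmod (g z)" by auto
  have "cmod (g w) > 0" using g(3) w(1) sub by auto
  moreover have "cmod (g w) * cmod (z - p) ^ k <= cmod (b z)" if z: "z : ball p (r / 2)" for z
  proof -
   have "z : cball p (r / 2)" using z by auto
   with sub have z': "z : cball p (r / 2)" "z : ball p r" by blast+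
   have "cmod (g w) * cmod (z - p) ^ k <= cmod (g z) * cmod (z - p) ^ k" by (rule mult_right_mono[OF w(2)[OF z'(1)]]) simp
   then show ?thesis unfolding g(2)[OF z'(2)] norm_mult norm_power by (simp add: mult.commute)
  qed
  ultimately show ?thesis using r by (intro exI[of _ "r / 2"] exI[of _ "cmod (g w)"] exI[of _ k]) auto
 qed
 show ?thesis
 proof (cases "b p = 0")
  case True
  have nc: "\<not> b constant_on C"
  proof
   assume "b constant_on C"
   then have "b q = b p" using p q C(3) unfolding constant_on_def by (metis subsetD)
   then show False using True q by simp
  qed
  obtain g r n where gr: "0 < n" "0 < r" "ball p r \<subseteq> C" "g holomorphic_on ball p r"
   "!!w. w : ball p r ==> b w = (w - p) ^ n * g w" "!!w. w : ball p r ==> g w ~= 0"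
   by (rule holomorphic_factor_zero_nonconstant[OF hol C(1,2) subsetD[OF C(3) p] True nc], rule that)
  show ?thesis
   by (rule lower[where g = g and r = r and k = n]; fact gr holomorphic_on_imp_continuous_on[OF gr(4)])
 next
  case False
  have "isCont b p" using holomorphic_on_imp_continuous_on[OF hol] C(1,3) p continuous_on_eq_continuous_at by blast
  then obtain r1 where r1: "r1 > 0" "!!z. dist z p < r1 ==> b z ~= 0"
   using continuous_at_avoid[of p b 0] False by (auto simp: dist_commute)
  obtain r2 where r2: "r2 > 0" "ball p r2 \<subseteq> C" using C(1,3) p open_contains_ball by blast
  have "continuous_on (ball p (min r1 r2)) b"
   by (rule continuous_on_subset[OF holomorphic_on_imp_continuous_on[OF hol]]) (use r2 in auto)
  then show ?thesis by (rule lower[where k = 0]) (use r1 r2 in \<open>auto simp: dist_commute\<close>)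
 qed
qed

lemma set_integrable_ln_dist: "set_integrable lborel {0..1} (%x. (abs p + 1) - ln (abs (x - p)) :: real)"
proof -
 have nn: "0 <= (abs p + 1) - ln (abs (x - p))" if "x : {0..1}" for x :: real
 proof (cases "x = p")
  case False
  then have "ln (abs (x - p)) <= abs (x - p) - 1" by (intro ln_le_minus_one) auto
  then show ?thesis using that by (auto simp: abs_le_iff)
 qed simp
 have "(%x. ln (cmod (complex_of_real x - of_real p))) integrable_on {0..1}" by (rule integrable_ln_dist) simp
 then have "(%x. ln (abs (x - p))) integrable_on {0..1}" by (simp flip: of_real_diff)
 then have "(%x. (abs p + 1) - ln (abs (x - p))) integrable_on {0..1}" by (intro integrable_diff) auto
 then have "(%x. (abs p + 1) - ln (abs (x - p))) absolutely_integrable_on {0..1}"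
  by (rule nonnegative_absolutely_integrable_1) (rule nn)
 moreover have "(%x. indicator {0..1} x *\<^sub>R ((abs p + 1) - ln (abs (x - p)))) : borel_measurable lborel" by simp
 ultimately show ?thesis unfolding set_integrable_def using integrable_completion by blast
qed

text \<open>Compactness of one period of the closed strip leaves finitely many local bounds, and
  distances in the plane dominate distances of real parts, so one integrable \<open>H\<close> serves
  all heights \<open>y\<close>. Hence the integrals in \<open>star_norm\<close> are genuine and
  their supremum is over a bounded set.\<close>

lemma strip_log_dominated:
 assumes \<rho>: "\<rho> > 0" and b: "b analytic_on closure (strip \<rho>)" and nz: "\<exists>x::real. b (of_real x) ~= 0"
 obtains Z H where "finite Z" "set_integrable lborel {0..1} H"
  "!!x y. x : {0..1} - Z ==> y : {-\<rho>..\<rho>} ==> b (Complex x y) ~= 0 & abs (ln (cmod (b (Complex x y)))) <= H x"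
proof -
 define K where "K = cbox (Complex 0 (- \<rho>)) (Complex 1 \<rho>)"
 have K: "Complex x y : K \<longleftrightarrow> x : {0..1} & y : {-\<rho>..\<rho>}" for x y by (auto simp: K_def in_cbox_complex_iff)
 have Ksub: "K \<subseteq> closure (strip \<rho>)"
  by (auto simp: K_def in_cbox_complex_iff intro!: closure_strip[OF \<rho>])
 obtain x0 where x0: "b (of_real x0) ~= 0" using nz by blast
 have x0s: "of_real x0 : closure (strip \<rho>)" by (rule subsetD[OF closure_subset]) (use \<rho> in simp)
 have conn: "connected (closure (strip \<rho>))" by (intro convex_connected convex_closure convex_strip)
 have "\<forall>p\<in>K. \<exists>t. (%(r, m, k). r > 0 & m > 0 & (\<forall>z\<in>ball p r. m * cmod (z - p) ^ k <= cmod (b z))) (t :: real \<times> real \<times> nat)"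
 proof
  fix p assume "p : K"
  then have "p : closure (strip \<rho>)" using Ksub by blast
  from analytic_local_lower_bound[OF b conn this x0s x0]
  show "\<exists>t. (%(r, m, k). r > 0 & m > 0 & (\<forall>z\<in>ball p r. m * cmod (z - p) ^ k <= cmod (b z))) (t :: real \<times> real \<times> nat)"
   by auto
 qed
 from bchoice[OF this] obtain t :: "complex => real \<times> real \<times> nat" where
  t: "\<forall>p\<in>K. (%(r, m, k). r > 0 & m > 0 & (\<forall>z\<in>ball p r. m * cmod (z - p) ^ k <= cmod (b z))) (t p)" ..
 define r where "r p = fst (t p)" for p
 define m where "m p = fst (snd (t p))" for p
 define k where "k p = snd (snd (t p))" for p
 have rmk: "r p > 0" "m p > 0" "!!z. z : ball p (r p) ==> m p * cmod (z - p) ^ k p <= cmod (b z)" if "p : K" for p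
  using bspec[OF t that] unfolding r_def m_def k_def case_prod_unfold by blast+
 have "compact K" by (simp add: K_def)
 then obtain P where P: "P \<subseteq> K" "finite P" "K \<subseteq> (\<Union>p\<in>P. ball p (r p))"
 proof (rule compactE_image[of K K "%p. ball p (r p)"])
  show "K \<subseteq> (\<Union>p\<in>K. ball p (r p))" using rmk(1) by force
 qed auto
 have "continuous_on K b" by (rule continuous_on_subset[OF holomorphic_on_imp_continuous_on[OF analytic_imp_holomorphic[OF b]] Ksub])
 then have "bounded (b ` K)" using \<open>compact K\<close> compact_continuous_image compact_imp_bounded by blast
 then obtain M where M: "M > 0" "!!z. z : K ==> cmod (b z) <= M" unfolding bounded_pos by auto
 define h where "h p x = (abs (Re p) + 1) - ln (abs (x - Re p)) + (abs (Re p) + 1)" for p x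
 define H where "H x = abs (ln M) + (\<Sum>p\<in>P. abs (ln (m p)) + real (k p) * h p x)" for x
 have h: "\<bar>ln \<bar>x - Re p\<bar>\<bar> <= h p x" if "x : {0..1}" for p x
 proof (cases "x = Re p")
  case False
  then have "ln (abs (x - Re p)) <= abs (x - Re p) - 1" by (intro ln_le_minus_one) auto
  also have "... <= abs (Re p) + 1" using that by (auto simp: abs_le_iff)
  finally show ?thesis unfolding h_def by (simp add: abs_le_iff)
 qed (simp add: h_def)
 show thesis
 proof (rule that[of "Re ` P" H])
  show "finite (Re ` P)" using P by simp
  have c: "set_integrable lborel {0..1} (%x::real. c)" for c :: real by (simp add: set_integrable_def)
  have "set_integrable lborel {0..1} (%x. abs (ln (m p)) + real (k p) * h p x)" for p
   unfolding h_def by (intro set_integral_add(1) set_integrable_mult_right c set_integrable_ln_dist)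
  then have "set_integrable lborel {0..1} (%x. \<Sum>p\<in>P. abs (ln (m p)) + real (k p) * h p x)"
   unfolding set_integrable_def scaleR_sum_right by (intro Bochner_Integration.integrable_sum)
  then show "set_integrable lborel {0..1} H" unfolding H_def by (intro set_integral_add(1) c)
  fix x y assume x: "x : {0..1} - Re ` P" and y: "y : {-\<rho>..\<rho>}"
  define z where "z = Complex x y"
  have zK: "z : K" using x y unfolding z_def K by simp
  then obtain p where p: "p : P" "z : ball p (r p)" using P(3) by blast
  have pK: "p : K" using p P by blast
  have d: "abs (x - Re p) > 0" using x p by force
  have "m p * abs (x - Re p) ^ k p <= m p * cmod (z - p) ^ k p"
   using rmk(2)[OF pK] abs_Re_le_cmod[of "z - p"] by (intro mult_left_mono power_mono) (auto simp: z_def)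
  also have "... <= cmod (b z)" by (rule rmk(3)[OF pK p(2)])
  finally have low: "m p * abs (x - Re p) ^ k p <= cmod (b z)" .
  have lowpos: "0 < m p * abs (x - Re p) ^ k p" using rmk(2)[OF pK] d by simp
  have bz: "b z ~= 0" using low lowpos by auto
  have up: "ln (cmod (b z)) <= abs (ln M)"
   using ln_mono[of "cmod (b z)" M] bz M(2)[OF zK] by (simp add: order_trans[OF _ abs_ge_self])
  have "ln (m p * abs (x - Re p) ^ k p) <= ln (cmod (b z))" by (intro ln_mono low lowpos)
  then have "ln (m p) + real (k p) * ln (abs (x - Re p)) <= ln (cmod (b z))"
   using rmk(2)[OF pK] d by (simp add: ln_mult ln_realpow)
  moreover have "real (k p) * (- ln (abs (x - Re p))) <= real (k p) * h p x"
   using h[of x p] x by (intro mult_left_mono) (auto simp: abs_le_iff)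
  ultimately have dn: "- ln (cmod (b z)) <= abs (ln (m p)) + real (k p) * h p x" by (simp add: abs_if split: if_splits)
  have nn: "0 <= abs (ln (m q)) + real (k q) * h q x" for q
   using h[of x q] x by (intro add_nonneg_nonneg mult_nonneg_nonneg) auto
  have "abs (ln (m p)) + real (k p) * h p x <= (\<Sum>p\<in>P. abs (ln (m p)) + real (k p) * h p x)"
   by (rule member_le_sum[OF p(1) nn P(2)])
  moreover have "0 <= (\<Sum>p\<in>P. abs (ln (m p)) + real (k p) * h p x)" by (rule sum_nonneg) (rule nn)
  ultimately have "abs (ln (cmod (b z))) <= H x" using up dn unfolding H_def by (simp add: abs_le_iff)
  then show "b (Complex x y) ~= 0 & abs (ln (cmod (b (Complex x y)))) <= H x" using bz unfolding z_def by simp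
 qed
qed

lemma strip_bounded:
 assumes \<rho>: "\<rho> > 0" and f: "f analytic_on closure (strip \<rho>)" and per: "!!z. z : closure (strip \<rho>) ==> f (z + 1) = f z"
 obtains M where "!!z. z : strip \<rho> ==> cmod (f z) <= M"
proof -
 define K where "K = cbox (Complex 0 (- \<rho>)) (Complex 1 \<rho>)"
 have Ksub: "K \<subseteq> closure (strip \<rho>)"
  by (auto simp: K_def in_cbox_complex_iff intro!: closure_strip[OF \<rho>])
 have "continuous_on K f" by (rule continuous_on_subset[OF holomorphic_on_imp_continuous_on[OF analytic_imp_holomorphic[OF f]] Ksub])
 moreover have "compact K" by (simp add: K_def)
 ultimately have "bounded (f ` K)" using compact_continuous_image compact_imp_bounded by blast
 then obtain M where M: "!!z. z : K ==> cmod (f z) <= M" unfolding bounded_iff by auto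
 show thesis
 proof (rule that[of M])
  fix z assume z: "z : strip \<rho>"
  have "per (%s. f (Complex s (Im z)))" unfolding per_def
  proof
   fix s
   have "Complex s (Im z) : closure (strip \<rho>)" using z closure_subset[of "strip \<rho>"] by (auto simp: strip_def)
   moreover have "Complex (s + 1) (Im z) = Complex s (Im z) + 1" by (simp add: complex_eq_iff)
   ultimately show "f (Complex (s + 1) (Im z)) = f (Complex s (Im z))" using per by simp
  qed
  from per_int[OF this, of "Re z" "- \<lfloor>Re z\<rfloor>"]
  have "f z = f (Complex (Re z - of_int \<lfloor>Re z\<rfloor>) (Im z))" by simp
  moreover have "Complex (Re z - of_int \<lfloor>Re z\<rfloor>) (Im z) : K"
   using z by (auto simp: K_def in_cbox_complex_iff strip_def) linarith+
  ultimately show "cmod (f z) <= M" using M by metis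
 qed
qed

text \<open>The lower bound on the mean of \<open>ln (cmod b)\<close> is the height \<open>0\<close>
  instance of the supremum in \<open>star_norm\<close>; using it as an upper bound requires the set
  of values to be bounded above.\<close>

theorem jac_of_jacobi_coeffs:
 assumes \<rho>: "\<rho> > 0" and J: "jacobi_coeffs \<rho> a b bt" and A: "1 <= A" "Linf_norm \<rho> a <= A" "star_norm \<rho> b <= A"
 shows "jac \<rho> A a b"
proof -
 have an: "a analytic_on closure (strip \<rho>)" "b analytic_on closure (strip \<rho>)"
  and per: "!!z. z : closure (strip \<rho>) ==> a (z + 1) = a z" "!!z. z : closure (strip \<rho>) ==> b (z + 1) = b z"
  and re: "!!x::real. a (of_real x) : \<real>" and nz: "\<exists>x::real. b (of_real x) ~= 0"
  using J unfolding jacobi_coeffs_def by auto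
 have sub: "strip \<rho> \<subseteq> closure (strip \<rho>)" by (rule closure_subset)
 have hol: "a holomorphic_on strip \<rho>" "b holomorphic_on strip \<rho>"
  using an sub by (meson analytic_imp_holomorphic holomorphic_on_subset)+
 have bnd: "cmod (f z) <= Linf_norm \<rho> f" if an': "f analytic_on closure (strip \<rho>)" "!!z. z : closure (strip \<rho>) ==> f (z + 1) = f z" "z : strip \<rho>" for f z
 proof -
  obtain M where M: "!!z. z : strip \<rho> ==> cmod (f z) <= M" by (rule strip_bounded[OF \<rho> an'(1)], rule an'(2), assumption, rule that)
  have "continuous_on (strip \<rho>) f"
   by (rule continuous_on_subset[OF holomorphic_on_imp_continuous_on[OF analytic_imp_holomorphic[OF an'(1)]] sub])
  then show ?thesis by (rule Linf_norm_bound[OF _ M an'(3)])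
 qed
 define S where "S = (SUP y\<in>{-\<rho>..\<rho>}. \<bar>LINT x:{0..1}|lborel. ln (cmod (b (Complex x y)))\<bar>)"
 obtain Z H where ZH: "finite Z" "set_integrable lborel {0..1} H"
  "!!x y. x : {0..1} - Z ==> y : {-\<rho>..\<rho>} ==> b (Complex x y) ~= 0 & abs (ln (cmod (b (Complex x y)))) <= H x"
  by (rule strip_log_dominated[OF \<rho> an(2) nz], rule that)
 have si: "set_integrable lborel {0..1} (%x. ln (cmod (b (Complex x y))))" if y: "y : {-\<rho>..\<rho>}" for y
 proof (rule set_integrable_of_ae_continuous[OF ZH(1), where l = "%x. - H x" and u = H])
  have "continuous_on ({0..1} - Z) (%x. b (Complex x y))"
   by (rule continuous_on_compose2[OF holomorphic_on_imp_continuous_on[OF analytic_imp_holomorphic[OF an(2)]]])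
    (use y in \<open>auto intro!: continuous_intros closure_strip[OF \<rho>] simp: Complex_eq\<close>)
  then show "continuous_on ({0..1} - Z) (%x. ln (cmod (b (Complex x y))))"
   by (rule continuous_on_ln[OF continuous_on_norm]) (use ZH(3) y in auto)
  show "set_integrable lborel {0..1} H" by (rule ZH)
  show "set_integrable lborel {0..1} (%x. - H x)" using Bochner_Integration.integrable_minus[OF ZH(2)[unfolded set_integrable_def]] unfolding set_integrable_def by simp
  show "- H x <= ln (cmod (b (Complex x y))) & ln (cmod (b (Complex x y))) <= H x" if "x : {0..1} - Z" for x
   using ZH(3)[OF that y] by (simp add: abs_le_iff)
 qed
 have int: "(LINT x:{0..1}|lborel. ln (cmod (b (Complex x y)))) = integral {0..1} (%x. ln (cmod (b (Complex x y))))"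
  "(%x. ln (cmod (b (Complex x y)))) integrable_on {0..1}" if "y : {-\<rho>..\<rho>}" for y
  using set_borel_integral_eq_integral[OF si[OF that]] by auto
 have Hi: "H integrable_on {0..1}" using set_borel_integral_eq_integral[OF ZH(2)] by auto
 have bd: "\<bar>LINT x:{0..1}|lborel. ln (cmod (b (Complex x y)))\<bar> <= integral {0..1} H" if y: "y : {-\<rho>..\<rho>}" for y
 proof -
  have bnds: "- H x <= ln (cmod (b (Complex x y)))" "ln (cmod (b (Complex x y))) <= H x" if "x : {0..1} - Z" for x
   using ZH(3)[OF that y] by linarith+
  have "integral {0..1} (%x. ln (cmod (b (Complex x y)))) <= integral {0..1} H"
   by (rule integral_le_off_finite[OF ZH(1) int(2)[OF y] Hi]) (use bnds in blast)
  moreover have "integral {0..1} (%x. - H x) <= integral {0..1} (%x. ln (cmod (b (Complex x y))))"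
   by (rule integral_le_off_finite[OF ZH(1) integrable_neg[OF Hi] int(2)[OF y]]) (use bnds in blast)
  ultimately show ?thesis unfolding int(1)[OF y] by (simp add: abs_le_iff)
 qed
 have y0: "0 : {-\<rho>..\<rho>}" using \<rho> by simp
 have "bdd_above ((%y. \<bar>LINT x:{0..1}|lborel. ln (cmod (b (Complex x y)))\<bar>) ` {-\<rho>..\<rho>})"
  by (rule bdd_aboveI2) (rule bd)
 from cSUP_upper[OF y0 this] have S0: "abs (integral {0..1} (%x. ln (cmod (b (Complex x 0))))) <= S"
  unfolding S_def int(1)[OF y0] .
 have z0: "0 : strip \<rho>" using \<rho> by (simp add: strip_def)
 have L0: "0 <= Linf_norm \<rho> b" using order_trans[OF norm_ge_zero bnd[OF an(2) per(2) z0]] by blast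
 have star: "Linf_norm \<rho> b + S <= A" using A(3) unfolding star_norm_def S_def .
 show ?thesis
 proof
  show "a (z + 1) = a z" "b (z + 1) = b z" if "z : strip \<rho>" for z using that sub per by auto
  show "cmod (a z) <= A" if "z : strip \<rho>" for z using bnd[OF an(1) per(1) that] A(2) by linarith
  show "cmod (b z) <= A" if "z : strip \<rho>" for z
   using bnd[OF an(2) per(2) that] star S0 by linarith
  have "Complex x 0 = of_real x" for x by (simp add: complex_eq_iff)
  then show "- A <= integral {0..1} (%x. ln (cmod (b (of_real x))))" using S0 star L0 by (simp add: abs_le_iff)
 qed (use \<rho> A hol re nz in auto)
qed

lemma (in jac) char_poly_jacobi:
 assumes bt: "!!x::real. bt (of_real x) = cnj (b (of_real x))"
 shows "char_poly (jacobi_matrix a b bt N (of_real x) om) = char_poly (hmat N (TM om x))"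
proof -
 have e: "of_real x + of_nat k * complex_of_real om = of_real (x + real k * om)" for k by simp
 have "jacobi_matrix a b bt N (of_real x) om = tridiag N (%k. a (of_real (x + real k * om)))
   (%k. - b (of_real (x + real (Suc k) * om))) (%k. - bt (of_real (x + real (Suc k) * om)))"
  unfolding jacobi_matrix_def tridiag_def e ..
 then show ?thesis unfolding TM_tridiag
 proof (simp only:, intro char_poly_tridiag_cong)
  fix k
  have "b (of_real y) * bt (of_real y) = of_real (cmod (b (of_real y))) * of_real (cmod (b (of_real y)))" for y
   unfolding bt complex_norm_square[symmetric] by (simp add: power2_eq_square)
  then show "- b (of_real (x + real (Suc k) * om)) * - bt (of_real (x + real (Suc k) * om)) =
    - of_real (\<beta> om x (Suc k)) * - of_real (\<beta> om x (Suc k))"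
   unfolding \<beta>_def minus_mult_minus .
 qed
qed

text \<open>Only numbers occur in the conclusion; the coefficients enter through the premise that
  some pair admits these bounds. A choice of \<open>n\<close> is therefore a function of the norms
  and parameters, as \<open>N0\<close> has to be.\<close>

definition threshold :: "real => real => real => real => real => nat => bool" where
 "threshold \<rho> A c \<alpha> \<gamma> n \<longleftrightarrow> ((\<exists>a b. jac \<rho> A a b) --> 0 < c --> \<alpha> > 1 --> \<gamma> > 0 -->
   (\<exists>\<tau> Q. 0 < \<tau> & \<tau> <= 1 & 2 <= Q & eb \<rho> A \<tau> + 2 * VW \<rho> A \<tau> * Dn c \<alpha> (real Q) / real Q <= \<gamma> / 4 &
    (\<forall>N\<ge>n. elim_num A (6 * A / \<rho>) (real (nc \<rho>)) N & elim_num A (6 * A / \<rho>) (real (nc \<rho>)) (Rs N) &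
     decay_num A (real (nc \<rho>)) c \<alpha> \<gamma> (2 * A * real Q) N & decay_num A (real (nc \<rho>)) c \<alpha> \<gamma> (2 * A * real Q) (Rs N) &
     pair_num A (6 * A / \<rho>) (real (zb \<rho> A)) (cb \<rho> A) (real (nb \<rho> * zb \<rho> A)) \<gamma> N)))"

lemma threshold_exists: "\<exists>n. threshold \<rho> A c \<alpha> \<gamma> n"
proof (cases "(\<exists>a b. jac \<rho> A a b) & 0 < c & \<alpha> > 1 & \<gamma> > 0")
 case True
 then obtain a b where "jac \<rho> A a b" by blast
 then interpret jac \<rho> A a b .
 have cond: "0 < c" "\<alpha> > 1" "\<gamma> > 0" using True by auto
 have pos: "real (zb \<rho> A) > 0" "real (nb \<rho> * zb \<rho> A) > 0" "6 * A / \<rho> > 0"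
  using zb_pos nb_ge(2) A \<rho> by auto
 have "0 < 4 / \<rho>" using \<rho> by simp
 then have nc: "real (nc \<rho>) > 0" using nc_ge[OF \<rho>] by linarith
 obtain \<tau> Q where \<tau>Q: "0 < \<tau>" "\<tau> <= 1" "2 <= Q" "eb \<rho> A \<tau> + 2 * VW \<rho> A \<tau> * Dn c \<alpha> (real Q) / real Q <= \<gamma> / 4"
  by (rule b_prod_constants[of "\<gamma> / 4" c \<rho> A \<alpha>]) (use cond zb_pos in auto)
 note e1 = elim_num_eventually[OF A nc pos(3)] and e2 = decay_num_eventually[OF A nc cond, of "2 * A * real Q"]
 have "eventually (%N. elim_num A (6 * A / \<rho>) (real (nc \<rho>)) N & elim_num A (6 * A / \<rho>) (real (nc \<rho>)) (Rs N) &
     decay_num A (real (nc \<rho>)) c \<alpha> \<gamma> (2 * A * real Q) N & decay_num A (real (nc \<rho>)) c \<alpha> \<gamma> (2 * A * real Q) (Rs N) &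
     pair_num A (6 * A / \<rho>) (real (zb \<rho> A)) (cb \<rho> A) (real (nb \<rho> * zb \<rho> A)) \<gamma> N) sequentially"
  by (intro eventually_conj e1 e2 eventually_compose_filterlim[OF e1 Rs_at_top] eventually_compose_filterlim[OF e2 Rs_at_top]
    pair_num_eventually A pos cb_pos cond)
 then show ?thesis unfolding threshold_def eventually_sequentially using \<tau>Q by blast
qed (auto simp: threshold_def)

lemma eigenvalue_separation:
 fixes \<rho>0 c \<alpha> \<gamma> p :: real
 assumes p: "p > 15" and \<rho>: "\<rho>0 > 0" and c: "0 < c" "c < 1" and \<alpha>: "\<alpha> > 1" and \<gamma>: "\<gamma> > 0" and J: "jacobi_coeffs \<rho>0 a b bt"
  and EE: "E' < E''" and L: "\<forall>om\<in>{om'<..<om''}. \<forall>E\<in>{E'<..<E''}. lyapunov a b bt om E > \<gamma>"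
  and thr: "threshold \<rho>0 (max 1 (max (Linf_norm \<rho>0 a) (max (star_norm \<rho>0 b) (SUP E\<in>{E'<..<E''}. abs E)))) c \<alpha> \<gamma> n"
  and N: "n <= N"
 shows "\<exists>\<Omega>. mes_compl_le \<Omega> (4 * exp (- ((ln (ln (ln (real N))))^2 / 20))) (4 * (real N ^ 2 * ln (real N) powr p)) &
  (\<forall>om\<in>({om'<..<om''} \<inter> diophantine c \<alpha>) - \<Omega>.
   \<exists>\<E>. mes_compl_le \<E> (4 * ln (ln (real N)) powr (- 1 / 10)) (4 * (real N * ln (real N) ^ 6)) &
    (\<forall>x::real. \<forall>j\<in>{1..N}. jacobi_eigenvalue a b bt N x om j : {E'<..<E''} - \<E> -->
     (\<forall>k\<in>{1..N}. k ~= j -->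
      abs (jacobi_eigenvalue a b bt N x om j - jacobi_eigenvalue a b bt N x om k) >= 1 / (real N * ln (real N) powr p))))"
  (is "\<exists>\<Omega>. _ & (\<forall>om\<in>_. ?P om)")
proof -
 define A where "A = max 1 (max (Linf_norm \<rho>0 a) (max (star_norm \<rho>0 b) (SUP E\<in>{E'<..<E''}. abs E)))"
 have AB: "1 <= A" "Linf_norm \<rho>0 a <= A" "star_norm \<rho>0 b <= A" "(SUP E\<in>{E'<..<E''}. abs E) <= A" unfolding A_def by auto
 interpret jac \<rho>0 A a b by (rule jac_of_jacobi_coeffs[OF \<rho> J AB(1-3)])
 have bt: "bt (of_real x) = cnj (b (of_real x))" for x :: real using J unfolding jacobi_coeffs_def by blast
 have EA: "abs E <= A" if "E : {E'<..<E''}" for E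
 proof -
  have "bdd_above ((%E. abs E) ` {E'<..<E''})" by (rule bdd_aboveI2[of _ _ "abs E' + abs E''"]) auto
  from cSUP_upper[OF that this] show ?thesis using AB(4) by linarith
 qed
 from thr obtain \<tau> Q where \<tau>Q: "0 < \<tau>" "\<tau> <= 1" "2 <= Q" "eb \<rho>0 A \<tau> + 2 * VW \<rho>0 A \<tau> * Dn c \<alpha> (real Q) / real Q <= \<gamma> / 4"
  and num: "elim_num A Lip (real (nc \<rho>0)) N" "elim_num A Lip (real (nc \<rho>0)) (Rs N)"
   "decay_num A (real (nc \<rho>0)) c \<alpha> \<gamma> (2 * A * real Q) N" "decay_num A (real (nc \<rho>0)) c \<alpha> \<gamma> (2 * A * real Q) (Rs N)"
   "pair_num A Lip (real (zb \<rho>0 A)) (cb \<rho>0 A) (real (nb \<rho>0 * zb \<rho>0 A)) \<gamma> N"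
  unfolding threshold_def A_def[symmetric] Lip_def using jac_axioms c \<alpha> \<gamma> N by blast
 have lnN: "3 <= ln (real N)" by (rule elim_num.num(1)[OF num(1)])
 have N1: "real N > 0"
 proof (rule ccontr)
  assume "\<not> real N > 0"
  then show False using lnN by simp
 qed
 have lp: "ln (real N) powr 15 <= ln (real N) powr p" by (rule powr_mono) (use lnN p in linarith)+
 have lp': "ln (real N) powr 15 > 0" using lnN by (subst powr_gt_zero) linarith
 have lp1: "real N * ln (real N) powr 15 <= real N * ln (real N) powr p" "0 < real N * ln (real N) powr 15"
  by (intro mult_left_mono lp less_imp_le[OF N1], intro mult_pos_pos N1 lp')
 obtain \<Omega> where \<Omega>: "mes_compl_le \<Omega> (exp (- ((ln (ln (ln (real N))))^2 / 20))) (4 * (real N ^ 2 * ln (real N) powr 15))"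
  "!!om. om : diophantine c \<alpha> - \<Omega> ==> \<exists>\<E>. mes_compl_le \<E> (ln (ln (real N)) powr (- 1 / 10)) (real N * ln (real N) ^ 6) &
   (\<forall>E x es j k. abs E <= A --> E \<notin> \<E> --> lyapunov a b bt om E > \<gamma> -->
    char_poly (hmat N (TM om x)) = (\<Prod>e\<leftarrow>map complex_of_real es. [:- e, 1:]) --> j < N --> k < N --> j ~= k --> es ! j = E -->
    1 / (real N * ln (real N) powr 15) < abs (es ! k - E))"
  by (rule two_scales[OF num c \<alpha> \<gamma> bt \<tau>Q], rule that)
 show ?thesis
 proof (rule exI[of _ \<Omega>], intro conjI ballI)
  show "mes_compl_le \<Omega> (4 * exp (- ((ln (ln (ln (real N))))^2 / 20))) (4 * (real N ^ 2 * ln (real N) powr p))"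
   by (rule mes_compl_le_mono[OF \<Omega>(1)]) (use lp in \<open>auto intro!: mult_left_mono simp del: powr_numeral\<close>)
  fix om assume w: "om : ({om'<..<om''} \<inter> diophantine c \<alpha>) - \<Omega>"
  then have "om : diophantine c \<alpha> - \<Omega>" by blast
  from \<Omega>(2)[OF this] obtain \<E> where \<E>: "mes_compl_le \<E> (ln (ln (real N)) powr (- 1 / 10)) (real N * ln (real N) ^ 6)"
   "!!E x es j k. abs E <= A ==> E \<notin> \<E> ==> lyapunov a b bt om E > \<gamma> ==>
    char_poly (hmat N (TM om x)) = (\<Prod>e\<leftarrow>map complex_of_real es. [:- e, 1:]) ==> j < N ==> k < N ==> j ~= k ==> es ! j = E ==>
    1 / (real N * ln (real N) powr 15) < abs (es ! k - E)" by blast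
  show "?P om"
  proof (rule exI[of _ \<E>], intro conjI allI ballI impI)
   show "mes_compl_le \<E> (4 * ln (ln (real N)) powr (- 1 / 10)) (4 * (real N * ln (real N) ^ 6))"
    by (rule mes_compl_le_mono[OF \<E>(1)]) (use N1 lnN in auto)
   fix x j k
   assume j: "j : {1..N}" and Ej: "jacobi_eigenvalue a b bt N x om j : {E'<..<E''} - \<E>" and k: "k : {1..N}" "k ~= j"
   \<comment> \<open>Listing the eigenvalues by index keeps multiplicities: position
     \<open>j - 1\<close> is the \<open>j\<close>-th one, so \<open>two_scales\<close> applies to
     indices rather than to values.\<close>
   define es where "es = map (jacobi_eigenvalue a b bt N x om) [1..<Suc N]"
   have nth: "es ! (i - 1) = jacobi_eigenvalue a b bt N x om i" if "i : {1..N}" for i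
    using that unfolding es_def by (subst nth_map) (auto simp del: upt_Suc)
   have "char_poly (hmat N (TM om x)) = (\<Prod>j=1..N. [:- of_real (jacobi_eigenvalue a b bt N x om j), 1:])"
    unfolding char_poly_jacobi[OF bt, symmetric] by (rule char_poly_jacobi_matrix[OF J])
   also have "... = (\<Prod>j\<leftarrow>[1..<Suc N]. [:- of_real (jacobi_eigenvalue a b bt N x om j), 1:])"
    by (subst prod.distinct_set_conv_list[symmetric]) (simp_all only: distinct_upt set_upt atLeastLessThanSuc_atLeastAtMost)
   also have "... = (\<Prod>e\<leftarrow>map complex_of_real es. [:- e, 1:])" by (simp only: es_def map_map o_def)
   finally have cp: "char_poly (hmat N (TM om x)) = (\<Prod>e\<leftarrow>map complex_of_real es. [:- e, 1:])" .
   have "1 / (real N * ln (real N) powr 15) < abs (es ! (k - 1) - jacobi_eigenvalue a b bt N x om j)"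
   proof (rule \<E>(2)[OF EA _ _ cp])
    show "lyapunov a b bt om (jacobi_eigenvalue a b bt N x om j) > \<gamma>" using L w Ej by blast
    show "es ! (j - 1) = jacobi_eigenvalue a b bt N x om j" by (rule nth[OF j])
   qed (use Ej j k in auto)
   moreover have "1 / (real N * ln (real N) powr p) <= 1 / (real N * ln (real N) powr 15)"
    by (rule divide_left_mono[OF lp1(1) zero_le_one mult_pos_pos[OF less_le_trans[OF lp1(2,1)] lp1(2)]])
   ultimately show "1 / (real N * ln (real N) powr p) <= abs (jacobi_eigenvalue a b bt N x om j - jacobi_eigenvalue a b bt N x om k)"
    unfolding nth[OF k(1)] by (simp only: abs_minus_commute)
  qed
 qed
qed

theorem theorem7p8:
 shows "\<exists>C::real. C > 0 \<and> (\<forall>p::real. p > 15 \<longrightarrow>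
  (\<exists>N0 :: real \<Rightarrow> real \<Rightarrow> real \<Rightarrow> real \<Rightarrow> real \<Rightarrow> real \<Rightarrow> real \<Rightarrow> nat.
   \<forall>(\<rho>0::real) (c::real) (\<alpha>::real) (\<gamma>::real) a b bt
    (\<omega>'::real) (\<omega>''::real) (E'::real) (E''::real).
    \<rho>0 > 0 \<longrightarrow> 0 < c \<longrightarrow> c < 1 \<longrightarrow> \<alpha> > 1 \<longrightarrow> \<gamma> > 0 \<longrightarrow>
    jacobi_coeffs \<rho>0 a b bt \<longrightarrow> \<omega>' < \<omega>'' \<longrightarrow> E' < E'' \<longrightarrow>
    (\<forall>\<omega>\<in>{\<omega>'<..<\<omega>''}. \<forall>E\<in>{E'<..<E''}. lyapunov a b bt \<omega> E > \<gamma>) \<longrightarrow>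
    (\<forall>N \<ge> N0 \<rho>0 (Linf_norm \<rho>0 a) (star_norm \<rho>0 b) c \<alpha> \<gamma> (SUP E\<in>{E'<..<E''}. \<bar>E\<bar>).
     \<exists>\<Omega>\<^sub>N :: real set.
      mes_compl_le \<Omega>\<^sub>N
       (C * exp (- ((ln (ln (ln (real N))))\<^sup>2 / 20)))
       (C * (real N ^ 2 * ln (real N) powr p)) \<and>
      (\<forall>\<omega> \<in> ({\<omega>'<..<\<omega>''} \<inter> diophantine c \<alpha>) - \<Omega>\<^sub>N.
       \<exists>\<E>\<^sub>N :: real set.
        mes_compl_le \<E>\<^sub>N
         (C * ln (ln (real N)) powr (- 1 / 10))
         (C * (real N * ln (real N) ^ 6)) \<and>
        (\<forall>x::real. \<forall>j\<in>{1..N}.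
         jacobi_eigenvalue a b bt N x \<omega> j \<in> {E'<..<E''} - \<E>\<^sub>N \<longrightarrow>
         (\<forall>k\<in>{1..N}. k \<noteq> j \<longrightarrow>
          \<bar>jacobi_eigenvalue a b bt N x \<omega> j - jacobi_eigenvalue a b bt N x \<omega> k\<bar>
           \<ge> 1 / (real N * ln (real N) powr p)))))))"
proof (intro exI[of _ "4::real"] exI[of _ "\<lambda>\<rho>0 La Lb c \<alpha> \<gamma> E0. SOME n. threshold \<rho>0 (max 1 (max La (max Lb E0))) c \<alpha> \<gamma> n"] conjI allI impI)
 show "0 < (4::real)" by simp
qed (rule eigenvalue_separation[OF _ _ _ _ _ _ _ _ _ someI_ex[OF threshold_exists]], assumption+)

end
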